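(* Let $I=\{i\}$ be the Cartan datum of type $A_1$. Let $\lambda=(s_1\bar i,\dots,s_m\bar i)\in(\mathbb Z_{\ge0}[\bar I])^m$, set $\mathbf s=(s_1,\dots,s_m)$, and let $\nu=(i,\dots,i)\in I^n$. Then the Khovanov-Lauda-Rouquier subalgebra $S_C(\lambda,\nu)$ is isomorphic to the redotted Webster algebra $W(\mathbf s,n)$.
   Context: $\Bbbk$ is the ground field. Definition of $S_C(\lambda,\nu)$ for $I=\{i\}$. The Cartan datum of type $A_1$ has $i\cdot i=2$. Let $\tilde I=\{i,\bar i\}$ with $\bar i\cdot\bar i=i\cdot i$, $i\cdot\bar i=\bar i\cdot i=-\frac{i\cdot i}{2}$ (so the off-diagonal Cartan integers are $-1$). For $r\ge0$ let $R_r=R_r(\overline Q_{\tilde C})$ be the $\Bbbk$-algebra generated by $e(\mathbf i)$ ($\mathbf i\in\tilde I^r$), $x_j$ ($1\le j\le r$), $\psi_j$ ($1\le j\le r-1$), with unit $\sum_{\mathbf i}e(\mathbf i)$, subject to: $e(\mathbf i)e(\mathbf j)=\delta_{\mathbf i,\mathbf j}e(\mathbf i)$; $x_je(\mathbf i)=e(\mathbf i)x_j$; $\psi_je(\mathbf i)=e(\sigma_j\mathbf i)\psi_j$ ($\sigma_j$ swaps entries $j,j+1$); $x_jx_k=x_kx_j$; $\psi_jx_k=x_k\psi_j$ if $k\ne j,j+1$; $\psi_j\psi_k=\psi_k\psi_j$ if $|j-k|>1$; $(x_j\psi_j-\psi_jx_{j+1})e(\mathbf i)=(\psi_jx_j-x_{j+1}\psi_j)e(\mathbf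 i)=\delta_{\mathbf i_j,\mathbf i_{j+1}}e(\mathbf i)$; $\psi_j^2e(\mathbf i)=0$ if $\mathbf i_j=\mathbf i_{j+1}$, $\psi_j^2e(\mathbf i)=(x_j-x_{j+1})e(\mathbf i)$ if $(\mathbf i_j,\mathbf i_{j+1})=(i,\bar i)$, $\psi_j^2e(\mathbf i)=(-x_j+x_{j+1})e(\mathbf i)$ if $(\mathbf i_j,\mathbf i_{j+1})=(\bar i,i)$; and $(\psi_j\psi_{j+1}\psi_j-\psi_{j+1}\psi_j\psi_{j+1})e(\mathbf i)$ equals $e(\mathbf i)$ if $(\mathbf i_j,\mathbf i_{j+1},\mathbf i_{j+2})=(i,\bar i,i)$, equals $-e(\mathbf i)$ if it is $(\bar i,i,\bar i)$, and $0$ otherwise. Write $\lambda_k=s_k\bar i$, $|\lambda|=\sum_ks_k$. $\mathrm{Seq}(\lambda,\nu)$ is the set of sequences $\mathbf i=(\mathbf i_1,\dots,\mathbf i_{m+n})$ with $n$ entries equal to $i$ ("solid") and the other $m$ entries being $\lambda_1,\dots,\lambda_m$ in this order ("thick"). Replacing the entry $\lambda_k$ by the word $\bar i^{\,s_k}$ gives $\hat{\mathbf i}\in\tilde I^{|\lambda|+n}$. The following are elements of $R_{|\lambda|+n}$: - On $r$ consecutive strands labelled $\bar i$ let $e_r=x_1^{r-1}x_2^{r-2}\cdots x_{r-1}\psi_{w_0}$ (indices shifted; $w_0$ the longest element of $\mathfrak S_r$, $\psi_{w_0}$ the product of $\psi$'s along a reduced word). $e(\mathbf i)$ is the idempotent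 obtained from $e(\hat{\mathbf i})$ by multiplying by $e_{s_k}$ on the block of strands of $\lambda_k$, for every $k$. - $y_pe(\mathbf i)=x_\alpha e(\mathbf i)$ if $\mathbf i_p=i$ is solid, with $\alpha$ its position in $\hat{\mathbf i}$; $y_pe(\mathbf i)=0$ if $\mathbf i_p$ is thick. - $E_{k,d}e(\mathbf i)$ ($1\le d\le s_k$): the $d$-th elementary symmetric polynomial in the $x$'s at the positions in $\hat{\mathbf i}$ of the block of $\lambda_k$, times $e(\mathbf i)$. - $\Psi_pe(\mathbf i)$: let $q$ be the position in $\hat{\mathbf i}$ of the first strand of the entry $\mathbf i_p$. It is $\psi_qe(\mathbf i)$ if $\mathbf i_p,\mathbf i_{p+1}$ are solid; $\psi_q\psi_{q+1}\cdots\psi_{q+s_k-1}e(\mathbf i)$ if $\mathbf i_p=\lambda_k$ is thick and $\mathbf i_{p+1}$ solid; $\psi_{q+s_k-1}\cdots\psi_{q+1}\psi_qe(\mathbf i)$ if $\mathbf i_p$ is solid and $\mathbf i_{p+1}=\lambda_k$ thick; $0$ if both are thick. $S_C(\lambda,\nu)$ is the subalgebra of $R_{|\lambda|+n}$ generated by $e(\mathbf i)$ ($\mathbf i\in\mathrm{Seq}(\lambda,\nu)$), $y_p$, $E_{k,d}$, $\Psi_p$, where $y_p$, $E_{k,d}$ and $\Psi_p$ denote the sums $\sum_{\mathbf i\in\mathrm{Seq}(\lambda,\nu)}y_pe(\mathbf i)$, $\sum_{\mathbf i\in\mathrm{Seq}(\lambda,\nu)}E_{k,d}e(\mathbf i)$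 and $\sum_{\mathbf i\in\mathrm{Seq}(\lambda,\nu)}\Psi_pe(\mathbf i)$ of elements of $R_{|\lambda|+n}$; its unit is $\sum_{\mathbf i\in\mathrm{Seq}(\lambda,\nu)}e(\mathbf i)$. Definition of $W(\mathbf s,n)$ (redotted Webster algebra of Khovanov-Lauda-Sussan-Yonezawa). Let $\mathrm{Seq}(\mathbf s,n)$ be the set of sequences of length $m+n$ with $n$ entries $b$ ("black") and $m$ entries $s_1,\dots,s_m$ ("red", regarded as distinguishable by their index) in this order. $W(\mathbf s,n)$ is the $\Bbbk$-algebra with generators $e(\mathbf i)$ ($\mathbf i\in\mathrm{Seq}(\mathbf s,n)$), $y_p$ ($1\le p\le m+n$), $E_{k,d}$ ($1\le k\le m$, $1\le d\le s_k$; set $E_{k,0}=1$), $\psi_p$ ($1\le p\le m+n-1$), unit $\sum_{\mathbf i}e(\mathbf i)$, and relations: - $e(\mathbf i)e(\mathbf j)=\delta_{\mathbf i,\mathbf j}e(\mathbf i)$; $y_p$ and $E_{k,d}$ commute with all $e(\mathbf i)$ and with each other; $y_pe(\mathbf i)=0$ if $\mathbf i_p$ is red; $\psi_pe(\mathbf i)=0$ if $\mathbf i_p,\mathbf i_{p+1}$ are both red; otherwise $\psi_pe(\mathbf i)=e(\sigma_p\mathbf i)\psi_p$. - $\psi_py_q=y_q\psi_p$ if $q\ne p,p+1$; $\psi_p\psi_q=\psi_q\psi_p$ if $|p-q|>1$; $\psi_pE_{k,d}=E_{k,d}\psi_p$. - If $\mathbf i_p=\mathbf i_{p+1}=b$: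 $(y_p\psi_p-\psi_py_{p+1})e(\mathbf i)=e(\mathbf i)=(\psi_py_p-y_{p+1}\psi_p)e(\mathbf i)$ and $\psi_p^2e(\mathbf i)=0$. - If exactly one of $\mathbf i_p,\mathbf i_{p+1}$ is red: $\psi_py_pe(\mathbf i)=y_{p+1}\psi_pe(\mathbf i)$ and $y_p\psi_pe(\mathbf i)=\psi_py_{p+1}e(\mathbf i)$. - If $(\mathbf i_p,\mathbf i_{p+1})=(b,s_k)$: $\psi_p^2e(\mathbf i)=\sum_{d_1+d_2=s_k}(-1)^{d_2}y_p^{d_1}E_{k,d_2}e(\mathbf i)$. If $(\mathbf i_p,\mathbf i_{p+1})=(s_k,b)$: $\psi_p^2e(\mathbf i)=\sum_{d_1+d_2=s_k}(-1)^{d_1}E_{k,d_1}y_{p+1}^{d_2}e(\mathbf i)$. - $(\psi_p\psi_{p+1}\psi_p-\psi_{p+1}\psi_p\psi_{p+1})e(\mathbf i)$ equals $\sum_{a+b'+c=s_k-1}(-1)^cy_p^aE_{k,c}y_{p+2}^{b'}e(\mathbf i)$ if $(\mathbf i_p,\mathbf i_{p+1},\mathbf i_{p+2})=(b,s_k,b)$, and $0$ if at most one of $\mathbf i_p,\mathbf i_{p+1},\mathbf i_{p+2}$ is red and the triple is not of this form.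
   Formalization: Assumes n = 0 or all s_k ≥ 1: if some s_k = 0 and n ≥ 1, distinct sequences give the same e(𝐢), so S_C is ill-defined; e.g. for m = n = 1, s = (0), S_C is commutative while W is a 2×2 matrix algebra. *)

theory Defs
  imports
    "HOL-Algebra.QuotRing"
    "HOL-Algebra.Module"
    "HOL-Library.Poly_Mapping"
begin

section \<open>Algebras given by generators and relations\<close>

text \<open>
  The ground field is a type \<open>'k\<close> of class \<open>field\<close>. The free associative \<open>'k\<close>-algebra on a
  type of generators is the monoid algebra of the free monoid. The free monoid is a copy of the
  list type, so that no additive structure has to be put on lists themselves.
\<close>

datatype 'g word = Word (letters: "'g list")

instantiation word :: (type) monoid_add
begin

definition zero_word :: "'a word" where
  "0 = Word []"

definition plus_word :: "'a word \<Rightarrow> 'a word \<Rightarrow> 'a word" where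
  "u + v = Word (letters u @ letters v)"

instance
  by standard (simp_all add: zero_word_def plus_word_def)

end

type_synonym ('k, 'g) free_alg = "'g word \<Rightarrow>\<^sub>0 'k"

definition fgen :: "'g \<Rightarrow> ('k::field, 'g) free_alg" where
  "fgen g = Poly_Mapping.single (Word [g]) 1"

definition fscalar :: "'k \<Rightarrow> ('k::field, 'g) free_alg" where
  "fscalar c = Poly_Mapping.single 0 c"

text \<open>
  A \<open>'k\<close>-algebra is represented by a \<open>module\<close> record, which consists of the ring operations and a
  scalar multiplication. (The locale \<open>algebra\<close> of HOL-Algebra is not used, because it requires
  commutativity.)
\<close>

definition free_algebra :: "'g set \<Rightarrow> ('k::field, ('k, 'g) free_alg) module" where
  "free_algebra G =
    \<lparr>carrier = {p. \<forall>w \<in> Poly_Mapping.keys p. set (letters w) \<subseteq> G},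
     mult = (*), one = 1, zero = 0, add = (+),
     smult = (\<lambda>c p. fscalar c * p)\<rparr>"

definition rel_ideal ::
    "'g set \<Rightarrow> (('k::field, 'g) free_alg \<Rightarrow> ('k, 'g) free_alg \<Rightarrow> bool) \<Rightarrow> ('k, 'g) free_alg set" where
  "rel_ideal G rel = Idl\<^bsub>free_algebra G\<^esub> {a - b | a b. rel a b}"

definition pres_class ::
    "'g set \<Rightarrow> (('k::field, 'g) free_alg \<Rightarrow> ('k, 'g) free_alg \<Rightarrow> bool) \<Rightarrow>
     ('k, 'g) free_alg \<Rightarrow> ('k, 'g) free_alg set" where
  "pres_class G rel p = rel_ideal G rel +>\<^bsub>free_algebra G\<^esub> p"

definition presented_algebra ::
    "'g set \<Rightarrow> (('k::field, 'g) free_alg \<Rightarrow> ('k, 'g) free_alg \<Rightarrow> bool) \<Rightarrow>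
     ('k, ('k, 'g) free_alg set) module" where
  "presented_algebra G rel =
    (let Q = free_algebra G Quot rel_ideal G rel in
     \<lparr>carrier = carrier Q, mult = mult Q, one = one Q, zero = zero Q, add = add Q,
      smult = (\<lambda>c A. pres_class G rel (fscalar c) \<otimes>\<^bsub>Q\<^esub> A)\<rparr>)"

text \<open>
  The subalgebra generated by a set does not have to contain the unit of the ambient algebra;
  it is the smallest linear subspace that contains the set and is closed under multiplication.
\<close>

inductive_set subalg_span :: "('k, 'a) module \<Rightarrow> 'a set \<Rightarrow> 'a set" for A X where
  incl: "x \<in> X \<Longrightarrow> x \<in> subalg_span A X"
| zero: "\<zero>\<^bsub>A\<^esub> \<in> subalg_span A X"
| add: "x \<in> subalg_span A X \<Longrightarrow> y \<in> subalg_span A X \<Longrightarrow> x \<oplus>\<^bsub>A\<^esub> y \<in> subalg_span A X"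
| smult: "x \<in> subalg_span A X \<Longrightarrow> c \<odot>\<^bsub>A\<^esub> x \<in> subalg_span A X"
| mult: "x \<in> subalg_span A X \<Longrightarrow> y \<in> subalg_span A X \<Longrightarrow> x \<otimes>\<^bsub>A\<^esub> y \<in> subalg_span A X"

definition alg_isomorphic :: "('k, 'a) module \<Rightarrow> ('k, 'b) module \<Rightarrow> bool" where
  "alg_isomorphic A B \<longleftrightarrow>
    (\<exists>h \<in> ring_iso A B. \<forall>c. \<forall>x \<in> carrier A. h (c \<odot>\<^bsub>A\<^esub> x) = c \<odot>\<^bsub>B\<^esub> h x)"


section \<open>The KLR algebra of the doubled quiver of type \<open>A\<^sub>1\<close>\<close>

text \<open>
  All positions and indices are 0-based: \<open>x j\<close>, \<open>\<psi> j\<close>, \<open>y p\<close>, \<open>\<lambda>\<^sub>k\<close> below are the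
  \<open>x\<close>, \<open>\<psi>\<close>, \<open>y\<close>, \<open>\<lambda>\<close> with index \<open>j + 1\<close>, \<open>p + 1\<close>, \<open>k + 1\<close> in 1-based notation. The only exception is the degree
  \<open>d\<close> of the elementary symmetric polynomials \<open>E k d\<close>.
\<close>

text \<open>The vertex \<open>i\<close> and its barred copy are \<open>Plain\<close> and \<open>Bar\<close>.\<close>

datatype colour = Plain | Bar

datatype klr_gen = KE "colour list" | KX nat | KPsi nat

definition klr_gens :: "nat \<Rightarrow> klr_gen set" where
  "klr_gens r = {KE c | c. length c = r} \<union> {KX j | j. j < r} \<union> {KPsi j | j. Suc j < r}"

definition swap_at :: "nat \<Rightarrow> 'a list \<Rightarrow> 'a list" where
  "swap_at j xs = xs[j := xs ! Suc j, Suc j := xs ! j]"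

abbreviation klr_e :: "colour list \<Rightarrow> ('k::field, klr_gen) free_alg" where
  "klr_e c \<equiv> fgen (KE c)"
abbreviation klr_x :: "nat \<Rightarrow> ('k::field, klr_gen) free_alg" where
  "klr_x j \<equiv> fgen (KX j)"
abbreviation klr_psi :: "nat \<Rightarrow> ('k::field, klr_gen) free_alg" where
  "klr_psi j \<equiv> fgen (KPsi j)"

inductive klr_rel ::
    "nat \<Rightarrow> ('k::field, klr_gen) free_alg \<Rightarrow> ('k, klr_gen) free_alg \<Rightarrow> bool" for r where
  unit: "klr_rel r (\<Sum>c | length c = r. klr_e c) 1"
| e_e: "length c = r \<Longrightarrow> length c' = r \<Longrightarrow>
    klr_rel r (klr_e c * klr_e c') (if c = c' then klr_e c else 0)"
| x_e: "length c = r \<Longrightarrow> j < r \<Longrightarrow> klr_rel r (klr_x j * klr_e c) (klr_e c * klr_x j)"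
| psi_e: "length c = r \<Longrightarrow> Suc j < r \<Longrightarrow>
    klr_rel r (klr_psi j * klr_e c) (klr_e (swap_at j c) * klr_psi j)"
| x_x: "j < r \<Longrightarrow> k < r \<Longrightarrow> klr_rel r (klr_x j * klr_x k) (klr_x k * klr_x j)"
| psi_x: "Suc j < r \<Longrightarrow> k < r \<Longrightarrow> k \<noteq> j \<Longrightarrow> k \<noteq> Suc j \<Longrightarrow>
    klr_rel r (klr_psi j * klr_x k) (klr_x k * klr_psi j)"
| psi_psi: "Suc j < r \<Longrightarrow> Suc k < r \<Longrightarrow> Suc j < k \<or> Suc k < j \<Longrightarrow>
    klr_rel r (klr_psi j * klr_psi k) (klr_psi k * klr_psi j)"
| slide1: "length c = r \<Longrightarrow> Suc j < r \<Longrightarrow>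
    klr_rel r ((klr_x j * klr_psi j - klr_psi j * klr_x (Suc j)) * klr_e c)
              (if c ! j = c ! Suc j then klr_e c else 0)"
| slide2: "length c = r \<Longrightarrow> Suc j < r \<Longrightarrow>
    klr_rel r ((klr_psi j * klr_x j - klr_x (Suc j) * klr_psi j) * klr_e c)
              (if c ! j = c ! Suc j then klr_e c else 0)"
| quad: "length c = r \<Longrightarrow> Suc j < r \<Longrightarrow>
    klr_rel r (klr_psi j ^ 2 * klr_e c)
      (case (c ! j, c ! Suc j) of
         (Plain, Bar) \<Rightarrow> (klr_x j - klr_x (Suc j)) * klr_e c
       | (Bar, Plain) \<Rightarrow> (- klr_x j + klr_x (Suc j)) * klr_e c
       | _ \<Rightarrow> 0)"
| braid: "length c = r \<Longrightarrow> Suc (Suc j) < r \<Longrightarrow>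
    klr_rel r
      ((klr_psi j * klr_psi (Suc j) * klr_psi j - klr_psi (Suc j) * klr_psi j * klr_psi (Suc j)) * klr_e c)
      (case (c ! j, c ! Suc j, c ! Suc (Suc j)) of
         (Plain, Bar, Plain) \<Rightarrow> klr_e c
       | (Bar, Plain, Bar) \<Rightarrow> - klr_e c
       | _ \<Rightarrow> 0)"

definition KLR :: "nat \<Rightarrow> ('k::field, ('k, klr_gen) free_alg set) module" where
  "KLR r = presented_algebra (klr_gens r) (klr_rel r)"

text \<open>The element of \<open>KLR r\<close> represented by an element of the free algebra.\<close>

definition klr_class :: "nat \<Rightarrow> ('k::field, klr_gen) free_alg \<Rightarrow> ('k, klr_gen) free_alg set" where
  "klr_class r = pres_class (klr_gens r) (klr_rel r)"


section \<open>Sequences\<close>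

text \<open>
  \<open>Seqs m n\<close> serves both as \<open>Seq(\<lambda>,\<nu>)\<close> (with \<open>Single\<close> a solid strand and \<open>Multi k\<close> the thick
  strand \<open>\<lambda>\<^sub>k\<close>) and as \<open>Seq(s,n)\<close> (with \<open>Single\<close> the black strand \<open>b\<close> and \<open>Multi k\<close> the red strand
  \<open>s\<^sub>k\<close>). Entries are recorded by their index \<open>k\<close> and not by the value \<open>s\<^sub>k\<close>.
\<close>

datatype strand = Single | Multi nat

definition Seqs :: "nat \<Rightarrow> nat \<Rightarrow> strand list set" where
  "Seqs m n = {w. filter (\<lambda>a. a \<noteq> Single) w = map Multi [0..<m] \<and> count_list w Single = n}"


section \<open>The subalgebra \<open>S\<^sub>C(\<lambda>,\<nu>)\<close>\<close>

text \<open>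
  Here \<open>\<lambda> = (s\<^sub>0 Bar, s\<^sub>1 Bar, \<dots>)\<close> is given by the list \<open>s\<close>, and \<open>\<nu> = (Plain, \<dots>, Plain)\<close> by its
  length \<open>n\<close>. The definition presupposes that the elements \<open>thick_e s w\<close> are orthogonal
  idempotents, and hence that \<open>n = 0\<close> or all \<open>s\<^sub>k\<close> are positive: if \<open>s\<^sub>k = 0\<close>, then two sequences
  that differ by moving \<open>Multi k\<close> past a \<open>Single\<close> have the same expansion, their elements
  \<open>thick_e\<close> coincide, and \<open>\<Sum>w. thick_e s w\<close> is not a unit of the generated subalgebra.
\<close>

fun expand_strand :: "nat list \<Rightarrow> strand \<Rightarrow> colour list" where
  "expand_strand s Single = [Plain]"
| "expand_strand s (Multi k) = replicate (s ! k) Bar"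

definition expand :: "nat list \<Rightarrow> strand list \<Rightarrow> colour list" where
  "expand s w = concat (map (expand_strand s) w)"

text \<open>The position in \<open>expand s w\<close> of the first strand of the entry \<open>w ! p\<close>.\<close>

definition start :: "nat list \<Rightarrow> strand list \<Rightarrow> nat \<Rightarrow> nat" where
  "start s w p = length (expand s (take p w))"

text \<open>
  The element \<open>e\<^sub>a\<close> on the \<open>a\<close> strands \<open>q, \<dots>, q + a - 1\<close>. The reduced word of the longest element
  of the symmetric group is \<open>q, (q+1, q), (q+2, q+1, q), \<dots>, (q+a-2, \<dots>, q)\<close>.
\<close>

definition longest_word :: "nat \<Rightarrow> nat \<Rightarrow> nat list" where
  "longest_word q a = concat (map (\<lambda>j. rev [q..<q + j]) [1..<a])"

definition block_idem :: "nat \<Rightarrow> nat \<Rightarrow> ('k::field, klr_gen) free_alg" where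
  "block_idem q a =
    prod_list (map (\<lambda>j. klr_x (q + j) ^ (a - 1 - j)) [0..<a]) *
    prod_list (map klr_psi (longest_word q a))"

definition thick_e :: "nat list \<Rightarrow> strand list \<Rightarrow> ('k::field, klr_gen) free_alg" where
  "thick_e s w =
    prod_list (map (\<lambda>p. case w ! p of Single \<Rightarrow> 1 | Multi k \<Rightarrow> block_idem (start s w p) (s ! k))
      [0..<length w]) *
    klr_e (expand s w)"

definition thick_y :: "nat list \<Rightarrow> nat \<Rightarrow> strand list \<Rightarrow> ('k::field, klr_gen) free_alg" where
  "thick_y s p w = (case w ! p of Single \<Rightarrow> klr_x (start s w p) * thick_e s w | Multi k \<Rightarrow> 0)"

text \<open>
  The \<open>d\<close>-th elementary symmetric polynomial in the \<open>x t\<close> with \<open>t \<in> T\<close>; the \<open>x t\<close> do not commute in the free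
  algebra, so the monomials are written in increasing order of the indices.
\<close>

definition elem_sym :: "nat set \<Rightarrow> nat \<Rightarrow> ('k::field, klr_gen) free_alg" where
  "elem_sym T d = (\<Sum>U | U \<subseteq> T \<and> card U = d. prod_list (map klr_x (sorted_list_of_set U)))"

definition thick_E :: "nat list \<Rightarrow> nat \<Rightarrow> nat \<Rightarrow> strand list \<Rightarrow> ('k::field, klr_gen) free_alg" where
  "thick_E s k d w =
    (let q = start s w (length (takeWhile (\<lambda>a. a \<noteq> Multi k) w))
     in elem_sym {q..<q + s ! k} d * thick_e s w)"

definition thick_Psi :: "nat list \<Rightarrow> nat \<Rightarrow> strand list \<Rightarrow> ('k::field, klr_gen) free_alg" where
  "thick_Psi s p w =
    (let q = start s w p in
     (case (w ! p, w ! Suc p) of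
        (Single, Single) \<Rightarrow> klr_psi q * thick_e s w
      | (Multi k, Single) \<Rightarrow> prod_list (map klr_psi [q..<q + s ! k]) * thick_e s w
      | (Single, Multi k) \<Rightarrow> prod_list (map klr_psi (rev [q..<q + s ! k])) * thick_e s w
      | (Multi k, Multi l) \<Rightarrow> 0))"

definition SC_generators :: "nat list \<Rightarrow> nat \<Rightarrow> ('k::field, klr_gen) free_alg set" where
  "SC_generators s n =
    (let m = length s; S = Seqs m n in
     {thick_e s w | w. w \<in> S} \<union>
     {\<Sum>w\<in>S. thick_y s p w | p. p < m + n} \<union>
     {\<Sum>w\<in>S. thick_E s k d w | k d. k < m \<and> 1 \<le> d \<and> d \<le> s ! k} \<union>
     {\<Sum>w\<in>S. thick_Psi s p w | p. Suc p < m + n})"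

definition S_C :: "nat list \<Rightarrow> nat \<Rightarrow> ('k::field, ('k, klr_gen) free_alg set) module" where
  "S_C s n =
    (let r = sum_list s + n; R = KLR r in
     R\<lparr>carrier := subalg_span R (klr_class r ` SC_generators s n),
       one := klr_class r (\<Sum>w\<in>Seqs (length s) n. thick_e s w)\<rparr>)"


section \<open>The redotted Webster algebra\<close>

datatype web_gen = WE "strand list" | WY nat | WEl nat nat | WPsi nat

definition web_gens :: "nat list \<Rightarrow> nat \<Rightarrow> web_gen set" where
  "web_gens s n =
    {WE w | w. w \<in> Seqs (length s) n} \<union>
    {WY p | p. p < length s + n} \<union>
    {WEl k d | k d. k < length s \<and> 1 \<le> d \<and> d \<le> s ! k} \<union>
    {WPsi p | p. Suc p < length s + n}"

abbreviation web_e :: "strand list \<Rightarrow> ('k::field, web_gen) free_alg" where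
  "web_e w \<equiv> fgen (WE w)"
abbreviation web_y :: "nat \<Rightarrow> ('k::field, web_gen) free_alg" where
  "web_y p \<equiv> fgen (WY p)"
abbreviation web_psi :: "nat \<Rightarrow> ('k::field, web_gen) free_alg" where
  "web_psi p \<equiv> fgen (WPsi p)"

definition web_E :: "nat \<Rightarrow> nat \<Rightarrow> ('k::field, web_gen) free_alg" where
  "web_E k d = (if d = 0 then 1 else fgen (WEl k d))"

inductive web_rel ::
    "nat list \<Rightarrow> nat \<Rightarrow> ('k::field, web_gen) free_alg \<Rightarrow> ('k, web_gen) free_alg \<Rightarrow> bool"
  for s n where
  unit: "web_rel s n (\<Sum>w\<in>Seqs (length s) n. web_e w) 1"
| e_e: "w \<in> Seqs (length s) n \<Longrightarrow> w' \<in> Seqs (length s) n \<Longrightarrow>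
    web_rel s n (web_e w * web_e w') (if w = w' then web_e w else 0)"
| y_e: "w \<in> Seqs (length s) n \<Longrightarrow> p < length s + n \<Longrightarrow>
    web_rel s n (web_y p * web_e w) (web_e w * web_y p)"
| E_e: "w \<in> Seqs (length s) n \<Longrightarrow> k < length s \<Longrightarrow> 1 \<le> d \<Longrightarrow> d \<le> s ! k \<Longrightarrow>
    web_rel s n (web_E k d * web_e w) (web_e w * web_E k d)"
| y_y: "p < length s + n \<Longrightarrow> q < length s + n \<Longrightarrow>
    web_rel s n (web_y p * web_y q) (web_y q * web_y p)"
| y_E: "p < length s + n \<Longrightarrow> k < length s \<Longrightarrow> 1 \<le> d \<Longrightarrow> d \<le> s ! k \<Longrightarrow>
    web_rel s n (web_y p * web_E k d) (web_E k d * web_y p)"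
| E_E: "k < length s \<Longrightarrow> 1 \<le> d \<Longrightarrow> d \<le> s ! k \<Longrightarrow> l < length s \<Longrightarrow> 1 \<le> d' \<Longrightarrow> d' \<le> s ! l \<Longrightarrow>
    web_rel s n (web_E k d * web_E l d') (web_E l d' * web_E k d)"
| y_red: "w \<in> Seqs (length s) n \<Longrightarrow> p < length s + n \<Longrightarrow> w ! p = Multi k \<Longrightarrow>
    web_rel s n (web_y p * web_e w) 0"
| psi_red_red: "w \<in> Seqs (length s) n \<Longrightarrow> Suc p < length s + n \<Longrightarrow>
    w ! p = Multi k \<Longrightarrow> w ! Suc p = Multi l \<Longrightarrow>
    web_rel s n (web_psi p * web_e w) 0"
| psi_e: "w \<in> Seqs (length s) n \<Longrightarrow> Suc p < length s + n \<Longrightarrow>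
    w ! p = Single \<or> w ! Suc p = Single \<Longrightarrow>
    web_rel s n (web_psi p * web_e w) (web_e (swap_at p w) * web_psi p)"
| psi_y: "Suc p < length s + n \<Longrightarrow> q < length s + n \<Longrightarrow> q \<noteq> p \<Longrightarrow> q \<noteq> Suc p \<Longrightarrow>
    web_rel s n (web_psi p * web_y q) (web_y q * web_psi p)"
| psi_psi: "Suc p < length s + n \<Longrightarrow> Suc q < length s + n \<Longrightarrow> Suc p < q \<or> Suc q < p \<Longrightarrow>
    web_rel s n (web_psi p * web_psi q) (web_psi q * web_psi p)"
| psi_E: "Suc p < length s + n \<Longrightarrow> k < length s \<Longrightarrow> 1 \<le> d \<Longrightarrow> d \<le> s ! k \<Longrightarrow>
    web_rel s n (web_psi p * web_E k d) (web_E k d * web_psi p)"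
| black1: "w \<in> Seqs (length s) n \<Longrightarrow> Suc p < length s + n \<Longrightarrow>
    w ! p = Single \<Longrightarrow> w ! Suc p = Single \<Longrightarrow>
    web_rel s n ((web_y p * web_psi p - web_psi p * web_y (Suc p)) * web_e w) (web_e w)"
| black2: "w \<in> Seqs (length s) n \<Longrightarrow> Suc p < length s + n \<Longrightarrow>
    w ! p = Single \<Longrightarrow> w ! Suc p = Single \<Longrightarrow>
    web_rel s n ((web_psi p * web_y p - web_y (Suc p) * web_psi p) * web_e w) (web_e w)"
| black_quad: "w \<in> Seqs (length s) n \<Longrightarrow> Suc p < length s + n \<Longrightarrow>
    w ! p = Single \<Longrightarrow> w ! Suc p = Single \<Longrightarrow>
    web_rel s n (web_psi p ^ 2 * web_e w) 0"
| mixed1: "w \<in> Seqs (length s) n \<Longrightarrow> Suc p < length s + n \<Longrightarrow>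
    (w ! p = Single) \<noteq> (w ! Suc p = Single) \<Longrightarrow>
    web_rel s n (web_psi p * web_y p * web_e w) (web_y (Suc p) * web_psi p * web_e w)"
| mixed2: "w \<in> Seqs (length s) n \<Longrightarrow> Suc p < length s + n \<Longrightarrow>
    (w ! p = Single) \<noteq> (w ! Suc p = Single) \<Longrightarrow>
    web_rel s n (web_y p * web_psi p * web_e w) (web_psi p * web_y (Suc p) * web_e w)"
| black_red_quad: "w \<in> Seqs (length s) n \<Longrightarrow> Suc p < length s + n \<Longrightarrow>
    w ! p = Single \<Longrightarrow> w ! Suc p = Multi k \<Longrightarrow>
    web_rel s n (web_psi p ^ 2 * web_e w)
      (\<Sum>(d1, d2) \<in> {(d1, d2). d1 + d2 = s ! k}.
         (-1) ^ d2 * web_y p ^ d1 * web_E k d2 * web_e w)"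
| red_black_quad: "w \<in> Seqs (length s) n \<Longrightarrow> Suc p < length s + n \<Longrightarrow>
    w ! p = Multi k \<Longrightarrow> w ! Suc p = Single \<Longrightarrow>
    web_rel s n (web_psi p ^ 2 * web_e w)
      (\<Sum>(d1, d2) \<in> {(d1, d2). d1 + d2 = s ! k}.
         (-1) ^ d1 * web_E k d1 * web_y (Suc p) ^ d2 * web_e w)"
| braid_black_red_black: "w \<in> Seqs (length s) n \<Longrightarrow> Suc (Suc p) < length s + n \<Longrightarrow>
    w ! p = Single \<Longrightarrow> w ! Suc p = Multi k \<Longrightarrow> w ! Suc (Suc p) = Single \<Longrightarrow>
    web_rel s n
      ((web_psi p * web_psi (Suc p) * web_psi p - web_psi (Suc p) * web_psi p * web_psi (Suc p)) * web_e w)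
      (\<Sum>(a, b, c) \<in> {(a, b, c). a + b + c + 1 = s ! k}.
         (-1) ^ c * web_y p ^ a * web_E k c * web_y (Suc (Suc p)) ^ b * web_e w)"
| braid_zero: "w \<in> Seqs (length s) n \<Longrightarrow> Suc (Suc p) < length s + n \<Longrightarrow>
    card {q \<in> {p, Suc p, Suc (Suc p)}. w ! q \<noteq> Single} \<le> 1 \<Longrightarrow>
    \<not> (w ! p = Single \<and> w ! Suc p \<noteq> Single \<and> w ! Suc (Suc p) = Single) \<Longrightarrow>
    web_rel s n
      ((web_psi p * web_psi (Suc p) * web_psi p - web_psi (Suc p) * web_psi p * web_psi (Suc p)) * web_e w)
      0"

definition webster :: "nat list \<Rightarrow> nat \<Rightarrow> ('k::field, ('k, web_gen) free_alg set) module" where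
  "webster s n = presented_algebra (web_gens s n) (web_rel s n)"

end

theory Submission
  imports Defs "HOL-Computational_Algebra.Fraction_Field" "HOL-Combinatorics.Permutations"
    "HOL-Library.Multiset" "HOL-Library.Nat_Bijection"
begin

text \<open>
  Both algebras act faithfully on vectors of rational functions indexed by sequences: dots act by
  multiplication, crossings of equal strands by divided differences, and mixed crossings by a
  permutation of the index together with a polynomial factor. For faithfulness, the relations reduce
  every element to a combination of terms \<open>q \<psi>\<^sub>w e(i)\<close> with \<open>q\<close> a polynomial in the commuting
  generators and one chosen reduced word for every permutation \<open>w\<close>. Such a term acts as a combination
  of \<open>w\<close>, with nonzero coefficient, and shorter permutations of the variables. Distinct permutations
  are linearly independent over the rational functions (Dedekind), so all \<open>q\<close> vanish if the element
  acts as zero.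

  Multiplication by a fixed monomial \<open>\<delta>\<close>, which is \<open>x\<^sub>0\<^bsup>a-1\<^esup> x\<^sub>1\<^bsup>a-2\<^esup> \<dots>\<close> on a block of \<open>a\<close> barred strands,
  identifies the vectors that are symmetric in every block of barred variables with the image of the
  thick idempotents in the KLR representation. Under this identification the thick generators act
  exactly as the Webster generators. By faithfulness on both sides, an element of the free algebra on
  the Webster generators vanishes in the Webster algebra iff its image in the KLR algebra, multiplied
  by the sum of the thick idempotents, vanishes.
\<close>

section \<open>Homomorphisms out of monoid algebras\<close>

text \<open>Neither algebra comes with a basis, and no relation between thick generators is checked
  inside the KLR algebra: all identities are read off the representations. The obstacle is that
  faithfulness of the Webster representation concerns all rational functions, while the comparison
  with the KLR side sees only vectors symmetric in every barred block. It is met by testing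
  faithfulness on monomials in the strand variables alone. On the Webster side these are the black
  variables and the red dummies, so the test vectors are constant in the barred variables and hence
  symmetric. The elementary symmetric generators then count as coefficients, and their independence
  is the leading monomial argument of the fundamental theorem on symmetric polynomials. The
  staircase \<delta> appears because the longest divided difference sends it to 1: the image of a
  thick idempotent is then \<delta> times the functions symmetric in the block. The factor given by
  the sum of the thick idempotents is there because a map of free algebras sends 1 to the unit of
  the whole KLR algebra, which is not the unit of the subalgebra.\<close>

definition lift :: "('k::field \<Rightarrow> 'b::ring_1) \<Rightarrow> ('m::monoid_add \<Rightarrow> 'b) \<Rightarrow> ('m \<Rightarrow>\<^sub>0 'k) \<Rightarrow> 'b" where
  "lift h \<chi> p = (\<Sum>w\<in>Poly_Mapping.keys p. h (Poly_Mapping.lookup p w) * \<chi> w)"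

text \<open>Permutations of variables, the retraction onto a free subalgebra, the representations
  and the map to thick generators are all instances. The target is any \<open>ring_1\<close> without
  a scalar action of its own, so scalars enter through \<open>h\<close>; they have to commute with
  the values of \<open>\<chi>\<close>.\<close>

locale monoid_algebra_hom =
  fixes h :: "'k::field \<Rightarrow> 'b::ring_1" and \<chi> :: "'m::monoid_add \<Rightarrow> 'b"
  assumes h_add: "h (a + b) = h a + h b" and h_mult: "h (a * b) = h a * h b" and h_one: "h 1 = 1"
    and \<chi>_zero: "\<chi> 0 = 1" and \<chi>_plus: "\<chi> (u + v) = \<chi> u * \<chi> v"
    and central: "h a * \<chi> u = \<chi> u * h a"
begin

lemma h_zero: "h 0 = 0"
  using h_add[of 0 0] by simp

lemma lift_eq_sum_superset:
  assumes "finite A" "Poly_Mapping.keys p \<subseteq> A"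
  shows "lift h \<chi> p = (\<Sum>w\<in>A. h (Poly_Mapping.lookup p w) * \<chi> w)"
  unfolding lift_def
  by (rule sum.mono_neutral_left) (use assms in \<open>auto simp: in_keys_iff h_zero\<close>)

lemma lift_single: "lift h \<chi> (Poly_Mapping.single w c) = h c * \<chi> w"
  by (subst lift_eq_sum_superset[of "{w}"]) auto

lemma lift_add: "lift h \<chi> (p + q) = lift h \<chi> p + lift h \<chi> q"
proof -
  let ?A = "Poly_Mapping.keys p \<union> Poly_Mapping.keys q"
  have "lift h \<chi> (p + q) = (\<Sum>w\<in>?A. h (Poly_Mapping.lookup (p + q) w) * \<chi> w)"
    using keys_add[of p q] by (intro lift_eq_sum_superset) auto
  also have "\<dots> = lift h \<chi> p + lift h \<chi> q"
    by (subst (1 2) lift_eq_sum_superset[of ?A])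
      (auto simp: lookup_add h_add distrib_right sum.distrib)
  finally show ?thesis .
qed

lemma lift_zero: "lift h \<chi> 0 = 0"
  by (simp add: lift_def)

lemma lift_one: "lift h \<chi> 1 = 1"
  using lift_single[of 0 1] by (simp add: h_one \<chi>_zero)

lemma lift_minus: "lift h \<chi> (p - q) = lift h \<chi> p - lift h \<chi> q"
  using lift_add[of "p - q" q] by (simp add: algebra_simps)

lemma lift_uminus: "lift h \<chi> (- p) = - lift h \<chi> p"
  using lift_minus[of 0 p] by (simp add: lift_zero)

lemma lift_sum: "lift h \<chi> (sum f A) = (\<Sum>x\<in>A. lift h \<chi> (f x))"
  by (induction A rule: infinite_finite_induct) (auto simp: lift_zero lift_add)

lemma poly_mapping_eq_sum_single:
  "(p :: 'm \<Rightarrow>\<^sub>0 'k) = (\<Sum>w\<in>Poly_Mapping.keys p. Poly_Mapping.single w (Poly_Mapping.lookup p w))"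
  by (rule poly_mapping_eqI)
    (auto simp: lookup_sum lookup_single when_def in_keys_iff sum.delta)

lemma lift_mult: "lift h \<chi> (p * q) = lift h \<chi> p * lift h \<chi> q"
proof -
  have "p * q = (\<Sum>u\<in>Poly_Mapping.keys p. \<Sum>v\<in>Poly_Mapping.keys q.
      Poly_Mapping.single (u + v) (Poly_Mapping.lookup p u * Poly_Mapping.lookup q v))"
    by (subst (1) poly_mapping_eq_sum_single[of p], subst (1) poly_mapping_eq_sum_single[of q])
      (simp add: sum_product mult_single)
  then have "lift h \<chi> (p * q) = (\<Sum>u\<in>Poly_Mapping.keys p. \<Sum>v\<in>Poly_Mapping.keys q.
      h (Poly_Mapping.lookup p u) * (h (Poly_Mapping.lookup q v) * \<chi> u) * \<chi> v)"
    by (simp add: lift_sum lift_single h_mult \<chi>_plus mult.assoc)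
  also have "\<dots> = lift h \<chi> p * lift h \<chi> q"
    unfolding lift_def sum_product
    by (intro sum.cong refl) (metis central mult.assoc)
  finally show ?thesis .
qed

lemmas lift_hom = lift_zero lift_one lift_add lift_minus lift_uminus lift_mult lift_sum

lemma lift_power: "lift h \<chi> (p ^ n) = lift h \<chi> p ^ n"
  by (induction n) (auto simp: lift_one lift_mult)

end

lemma poly_mapping_sum_single:
  "(\<Sum>w\<in>Poly_Mapping.keys p. Poly_Mapping.single w (Poly_Mapping.lookup p w)) = p"
  by (rule poly_mapping_eqI)
    (auto simp: lookup_sum lookup_single when_def in_keys_iff sum.delta)

section \<open>A rational function field with permutation action\<close>

type_synonym 'k mpoly = "(nat \<Rightarrow>\<^sub>0 nat) \<Rightarrow>\<^sub>0 'k"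
type_synonym 'k rf = "'k mpoly fract"

text \<open>\<open>map_key\<close> pulls an exponent vector back along a function, so it is the
  inverse of \<open>g\<close> that moves the variable \<open>t\<close> to \<open>g t\<close>. The
  identity as value for a non-bijective \<open>g\<close> makes additivity and multiplicativity hold
  unconditionally.\<close>

definition poly_perm :: "(nat \<Rightarrow> nat) \<Rightarrow> 'k::field mpoly \<Rightarrow> 'k mpoly" where
  "poly_perm g = (if bij g then
     lift (Poly_Mapping.single 0) (\<lambda>\<alpha>. Poly_Mapping.single (Poly_Mapping.map_key (inv_into UNIV g) \<alpha>) 1) else id)"

lemma monoid_algebra_hom_poly_perm:
  assumes "bij g"
  shows "monoid_algebra_hom (Poly_Mapping.single 0)
    (\<lambda>\<alpha>. Poly_Mapping.single (Poly_Mapping.map_key (inv_into UNIV g) \<alpha>) 1 :: 'k::field mpoly)"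
proof -
  have i: "inj (inv_into UNIV g)" using assms by (simp add: bij_imp_bij_inv bij_is_inj)
  show ?thesis
    by standard (auto simp: single_add mult_single map_key_plus[OF i] map_key_zero[OF i])
qed

lemma poly_perm_single:
  assumes "bij g"
  shows "poly_perm g (Poly_Mapping.single \<alpha> c) =
    Poly_Mapping.single (Poly_Mapping.map_key (inv_into UNIV g) \<alpha>) (c::'k::field)"
  using monoid_algebra_hom.lift_single[OF monoid_algebra_hom_poly_perm[OF assms]] assms
  by (simp add: poly_perm_def mult_single)

lemma poly_perm_add: "poly_perm g (p + q) = poly_perm g p + poly_perm g (q :: 'k::field mpoly)"
  using monoid_algebra_hom.lift_add[OF monoid_algebra_hom_poly_perm] by (auto simp: poly_perm_def)

lemma poly_perm_mult: "poly_perm g (p * q) = poly_perm g p * poly_perm g (q :: 'k::field mpoly)"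
  using monoid_algebra_hom.lift_mult[OF monoid_algebra_hom_poly_perm] by (auto simp: poly_perm_def)

lemma poly_perm_zero [simp]: "poly_perm g 0 = (0 :: 'k::field mpoly)"
  using monoid_algebra_hom.lift_zero[OF monoid_algebra_hom_poly_perm] by (auto simp: poly_perm_def)

lemma poly_perm_one [simp]: "poly_perm g 1 = (1 :: 'k::field mpoly)"
  using monoid_algebra_hom.lift_one[OF monoid_algebra_hom_poly_perm] by (auto simp: poly_perm_def)

lemma poly_perm_sum: "poly_perm g (sum f A) = (\<Sum>x\<in>A. poly_perm g (f x :: 'k::field mpoly))"
  by (induction A rule: infinite_finite_induct) (auto simp: poly_perm_add)

lemma poly_perm_comp:
  assumes "bij g" "bij h"
  shows "poly_perm g (poly_perm h p) = poly_perm (g \<circ> h) (p :: 'k::field mpoly)"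
proof -
  have i: "inj (inv_into UNIV g)" "inj (inv_into UNIV h)" using assms by (simp_all add: bij_imp_bij_inv bij_is_inj)
  have "poly_perm g (poly_perm h (Poly_Mapping.single \<alpha> (c::'k))) = poly_perm (g \<circ> h) (Poly_Mapping.single \<alpha> c)" for \<alpha> c
    using assms i by (simp add: poly_perm_single bij_comp o_inv_distrib map_key_compose)
  then show ?thesis
    by (subst (1 2) poly_mapping_sum_single[of p, symmetric]) (simp add: poly_perm_sum)
qed

lemma poly_perm_id: "poly_perm id p = (p :: 'k::field mpoly)"
proof -
  have "poly_perm id (Poly_Mapping.single \<alpha> (c::'k)) = Poly_Mapping.single \<alpha> c" for \<alpha> c
    by (simp add: poly_perm_single map_key_id[unfolded id_def[symmetric]])
  then show ?thesis
    by (subst (1 2) poly_mapping_sum_single[of p, symmetric]) (simp only: poly_perm_sum)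
qed

text \<open>Injectivity keeps denominators nonzero, which lets the action descend to
  fractions.\<close>

lemma poly_perm_eq_0_iff: "poly_perm g p = 0 \<longleftrightarrow> p = (0 :: 'k::field mpoly)"
proof (cases "bij g")
  case True
  then have "poly_perm (inv_into UNIV g) (poly_perm g p) = p"
    by (simp add: poly_perm_comp bij_imp_bij_inv poly_perm_id inv_o_cancel bij_is_inj)
  then show ?thesis by (metis poly_perm_zero)
qed (simp add: poly_perm_def)

lift_definition rf_perm :: "(nat \<Rightarrow> nat) \<Rightarrow> 'k::field rf \<Rightarrow> 'k rf" is
  "\<lambda>g (a, b). (poly_perm g a, poly_perm g b)"
  by (auto simp: poly_perm_eq_0_iff poly_perm_mult[symmetric])

lemma rf_perm_Fract: "b \<noteq> 0 \<Longrightarrow> rf_perm g (Fract a b) = Fract (poly_perm g a) (poly_perm g (b :: 'k::field mpoly))"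
  by transfer (auto simp: poly_perm_eq_0_iff)

lemma rf_perm_0 [simp]: "rf_perm g 0 = (0 :: 'k::field rf)"
  by (simp add: Zero_fract_def rf_perm_Fract)

lemma rf_perm_1 [simp]: "rf_perm g 1 = (1 :: 'k::field rf)"
  by (simp add: One_fract_def rf_perm_Fract)

lemma rf_perm_add: "rf_perm g (x + y) = rf_perm g x + rf_perm g (y :: 'k::field rf)"
  by (cases x, cases y) (simp add: rf_perm_Fract poly_perm_add poly_perm_mult poly_perm_eq_0_iff)

lemma rf_perm_mult: "rf_perm g (x * y) = rf_perm g x * rf_perm g (y :: 'k::field rf)"
  by (cases x, cases y) (simp add: rf_perm_Fract poly_perm_mult poly_perm_eq_0_iff)

lemma rf_perm_minus: "rf_perm g (x - y) = rf_perm g x - rf_perm g (y :: 'k::field rf)"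
  using rf_perm_add[of g "x - y" y] by (simp add: algebra_simps)

lemma rf_perm_uminus: "rf_perm g (- y) = - rf_perm g (y :: 'k::field rf)"
  using rf_perm_minus[of g 0 y] by simp

lemma rf_perm_divide: "rf_perm g (x / y) = rf_perm g x / rf_perm g (y :: 'k::field rf)"
proof (cases "y = 0")
  case False
  then have "rf_perm g (x / y) * rf_perm g y = rf_perm g x"
    by (simp add: rf_perm_mult[symmetric])
  moreover have "rf_perm g y \<noteq> 0"
    using False by (metis right_inverse rf_perm_mult rf_perm_1 mult_zero_left zero_neq_one)
  ultimately show ?thesis by (simp add: field_simps)
qed simp

lemma rf_perm_power: "rf_perm g (x ^ n) = rf_perm g (x :: 'k::field rf) ^ n"
  by (induction n) (auto simp: rf_perm_mult)

lemma rf_perm_sum: "rf_perm g (sum f A) = (\<Sum>x\<in>A. rf_perm g (f x :: 'k::field rf))"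
  by (induction A rule: infinite_finite_induct) (auto simp: rf_perm_add)

lemma rf_perm_prod: "rf_perm g (prod f A) = (\<Prod>x\<in>A. rf_perm g (f x :: 'k::field rf))"
  by (induction A rule: infinite_finite_induct) (auto simp: rf_perm_mult)

lemma rf_perm_comp:
  assumes "bij g" "bij h"
  shows "rf_perm g (rf_perm h x) = rf_perm (g \<circ> h) (x :: 'k::field rf)"
  using assms by (cases x) (simp add: rf_perm_Fract poly_perm_comp poly_perm_eq_0_iff)

lemma rf_perm_id: "rf_perm id x = (x :: 'k::field rf)"
  by (cases x) (simp add: rf_perm_Fract poly_perm_id)

definition rf_poly :: "'k::field mpoly \<Rightarrow> 'k rf" where
  "rf_poly p = Fract p 1"

lemma rf_poly_hom:
  "rf_poly 0 = 0" "rf_poly 1 = 1" "rf_poly (p + q) = rf_poly p + rf_poly q"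
  "rf_poly (p * q) = rf_poly p * rf_poly q"
  by (simp_all add: rf_poly_def Zero_fract_def One_fract_def)

lemma rf_poly_sum: "rf_poly (sum f A) = (\<Sum>x\<in>A. rf_poly (f x))"
  by (induction A rule: infinite_finite_induct) (auto simp: rf_poly_hom)

lemma rf_poly_prod: "rf_poly (prod f A) = (\<Prod>x\<in>A. rf_poly (f x))"
  by (induction A rule: infinite_finite_induct) (auto simp: rf_poly_hom)

lemma rf_poly_eq_0_iff: "rf_poly p = 0 \<longleftrightarrow> p = 0"
  by (simp add: rf_poly_def Zero_fract_def eq_fract)

lemma rf_poly_inject: "rf_poly p = rf_poly q \<longleftrightarrow> p = q"
  by (simp add: rf_poly_def eq_fract)

definition rf_const :: "'k::field \<Rightarrow> 'k rf" where
  "rf_const c = rf_poly (Poly_Mapping.single 0 c)"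

definition rf_var :: "nat \<Rightarrow> 'k::field rf" where
  "rf_var t = rf_poly (Poly_Mapping.single (Poly_Mapping.single t 1) 1)"

lemma rf_const_hom [simp]:
  "rf_const 0 = 0" "rf_const 1 = 1" "rf_const (a + b) = rf_const a + rf_const b"
  "rf_const (a * b) = rf_const a * rf_const b"
  by (simp_all add: rf_const_def rf_poly_hom single_add mult_single flip: rf_poly_hom(4))

lemma rf_perm_const [simp]: "rf_perm g (rf_const c) = rf_const (c::'k::field)"
proof (cases "bij g")
  case True
  then show ?thesis
    by (simp add: rf_const_def rf_poly_def rf_perm_Fract poly_perm_single bij_imp_bij_inv bij_is_inj)
qed (simp add: rf_const_def rf_poly_def rf_perm_Fract poly_perm_def)

lemma rf_perm_var:
  assumes "bij g" shows "rf_perm g (rf_var t) = (rf_var (g t) :: 'k::field rf)"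
proof -
  have "Poly_Mapping.map_key (inv_into UNIV g) (Poly_Mapping.single t (1::nat)) = Poly_Mapping.single (g t) 1"
    using map_key_single[of "inv_into UNIV g" "g t" "1::nat"] assms
    by (simp add: bij_imp_bij_inv bij_is_inj)
  then show ?thesis
    using assms by (simp add: rf_var_def rf_poly_def rf_perm_Fract poly_perm_single)
qed

lemma rf_var_inject [simp]: "(rf_var t :: 'k::field rf) = rf_var t' \<longleftrightarrow> t = t'"
proof
  assume "(rf_var t :: 'k rf) = rf_var t'"
  then have "Poly_Mapping.keys (Poly_Mapping.single (Poly_Mapping.single t (1::nat)) (1::'k))
      = Poly_Mapping.keys (Poly_Mapping.single (Poly_Mapping.single t' 1) (1::'k))"
    by (simp add: rf_var_def rf_poly_inject)
  then have "Poly_Mapping.keys (Poly_Mapping.single t (1::nat)) = Poly_Mapping.keys (Poly_Mapping.single t' (1::nat))"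
    by simp
  then show "t = t'" by simp
qed simp

abbreviation swp :: "nat \<Rightarrow> nat \<Rightarrow> 'k::field rf \<Rightarrow> 'k rf" where
  "swp a b \<equiv> rf_perm (transpose a b)"

lemma swp_var: "swp a b (rf_var t) = (rf_var (transpose a b t) :: 'k::field rf)"
  by (simp add: rf_perm_var)

lemma swp_swp [simp]: "swp a b (swp a b x) = (x :: 'k::field rf)"
  by (simp add: rf_perm_comp rf_perm_id)

lemma swp_braid:
  assumes "a \<noteq> b" "b \<noteq> c" "a \<noteq> c"
  shows "swp a b (swp b c (swp a b x)) = swp a c (x :: 'k::field rf)"
    "swp b c (swp a b (swp b c x)) = swp a c x"
proof -
  have 1: "transpose a b \<circ> transpose b c \<circ> transpose a b = transpose a c"
    "transpose b c \<circ> transpose a b \<circ> transpose b c = transpose a c"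
    using assms by (auto simp: fun_eq_iff transpose_def)
  show "swp a b (swp b c (swp a b x)) = swp a c x"
    "swp b c (swp a b (swp b c x)) = swp a c x"
    by (simp_all add: rf_perm_comp bij_comp 1 flip: o_assoc) (simp_all add: o_assoc 1)
qed

lemma swp_commute:
  assumes "{a, b} \<inter> {c, d} = {}"
  shows "swp a b (swp c d x) = swp c d (swp a b (x :: 'k::field rf))"
proof -
  have "transpose a b \<circ> transpose c d = transpose c d \<circ> transpose a b"
    using assms by (auto simp: fun_eq_iff transpose_def)
  then show ?thesis by (simp add: rf_perm_comp)
qed

lemmas rf_perm_hom = rf_perm_add rf_perm_mult rf_perm_minus rf_perm_uminus rf_perm_divide

section \<open>Divided differences and their relations\<close>

definition dd :: "nat \<Rightarrow> nat \<Rightarrow> 'k::field rf \<Rightarrow> 'k rf" where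
  "dd a b f = (f - swp a b f) / (rf_var a - rf_var b)"

lemma dd_add: "dd a b (f + g) = dd a b f + dd a b (g :: 'k::field rf)"
  by (simp add: dd_def rf_perm_add add_divide_distrib diff_divide_distrib)

lemma dd_const: "dd a b (rf_const c * g) = rf_const c * dd a b (g :: 'k::field rf)"
  by (simp add: dd_def rf_perm_mult field_simps)

lemma dd_sym_mult: "swp a b h = h \<Longrightarrow> dd a b (h * g) = h * dd a b (g :: 'k::field rf)"
  by (simp add: dd_def rf_perm_mult field_simps)

lemma swp_dd: "swp a b (dd a b f) = dd a b (f :: 'k::field rf)"
  by (cases "a = b") (auto simp: dd_def rf_perm_hom swp_var field_simps)

lemma dd_dd: "dd a b (dd a b f) = (0 :: 'k::field rf)"
  unfolding dd_def[of a b "dd a b f"] swp_dd by simp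

lemma dd_commute:
  assumes "{a, b} \<inter> {c, d} = {}"
  shows "dd a b (dd c d f) = dd c d (dd a b (f :: 'k::field rf))"
proof -
  have "transpose a b c = c" "transpose a b d = d" "transpose c d a = a" "transpose c d b = b"
    using assms by auto
  then show ?thesis
    by (simp add: dd_def rf_perm_hom swp_var swp_commute[OF assms] diff_divide_distrib mult.commute)
qed

lemma swp_dd_commute:
  assumes "{a, b} \<inter> {c, d} = {}"
  shows "swp a b (dd c d f) = dd c d (swp a b (f :: 'k::field rf))"
proof -
  have "transpose a b c = c" "transpose a b d = d"
    using assms by auto
  then show ?thesis
    by (simp add: dd_def rf_perm_hom swp_var swp_commute[OF assms])
qed

text \<open>Both sides expand over the six permutations of the three variables. Their difference is
  a multiple of the partial fraction identity \<open>pqr\<close> between the inverse differences of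
  the variables.\<close>

lemma dd_braid:
  assumes "a \<noteq> b" "b \<noteq> c" "a \<noteq> c"
  shows "dd a b (dd b c (dd a b f)) = dd b c (dd a b (dd b c (f :: 'k::field rf)))"
proof -
  define p q r where "p = 1 / (rf_var a - rf_var b :: 'k rf)" and "q = 1 / (rf_var b - rf_var c :: 'k rf)"
    and "r = 1 / (rf_var a - rf_var c :: 'k rf)"
  have pqr: "p * q = r * p + r * q"
    using assms by (simp add: p_def q_def r_def divide_simps)
  have d: "dd a b g = p * (g - swp a b g)" "dd b c g = q * (g - swp b c g)" for g
    by (simp_all add: dd_def p_def q_def)
  have t: "transpose a b c = c" "transpose b c a = a" using assms by auto
  have s: "swp a b (swp b c (swp a b f)) = swp b c (swp a b (swp b c f))"
    by (simp only: swp_braid[OF assms])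
  have P: "swp a b p = - p" "swp a b q = r" "swp b c p = r" "swp b c q = - q" "swp a b r = q" "swp b c r = p"
    using assms by (simp_all add: p_def q_def r_def rf_perm_hom swp_var t)
      (simp_all add: divide_simps)
  \<comment> \<open>The letters \<open>u0\<close>, ..., \<open>u5\<close> are the images of
    \<open>f\<close> under the six permutations, with \<open>u5\<close> standing for the common
    value in \<open>s\<close>.\<close>
  have ring: "p * (q * (p * (u0 - u1) - r * (u2 - u4)) - r * (- p * (u1 - u0) - q * (u3 - u5)))
      - q * (p * (q * (u0 - u2) - r * (u1 - u3)) - r * (- q * (u2 - u0) - p * (u4 - u5)))
    = (p * q - (r * p + r * q)) * ((p - q) * u0 - p * u1 + q * u2)" for u0 u1 u2 u3 u4 u5
    by (simp add: algebra_simps)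
  show ?thesis
    unfolding d rf_perm_hom P swp_swp s
    by (subst eq_iff_diff_eq_0) (simp only: ring pqr diff_self mult_zero_left)
qed

section \<open>Linear operators on vectors of rational functions\<close>

text \<open>Only linearity over the constants is asked for, since divided differences and
  permutations of variables are not linear over the rational functions. Bundled into a type, such
  operators form a \<open>ring_1\<close> and can be the target of \<open>lift\<close>.\<close>

definition linear_op :: "(('a \<Rightarrow> 'k::field rf) \<Rightarrow> 'a \<Rightarrow> 'k rf) \<Rightarrow> bool" where
  "linear_op T \<longleftrightarrow> (\<forall>u v. T (\<lambda>c. u c + v c) = (\<lambda>c. T u c + T v c)) \<and>
    (\<forall>a v. T (\<lambda>c. rf_const a * v c) = (\<lambda>c. rf_const a * T v c))"

lemma linear_op_zero: "linear_op T \<Longrightarrow> T (\<lambda>c. 0) = (\<lambda>c. 0)"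
  unfolding linear_op_def by (metis (no_types, lifting) mult_zero_left rf_const_hom(1) ext)

typedef (overloaded) ('a, 'k) oper = "{T :: ('a \<Rightarrow> 'k::field rf) \<Rightarrow> 'a \<Rightarrow> 'k rf. linear_op T}"
  morphisms app Oper
  by (rule exI[of _ "\<lambda>v. v"]) (simp add: linear_op_def)

setup_lifting type_definition_oper

instantiation oper :: (type, field) ring_1
begin

lift_definition zero_oper :: "('a, 'b) oper" is "\<lambda>v c. 0" by (simp add: linear_op_def)
lift_definition one_oper :: "('a, 'b) oper" is "\<lambda>v. v" by (simp add: linear_op_def)
lift_definition plus_oper :: "('a, 'b) oper \<Rightarrow> ('a, 'b) oper \<Rightarrow> ('a, 'b) oper"
  is "\<lambda>S T v c. S v c + T v c"
  by (auto simp: linear_op_def fun_eq_iff algebra_simps)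
lift_definition uminus_oper :: "('a, 'b) oper \<Rightarrow> ('a, 'b) oper"
  is "\<lambda>S v c. - S v c"
  by (auto simp: linear_op_def fun_eq_iff algebra_simps)
lift_definition minus_oper :: "('a, 'b) oper \<Rightarrow> ('a, 'b) oper \<Rightarrow> ('a, 'b) oper"
  is "\<lambda>S T v c. S v c - T v c"
  by (auto simp: linear_op_def fun_eq_iff algebra_simps)
lift_definition times_oper :: "('a, 'b) oper \<Rightarrow> ('a, 'b) oper \<Rightarrow> ('a, 'b) oper"
  is "\<lambda>S T v. S (T v)"
  by (auto simp: linear_op_def)

instance
proof
  show "(0 :: ('a, 'b) oper) \<noteq> 1"
  proof transfer
    show "(\<lambda>v c. 0) \<noteq> (\<lambda>v :: 'a \<Rightarrow> 'b rf. v)"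
      by (metis zero_neq_one)
  qed
qed (transfer; auto simp: fun_eq_iff linear_op_def algebra_simps)+

end

lift_definition oper_scal :: "'k::field \<Rightarrow> ('a, 'k) oper" is "\<lambda>a v c. rf_const a * v c"
  by (auto simp: linear_op_def fun_eq_iff algebra_simps)

lemma app_ring [simp]:
  "app 0 v = (\<lambda>c. 0)" "app 1 v = v" "app (S + T) v = (\<lambda>c. app S v c + app T v c)"
  "app (- S) v = (\<lambda>c. - app S v c)"
  "app (S - T) v = (\<lambda>c. app S v c - app T v c)" "app (S * T) v = app S (app T v)"
  "app (oper_scal a) v = (\<lambda>c. rf_const a * v c)"
  by (transfer; simp)+

lemma linear_app: "linear_op (app T)"
  using app by auto

lemma app_add: "app T (\<lambda>c. u c + v c) = (\<lambda>c. app T u c + app T v c)"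
  and app_scal: "app T (\<lambda>c. rf_const a * v c) = (\<lambda>c. rf_const a * app T v c)"
  using linear_app[of T] by (simp_all add: linear_op_def)

lemma app_0: "app T (\<lambda>c. 0) = (\<lambda>c. 0)"
  using linear_op_zero[OF linear_app] .

lemma app_vec_sum: "app T (\<lambda>c. \<Sum>i\<in>A. f i c) = (\<lambda>c. \<Sum>i\<in>A. app T (f i) c)"
proof (induction A rule: infinite_finite_induct)
  case (insert x F)
  then show ?case using app_add[of T "f x" "\<lambda>c. \<Sum>i\<in>F. f i c"] by simp
qed (auto simp: app_0)

lemma app_sum: "app (\<Sum>i\<in>A. T i) v = (\<lambda>c. \<Sum>i\<in>A. app (T i) v c)"
  by (induction A rule: infinite_finite_induct) auto

lemma oper_scal_hom: "oper_scal (a + b) = oper_scal a + oper_scal b"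
  "oper_scal (a * b) = oper_scal a * oper_scal b" "oper_scal 1 = 1"
  by (transfer; simp add: fun_eq_iff algebra_simps)+

lemma oper_scal_central: "oper_scal a * T = T * oper_scal a"
  by transfer (auto simp: linear_op_def)

lemma app_Oper: "linear_op T \<Longrightarrow> app (Oper T) = T"
  by (simp add: Oper_inverse)

section \<open>Free algebras and presentations\<close>

definition word_prod :: "('g \<Rightarrow> 'b::monoid_mult) \<Rightarrow> 'g word \<Rightarrow> 'b" where
  "word_prod f w = prod_list (map f (letters w))"

lemma word_prod_simps: "word_prod f 0 = 1" "word_prod f (u + v) = word_prod f u * word_prod f v"
  by (simp_all add: word_prod_def zero_word_def plus_word_def)

lemma monoid_algebra_hom_word:
  assumes "\<And>a b. h (a + b) = h a + h b" "\<And>a b. h (a * b) = h a * h b" "h 1 = 1"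
    and "\<And>a g. h a * f g = f g * h a"
  shows "monoid_algebra_hom (h :: 'k::field \<Rightarrow> 'b::ring_1) (word_prod f)"
proof
  fix a u
  have "h a * prod_list (map f l) = prod_list (map f l) * h a" for l
    by (induction l) (auto simp: assms(4) mult.assoc simp flip: mult.assoc[of "h a"])
  then show "h a * word_prod f u = word_prod f u * h a" by (simp add: word_prod_def)
qed (auto simp: assms word_prod_simps)

lemma fscalar_hom:
  "fscalar (a + b) = fscalar a + (fscalar b :: ('k::field, 'g) free_alg)"
  "fscalar (a * b) = fscalar a * (fscalar b :: ('k::field, 'g) free_alg)"
  "fscalar 1 = (1 :: ('k::field, 'g) free_alg)"
  "fscalar 0 = (0 :: ('k::field, 'g) free_alg)"
  by (simp_all add: fscalar_def single_add mult_single)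

lemma fscalar_central: "fscalar a * p = p * (fscalar a :: ('k::field, 'g) free_alg)"
proof -
  have "fscalar a * Poly_Mapping.single w b = Poly_Mapping.single w b * (fscalar a :: ('k, 'g) free_alg)" for w b
    by (simp add: fscalar_def mult_single mult.commute)
  then show ?thesis
    by (subst (1 2) poly_mapping_sum_single[of p, symmetric]) (simp add: sum_distrib_left sum_distrib_right)
qed

lemma single_eq_word_prod:
  "Poly_Mapping.single w a = fscalar a * (word_prod fgen w :: ('k::field, 'g) free_alg)"
proof -
  have "prod_list (map fgen l) = (Poly_Mapping.single (Word l) 1 :: ('k, 'g) free_alg)" for l
    by (induction l) (auto simp: fgen_def mult_single plus_word_def zero_word_def simp flip: single_one)
  then show ?thesis by (cases w) (simp add: word_prod_def fscalar_def mult_single)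
qed

lemma free_alg_eq_sum_words:
  "p = (\<Sum>w\<in>Poly_Mapping.keys p. fscalar (Poly_Mapping.lookup p w) * (word_prod fgen w :: ('k::field, 'g) free_alg))"
  by (subst poly_mapping_sum_single[of p, symmetric]) (simp only: single_eq_word_prod)

lemma free_alg_induct [case_names zero add scal gen one]:
  assumes "P 0" "\<And>p q. P p \<Longrightarrow> P q \<Longrightarrow> P (p + q)" "\<And>a p. P p \<Longrightarrow> P (fscalar a * p)"
    and "\<And>g p. P p \<Longrightarrow> P (fgen g * p)" "P 1"
  shows "P (p :: ('k::field, 'g) free_alg)"
proof -
  have "P (prod_list (map fgen l))" for l
    by (induction l) (auto intro: assms)
  then have w: "P (word_prod fgen w)" for w by (simp add: word_prod_def)
  have "P (\<Sum>w\<in>A. fscalar (Poly_Mapping.lookup p w) * word_prod fgen w)" if "finite A" for A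
    using that by (induction A) (auto intro: assms w)
  then show ?thesis by (subst free_alg_eq_sum_words) simp
qed

section \<open>Free subalgebras, two-sided ideals and presentations\<close>

abbreviation fcarrier :: "'g set \<Rightarrow> ('k::field, 'g) free_alg set" where
  "fcarrier G \<equiv> carrier (free_algebra G)"

lemma fcarrier_iff: "p \<in> fcarrier G \<longleftrightarrow> (\<forall>w\<in>Poly_Mapping.keys p. set (letters w) \<subseteq> G)"
  by (simp add: free_algebra_def)

lemma fcarrier_0 [simp, intro]: "0 \<in> fcarrier G"
  and fcarrier_1 [simp, intro]: "1 \<in> fcarrier G"
  by (auto simp: fcarrier_iff zero_word_def split: if_splits)

lemma fcarrier_add [intro]: "p \<in> fcarrier G \<Longrightarrow> q \<in> fcarrier G \<Longrightarrow> p + q \<in> fcarrier G"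
  unfolding fcarrier_iff using keys_add[of p q] by blast

lemma fcarrier_mult [intro]: "p \<in> fcarrier G \<Longrightarrow> q \<in> fcarrier G \<Longrightarrow> p * q \<in> fcarrier G"
  unfolding fcarrier_iff using keys_mult[of p q] by (fastforce simp: plus_word_def)

lemma fcarrier_uminus [intro]: "p \<in> fcarrier G \<Longrightarrow> - p \<in> fcarrier G"
  by (auto simp: fcarrier_iff in_keys_iff)

lemma fcarrier_minus [intro]: "p \<in> fcarrier G \<Longrightarrow> q \<in> fcarrier G \<Longrightarrow> p - q \<in> fcarrier G"
  using fcarrier_add[of p G "- q"] fcarrier_uminus[of q G] by simp

lemma fcarrier_fgen [simp, intro]: "g \<in> G \<Longrightarrow> fgen g \<in> fcarrier G"
  by (auto simp: fcarrier_iff fgen_def)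

lemma fcarrier_fscalar [simp, intro]: "fscalar a \<in> fcarrier G"
  by (auto simp: fcarrier_iff fscalar_def zero_word_def split: if_splits)

lemma fcarrier_sum [intro]: "(\<And>x. x \<in> A \<Longrightarrow> f x \<in> fcarrier G) \<Longrightarrow> sum f A \<in> fcarrier G"
  by (induction A rule: infinite_finite_induct) auto

lemma fcarrier_power [intro]: "p \<in> fcarrier G \<Longrightarrow> p ^ k \<in> fcarrier G"
  by (induction k) auto

lemma fcarrier_prod_list [intro]: "(\<And>x. x \<in> set xs \<Longrightarrow> x \<in> fcarrier G) \<Longrightarrow> prod_list xs \<in> fcarrier G"
  by (induction xs) auto

lemma free_algebra_simps [simp]:
  "monoid.mult (free_algebra G) = (*)" "monoid.one (free_algebra G) = 1" "ring.zero (free_algebra G) = 0"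
  "ring.add (free_algebra G) = (+)" "module.smult (free_algebra G) = (\<lambda>c p. fscalar c * p)"
  by (simp_all add: free_algebra_def)

lemma ring_free_algebra: "ring (free_algebra G :: ('k::field, ('k, 'g) free_alg) module)"
proof (rule ringI)
  show "abelian_group (free_algebra G :: ('k, ('k, 'g) free_alg) module)"
  proof (rule abelian_groupI)
    fix x :: "('k, 'g) free_alg" assume "x \<in> fcarrier G"
    then show "\<exists>y\<in>fcarrier G. y \<oplus>\<^bsub>free_algebra G\<^esub> x = \<zero>\<^bsub>free_algebra G\<^esub>"
      by (intro bexI[of _ "- x"]) auto
  qed (auto simp: add_ac)
  show "Group.monoid (free_algebra G :: ('k, ('k, 'g) free_alg) module)"
    by (rule monoidI) (auto simp: mult.assoc)
qed (auto simp: algebra_simps)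

text \<open>A two-sided ideal of a whole type: membership is computed with type class operations
  instead of the record operations of an abstract ring.\<close>

definition tsi :: "'r::ring_1 set \<Rightarrow> bool" where
  "tsi K \<longleftrightarrow> 0 \<in> K \<and> (\<forall>x\<in>K. \<forall>y\<in>K. x + y \<in> K) \<and> (\<forall>x\<in>K. \<forall>a. a * x \<in> K \<and> x * a \<in> K)"

lemma tsiD:
  assumes "tsi K"
  shows "0 \<in> K" "x \<in> K \<Longrightarrow> y \<in> K \<Longrightarrow> x + y \<in> K" "x \<in> K \<Longrightarrow> a * x \<in> K" "x \<in> K \<Longrightarrow> x * a \<in> K"
    "x \<in> K \<Longrightarrow> - x \<in> K" "x \<in> K \<Longrightarrow> y \<in> K \<Longrightarrow> x - y \<in> K"
proof -
  show 1: "0 \<in> K" "x \<in> K \<Longrightarrow> y \<in> K \<Longrightarrow> x + y \<in> K" "x \<in> K \<Longrightarrow> a * x \<in> K" "x \<in> K \<Longrightarrow> x * a \<in> K" for x y a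
    using assms by (auto simp: tsi_def)
  show 2: "x \<in> K \<Longrightarrow> - x \<in> K" for x using 1(3)[of x "-1"] by simp
  show "x \<in> K \<Longrightarrow> y \<in> K \<Longrightarrow> x - y \<in> K" using 1(2)[of x "- y"] 2 by simp
qed

lemma a_inv_free_algebra:
  assumes "y \<in> fcarrier G"
  shows "\<ominus>\<^bsub>free_algebra G\<^esub> y = - (y :: ('k::field, 'g) free_alg)"
proof -
  interpret R: ring "free_algebra G :: ('k, ('k, 'g) free_alg) module" by (rule ring_free_algebra)
  show ?thesis
    by (rule R.minus_equality) (use assms in auto)
qed

lemma minus_eq_free_algebra:
  assumes "y \<in> fcarrier G"
  shows "x \<ominus>\<^bsub>free_algebra G\<^esub> y = x - (y :: ('k::field, 'g) free_alg)"
  using a_inv_free_algebra[OF assms] by (simp add: a_minus_def)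

locale presentation =
  fixes G :: "'g set" and rel :: "('k::field, 'g) free_alg \<Rightarrow> ('k, 'g) free_alg \<Rightarrow> bool"
  assumes rel_carrier: "rel a b \<Longrightarrow> a \<in> fcarrier G \<and> b \<in> fcarrier G"
begin

abbreviation "FA \<equiv> (free_algebra G :: ('k, ('k, 'g) free_alg) module)"

text \<open>Killing the generators outside \<open>G\<close> is an algebra map that is the identity
  on \<open>fcarrier G\<close>. It translates between the record \<open>free_algebra G\<close> and
  the full type of the free algebra.\<close>

definition retract :: "('k, 'g) free_alg \<Rightarrow> ('k, 'g) free_alg" where
  "retract = lift fscalar (word_prod (\<lambda>g. if g \<in> G then fgen g else 0))"

sublocale retract: monoid_algebra_hom fscalar "word_prod (\<lambda>g. if g \<in> G then fgen g else (0 :: ('k, 'g) free_alg))"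
  by (rule monoid_algebra_hom_word) (simp_all only: fscalar_hom, rule fscalar_central)

lemmas retract_hom = retract.lift_hom[folded retract_def]

lemma retract_gen: "retract (fgen g) = (if g \<in> G then fgen g else 0)"
  using retract.lift_single[of "Word [g]" 1]
  by (simp add: retract_def fgen_def word_prod_def fscalar_hom)

lemma retract_scal: "retract (fscalar a) = fscalar a"
  using retract.lift_single[of 0 a] by (simp add: retract_def fscalar_def word_prod_simps)

lemma retract_carrier: "retract p \<in> fcarrier G"
  by (induction p rule: free_alg_induct) (auto simp: retract_hom retract_gen retract_scal)

lemma retract_word: "set (letters w) \<subseteq> G \<Longrightarrow> retract (word_prod fgen w) = word_prod fgen w"
proof -
  have "set l \<subseteq> G \<Longrightarrow> retract (prod_list (map fgen l)) = prod_list (map fgen l)" for l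
    by (induction l) (auto simp: retract_hom retract_gen)
  then show "set (letters w) \<subseteq> G \<Longrightarrow> ?thesis" by (simp add: word_prod_def)
qed

lemma retract_id: "p \<in> fcarrier G \<Longrightarrow> retract p = p"
proof -
  assume p: "p \<in> fcarrier G"
  have "retract p = (\<Sum>w\<in>Poly_Mapping.keys p. retract (fscalar (Poly_Mapping.lookup p w) * word_prod fgen w))"
    by (subst (1) free_alg_eq_sum_words) (simp add: retract_hom)
  also have "\<dots> = p"
    using p by (subst (4) free_alg_eq_sum_words)
      (auto simp: retract_hom retract_scal retract_word fcarrier_iff intro!: sum.cong)
  finally show ?thesis .
qed

text \<open>
  The relation ideal is extended to the free algebra on all generators by adding the generators
  outside of \<open>G\<close>; calculations modulo \<open>J\<close> then need no carrier conditions.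
\<close>

definition J :: "('k, 'g) free_alg set" where
  "J = {p. retract p \<in> rel_ideal G rel}"

lemma ideal_rel: "ideal (rel_ideal G rel) FA"
  unfolding rel_ideal_def
  by (rule ring.genideal_ideal[OF ring_free_algebra]) (auto dest: rel_carrier)

lemma tsi_J: "tsi J"
proof -
  interpret I: ideal "rel_ideal G rel" FA by (rule ideal_rel)
  show ?thesis
    unfolding tsi_def J_def
    using I.I_l_closed I.I_r_closed additive_subgroup.a_closed[OF I.is_additive_subgroup]
      additive_subgroup.zero_closed[OF I.is_additive_subgroup] retract_carrier
    by (auto simp: retract_hom)
qed

lemmas J = tsiD[OF tsi_J]

lemma J_rel: "rel a b \<Longrightarrow> a - b \<in> J"
proof -
  assume r: "rel a b"
  then have "a - b \<in> rel_ideal G rel"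
    unfolding rel_ideal_def
    by (intro subsetD[OF ring.genideal_self[OF ring_free_algebra]]) (auto dest: rel_carrier)
  moreover have "a - b \<in> fcarrier G"
    using rel_carrier[OF r] by auto
  ultimately show ?thesis
    by (simp add: J_def retract_id)
qed

lemma J_gen: "g \<notin> G \<Longrightarrow> fgen g \<in> J"
  using J(1) by (simp add: J_def retract_gen retract_hom)

text \<open>The universal property of the presentation. \<open>K\<close> meets the free subalgebra
  in an ideal that contains the relations, and every element differs from its retract by an element
  of \<open>K\<close>. It is applied with \<open>K\<close> the annihilator of a
  representation.\<close>

lemma J_least:
  assumes K: "tsi K" and rel: "\<And>a b. rel a b \<Longrightarrow> a - b \<in> K" and gen: "\<And>g. g \<notin> G \<Longrightarrow> fgen g \<in> K"
  shows "J \<subseteq> K"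
proof
  note K' = tsiD[OF K]
  fix p assume p: "p \<in> J"
  have "ideal (K \<inter> fcarrier G) FA"
  proof (rule idealI[OF ring_free_algebra])
    show "subgroup (K \<inter> fcarrier G) (add_monoid FA)"
    proof (rule group.subgroupI)
      show "Group.group (add_monoid FA)"
        using abelian_group.a_group[OF ring.is_abelian_group[OF ring_free_algebra]] .
      show "inv\<^bsub>add_monoid FA\<^esub> a \<in> K \<inter> fcarrier G" if a: "a \<in> K \<inter> fcarrier G" for a
      proof -
        have "inv\<^bsub>add_monoid FA\<^esub> a = - a"
          using a a_inv_free_algebra[of a G] by (simp only: a_inv_def IntD2)
        then show ?thesis using a K'(5)[of a] by (simp add: fcarrier_uminus)
      qed
    qed (use K' in auto)
  qed (use K' in auto)
  then have "rel_ideal G rel \<subseteq> K \<inter> fcarrier G"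
    unfolding rel_ideal_def
    by (rule ring.genideal_minimal[OF ring_free_algebra]) (auto dest: rel_carrier rel)
  then have "retract p \<in> K" using p by (auto simp: J_def)
  moreover have "q - retract q \<in> K" for q
  proof (induction q rule: free_alg_induct)
    case (add p q)
    then show ?case using K'(2)[OF add] by (simp add: retract_hom algebra_simps)
  next
    case (scal a p)
    then show ?case using K'(3)[OF scal, of "fscalar a"] by (simp add: retract_hom retract_scal algebra_simps)
  next
    case (gen g p)
    \<comment> \<open>The difference between a product and its retract, written as two products with
      one factor in \<open>K\<close> each.\<close>
    have "fgen g * (p - retract p) + (fgen g - retract (fgen g)) * retract p \<in> K"
      using K' gen assms(3)[of g] by (intro K'(2) K'(3,4)) (auto simp: retract_gen)
    then show ?case by (simp add: retract_hom algebra_simps)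
  qed (auto simp: retract_hom K')
  ultimately show "p \<in> K" using K'(2)[of "p - retract p" "retract p"] by simp
qed

lemma J_iff: "p \<in> fcarrier G \<Longrightarrow> p \<in> J \<longleftrightarrow> p \<in> rel_ideal G rel"
  by (simp add: J_def retract_id)

abbreviation "cls \<equiv> pres_class G rel"
abbreviation "PA \<equiv> presented_algebra G rel"

lemma cls_eq_iff:
  assumes "p \<in> fcarrier G" "q \<in> fcarrier G"
  shows "cls p = cls q \<longleftrightarrow> p - q \<in> J"
  using ring.quotient_eq_iff_same_a_r_cos[OF ring_free_algebra ideal_rel assms]
    minus_eq_free_algebra[OF assms(2)] assms J_iff[of "p - q"]
  by (auto simp: pres_class_def)

lemma PA_carrier: "carrier PA = cls ` fcarrier G"
  unfolding presented_algebra_def Let_def FactRing_def A_RCOSETS_def' pres_class_def by auto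

lemma PA_simps:
  shows "p \<in> fcarrier G \<Longrightarrow> q \<in> fcarrier G \<Longrightarrow> cls p \<otimes>\<^bsub>PA\<^esub> cls q = cls (p * q)"
    and "p \<in> fcarrier G \<Longrightarrow> q \<in> fcarrier G \<Longrightarrow> cls p \<oplus>\<^bsub>PA\<^esub> cls q = cls (p + q)"
    and "\<one>\<^bsub>PA\<^esub> = cls 1" "\<zero>\<^bsub>PA\<^esub> = cls 0"
    and "p \<in> fcarrier G \<Longrightarrow> a \<odot>\<^bsub>PA\<^esub> cls p = cls (fscalar a * p)"
proof -
  interpret I: ideal "rel_ideal G rel" FA by (rule ideal_rel)
  show m: "p \<in> fcarrier G \<Longrightarrow> q \<in> fcarrier G \<Longrightarrow> cls p \<otimes>\<^bsub>PA\<^esub> cls q = cls (p * q)" for p q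
    using I.rcoset_mult_add[of p q] unfolding presented_algebra_def Let_def FactRing_def pres_class_def by simp
  show "p \<in> fcarrier G \<Longrightarrow> q \<in> fcarrier G \<Longrightarrow> cls p \<oplus>\<^bsub>PA\<^esub> cls q = cls (p + q)"
    using I.a_rcos_sum[of p q] unfolding presented_algebra_def Let_def FactRing_def pres_class_def by simp
  show "\<one>\<^bsub>PA\<^esub> = cls 1"
    unfolding presented_algebra_def Let_def FactRing_def pres_class_def by simp
  show "\<zero>\<^bsub>PA\<^esub> = cls 0"
    using I.a_coset_add_zero[OF I.a_subset] unfolding presented_algebra_def Let_def FactRing_def pres_class_def by simp
  show "p \<in> fcarrier G \<Longrightarrow> a \<odot>\<^bsub>PA\<^esub> cls p = cls (fscalar a * p)"
    using m[of "fscalar a" p] unfolding presented_algebra_def Let_def by simp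
qed

end

section \<open>Braid equivalence of words\<close>

text \<open>Only the length-preserving relations of the symmetric group are included. Cancellation
  of a double letter is kept apart, because in the algebras the square of a crossing is not 1 but a
  polynomial.\<close>

inductive braid_eq :: "nat list \<Rightarrow> nat list \<Rightarrow> bool" (infix \<open>\<approx>\<close> 50) where
  reflexive [simp, intro]: "u \<approx> u"
| symmetric: "u \<approx> v \<Longrightarrow> v \<approx> u"
| transitive [trans]: "u \<approx> v \<Longrightarrow> v \<approx> w \<Longrightarrow> u \<approx> w"
| comm: "Suc p < q \<Longrightarrow> a @ [p, q] @ b \<approx> a @ [q, p] @ b"
| braid: "a @ [p, Suc p, p] @ b \<approx> a @ [Suc p, p, Suc p] @ b"

lemma braid_eq_append_context: "u \<approx> v \<Longrightarrow> a @ u @ b \<approx> a @ v @ b"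
proof (induction rule: braid_eq.induct)
  case (comm p q a' b')
  then show ?case using braid_eq.comm[of p q "a @ a'" "b' @ b"] by simp
next
  case (braid a' p b')
  then show ?case using braid_eq.braid[of "a @ a'" p "b' @ b"] by simp
qed (auto intro: braid_eq.intros)

lemma braid_eq_left: "u \<approx> v \<Longrightarrow> a @ u \<approx> a @ v"
  using braid_eq_append_context[of u v a "[]"] by simp

lemma braid_eq_right: "u \<approx> v \<Longrightarrow> u @ b \<approx> v @ b"
  using braid_eq_append_context[of u v "[]" b] by simp

lemma braid_eq_Cons: "u \<approx> v \<Longrightarrow> x # u \<approx> x # v"
  using braid_eq_left[of u v "[x]"] by simp

lemma braid_eq_length: "u \<approx> v \<Longrightarrow> length u = length v"
  by (induction rule: braid_eq.induct) auto

lemma braid_eq_set: "u \<approx> v \<Longrightarrow> set u = set v"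
  by (induction rule: braid_eq.induct) auto

lemma braid_eq_far_letter:
  assumes "\<forall>x\<in>set v. Suc x < p"
  shows "p # v \<approx> v @ [p]"
  using assms
proof (induction v)
  case (Cons x v)
  have "p # x # v \<approx> x # p # v"
    using braid_eq.symmetric[OF braid_eq.comm[of x p "[]" v]] Cons.prems by simp
  also have "\<dots> \<approx> x # (v @ [p])"
    using Cons by (intro braid_eq_Cons) auto
  finally show ?case by simp
qed simp

section \<open>Descending words and normal forms for the symmetric group\<close>

definition desc :: "nat \<Rightarrow> nat \<Rightarrow> nat list" where
  "desc t R = rev [t..<R]"

lemma desc_Suc [simp]: "t \<le> R \<Longrightarrow> desc t (Suc R) = R # desc t R"
  by (simp add: desc_def)

lemma desc_empty [simp]: "desc R R = []"
  by (simp add: desc_def)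

lemma set_desc [simp]: "set (desc t R) = {t..<R}"
  by (simp add: desc_def)

lemma desc_split: "t \<le> k \<Longrightarrow> k \<le> R \<Longrightarrow> desc t R = desc k R @ desc t k"
  by (metis desc_def rev_append le_iff_add upt_add_eq_append)

text \<open>A descending word represents a cycle, and conjugation by it lowers by one every letter
  of it except the smallest. On words, the letter commutes past the tail, takes part in one braid
  relation with its predecessor, and then commutes past the head.\<close>

lemma desc_letter:
  assumes "t < x" "x < R"
  shows "desc t R @ [x] \<approx> (x - 1) # desc t R"
proof -
  obtain y where x: "x = Suc y" using assms by (cases x) auto
  have yR: "t \<le> y" "Suc (Suc y) \<le> R" using assms x by auto
  have split: "desc t R = desc (Suc (Suc y)) R @ [Suc y, y] @ desc t y"
    using yR desc_split[of t y R] desc_split[of y "Suc (Suc y)" R] by simp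
  have "desc t R @ [x] = desc (Suc (Suc y)) R @ [Suc y, y] @ (desc t y @ [Suc y])"
    using split x by simp
  also have "\<dots> \<approx> desc (Suc (Suc y)) R @ [Suc y, y] @ (Suc y # desc t y)"
    by (intro braid_eq_left braid_eq.symmetric[OF braid_eq_far_letter]) auto
  also have "\<dots> \<approx> desc (Suc (Suc y)) R @ [y, Suc y, y] @ desc t y"
    using braid_eq.symmetric[OF braid_eq.braid] by simp
  also have "\<dots> = (desc (Suc (Suc y)) R @ [y]) @ [Suc y, y] @ desc t y" by simp
  also have "\<dots> \<approx> (y # desc (Suc (Suc y)) R) @ [Suc y, y] @ desc t y"
  proof (rule braid_eq_right)
    have "desc k R @ [y] \<approx> y # desc k R" if "Suc y < k" for k
    proof -
      have "v @ [y] \<approx> y # v" if "\<forall>z\<in>set v. Suc y < z" for v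
        using that
      proof (induction v)
        case (Cons z v)
        have "z # (v @ [y]) \<approx> z # y # v" using Cons by (intro braid_eq_Cons) auto
        also have "\<dots> \<approx> y # z # v"
          using braid_eq.symmetric[OF braid_eq.comm[of y z "[]" v]] Cons.prems by simp
        finally show ?case by simp
      qed simp
      then show ?thesis using that by auto
    qed
    then show "desc (Suc (Suc y)) R @ [y] \<approx> y # desc (Suc (Suc y)) R" by simp
  qed
  finally show ?thesis using split x by simp
qed

lemma desc_shift:
  assumes "u < t" "t \<le> R'" "R' \<le> R"
  shows "desc u R @ desc t R' \<approx> desc (t - 1) (R' - 1) @ desc u R"
  using assms
proof (induction R')
  case (Suc R')
  show ?case
  proof (cases "t = Suc R'")
    case False
    then have "desc u R @ desc t (Suc R') = (desc u R @ [R']) @ desc t R'"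
      using Suc.prems by simp
    also have "\<dots> \<approx> ((R' - 1) # desc u R) @ desc t R'"
      using Suc.prems False by (intro braid_eq_right desc_letter) auto
    also have "\<dots> \<approx> (R' - 1) # (desc (t - 1) (R' - 1) @ desc u R)"
      using Suc False by (auto intro: braid_eq_Cons)
    also have "\<dots> = desc (t - 1) (Suc R' - 1) @ desc u R"
      using Suc.prems False by (cases R') auto
    finally show ?thesis .
  qed simp
qed simp

text \<open>The descending factors represent the cosets of each symmetric group in the next one, so
  there is one word for each permutation of \<open>R + 1\<close> points. The choice
  \<open>t = Suc R\<close> is the empty factor.\<close>

fun normal_words :: "nat \<Rightarrow> nat list set" where
  "normal_words 0 = {[]}"
| "normal_words (Suc R) = {v @ desc t (Suc R) | v t. v \<in> normal_words R \<and> t \<le> Suc R}"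

lemma normal_words_Suc_I: "v \<in> normal_words R \<Longrightarrow> t \<le> Suc R \<Longrightarrow> v @ desc t (Suc R) \<in> normal_words (Suc R)"
  by auto

lemma normal_words_letters: "v \<in> normal_words R \<Longrightarrow> set v \<subseteq> {..<R}"
  by (induction R arbitrary: v) fastforce+

lemma finite_normal_words: "finite (normal_words R)"
proof (induction R)
  case (Suc R)
  have "normal_words (Suc R) = (\<lambda>(v, t). v @ desc t (Suc R)) ` (normal_words R \<times> {..Suc R})"
    by (auto simp del: desc_Suc)
  then show ?case using Suc by simp
qed simp

definition reducible :: "nat list \<Rightarrow> bool" where
  "reducible u \<longleftrightarrow> (\<exists>a q b. u \<approx> a @ [q, q] @ b)"

lemma reducibleI: "u \<approx> a @ [q, q] @ b \<Longrightarrow> reducible u"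
  by (auto simp: reducible_def)

lemma reducible_braid_eq: "u \<approx> v \<Longrightarrow> reducible v \<Longrightarrow> reducible u"
  by (auto simp: reducible_def intro: braid_eq.transitive)

lemma reducible_context: "reducible u \<Longrightarrow> reducible (c @ u @ d)"
proof -
  assume "reducible u"
  then obtain a q b where "u \<approx> a @ [q, q] @ b" by (auto simp: reducible_def)
  then have "c @ u @ d \<approx> c @ (a @ [q, q] @ b) @ d" by (rule braid_eq_append_context)
  then show ?thesis by (intro reducibleI[of _ "c @ a" q "b @ d"]) simp
qed

text \<open>A letter below \<open>R\<close> is absorbed by the induction hypothesis. The letter
  \<open>R\<close> slides past the inner part and extends the next descending factor to the left.
  Two neighbouring descending words with the same upper bound remain, and comparing their end points
  \<open>u\<close> and \<open>t\<close> decides between the alternatives.\<close>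

lemma normal_words_Cons:
  assumes "v \<in> normal_words R" "p < R"
  shows "(\<exists>v'\<in>normal_words R. p # v \<approx> v') \<or> reducible (p # v)"
  using assms
proof (induction R arbitrary: v p)
  case (Suc R)
  from Suc.prems obtain v1 t where v: "v = v1 @ desc t (Suc R)" "v1 \<in> normal_words R" "t \<le> Suc R"
    by auto
  show ?case
  proof (cases "p < R")
    case True
    from Suc.IH[OF v(2) True] show ?thesis
    proof
      assume "\<exists>v'\<in>normal_words R. p # v1 \<approx> v'"
      then obtain v' where "v' \<in> normal_words R" "p # v1 \<approx> v'" by auto
      then show ?thesis
        using v braid_eq_right[of "p # v1" v'] normal_words_Suc_I[of v' R t] by fastforce
    next
      assume "reducible (p # v1)"
      from reducible_context[OF this, of "[]"] show ?thesis using v by simp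
    qed
  next
    case False
    then have p: "p = R" using Suc.prems by simp
    have "\<exists>v2 u. v1 = v2 @ desc u R \<and> v2 \<in> normal_words (R - 1) \<and> u \<le> R"
      using v(2) by (cases R) fastforce+
    then obtain v2 u where v1: "v1 = v2 @ desc u R" "v2 \<in> normal_words (R - 1)" "u \<le> R" by auto
    have "R # v2 \<approx> v2 @ [R]"
      using normal_words_letters[OF v1(2)] by (intro braid_eq_far_letter) auto
    then have 1: "p # v \<approx> v2 @ desc u (Suc R) @ desc t (Suc R)"
      using braid_eq_right[of "R # v2" "v2 @ [R]" "desc u R @ desc t (Suc R)"] v1 v p by simp
    show ?thesis
    proof (cases "u < t")
      case True
      have "p # v \<approx> v2 @ desc (t - 1) R @ desc u (Suc R)"
        using braid_eq.transitive[OF 1 braid_eq_left[OF desc_shift[of u t "Suc R" "Suc R"]]] True v by simp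
      moreover have "v2 @ desc (t - 1) R \<in> normal_words R"
        using v1 v True normal_words_Suc_I[of v2 "R - 1" "t - 1"] by (cases R) auto
      then have "v2 @ desc (t - 1) R @ desc u (Suc R) \<in> normal_words (Suc R)"
        using normal_words_Suc_I[of "v2 @ desc (t - 1) R" R u] v1 by simp
      ultimately show ?thesis by blast
    next
      case False
      \<comment> \<open>Now \<open>t \<le> u\<close>. Cutting the second word at \<open>u\<close>
        and shifting its upper part through the first exposes the double letter \<open>u\<close>,
        \<open>u\<close>.\<close>
      have s: "desc t (Suc R) = desc (Suc u) (Suc R) @ [u] @ desc t u"
        using False v1 desc_split[of t "u" "Suc R"] desc_split[of "u" "Suc u" "Suc R"] by simp
      have s': "desc u (Suc R) = desc (Suc u) (Suc R) @ [u]"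
        using v1 desc_split[of "u" "Suc u" "Suc R"] by simp
      have "desc u (Suc R) @ desc t (Suc R) = (desc u (Suc R) @ desc (Suc u) (Suc R)) @ [u] @ desc t u"
        using s by simp
      also have "\<dots> \<approx> (desc u R @ desc u (Suc R)) @ [u] @ desc t u"
        using desc_shift[of u "Suc u" "Suc R" "Suc R"] v1 by (intro braid_eq_right) simp
      also have "\<dots> = (desc u R @ desc (Suc u) (Suc R)) @ [u, u] @ desc t u"
        using s' by simp
      finally have "reducible (desc u (Suc R) @ desc t (Suc R))" by (rule reducibleI)
      from reducible_context[OF this, of v2 "[]"] have "reducible (p # v)"
        using reducible_braid_eq[OF 1] by simp
      then show ?thesis ..
    qed
  qed
qed simp

lemma normal_words_Nil: "[] \<in> normal_words R"
proof (induction R)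
  case (Suc R)
  then show ?case using normal_words_Suc_I[of "[]" R "Suc R"] by simp
qed simp

text \<open>The form in which the word problem enters the algebras: the first alternative leads to a
  spanning element, the second to terms with fewer crossings.\<close>

lemma braid_eq_normal_or_reducible:
  assumes "set u \<subseteq> {..<R}"
  shows "(\<exists>v\<in>normal_words R. u \<approx> v) \<or> reducible u"
  using assms
proof (induction u)
  case Nil
  then show ?case using normal_words_Nil by blast
next
  case (Cons p u)
  then consider v where "v \<in> normal_words R" "u \<approx> v" | "reducible u" by auto
  then show ?case
  proof cases
    case 1
    then have "p # u \<approx> p # v" by (simp add: braid_eq_Cons)
    then show ?thesis
      using normal_words_Cons[OF 1(1), of p] Cons.prems reducible_braid_eq[of "p # u" "p # v"]
        braid_eq.transitive[of "p # u" "p # v"] by force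
  next
    case 2
    then show ?thesis using reducible_context[of u "[p]" "[]"] by simp
  qed
qed

section \<open>Permutations of words, and minimality of normal words\<close>

abbreviation sw :: "nat \<Rightarrow> nat \<Rightarrow> nat" where
  "sw p \<equiv> transpose p (Suc p)"

primrec word_perm :: "nat list \<Rightarrow> nat \<Rightarrow> nat" where
  "word_perm [] = id"
| "word_perm (p # u) = sw p \<circ> word_perm u"

lemma word_perm_append: "word_perm (u @ v) = word_perm u \<circ> word_perm v"
  by (induction u) auto

lemma bij_word_perm: "bij (word_perm u)"
proof (induction u)
  case (Cons p u)
  then show ?case unfolding word_perm.simps by (intro bij_comp) simp_all
qed (simp only: word_perm.simps bij_id)

lemma word_perm_permutes: "set u \<subseteq> {..<R} \<Longrightarrow> word_perm u permutes {..R}"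
  by (induction u) (auto intro!: permutes_compose permutes_swap_id simp: permutes_id)

lemma word_perm_braid_eq: "u \<approx> v \<Longrightarrow> word_perm u = word_perm v"
proof (induction rule: braid_eq.induct)
  case (comm p q a b)
  then have "sw p \<circ> sw q = sw q \<circ> sw p" by (auto simp: fun_eq_iff transpose_def)
  then show ?case
    unfolding word_perm_append by (simp add: o_assoc)
next
  case (braid a p b)
  have "sw p \<circ> (sw (Suc p) \<circ> sw p) = sw (Suc p) \<circ> (sw p \<circ> sw (Suc p))"
    by (auto simp: fun_eq_iff transpose_def)
  then show ?case
    unfolding word_perm_append by (simp add: o_assoc)
qed auto

lemma word_perm_desc: "t \<le> R \<Longrightarrow> word_perm (desc t R) t = R"
  by (induction R) (auto simp: le_Suc_eq)

text \<open>The end point of the last descending factor is the preimage of the largest point under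
  the permutation. Once it is known, that factor cancels.\<close>

lemma word_perm_normal_inj:
  assumes "u \<in> normal_words R" "v \<in> normal_words R" "word_perm u = word_perm v"
  shows "u = v"
  using assms
proof (induction R arbitrary: u v)
  case (Suc R)
  from Suc.prems obtain u1 s v1 t where u: "u = u1 @ desc s (Suc R)" "u1 \<in> normal_words R" "s \<le> Suc R"
    and v: "v = v1 @ desc t (Suc R)" "v1 \<in> normal_words R" "t \<le> Suc R" by auto
  have fx: "word_perm w (Suc R) = Suc R" if "w \<in> normal_words R" for w
    using word_perm_permutes[OF normal_words_letters[OF that]] by (simp add: permutes_not_in)
  have "word_perm u s = Suc R" "word_perm v t = Suc R"
    unfolding u(1) v(1) word_perm_append using u(2,3) v(2,3) fx by (simp_all add: word_perm_desc del: desc_Suc)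
  then have st: "s = t"
    using Suc.prems(3) bij_word_perm by (metis bij_is_inj injD)
  have "word_perm u1 \<circ> word_perm (desc t (Suc R)) = word_perm v1 \<circ> word_perm (desc t (Suc R))"
    using Suc.prems(3) unfolding u(1) v(1) st word_perm_append .
  then have "word_perm u1 = word_perm v1"
    using bij_word_perm[of "desc t (Suc R)"] by (metis bij_is_surj surj_fun_eq)
  then show ?case using Suc.IH[OF u(2) v(2)] u v st by simp
qed simp

text \<open>Induction on the competing word: removing a double letter keeps the permutation and
  shortens the word, and a word that is not reducible is braid equivalent to the normal word of its
  permutation.\<close>

lemma normal_word_shortest:
  assumes "u \<in> normal_words R" "set v \<subseteq> {..<R}" "word_perm v = word_perm u"
  shows "length u \<le> length v"
  using assms(2,3)
proof (induction v rule: length_induct)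
  case (1 v)
  consider v' where "v' \<in> normal_words R" "v \<approx> v'" | a q b where "v \<approx> a @ [q, q] @ b"
    using braid_eq_normal_or_reducible[OF "1.prems"(1)] by (auto simp: reducible_def)
  then show ?case
  proof cases
    case 1
    then show ?thesis
      using word_perm_normal_inj[OF assms(1)] word_perm_braid_eq braid_eq_length "1.prems" by fastforce
  next
    case 2
    have "word_perm (a @ b) = word_perm v"
      using word_perm_braid_eq[OF 2] by (auto simp: word_perm_append fun_eq_iff)
    moreover have "set (a @ b) \<subseteq> {..<R}" "length (a @ b) < length v"
      using braid_eq_set[OF 2] braid_eq_length[OF 2] "1.prems" by auto
    ultimately show ?thesis using "1.IH" "1.prems" by fastforce
  qed
qed

lemma fcarrier_induct [consumes 1, case_names zero add scal gen one]:
  assumes "p \<in> fcarrier G"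
    and "P 0" "\<And>p q. P p \<Longrightarrow> P q \<Longrightarrow> P (p + q)" "\<And>a p. P p \<Longrightarrow> P (fscalar a * p)"
    and "\<And>g p. g \<in> G \<Longrightarrow> P p \<Longrightarrow> P (fgen g * p)" "P 1"
  shows "P (p :: ('k::field, 'g) free_alg)"
proof -
  have w: "P (word_prod fgen w)" if "set (letters w) \<subseteq> G" for w
  proof -
    have "set l \<subseteq> G \<Longrightarrow> P (prod_list (map fgen l))" for l
      by (induction l) (auto intro: assms)
    then show ?thesis using that by (simp add: word_prod_def)
  qed
  have "P (\<Sum>w\<in>A. fscalar (Poly_Mapping.lookup p w) * word_prod fgen w)" if "finite A" "A \<subseteq> Poly_Mapping.keys p" for A
    using that
  proof (induction A)
    case (insert x A)
    then have "P (word_prod fgen x)" using assms(1) by (intro w) (auto simp: fcarrier_iff)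
    then show ?case using insert by (auto intro!: assms(3,4))
  qed (simp add: assms)
  then show ?thesis by (subst free_alg_eq_sum_words) simp
qed

section \<open>Words of crossings on sequences, and a common spanning argument\<close>

lemma length_swap_at [simp]: "length (swap_at p c) = length c"
  by (simp add: swap_at_def)

text \<open>The last letter acts first, as for operators, so this is the sequence at the far end of
  the crossings \<open>u\<close> applied to the idempotent of \<open>c\<close>.\<close>

primrec seq_of :: "'a list \<Rightarrow> nat list \<Rightarrow> 'a list" where
  "seq_of c [] = c"
| "seq_of c (p # u) = swap_at p (seq_of c u)"

lemma length_seq_of [simp]: "length (seq_of c u) = length c"
  by (induction u) auto

text \<open>The common shape of both algebras: idempotents \<open>E\<close>, commuting generators
  \<open>Z\<close>, crossings \<open>Psi\<close>. The predicate \<open>ok c p\<close> singles out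
  the crossings on \<open>c\<close> that are not forced to vanish. A crossing passes a
  \<open>Z\<close> up to a scalar, and \<open>quad\<close> and \<open>braid\<close> hold up to
  polynomials; this precision suffices for a filtration by the number of crossings.\<close>

locale diagram_algebra =
  fixes J :: "('k::field, 'g) free_alg set" and r :: nat and S :: "'a list set"
    and E :: "'a list \<Rightarrow> 'g" and Z :: "'t \<Rightarrow> 'g" and T :: "'t set" and Psi :: "nat \<Rightarrow> 'g"
    and ok :: "'a list \<Rightarrow> nat \<Rightarrow> bool"
  assumes tsi: "tsi J"
    and gens: "g \<notin> E ` S \<union> Z ` T \<union> Psi ` {p. Suc p < r} \<Longrightarrow> fgen g \<in> J"
    and finite_S: "finite S" and length_S: "c \<in> S \<Longrightarrow> length c = r"
    and ok_S: "c \<in> S \<Longrightarrow> Suc p < r \<Longrightarrow> ok c p \<Longrightarrow> swap_at p c \<in> S"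
    and unit: "(\<Sum>c\<in>S. fgen (E c)) - 1 \<in> J"
    and e_e: "c \<in> S \<Longrightarrow> c' \<in> S \<Longrightarrow> fgen (E c) * fgen (E c') - (if c = c' then fgen (E c) else 0) \<in> J"
    and z_e: "c \<in> S \<Longrightarrow> t \<in> T \<Longrightarrow> fgen (Z t) * fgen (E c) - fgen (E c) * fgen (Z t) \<in> J"
    and z_z: "t \<in> T \<Longrightarrow> t' \<in> T \<Longrightarrow> fgen (Z t) * fgen (Z t') - fgen (Z t') * fgen (Z t) \<in> J"
    and psi_ok: "c \<in> S \<Longrightarrow> Suc p < r \<Longrightarrow> ok c p \<Longrightarrow>
      fgen (Psi p) * fgen (E c) - fgen (E (swap_at p c)) * fgen (Psi p) \<in> J"
    and psi_not_ok: "c \<in> S \<Longrightarrow> Suc p < r \<Longrightarrow> \<not> ok c p \<Longrightarrow> fgen (Psi p) * fgen (E c) \<in> J"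
    and psi_z: "c \<in> S \<Longrightarrow> Suc p < r \<Longrightarrow> t \<in> T \<Longrightarrow>
      \<exists>t'\<in>T. \<exists>a. (fgen (Psi p) * fgen (Z t) - fgen (Z t') * fgen (Psi p)) * fgen (E c)
        - fscalar a * fgen (E c) \<in> J"
    and quad: "c \<in> S \<Longrightarrow> Suc p < r \<Longrightarrow>
      \<exists>q\<in>fcarrier (Z ` T). fgen (Psi p) * fgen (Psi p) * fgen (E c) - q * fgen (E c) \<in> J"
    and comm: "c \<in> S \<Longrightarrow> Suc q < r \<Longrightarrow> Suc p < q \<Longrightarrow>
      (fgen (Psi p) * fgen (Psi q) - fgen (Psi q) * fgen (Psi p)) * fgen (E c) \<in> J"
    and braid: "c \<in> S \<Longrightarrow> Suc (Suc p) < r \<Longrightarrow>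
      \<exists>q\<in>fcarrier (Z ` T). (fgen (Psi p) * fgen (Psi (Suc p)) * fgen (Psi p)
        - fgen (Psi (Suc p)) * fgen (Psi p) * fgen (Psi (Suc p))) * fgen (E c) - q * fgen (E c) \<in> J"
begin

lemmas J = tsiD[OF tsi]

abbreviation "e c \<equiv> fgen (E c) :: ('k, 'g) free_alg"
abbreviation "z t \<equiv> fgen (Z t) :: ('k, 'g) free_alg"
abbreviation "ps p \<equiv> fgen (Psi p) :: ('k, 'g) free_alg"
abbreviation "pw u \<equiv> prod_list (map ps u)"
abbreviation "pol \<equiv> fcarrier (Z ` T) :: ('k, 'g) free_alg set"

definition eqv :: "('k, 'g) free_alg \<Rightarrow> ('k, 'g) free_alg \<Rightarrow> bool" (infix "\<sim>" 50) where
  "a \<sim> b \<longleftrightarrow> a - b \<in> J"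

lemma eqv_refl [simp]: "a \<sim> a" using J by (simp add: eqv_def)
lemma eqv_sym: "a \<sim> b \<Longrightarrow> b \<sim> a" using J(5)[of "a - b"] by (simp add: eqv_def)
lemma eqv_trans [trans]: "a \<sim> b \<Longrightarrow> b \<sim> c \<Longrightarrow> a \<sim> c" using J(2)[of "a - b" "b - c"] by (simp add: eqv_def)
lemma eqv_add: "a \<sim> b \<Longrightarrow> c \<sim> d \<Longrightarrow> a + c \<sim> b + d"
  using J(2)[of "a - b" "c - d"] by (simp add: eqv_def algebra_simps)
lemma eqv_mult: "a \<sim> b \<Longrightarrow> c \<sim> d \<Longrightarrow> a * c \<sim> b * d"
  using J(2)[OF J(4)[of "a - b" c] J(3)[of "c - d" b]] by (simp add: eqv_def algebra_simps)
lemma eqv_left: "c \<sim> d \<Longrightarrow> a * c \<sim> a * d" by (simp add: eqv_mult)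
lemma eqv_right: "a \<sim> b \<Longrightarrow> a * c \<sim> b * c" by (simp add: eqv_mult)
lemma eqv_sum: "(\<And>i. i \<in> A \<Longrightarrow> f i \<sim> g i) \<Longrightarrow> sum f A \<sim> sum g A"
  by (induction A rule: infinite_finite_induct) (auto intro: eqv_add)
lemma eqv_J: "a \<sim> b \<Longrightarrow> b \<in> J \<Longrightarrow> a \<in> J" using J(2)[of "a - b" b] by (simp add: eqv_def)
lemma eqv_0: "a \<sim> 0 \<longleftrightarrow> a \<in> J" by (simp add: eqv_def)

lemma eqv_unit: "x \<sim> (\<Sum>c\<in>S. e c * x)"
  using eqv_sym[OF eqv_right[of "sum e S" 1 x]] unit by (simp add: eqv_def sum_distrib_right)

lemma e_e_same: "c \<in> S \<Longrightarrow> e c * e c \<sim> e c"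
  using e_e[of c c] by (simp add: eqv_def)

lemma e_e_other: "c \<in> S \<Longrightarrow> c' \<in> S \<Longrightarrow> c \<noteq> c' \<Longrightarrow> e c * e c' \<in> J"
  using e_e[of c c'] by simp

abbreviation "valid u \<equiv> set u \<subseteq> {..<r - 1}"

primrec okw :: "'a list \<Rightarrow> nat list \<Rightarrow> bool" where
  "okw c [] \<longleftrightarrow> True"
| "okw c (p # u) \<longleftrightarrow> okw c u \<and> ok (seq_of c u) p"

lemma seq_of_S: "c \<in> S \<Longrightarrow> valid u \<Longrightarrow> okw c u \<Longrightarrow> seq_of c u \<in> S"
  by (induction u) (auto intro: ok_S)

lemma psi_e: "c \<in> S \<Longrightarrow> Suc p < r \<Longrightarrow> ok c p \<Longrightarrow> ps p * e c \<sim> e (swap_at p c) * (ps p * e c)"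
proof -
  assume a: "c \<in> S" "Suc p < r" "ok c p"
  have "ps p * e c \<sim> (ps p * e c) * e c"
    using eqv_sym[OF eqv_left[OF e_e_same[OF a(1)], of "ps p"]] by (simp add: mult.assoc)
  also have "\<dots> \<sim> (e (swap_at p c) * ps p) * e c"
    using psi_ok[OF a] by (intro eqv_right) (simp add: eqv_def)
  finally show ?thesis by (simp add: mult.assoc)
qed

lemma pw_e:
  assumes "c \<in> S" "valid u"
  shows "(okw c u \<longrightarrow> pw u * e c \<sim> e (seq_of c u) * (pw u * e c)) \<and> (\<not> okw c u \<longrightarrow> pw u * e c \<in> J)"
  using assms(2)
proof (induction u)
  case Nil
  then show ?case using eqv_sym[OF e_e_same[OF assms(1)]] by simp
next
  case (Cons p u)
  show ?case
  proof (cases "okw c u")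
    case True
    let ?k = "seq_of c u"
    have k: "?k \<in> S" using seq_of_S[OF assms(1) _ True] Cons.prems by simp
    have p: "Suc p < r" using Cons.prems by auto
    have "ps p * (pw u * e c) \<sim> ps p * (e ?k * (pw u * e c))"
      using Cons True by (intro eqv_left) simp
    then have 1: "pw (p # u) * e c \<sim> (ps p * e ?k) * (pw u * e c)" by (simp add: mult.assoc)
    show ?thesis
    proof (cases "ok ?k p")
      case ok: True
      have "(ps p * e ?k) * (pw u * e c) \<sim> e (swap_at p ?k) * (ps p * e ?k) * (pw u * e c)"
        using psi_e[OF k p ok] by (rule eqv_right)
      also have "\<dots> = e (swap_at p ?k) * ((ps p * e ?k) * (pw u * e c))" by (simp add: mult.assoc)
      also have "\<dots> \<sim> e (swap_at p ?k) * (pw (p # u) * e c)"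
        using 1 by (rule eqv_left[OF eqv_sym])
      finally have "pw (p # u) * e c \<sim> e (swap_at p ?k) * (pw (p # u) * e c)" by (rule eqv_trans[OF 1])
      then show ?thesis using ok True by simp
    next
      case False
      then show ?thesis using eqv_J[OF 1] J(4)[OF psi_not_ok[OF k p False]] by simp
    qed
  next
    case False
    then show ?thesis using Cons J(3)[of "pw u * e c" "ps p"] by (simp add: mult.assoc)
  qed
qed

text \<open>The filtration by the number of crossings, with arbitrary words and taken modulo
  \<open>J\<close>. Coefficients stand on the left only, so stability under left multiplication by a
  crossing or an idempotent has to be proved.\<close>

inductive_set D :: "nat \<Rightarrow> ('k, 'g) free_alg set" for L where
  ideal: "x \<in> J \<Longrightarrow> x \<in> D L"
| add: "x \<in> D L \<Longrightarrow> y \<in> D L \<Longrightarrow> x + y \<in> D L"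
| scal: "x \<in> D L \<Longrightarrow> fscalar a * x \<in> D L"
| var: "x \<in> D L \<Longrightarrow> t \<in> T \<Longrightarrow> z t * x \<in> D L"
| word: "valid u \<Longrightarrow> length u \<le> L \<Longrightarrow> c \<in> S \<Longrightarrow> pw u * e c \<in> D L"

lemma D_mono: "x \<in> D L \<Longrightarrow> L \<le> L' \<Longrightarrow> x \<in> D L'"
proof (induction rule: D.induct)
  case (word u c)
  then show ?case by (intro D.word) auto
qed (auto intro: D.intros)

lemma D_cong: "x \<sim> y \<Longrightarrow> y \<in> D L \<Longrightarrow> x \<in> D L"
proof -
  assume a: "x \<sim> y" "y \<in> D L"
  have "(x - y) + y \<in> D L" using D.add[OF D.ideal a(2)] a(1) by (simp only: eqv_def)
  then show "x \<in> D L" by simp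
qed

lemma D_uminus: "x \<in> D L \<Longrightarrow> - x \<in> D L"
  using D.scal[where x = x and L = L and a = "-1"] by (simp add: fscalar_def single_uminus)

lemma D_sum: "(\<And>i. i \<in> A \<Longrightarrow> f i \<in> D L) \<Longrightarrow> sum f A \<in> D L"
  by (induction A rule: infinite_finite_induct) (auto intro: D.add D.ideal J)

lemma D_pol:
  assumes "q \<in> pol" "x \<in> D L" shows "q * x \<in> D L"
  using assms(1) assms(2)
proof (induction q arbitrary: x rule: fcarrier_induct)
  case (gen g p)
  then show ?case by (auto simp: mult.assoc intro: D.var)
qed (auto simp: algebra_simps J intro: D.add D.ideal D.scal)

lemma e_D:
  assumes "c \<in> S" "x \<in> D L" shows "e c * x \<in> D L"
  using assms(2)
proof (induction rule: D.induct)
  case (scal x a)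
  have "e c * (fscalar a * x) = fscalar a * (e c * x)"
    by (simp add: mult.assoc[symmetric] fscalar_central[of a "e c"])
  then show ?case using scal by (simp add: D.scal)
next
  case (var x t)
  have "e c * z t \<sim> z t * e c" using z_e[OF assms(1) var(2)] by (simp add: eqv_def eqv_sym[unfolded eqv_def])
  from eqv_right[OF this, of x] show ?case
    using var D_cong[OF _ D.var[where x = "e c * x" and L = L and t = t]] by (simp add: mult.assoc)
next
  case (word u c')
  let ?k = "seq_of c' u"
  show ?case
  proof (cases "okw c' u")
    case True
    then have k: "?k \<in> S" using seq_of_S word by simp
    have "pw u * e c' \<sim> e ?k * (pw u * e c')" using pw_e word True by simp
    from eqv_left[OF this, of "e c"] have 1: "e c * (pw u * e c') \<sim> (e c * e ?k) * (pw u * e c')"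
      by (simp add: mult.assoc)
    show ?thesis
    proof (cases "c = ?k")
      case True
      have "(e c * e ?k) * (pw u * e c') \<sim> e ?k * (pw u * e c')"
        using True k by (intro eqv_right) (simp add: e_e_same)
      also have "\<dots> \<sim> pw u * e c'"
        using pw_e word \<open>okw c' u\<close> by - (rule eqv_sym, simp)
      finally show ?thesis using D_cong[OF eqv_trans[OF 1]] D.word[OF word] by blast
    next
      case False
      then show ?thesis using D.ideal[OF eqv_J[OF 1 J(4)[OF e_e_other[OF assms(1) k]]]] by simp
    qed
  next
    case False
    then show ?thesis using pw_e word J(3) by (intro D.ideal) auto
  qed
qed (auto simp: algebra_simps intro: D.add D.ideal J)

text \<open>Exchanging the crossing with a \<open>z\<close> on its right costs a scalar multiple of
  a term without the new crossing. The idempotent in between makes \<open>psi_z\<close> applicable;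
  decomposing the unit removes it in \<open>psi_D\<close>.\<close>

lemma psi_e_D:
  assumes "x \<in> D L" "Suc p < r" "c \<in> S"
  shows "ps p * (e c * x) \<in> D (Suc L)"
  using assms(1) assms(3)
proof (induction arbitrary: c rule: D.induct)
  case (scal x a)
  have "ps p * (e c * (fscalar a * x)) = fscalar a * (ps p * (e c * x))"
    by (metis fscalar_central mult.assoc)
  then show ?case using scal by (simp add: D.scal)
next
  case (var x t)
  obtain t' a where t': "t' \<in> T" "(ps p * z t - z t' * ps p) * e c \<sim> fscalar a * e c"
    using psi_z[OF var.prems assms(2) var.hyps(2)] by (auto simp: eqv_def)
  have "e c * z t \<sim> z t * e c" using z_e[OF var.prems var.hyps(2)] by (simp add: eqv_def eqv_sym[unfolded eqv_def])
  from eqv_left[OF eqv_right[OF this, of x], of "ps p"]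
  have "ps p * (e c * (z t * x)) \<sim> ps p * (z t * e c * x)" by (simp add: mult.assoc)
  also have "\<dots> = z t' * (ps p * (e c * x)) + (ps p * z t - z t' * ps p) * e c * x"
    by (simp add: algebra_simps)
  also have "\<dots> \<sim> z t' * (ps p * (e c * x)) + fscalar a * e c * x"
    by (rule eqv_add[OF eqv_refl eqv_right[OF t'(2)]])
  finally have 1: "ps p * (e c * (z t * x)) \<sim> z t' * (ps p * (e c * x)) + fscalar a * e c * x" .
  have "e c * x \<in> D (Suc L)" using D_mono[OF e_D[OF var.prems var.hyps(1)]] by simp
  then show ?case
    using D_cong[OF 1] var t' by (simp add: mult.assoc D.add D.var D.scal)
next
  case (word u c')
  let ?k = "seq_of c' u"
  show ?case
  proof (cases "okw c' u")
    case True
    then have k: "?k \<in> S" using seq_of_S word by simp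
    have 2: "pw u * e c' \<sim> e ?k * (pw u * e c')" using pw_e word True by simp
    from eqv_left[OF eqv_left[OF this, of "e c"], of "ps p"]
    have 1: "ps p * (e c * (pw u * e c')) \<sim> ps p * ((e c * e ?k) * (pw u * e c'))"
      by (simp add: mult.assoc)
    show ?thesis
    proof (cases "c = ?k")
      case True
      have "ps p * ((e c * e ?k) * (pw u * e c')) \<sim> ps p * (e ?k * (pw u * e c'))"
        using True k by (intro eqv_left eqv_right) (simp add: e_e_same)
      also have "\<dots> \<sim> ps p * (pw u * e c')"
        using 2 by (rule eqv_left[OF eqv_sym])
      also have "\<dots> = pw (p # u) * e c'" by (simp add: mult.assoc)
      finally have "ps p * (e c * (pw u * e c')) \<sim> pw (p # u) * e c'" using eqv_trans[OF 1] by blast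
      then show ?thesis
        by (rule D_cong) (use word assms in \<open>auto intro!: D.word simp del: prod_list.Cons list.map\<close>)
    next
      case False
      then show ?thesis
        using D.ideal[OF eqv_J[OF 1 J(3)[OF J(4)[OF e_e_other[OF word.prems k]]]]] by simp
    qed
  next
    case False
    then show ?thesis using pw_e word J(3) by (intro D.ideal) auto
  qed
qed (auto simp: algebra_simps intro: D.add D.ideal J)

lemma psi_D:
  assumes "x \<in> D L" "Suc p < r" shows "ps p * x \<in> D (Suc L)"
proof -
  have "ps p * x \<sim> (\<Sum>c\<in>S. ps p * (e c * x))"
    using eqv_left[OF eqv_unit[of x], of "ps p"] by (simp add: sum_distrib_left)
  then show ?thesis by (rule D_cong) (use psi_e_D assms in \<open>auto intro: D_sum\<close>)
qed

lemma pw_D: "x \<in> D L \<Longrightarrow> valid u \<Longrightarrow> pw u * x \<in> D (length u + L)"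
  by (induction u) (auto simp: mult.assoc intro: psi_D)

lemma all_D: "\<exists>L. p \<in> D L"
proof (induction p rule: free_alg_induct)
  case zero
  then show ?case using D.ideal J(1) by blast
next
  case (add p q)
  then obtain L L' where "p \<in> D L" "q \<in> D L'" by blast
  then have "p + q \<in> D (max L L')" by (intro D.add) (auto intro: D_mono)
  then show ?case by blast
next
  case (scal a p)
  then show ?case using D.scal by blast
next
  case (gen g p)
  then obtain L where L: "p \<in> D L" by blast
  consider c where "c \<in> S" "g = E c" | t where "t \<in> T" "g = Z t" | q where "Suc q < r" "g = Psi q"
    | "fgen g \<in> J" using gens by blast
  then show ?case
    by cases (use L e_D D.var psi_D D.ideal J(4) in \<open>blast+\<close>)
next
  case one
  have "1 \<sim> (\<Sum>c\<in>S. pw [] * e c)" using eqv_unit[of 1] by simp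
  moreover have "(\<Sum>c\<in>S. pw [] * e c) \<in> D 0" by (intro D_sum D.word) auto
  ultimately show ?case using D_cong by blast
qed

text \<open>A factor that is polynomial on every idempotent adds no crossings. With \<open>m\<close>
  the square of a crossing, or the defect of a commutation or braid relation, this bounds the error
  terms.\<close>

lemma pw_middle:
  assumes "c \<in> S" "valid b" and m: "\<And>k. k \<in> S \<Longrightarrow> \<exists>q\<in>pol. m * e k \<sim> q * e k"
  shows "m * (pw b * e c) \<in> D (length b)"
proof (cases "okw c b")
  case True
  let ?k = "seq_of c b"
  have k: "?k \<in> S" using assms seq_of_S True by simp
  then obtain q where q: "q \<in> pol" "m * e ?k \<sim> q * e ?k" using m by blast
  have "m * (pw b * e c) \<sim> m * (e ?k * (pw b * e c))"
    using pw_e assms True by (intro eqv_left) auto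
  also have "\<dots> = (m * e ?k) * (pw b * e c)" by (simp add: mult.assoc)
  also have "\<dots> \<sim> (q * e ?k) * (pw b * e c)" by (rule eqv_right[OF q(2)])
  finally have "m * (pw b * e c) \<sim> q * (e ?k * (pw b * e c))" by (simp add: mult.assoc)
  then show ?thesis
    by (rule D_cong[OF _ D_pol[OF q(1) e_D[OF k D.word[OF assms(2) le_refl assms(1)]]]])
next
  case False
  then show ?thesis using pw_e assms J(3) by (intro D.ideal) auto
qed

lemma quad_D:
  assumes "c \<in> S" "valid (a @ [p, p] @ b)"
  shows "pw (a @ [p, p] @ b) * e c \<in> D (length a + length b)"
proof -
  have "(ps p * ps p) * (pw b * e c) \<in> D (length b)"
    using assms quad by (intro pw_middle) (auto simp: eqv_def)
  from pw_D[OF this, of a] show ?thesis using assms by (simp add: mult.assoc)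
qed

text \<open>The defect of a single move sits between two unchanged words and is itself free of
  crossings, so every error has fewer crossings than \<open>u\<close>.\<close>

lemma braid_eq_D:
  assumes "u \<approx> v" "c \<in> S" "valid u"
  shows "pw u * e c - pw v * e c \<in> D (length u - 1)"
  using assms(1,3)
proof (induction rule: braid_eq.induct)
  case (reflexive u)
  then show ?case by (auto intro: D.ideal J)
next
  case (symmetric u v)
  then show ?case using D_uminus[of "pw u * e c - pw v * e c"] braid_eq_set[of u v] braid_eq_length[of u v] by auto
next
  case (transitive u v w)
  then have "(pw u * e c - pw v * e c) + (pw v * e c - pw w * e c) \<in> D (length u - 1)"
    using braid_eq_set[of u v] braid_eq_length[of u v] by (intro D.add) auto
  then show ?case by simp
next
  case (comm p q a b)
  have "(ps p * ps q - ps q * ps p) * (pw b * e c) \<in> D (length b)"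
    using comm assms(2) diagram_algebra.comm[OF diagram_algebra_axioms, of _ q p]
    by (intro pw_middle bexI[of _ 0]) (auto simp: eqv_def)
  from pw_D[OF this, of a] have "pw (a @ [p, q] @ b) * e c - pw (a @ [q, p] @ b) * e c \<in> D (length a + length b)"
    using comm by (simp add: algebra_simps)
  then show ?case by (rule D_mono) simp
next
  case (braid a p b)
  have "(ps p * ps (Suc p) * ps p - ps (Suc p) * ps p * ps (Suc p)) * (pw b * e c) \<in> D (length b)"
    using braid assms(2) diagram_algebra.braid[OF diagram_algebra_axioms, of _ p]
    by (intro pw_middle) (auto simp: eqv_def)
  from pw_D[OF this, of a]
  have "pw (a @ [p, Suc p, p] @ b) * e c - pw (a @ [Suc p, p, Suc p] @ b) * e c \<in> D (length a + length b)"
    using braid by (simp add: algebra_simps)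
  then show ?case by (rule D_mono) simp
qed

text \<open>Only spanning over the polynomials is shown in this locale; independence comes from a
  representation.\<close>

definition basis :: "(nat list \<times> 'a list) set" where
  "basis = {(u, c). c \<in> S \<and> u \<in> normal_words (r - 1) \<and> okw c u}"

lemma finite_basis: "finite basis"
  by (rule finite_subset[of _ "normal_words (r - 1) \<times> S"])
    (auto simp: basis_def finite_normal_words finite_S)

definition span :: "('k, 'g) free_alg set" where
  "span = {x. \<exists>q. (\<forall>i. q i \<in> pol) \<and> x \<sim> (\<Sum>i\<in>basis. q i * (pw (fst i) * e (snd i)))}"

lemma span_J: "x \<in> J \<Longrightarrow> x \<in> span"
  unfolding span_def by (intro CollectI exI[of _ "\<lambda>_. 0"]) (simp add: eqv_0)

lemma span_add: "x \<in> span \<Longrightarrow> y \<in> span \<Longrightarrow> x + y \<in> span"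
proof -
  assume "x \<in> span" "y \<in> span"
  then obtain q q' where "\<forall>i. q i \<in> pol" "x \<sim> (\<Sum>i\<in>basis. q i * (pw (fst i) * e (snd i)))"
    "\<forall>i. q' i \<in> pol" "y \<sim> (\<Sum>i\<in>basis. q' i * (pw (fst i) * e (snd i)))" by (auto simp: span_def)
  then show ?thesis unfolding span_def
    by (intro CollectI exI[of _ "\<lambda>i. q i + q' i"]) (auto simp: distrib_right sum.distrib intro: eqv_add)
qed

lemma span_mult: "x \<in> span \<Longrightarrow> p \<in> pol \<Longrightarrow> p * x \<in> span"
proof -
  assume "x \<in> span" "p \<in> pol"
  then obtain q where "\<forall>i. q i \<in> pol" "x \<sim> (\<Sum>i\<in>basis. q i * (pw (fst i) * e (snd i)))"
    by (auto simp: span_def)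
  with \<open>p \<in> pol\<close> show ?thesis unfolding span_def
    by (intro CollectI exI[of _ "\<lambda>i. p * q i"]) (auto dest: eqv_left[of _ _ p] simp: sum_distrib_left mult.assoc)
qed

lemma span_basis: "(u, c) \<in> basis \<Longrightarrow> pw u * e c \<in> span"
proof -
  assume b: "(u, c) \<in> basis"
  have "(\<Sum>i\<in>basis. (if i = (u, c) then 1 else 0) * (pw (fst i) * e (snd i)))
      = (\<Sum>i\<in>basis. if i = (u, c) then pw (fst i) * e (snd i) else 0)"
    by (intro sum.cong) auto
  also have "\<dots> = pw u * e c" using b finite_basis by (simp add: sum.delta)
  finally show ?thesis unfolding span_def
    by (intro CollectI exI[of _ "\<lambda>i. if i = (u, c) then 1 else 0"]) auto
qed

text \<open>Induction on the number of crossings. A word is replaced by its normal form or by a word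
  with a double letter; the error of the replacement and the double letter both fall into an earlier
  step of the filtration.\<close>

lemma D_span: "D L \<subseteq> span"
proof (induction L rule: less_induct)
  case (less L)
  have lower: "x \<in> span" if "x \<in> D l" "l < L" for x l using less that by blast
  show ?case
  proof
    fix x assume "x \<in> D L"
    then show "x \<in> span"
    proof (induction rule: D.induct)
      case (word u c)
      show ?case
      proof (cases "u = []")
        case True
        then show ?thesis using word normal_words_Nil by (intro span_basis) (auto simp: basis_def)
      next
        case False
        then have L: "length u - 1 < L" using word(2) by (cases u) auto
        consider v where "v \<in> normal_words (r - 1)" "u \<approx> v" | a q b where "u \<approx> a @ [q, q] @ b"
          using braid_eq_normal_or_reducible[OF word(1)] by (auto simp: reducible_def)
        then show ?thesis
        proof cases
          case 1
          have "pw v * e c \<in> span"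
          proof (cases "okw c v")
            case True
            then show ?thesis using 1 word by (intro span_basis) (auto simp: basis_def)
          next
            case False
            then show ?thesis using pw_e[of c v] word normal_words_letters[OF 1(1)] by (intro span_J) auto
          qed
          moreover have "pw u * e c - pw v * e c \<in> span"
            by (rule lower[OF braid_eq_D L]) (use 1 word in auto)
          ultimately show ?thesis using span_add by fastforce
        next
          case 2
          have v: "valid (a @ [q, q] @ b)" using braid_eq_set[OF 2] word(1) by simp
          have "pw (a @ [q, q] @ b) * e c \<in> span"
            by (rule lower[OF quad_D[OF word(3) v]]) (use braid_eq_length[OF 2] word(2) in auto)
          moreover have "pw u * e c - pw (a @ [q, q] @ b) * e c \<in> span"
            by (rule lower[OF braid_eq_D L]) (use 2 word in auto)
          ultimately show ?thesis using span_add by fastforce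
        qed
      qed
    qed (auto intro: span_J span_add span_mult)
  qed
qed

lemma spanning:
  obtains q where "\<And>i. q i \<in> pol" "p \<sim> (\<Sum>i\<in>basis. q i * (pw (fst i) * e (snd i)))"
proof -
  have "p \<in> span" using all_D[of p] D_span by blast
  then show ?thesis using that by (auto simp: span_def)
qed

end

section \<open>Linear independence of characters\<close>

text \<open>Dedekind's argument for characters of the free monoid on \<open>X\<close>; lists of
  positions will play the part of monomials.\<close>

lemma characters_independent:
  fixes \<chi> :: "'i \<Rightarrow> 'x list \<Rightarrow> 'b::field"
  assumes "finite A"
    and \<chi>_Nil: "\<And>i. i \<in> A \<Longrightarrow> \<chi> i [] = 1"
    and \<chi>_append: "\<And>i l l'. i \<in> A \<Longrightarrow> \<chi> i (l @ l') = \<chi> i l * \<chi> i l'"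
    and distinct: "\<And>i j. i \<in> A \<Longrightarrow> j \<in> A \<Longrightarrow> i \<noteq> j \<Longrightarrow> \<exists>l. set l \<subseteq> X \<and> \<chi> i l \<noteq> \<chi> j l"
    and zero: "\<And>l. set l \<subseteq> X \<Longrightarrow> (\<Sum>i\<in>A. C i * \<chi> i l) = 0"
    and "i \<in> A"
  shows "C i = 0"
  using assms
proof (induction A arbitrary: C i rule: finite_induct)
  case (insert a A)
  have rest: "C b = 0" if b: "b \<in> A" for b
  proof -
    have ab: "a \<noteq> b" using insert.hyps b by auto
    obtain m where m: "set m \<subseteq> X" "\<chi> a m \<noteq> \<chi> b m"
      using insert.prems(3)[of a b] ab b by auto
    have "C b * (\<chi> b m - \<chi> a m) = 0"
    \<comment> \<open>Translating the relation by \<open>m\<close> and subtracting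
      \<open>\<chi> a m\<close> times the relation removes the term of \<open>a\<close>, while the
      coefficient of \<open>b\<close> is multiplied by a nonzero factor.\<close>
    proof (rule insert.IH[where C = "\<lambda>i. C i * (\<chi> i m - \<chi> a m)"])
      fix l :: "'x list" assume l: "set l \<subseteq> X"
      have "0 = (\<Sum>i\<in>insert a A. C i * \<chi> i (m @ l)) - \<chi> a m * (\<Sum>i\<in>insert a A. C i * \<chi> i l)"
        using insert.prems(4)[of "m @ l"] insert.prems(4)[of l] m l by simp
      also have "\<dots> = (\<Sum>i\<in>insert a A. C i * (\<chi> i m - \<chi> a m) * \<chi> i l)"
        unfolding sum_distrib_left sum_subtractf[symmetric]
      proof (rule sum.cong[OF refl])
        fix x assume "x \<in> insert a A"
        then have "\<chi> x (m @ l) = \<chi> x m * \<chi> x l" using insert.prems(2) by blast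
        then show "C x * \<chi> x (m @ l) - \<chi> a m * (C x * \<chi> x l) = C x * (\<chi> x m - \<chi> a m) * \<chi> x l"
          by (simp add: algebra_simps)
      qed
      also have "\<dots> = (\<Sum>i\<in>A. C i * (\<chi> i m - \<chi> a m) * \<chi> i l)"
        using insert.hyps by simp
      finally show "(\<Sum>i\<in>A. C i * (\<chi> i m - \<chi> a m) * \<chi> i l) = 0" by simp
    qed (use insert.prems(1-3) b in \<open>blast+\<close>)
    then show ?thesis using m by simp
  qed
  have "(\<Sum>i\<in>insert a A. C i * \<chi> i []) = 0" using insert.prems(4)[of "[]"] by simp
  then have "C a = 0" using insert.hyps insert.prems(1) rest by simp
  then show ?case using rest insert.prems(5) by blast
qed simp

section \<open>Strands acting on vectors of rational functions\<close>

definition vsingle :: "'a \<Rightarrow> 'k::field rf \<Rightarrow> 'a \<Rightarrow> 'k rf" where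
  "vsingle c f = (\<lambda>c'. if c' = c then f else 0)"

lemma vsingle_0 [simp]: "vsingle c 0 = (\<lambda>_. 0)"
  by (simp add: vsingle_def)

lemma vsingle_add: "vsingle c (f + g) = (\<lambda>d. vsingle c f d + vsingle c g d)"
  and vsingle_minus: "vsingle c (f - g) = (\<lambda>d. vsingle c f d - vsingle c g d)"
  and vsingle_uminus: "vsingle c (- f) = (\<lambda>d. - vsingle c f d)"
  and vsingle_scal: "vsingle c (a * f) = (\<lambda>d. a * vsingle c f d)"
  by (auto simp: vsingle_def)

lemma vsingle_same [simp]: "vsingle c f c = f"
  by (simp add: vsingle_def)

lemma vsingle_eq_iff [simp]: "vsingle c f = vsingle c g \<longleftrightarrow> f = g"
  by (metis vsingle_same)

lemma vsingle_eq_0_iff [simp]: "vsingle c f = (\<lambda>_. 0) \<longleftrightarrow> f = 0"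
  by (metis vsingle_same vsingle_0)

definition op_proj :: "'a \<Rightarrow> ('a, 'k::field) oper" where
  "op_proj c = Oper (\<lambda>v c'. if c' = c then v c' else 0)"

definition op_mult :: "('a \<Rightarrow> 'k::field rf) \<Rightarrow> ('a, 'k) oper" where
  "op_mult \<zeta> = Oper (\<lambda>v c. \<zeta> c * v c)"

lemma app_op_proj: "app (op_proj c) v = vsingle c (v c)"
  unfolding op_proj_def vsingle_def by (subst app_Oper) (auto simp: linear_op_def fun_eq_iff)

lemma app_op_mult: "app (op_mult \<zeta>) v = (\<lambda>c. \<zeta> c * v c)"
  unfolding op_mult_def by (subst app_Oper) (auto simp: linear_op_def fun_eq_iff algebra_simps)

lemma app_op_proj_vsingle [simp]: "app (op_proj c) (vsingle c' f) = (if c = c' then vsingle c f else (\<lambda>_. 0))"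
  by (auto simp: app_op_proj vsingle_def)

lemma app_op_mult_vsingle [simp]: "app (op_mult \<zeta>) (vsingle c f) = vsingle c (\<zeta> c * f)"
  by (auto simp: app_op_mult vsingle_def)

lemma vec_eq_sum_vsingle:
  assumes "finite S" "\<And>c. c \<notin> S \<Longrightarrow> v c = 0"
  shows "v = (\<lambda>d. \<Sum>c\<in>S. vsingle c (v c) d)"
  using assms by (auto simp: vsingle_def fun_eq_iff)

section \<open>Swapping entries of sequences, and strands that carry variables\<close>

lemma swap_at_append [simp]:
  "swap_at (length A) (A @ x # y # B) = A @ y # x # B"
  by (simp add: swap_at_def nth_append list_update_append)

lemma split_at2:
  assumes "Suc p < length c"
  obtains A x y B where "c = A @ x # y # B" "length A = p"
proof -
  have "c = take p c @ c ! p # c ! Suc p # drop (Suc (Suc p)) c"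
    using assms by (simp add: Cons_nth_drop_Suc)
  then show ?thesis using that[of "take p c"] assms by simp
qed

lemma swap_at_swap_at [simp]: "Suc p < length c \<Longrightarrow> swap_at p (swap_at p c) = c"
  by (erule split_at2) auto

lemma nth_swap_at: "Suc p < length c \<Longrightarrow> q < length c \<Longrightarrow> swap_at p c ! q = c ! sw p q"
  by (auto simp: swap_at_def nth_list_update transpose_def)

lemma swap_at_same: "Suc p < length c \<Longrightarrow> c ! p = c ! Suc p \<Longrightarrow> swap_at p c = c"
  by (simp add: swap_at_def list_eq_iff_nth_eq nth_list_update)

lemma swap_at_commute:
  "Suc p < q \<Longrightarrow> Suc q < length c \<Longrightarrow> swap_at p (swap_at q c) = swap_at q (swap_at p c)"
  by (simp add: list_eq_iff_nth_eq nth_swap_at transpose_def)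

lemma swap_at_braid:
  "Suc (Suc p) < length c \<Longrightarrow>
    swap_at p (swap_at (Suc p) (swap_at p c)) = swap_at (Suc p) (swap_at p (swap_at (Suc p) c))"
  by (simp add: list_eq_iff_nth_eq nth_swap_at transpose_def)

text \<open>\<open>lab a j\<close> is the index of the variable on strand number \<open>j\<close> of
  colour \<open>a\<close>. \<open>kap a b x y\<close> is the factor of a crossing whose left strand
  has colour \<open>a\<close> and variable \<open>x\<close> and whose right strand has colour
  \<open>b\<close> and variable \<open>y\<close>. By \<open>kap_swp\<close>, exchanging two
  variables of one colour affects the factor only through its arguments; the braid relations rest on
  this.\<close>

locale strand_rep =
  fixes lab :: "'a \<Rightarrow> nat \<Rightarrow> nat" and kap :: "'a \<Rightarrow> 'a \<Rightarrow> 'k::field rf \<Rightarrow> 'k rf \<Rightarrow> 'k rf"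
  assumes lab_inj: "lab a i = lab b j \<longleftrightarrow> a = b \<and> i = j"
    and kap_swp: "a \<noteq> b \<Longrightarrow> swp (lab d i) (lab d j) (kap a b x y)
      = kap a b (swp (lab d i) (lab d j) x) (swp (lab d i) (lab d j) y)"
begin

text \<open>Counting the strands of the same colour to the left gives a strand a name that survives
  mixed crossings (\<open>lam_swap_at\<close>), so it carries its variable along. In a crossing of
  equal colours the sequence stays the same, and the divided difference exchanges the
  variables.\<close>

definition lam :: "'a list \<Rightarrow> nat \<Rightarrow> nat" where
  "lam c p = lab (c ! p) (count_list (take p c) (c ! p))"

abbreviation "lv c p \<equiv> rf_var (lam c p) :: 'k rf"

definition dpsi :: "'a list \<Rightarrow> nat \<Rightarrow> 'k rf \<Rightarrow> 'k rf" where
  "dpsi c p f = (if c ! p = c ! Suc p then dd (lam c p) (lam c (Suc p)) f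
    else kap (c ! p) (c ! Suc p) (lv c p) (lv c (Suc p)) * f)"

text \<open>Vectors are functions of the sequence, so the entry at \<open>c\<close> is read from the
  sequence before the crossing. Sequences too short for the crossing receive 0.\<close>

definition op_psi :: "nat \<Rightarrow> ('a list, 'k) oper" where
  "op_psi p = Oper (\<lambda>v c. if Suc p < length c then dpsi (swap_at p c) p (v (swap_at p c)) else 0)"

lemma dpsi_add: "dpsi c p (f + g) = dpsi c p f + dpsi c p g"
  by (simp add: dpsi_def dd_add algebra_simps)

lemma dpsi_const: "dpsi c p (rf_const a * g) = rf_const a * dpsi c p g"
  by (simp add: dpsi_def dd_const)

lemma dpsi_0 [simp]: "dpsi c p 0 = 0"
  using dpsi_const[of c p 0 0] by simp

lemma app_op_psi:
  "app (op_psi p) v = (\<lambda>c. if Suc p < length c then dpsi (swap_at p c) p (v (swap_at p c)) else 0)"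
  unfolding op_psi_def by (subst app_Oper) (auto simp: linear_op_def fun_eq_iff dpsi_add dpsi_const)

lemma app_op_psi_vsingle:
  assumes "Suc p < length c"
  shows "app (op_psi p) (vsingle c f) = vsingle (swap_at p c) (dpsi c p f)"
proof
  fix d
  show "app (op_psi p) (vsingle c f) d = vsingle (swap_at p c) (dpsi c p f) d"
    using assms by (auto simp: app_op_psi vsingle_def)
qed

lemma lam_inj:
  assumes "p < length c" "q < length c"
  shows "lam c p = lam c q \<longleftrightarrow> p = q"
proof -
  have "lam c p \<noteq> lam c q" if "p < q" "q < length c" for p q
  proof
    assume "lam c p = lam c q"
    then have e: "c ! p = c ! q" "count_list (take p c) (c ! p) = count_list (take q c) (c ! p)"
      by (auto simp: lam_def lab_inj)
    have "take q c = take p c @ c ! p # take (q - Suc p) (drop (Suc p) c)"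
      using that by (metis Suc_leI id_take_nth_drop less_imp_add_positive less_trans take_Suc_conv_app_nth
          take_add append_Cons append_Nil append_assoc le_add_diff_inverse)
    then have "count_list (take q c) (c ! p) = Suc (count_list (take p c) (c ! p) + count_list (take (q - Suc p) (drop (Suc p) c)) (c ! p))"
      by simp
    then show False using e by simp
  qed
  from this[of p q] this[of q p] show ?thesis using assms by (metis linorder_neq_iff)
qed

lemma lam_swap_at:
  assumes "Suc p < length c" "c ! p \<noteq> c ! Suc p" "q < length c"
  shows "lam (swap_at p c) q = lam c (sw p q)"
proof -
  obtain A x y B where c: "c = A @ x # y # B" "length A = p" using split_at2[OF assms(1)] .
  have xy: "x \<noteq> y" using assms(2) c by (auto simp: nth_append)
  consider "q < p" | "q = p" | "q = Suc p" | k where "q = Suc (Suc (p + k))"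
    by (metis less_imp_Suc_add linorder_neqE_nat Suc_lessI add_Suc_right)
  then show ?thesis
    by cases (use c xy in \<open>auto simp: lam_def nth_append transpose_def\<close>)
qed

lemma lam_swap_at_far:
  assumes "Suc p < length c" "q < length c" "q \<noteq> p" "q \<noteq> Suc p"
  shows "lam (swap_at p c) q = lam c q"
  using lam_swap_at[OF assms(1) _ assms(2)] swap_at_same[OF assms(1)] assms
  by (cases "c ! p = c ! Suc p") (auto simp: transpose_def)

lemma swp_lam:
  assumes "p < length c" "q < length c" "s < length c"
  shows "swp (lam c p) (lam c q) (lv c s) = lv c (transpose p q s)"
  using assms by (simp add: swp_var) (auto simp: transpose_def lam_inj)

lemma kap_swp_lam:
  assumes "a \<noteq> b" "c ! p = c ! q"
  shows "swp (lam c p) (lam c q) (kap a b x y)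
      = kap a b (swp (lam c p) (lam c q) x) (swp (lam c p) (lam c q) y)"
  using kap_swp[OF assms(1)] assms(2) by (simp add: lam_def)

lemma dpsi_var_far:
  assumes "Suc p < length c" "q < length c" "q \<noteq> p" "q \<noteq> Suc p"
  shows "dpsi c p (lv c q * f) = lv c q * dpsi c p f"
  using assms by (auto simp: dpsi_def algebra_simps swp_lam transpose_def intro!: dd_sym_mult[simplified mult.commute] dd_sym_mult)

lemma dd_slide:
  assumes "a \<noteq> b"
  shows "rf_var a * dd a b f - dd a b (rf_var b * f) = (f :: 'k rf)"
    and "dd a b (rf_var a * f) - rf_var b * dd a b f = f"
proof -
  have ne: "rf_var a - (rf_var b :: 'k rf) \<noteq> 0" using assms by simp
  show "rf_var a * dd a b f - dd a b (rf_var b * f) = f"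
    "dd a b (rf_var a * f) - rf_var b * dd a b f = f"
    by (simp_all add: dd_def rf_perm_hom swp_var diff_divide_distrib[symmetric] nonzero_divide_eq_eq[OF ne])
      (simp_all add: algebra_simps)
qed

lemma dpsi_quad:
  assumes "Suc p < length c"
  shows "dpsi (swap_at p c) p (dpsi c p f) =
    (if c ! p = c ! Suc p then 0
     else kap (c ! p) (c ! Suc p) (lv c p) (lv c (Suc p)) * kap (c ! Suc p) (c ! p) (lv c (Suc p)) (lv c p) * f)"
proof (cases "c ! p = c ! Suc p")
  case True
  then show ?thesis using assms by (simp add: swap_at_same dpsi_def dd_dd)
next
  case False
  then show ?thesis using assms by (simp add: dpsi_def nth_swap_at lam_swap_at)
qed

lemma dpsi_far:
  assumes "Suc p < q" "Suc q < length c"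
  shows "dpsi (swap_at q c) p (dpsi c q f) = dpsi (swap_at p c) q (dpsi c p f)"
proof -
  have l: "lam (swap_at q c) p = lam c p" "lam (swap_at q c) (Suc p) = lam c (Suc p)"
    "lam (swap_at p c) q = lam c q" "lam (swap_at p c) (Suc q) = lam c (Suc q)"
    using assms by (simp_all add: lam_swap_at_far)
  have n: "swap_at q c ! p = c ! p" "swap_at q c ! Suc p = c ! Suc p"
    "swap_at p c ! q = c ! q" "swap_at p c ! Suc q = c ! Suc q"
    using assms by (simp_all add: nth_swap_at transpose_def)
  have d: "{lam c p, lam c (Suc p)} \<inter> {lam c q, lam c (Suc q)} = {}"
    using assms by (auto simp: lam_inj)
  have s: "swp (lam c p) (lam c (Suc p)) (lv c q) = lv c q" "swp (lam c p) (lam c (Suc p)) (lv c (Suc q)) = lv c (Suc q)"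
    "swp (lam c q) (lam c (Suc q)) (lv c p) = lv c p" "swp (lam c q) (lam c (Suc q)) (lv c (Suc p)) = lv c (Suc p)"
    using assms by (simp_all add: swp_lam transpose_def)
  show ?thesis
    using dd_commute[OF d]
    by (auto simp: dpsi_def l n s kap_swp_lam intro!: dd_sym_mult dd_sym_mult[symmetric])
qed

text \<open>The sides can differ only if the outer strands share a colour that the middle one lacks.
  Both are then a divided difference in the outer variables, with different mixed factors inside and
  outside of it. What is left is the divided difference of the product of factors in
  \<open>dpsi_quad\<close>.\<close>

lemma dpsi_braid:
  assumes "Suc (Suc p) < length c"
  defines "x \<equiv> lv c p" and "y \<equiv> lv c (Suc p)" and "w \<equiv> lv c (Suc (Suc p))"
    and "a \<equiv> c ! p" and "b \<equiv> c ! Suc p" and "d \<equiv> c ! Suc (Suc p)"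
  shows "dpsi (swap_at (Suc p) (swap_at p c)) p (dpsi (swap_at p c) (Suc p) (dpsi c p f))
    - dpsi (swap_at p (swap_at (Suc p) c)) (Suc p) (dpsi (swap_at (Suc p) c) p (dpsi c (Suc p) f))
    = (if a = d \<and> a \<noteq> b then (kap a b x y * kap b a y x - kap a b w y * kap b a y w) / (x - w) * f else 0)"
proof -
  let ?P = "Suc p" and ?Q = "Suc (Suc p)"
  have tr: "transpose p ?P p = ?P" "transpose p ?P ?P = p" "transpose p ?P ?Q = ?Q"
     "transpose ?P ?Q p = p" "transpose ?P ?Q ?P = ?Q" "transpose ?P ?Q ?Q = ?P" by (simp_all add: transpose_def)
  note simps = dpsi_def nth_swap_at lam_swap_at swap_at_same tr
  have li: "lam c p \<noteq> lam c ?P" "lam c ?P \<noteq> lam c ?Q" "lam c p \<noteq> lam c ?Q"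
    using assms by (simp_all add: lam_inj)

  consider "a = b" "b = d" | "a = b" "b \<noteq> d" | "a \<noteq> b" "b = d" | "a \<noteq> b" "a = d" | "a \<noteq> b" "b \<noteq> d" "a \<noteq> d"
    by auto
  then show ?thesis
  proof cases
    case 1
    then show ?thesis using assms dd_braid[OF li] by (simp add: simps)
  next
    case 2
    have s: "swp (lam c p) (lam c ?P) y = x" "swp (lam c p) (lam c ?P) x = y" "swp (lam c p) (lam c ?P) w = w"
      using assms by (simp_all add: swp_lam transpose_def)
    have "swp (lam c p) (lam c ?P) (kap a d x w * kap a d y w) = kap a d x w * kap a d y w"
      using 2 by (simp add: rf_perm_mult kap_swp_lam a_def b_def s)
    from dd_sym_mult[OF this] show ?thesis
      using 2 assms by (simp add: simps) (simp add: mult.assoc mult.commute mult.left_commute)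
  next
    case 3
    have s: "swp (lam c ?P) (lam c ?Q) y = w" "swp (lam c ?P) (lam c ?Q) x = x" "swp (lam c ?P) (lam c ?Q) w = y"
      using assms by (simp_all add: swp_lam transpose_def)
    have "swp (lam c ?P) (lam c ?Q) (kap a b x y * kap a b x w) = kap a b x y * kap a b x w"
      using 3 by (simp add: rf_perm_mult kap_swp_lam b_def d_def s)
    from dd_sym_mult[OF this] show ?thesis
      using 3 assms by (simp add: simps) (simp add: mult.assoc mult.commute mult.left_commute)
  next
    case 4
    have s: "swp (lam c p) (lam c ?Q) y = y" "swp (lam c p) (lam c ?Q) x = w" "swp (lam c p) (lam c ?Q) w = x"
      using assms by (simp_all add: swp_lam transpose_def)
    have k: "swp (lam c p) (lam c ?Q) (kap a b x y) = kap a b w y"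
      "swp (lam c p) (lam c ?Q) (kap b a y w) = kap b a y x"
      using 4 by (simp_all add: kap_swp_lam a_def d_def s)
    have "dpsi (swap_at ?P (swap_at p c)) p (dpsi (swap_at p c) ?P (dpsi c p f))
      = kap b a y x * dd (lam c p) (lam c ?Q) (kap a b x y * f)"
      using 4 assms by (simp add: simps)
    moreover have "dpsi (swap_at p (swap_at ?P c)) ?P (dpsi (swap_at ?P c) p (dpsi c ?P f))
      = kap a b w y * dd (lam c p) (lam c ?Q) (kap b a y w * f)"
      using 4 assms by (simp add: simps)
    moreover have "kap b a y x * dd (lam c p) (lam c ?Q) (kap a b x y * f)
        - kap a b w y * dd (lam c p) (lam c ?Q) (kap b a y w * f)
      = (kap a b x y * kap b a y x - kap a b w y * kap b a y w) / (x - w) * f"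
      unfolding dd_def rf_perm_mult k x_def[symmetric] w_def[symmetric]
      by (simp add: divide_inverse algebra_simps)
    ultimately show ?thesis
      using 4 by simp
  next
    case 5
    then show ?thesis using assms by (simp add: simps)
  qed
qed

end

section \<open>Crossing words as combinations of permutations of the variables\<close>

context strand_rep
begin

definition lmono :: "'a list \<Rightarrow> (nat \<Rightarrow> nat) \<Rightarrow> nat list \<Rightarrow> 'k rf" where
  "lmono c \<pi> l = prod_list (map (\<lambda>q. lv c (\<pi> q)) l)"

text \<open>The coefficient of the permutation \<open>\<pi>\<close> of positions in the operator of
  \<open>u\<close> on the component \<open>c\<close>. A divided difference contributes the identity
  and a transposition, each over the difference of the variables; a mixed crossing relabels the
  positions and multiplies by \<open>kap\<close>.\<close>

primrec coef :: "'a list \<Rightarrow> nat list \<Rightarrow> (nat \<Rightarrow> nat) \<Rightarrow> 'k rf" where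
  "coef c [] = (\<lambda>\<pi>. if \<pi> = id then 1 else 0)"
| "coef c (p # u) = (let k = seq_of c u in
    if k ! p = k ! Suc p
    then (\<lambda>\<pi>. (coef c u \<pi> - swp (lam k p) (lam k (Suc p)) (coef c u (sw p \<circ> \<pi>))) / (lv k p - lv k (Suc p)))
    else (\<lambda>\<pi>. kap (k ! p) (k ! Suc p) (lv k p) (lv k (Suc p)) * coef c u (sw p \<circ> \<pi>)))"

lemma sum_permutes_sw:
  assumes "Suc p < r"
  shows "(\<Sum>\<pi> | \<pi> permutes {..<r}. f (sw p \<circ> \<pi>)) = (\<Sum>\<pi> | \<pi> permutes {..<r}. f \<pi>)"
proof -
  have "sw p \<circ> \<pi> permutes {..<r}" if "\<pi> permutes {..<r}" for \<pi>
    using permutes_compose[OF that permutes_swap_id[of p "{..<r}" "Suc p"]] assms by simp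
  then show ?thesis
    by (intro sum.reindex_bij_witness[of _ "\<lambda>\<pi>. sw p \<circ> \<pi>" "\<lambda>\<pi>. sw p \<circ> \<pi>"]) (auto simp: o_assoc)
qed

lemma swp_lmono:
  assumes "Suc p < length c" "\<And>q. q \<in> set l \<Longrightarrow> \<pi> q < length c"
  shows "swp (lam c p) (lam c (Suc p)) (lmono c \<pi> l) = lmono c (sw p \<circ> \<pi>) l"
  using assms(2) assms(1)
  by (induction l) (simp_all add: lmono_def rf_perm_mult swp_lam)

lemma lmono_swap_at:
  assumes "Suc p < length c" "c ! p \<noteq> c ! Suc p" "\<And>q. q \<in> set l \<Longrightarrow> \<pi> q < length c"
  shows "lmono (swap_at p c) (sw p \<circ> \<pi>) l = lmono c \<pi> l"
proof -
  have "lam (swap_at p c) (sw p (\<pi> q)) = lam c (\<pi> q)" if "q \<in> set l" for q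
  proof -
    have "sw p (\<pi> q) < length c" using assms(1) assms(3)[OF that] by (auto simp: transpose_def)
    then show ?thesis using lam_swap_at[OF assms(1,2)] by simp
  qed
  then show ?thesis by (auto simp: lmono_def intro!: arg_cong[of _ _ prod_list])
qed

text \<open>Permutations act on positions, not on variable indices, so one list \<open>l\<close>
  gives a test monomial for every sequence: after the crossings it is read in the target
  sequence.\<close>

lemma app_word_lmono:
  assumes "length c = r" "set u \<subseteq> {..<r - 1}" "set l \<subseteq> {..<r}"
  shows "app (prod_list (map op_psi u)) (vsingle c (lmono c id l)) =
    vsingle (seq_of c u) (\<Sum>\<pi> | \<pi> permutes {..<r}. coef c u \<pi> * lmono (seq_of c u) \<pi> l)"
  using assms(2)
proof (induction u)
  case Nil
  have "(\<Sum>\<pi> | \<pi> permutes {..<r}. coef c [] \<pi> * lmono c \<pi> l) =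
      (\<Sum>\<pi> | \<pi> permutes {..<r}. if \<pi> = id then lmono c \<pi> l else 0)"
    by (intro sum.cong) auto
  also have "\<dots> = lmono c id l"
    by (subst sum.delta) (auto simp: finite_permutations permutes_id)
  finally show ?case by (simp add: id_def)
next
  case (Cons p u)
  let ?k = "seq_of c u" and ?P = "{\<pi>. \<pi> permutes {..<r}}"
  have p: "Suc p < r" "Suc p < length ?k" using Cons.prems assms(1) by auto
  have bd: "\<pi> q < length ?k" if "\<pi> \<in> ?P" "q \<in> set l" for \<pi> q
    using that permutes_in_image[of \<pi> "{..<r}" q] assms by auto
  have "app (prod_list (map op_psi (p # u))) (vsingle c (lmono c id l))
    = vsingle (swap_at p ?k) (dpsi ?k p (\<Sum>\<pi>\<in>?P. coef c u \<pi> * lmono ?k \<pi> l))"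
    using Cons p by (simp add: app_op_psi_vsingle id_def)
  moreover have "dpsi ?k p (\<Sum>\<pi>\<in>?P. coef c u \<pi> * lmono ?k \<pi> l) =
      (\<Sum>\<pi>\<in>?P. coef c (p # u) \<pi> * lmono (swap_at p ?k) \<pi> l)"
  proof (cases "?k ! p = ?k ! Suc p")
    case True
    let ?s = "swp (lam ?k p) (lam ?k (Suc p)) :: 'k rf \<Rightarrow> 'k rf"
    have "?s (\<Sum>\<pi>\<in>?P. coef c u \<pi> * lmono ?k \<pi> l)
      = (\<Sum>\<pi>\<in>?P. ?s (coef c u (sw p \<circ> (sw p \<circ> \<pi>))) * lmono ?k (sw p \<circ> \<pi>) l)"
      unfolding rf_perm_sum using bd p
      by (intro sum.cong refl) (simp add: rf_perm_mult swp_lmono o_assoc)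
    also have "\<dots> = (\<Sum>\<pi>\<in>?P. ?s (coef c u (sw p \<circ> \<pi>)) * lmono ?k \<pi> l)"
      by (rule sum_permutes_sw[OF p(1), of "\<lambda>\<pi>. ?s (coef c u (sw p \<circ> \<pi>)) * lmono ?k \<pi> l"])
    finally have s: "?s (\<Sum>\<pi>\<in>?P. coef c u \<pi> * lmono ?k \<pi> l)
      = (\<Sum>\<pi>\<in>?P. ?s (coef c u (sw p \<circ> \<pi>)) * lmono ?k \<pi> l)" .
    show ?thesis
      using True swap_at_same[OF p(2) True]
      by (simp add: dpsi_def dd_def s sum_subtractf[symmetric] sum_divide_distrib left_diff_distrib Let_def)
  next
    case False
    let ?\<kappa> = "kap (?k ! p) (?k ! Suc p) (lv ?k p) (lv ?k (Suc p))"
    have "dpsi ?k p (\<Sum>\<pi>\<in>?P. coef c u \<pi> * lmono ?k \<pi> l)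
      = (\<Sum>\<pi>\<in>?P. ?\<kappa> * coef c u (sw p \<circ> (sw p \<circ> \<pi>)) * lmono (swap_at p ?k) (sw p \<circ> \<pi>) l)"
      using False bd p unfolding dpsi_def
      by (auto simp: sum_distrib_left mult.assoc lmono_swap_at o_assoc intro!: sum.cong)
    also have "\<dots> = (\<Sum>\<pi>\<in>?P. ?\<kappa> * coef c u (sw p \<circ> \<pi>) * lmono (swap_at p ?k) \<pi> l)"
      by (rule sum_permutes_sw[OF p(1), of "\<lambda>\<pi>. ?\<kappa> * coef c u (sw p \<circ> \<pi>) * lmono (swap_at p ?k) \<pi> l"])
    finally show ?thesis using False by (simp add: Let_def)
  qed
  ultimately show ?case by (simp add: id_def)
qed

text \<open>Each letter contributes the identity or its transposition, so only permutations of
  subwords occur. A proper subword is shorter than \<open>u\<close> and cannot represent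
  \<open>\<pi>\<close>.\<close>

lemma coef_eq_0:
  assumes "set u \<subseteq> {..<R}" "\<pi> \<noteq> word_perm u"
    and "\<And>v. set v \<subseteq> {..<R} \<Longrightarrow> word_perm v = \<pi> \<Longrightarrow> length u \<le> length v"
  shows "coef c u \<pi> = 0"
  using assms
proof (induction u arbitrary: \<pi>)
  case (Cons p u)
  have "coef c u \<pi> = 0"
  proof (rule Cons.IH)
    show "\<pi> \<noteq> word_perm u" using Cons.prems(3)[of u] Cons.prems(1) by auto
    show "length u \<le> length v" if "set v \<subseteq> {..<R}" "word_perm v = \<pi>" for v
      using Cons.prems(3)[OF that] by simp
  qed (use Cons.prems in auto)
  moreover have "coef c u (sw p \<circ> \<pi>) = 0"
  proof (rule Cons.IH)
    show "sw p \<circ> \<pi> \<noteq> word_perm u"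
    proof
      assume "sw p \<circ> \<pi> = word_perm u"
      then have "sw p \<circ> (sw p \<circ> \<pi>) = word_perm (p # u)" by simp
      then show False using Cons.prems(2) by (simp add: o_assoc)
    qed
    show "length u \<le> length v" if v: "set v \<subseteq> {..<R}" "word_perm v = sw p \<circ> \<pi>" for v
    proof -
      have "word_perm (p # v) = \<pi>" using v(2) by (simp add: o_assoc)
      then show ?thesis using Cons.prems(3)[of "p # v"] v(1) Cons.prems(1) by simp
    qed
  qed (use Cons.prems in auto)
  ultimately show ?case by (simp add: Let_def)
qed simp

fun crossings_nonzero :: "'a list \<Rightarrow> nat list \<Rightarrow> bool" where
  "crossings_nonzero c [] \<longleftrightarrow> True"
| "crossings_nonzero c (p # u) \<longleftrightarrow> crossings_nonzero c u \<and> (let k = seq_of c u in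
    k ! p \<noteq> k ! Suc p \<longrightarrow> kap (k ! p) (k ! Suc p) (lv k p) (lv k (Suc p)) \<noteq> 0)"

lemma swp_eq_0_iff [simp]: "swp a b x = 0 \<longleftrightarrow> x = (0 :: 'k rf)"
  by (metis swp_swp rf_perm_0)

text \<open>For a shortest word only the full word reaches its permutation. Its coefficient is, up
  to sign and permutations of variables, a product of factors \<open>kap\<close> and inverse
  differences of variables.\<close>

lemma coef_leading_nonzero:
  assumes "length c = Suc R" "set u \<subseteq> {..<R}" "crossings_nonzero c u"
    and "\<And>v. set v \<subseteq> {..<R} \<Longrightarrow> word_perm v = word_perm u \<Longrightarrow> length u \<le> length v"
  shows "coef c u (word_perm u) \<noteq> 0"
  using assms(2-4)
proof (induction u)
  case (Cons p u)
  let ?k = "seq_of c u"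
  have short: "length u \<le> length v" if v: "set v \<subseteq> {..<R}" "word_perm v = word_perm u" for v
    using Cons.prems(3)[of "p # v"] v Cons.prems(1) by simp
  have nz: "coef c u (word_perm u) \<noteq> 0"
    using Cons.IH short Cons.prems by simp
  have id: "sw p \<circ> (sw p \<circ> word_perm u) = word_perm u" by (simp add: o_assoc)
  have z: "coef c u (word_perm (p # u)) = 0"
  proof (rule coef_eq_0)
    show "word_perm (p # u) \<noteq> word_perm u"
    proof
      assume "word_perm (p # u) = word_perm u"
      then have "length (p # u) \<le> length u" using Cons.prems(1) by (intro Cons.prems(3)) auto
      then show False by simp
    qed
    show "length u \<le> length v" if "set v \<subseteq> {..<R}" "word_perm v = word_perm (p # u)" for v
      using Cons.prems(3)[OF that] by simp
  qed (use Cons.prems in auto)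
  have "lv ?k p - lv ?k (Suc p) \<noteq> 0"
    using lam_inj[of p ?k "Suc p"] Cons.prems(1) assms(1) by simp
  then show ?case using nz z id Cons.prems(2) by (auto simp: Let_def comp_def)
qed (simp add: id_def)

text \<open>Take a longest word \<open>w\<close> with nonzero coefficient. No other such word
  reaches the permutation of \<open>w\<close>, since distinct normal words have distinct
  permutations and all of them are shortest. By independence of characters the total coefficient of
  that permutation is zero, a contradiction.\<close>

lemma words_independent:
  assumes len: "length c = Suc R" and fin: "finite U" and U: "U \<subseteq> normal_words R"
    and nonzero: "\<And>u. u \<in> U \<Longrightarrow> crossings_nonzero c u" and target: "\<And>u. u \<in> U \<Longrightarrow> seq_of c u = k"
    and zero: "\<And>l. set l \<subseteq> {..<Suc R} \<Longrightarrow>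
      (\<Sum>u\<in>U. q u * (\<Sum>\<pi> | \<pi> permutes {..<Suc R}. coef c u \<pi> * lmono k \<pi> l)) = 0"
    and "u \<in> U"
  shows "q u = 0"
proof (rule ccontr)
  assume "q u \<noteq> 0"
  define V where "V = {u \<in> U. q u \<noteq> 0}"
  have V: "finite V" "V \<noteq> {}" using fin \<open>u \<in> U\<close> \<open>q u \<noteq> 0\<close> by (auto simp: V_def)
  obtain w where w: "w \<in> V" "\<And>v. v \<in> V \<Longrightarrow> length v \<le> length w"
    using Max_in[of "length ` V"] Max_ge[of "length ` V"] V by (metis (no_types, lifting) finite_imageI imageE image_eqI image_is_empty)
  have lk: "length k = Suc R" using target[OF \<open>u \<in> U\<close>] len by auto
  have valid: "set v \<subseteq> {..<R}" if "v \<in> U" for v using normal_words_letters U that by blast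
  have wU: "w \<in> U" using w by (simp add: V_def)
  have short: "length w \<le> length v" if "set v \<subseteq> {..<R}" "word_perm v = word_perm w" for v
    using normal_word_shortest[of w R v] wU U that by auto
  have perm: "word_perm w permutes {..<Suc R}"
    using word_perm_permutes[OF valid[OF wU]] by (simp add: lessThan_Suc_atMost)
  \<comment> \<open>The characters are the permutations: \<open>lmono k \<pi>\<close> is
    multiplicative in the list, and its values at single positions determine
    \<open>\<pi>\<close>.\<close>
  have "(\<Sum>u\<in>U. q u * coef c u (word_perm w)) = 0"
  proof (rule characters_independent[where C = "\<lambda>\<pi>. \<Sum>u\<in>U. q u * coef c u \<pi>" and \<chi> = "lmono k"
        and A = "{\<pi>. \<pi> permutes {..<Suc R}}" and X = "{..<Suc R}"])
    fix \<pi> \<pi>' :: "nat \<Rightarrow> nat"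
    assume p: "\<pi> \<in> {\<pi>. \<pi> permutes {..<Suc R}}" "\<pi>' \<in> {\<pi>. \<pi> permutes {..<Suc R}}" "\<pi> \<noteq> \<pi>'"
    then obtain x where x: "\<pi> x \<noteq> \<pi>' x" by blast
    then have xR: "x < Suc R" using p permutes_not_in[of _ "{..<Suc R}" x] by (metis lessThan_iff mem_Collect_eq)
    then have "\<pi> x < length k" "\<pi>' x < length k"
      using p permutes_in_image[of _ "{..<Suc R}" x] lk by auto
    then have "lmono k \<pi> [x] \<noteq> lmono k \<pi>' [x]" using x by (simp add: lmono_def lam_inj)
    then show "\<exists>l. set l \<subseteq> {..<Suc R} \<and> lmono k \<pi> l \<noteq> lmono k \<pi>' l"
      using xR by (intro exI[of _ "[x]"]) simp
  next
    fix l assume "set l \<subseteq> {..<Suc R}"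
    from zero[OF this] show "(\<Sum>\<pi> | \<pi> permutes {..<Suc R}. (\<Sum>u\<in>U. q u * coef c u \<pi>) * lmono k \<pi> l) = 0"
      by (simp add: sum_distrib_left sum_distrib_right mult.assoc) (subst sum.swap, simp)
  qed (use perm in \<open>auto simp: lmono_def finite_permutations\<close>)
  moreover have "(\<Sum>u\<in>U. q u * coef c u (word_perm w)) = (\<Sum>u\<in>{w}. q u * coef c u (word_perm w))"
  proof (rule sum.mono_neutral_right[OF fin])
    show "\<forall>v\<in>U - {w}. q v * coef c v (word_perm w) = 0"
    proof
      fix v assume v: "v \<in> U - {w}"
      show "q v * coef c v (word_perm w) = 0"
      proof (cases "q v = 0")
        case False
        then have lv: "length v \<le> length w" using v w by (auto simp: V_def)
        have "coef c v (word_perm w) = 0"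
        proof (rule coef_eq_0)
          show "word_perm w \<noteq> word_perm v" using word_perm_normal_inj[of w R v] v wU U by auto
          show "length v \<le> length v'" if "set v' \<subseteq> {..<R}" "word_perm v' = word_perm w" for v'
            using short[OF that] lv by simp
        qed (use valid v in auto)
        then show ?thesis by simp
      qed simp
    qed
  qed (use wU in auto)
  moreover have "coef c w (word_perm w) \<noteq> 0"
    using coef_leading_nonzero[OF len valid[OF wU] nonzero[OF wU] short] .
  ultimately show False using w by (simp add: V_def)
qed

end

section \<open>Faithfulness of strand representations\<close>

locale faithful_rep = diagram_algebra J r S E Z T Psi ok + strand_rep lab kap
  for J :: "('k::field, 'g) free_alg set" and r and S :: "'a list set" and E Z
    and T :: "'t set" and Psi and ok and lab and kap :: "'a \<Rightarrow> 'a \<Rightarrow> 'k rf \<Rightarrow> 'k rf \<Rightarrow> 'k rf" +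
  fixes \<zeta> :: "'a list \<Rightarrow> 't \<Rightarrow> 'k rf" and gact :: "'g \<Rightarrow> ('a list, 'k) oper"
  assumes act_E: "c \<in> S \<Longrightarrow> gact (E c) = op_proj c"
    and act_Z: "t \<in> T \<Longrightarrow> gact (Z t) = op_mult (\<lambda>c. \<zeta> c t)"
    and act_Psi: "Suc p < r \<Longrightarrow> gact (Psi p) = op_psi p"
    and kap_ok: "c \<in> S \<Longrightarrow> Suc p < r \<Longrightarrow> ok c p \<Longrightarrow> c ! p \<noteq> c ! Suc p \<Longrightarrow>
      kap (c ! p) (c ! Suc p) (lv c p) (lv c (Suc p)) \<noteq> 0"
    and J_kills: "x \<in> J \<Longrightarrow> c \<in> S \<Longrightarrow> app (lift oper_scal (word_prod gact) x) (vsingle c f) = (\<lambda>_. 0)"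
    and pol_faithful: "c \<in> S \<Longrightarrow> q \<in> pol \<Longrightarrow>
      app (lift oper_scal (word_prod gact) q) (vsingle c 1) = (\<lambda>_. 0) \<Longrightarrow> q * e c \<in> J"
begin

abbreviation "rep \<equiv> lift oper_scal (word_prod gact)"

sublocale rep: monoid_algebra_hom oper_scal "word_prod gact"
  by (rule monoid_algebra_hom_word) (simp_all only: oper_scal_hom, rule oper_scal_central)

lemma rep_gen: "rep (fgen g) = gact g"
  using rep.lift_single[of "Word [g]" 1] by (simp add: fgen_def word_prod_def oper_scal_hom)

lemma rep_scal: "rep (fscalar a) = oper_scal a"
  using rep.lift_single[of 0 a] by (simp add: fscalar_def word_prod_simps)

lemma rep_pw: "valid u \<Longrightarrow> rep (pw u) = prod_list (map op_psi u)"
  by (induction u) (auto simp: rep.lift_hom rep_gen act_Psi)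

lemma pol_acts_diagonally:
  assumes "q \<in> pol"
  shows "\<exists>a. \<forall>f. app (rep q) (vsingle c f) = vsingle c (a * f)"
  using assms
proof (induction q rule: fcarrier_induct)
  case zero
  then show ?case by (intro exI[of _ 0]) (simp add: rep.lift_hom)
next
  case (add p q)
  then obtain a b where "\<forall>f. app (rep p) (vsingle c f) = vsingle c (a * f)"
    "\<forall>f. app (rep q) (vsingle c f) = vsingle c (b * f)" by blast
  then show ?case
    by (intro exI[of _ "a + b"]) (simp add: rep.lift_hom distrib_right vsingle_add)
next
  case (scal b p)
  then obtain a where "\<forall>f. app (rep p) (vsingle c f) = vsingle c (a * f)" by blast
  then show ?case
    by (intro exI[of _ "rf_const b * a"]) (simp add: rep.lift_hom rep_scal mult.assoc vsingle_scal[of c "rf_const b"])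
next
  case (gen g p)
  then obtain a t where "\<forall>f. app (rep p) (vsingle c f) = vsingle c (a * f)" "g = Z t" "t \<in> T" by blast
  then show ?case
    by (intro exI[of _ "\<zeta> c t * a"]) (simp add: rep.lift_hom rep_gen act_Z mult.assoc)
next
  case one
  then show ?case by (intro exI[of _ 1]) (simp add: rep.lift_hom)
qed

lemma okw_crossings: "c \<in> S \<Longrightarrow> valid u \<Longrightarrow> okw c u \<Longrightarrow> crossings_nonzero c u"
proof (induction u)
  case (Cons p u)
  have "seq_of c u \<in> S" using Cons.prems by (intro seq_of_S) auto
  moreover have "Suc p < r" using Cons.prems(2) by auto
  ultimately show ?case using Cons kap_ok[of "seq_of c u" p] by (auto simp: Let_def)
qed simp

text \<open>Only monomials in the variables of the strands, placed on one sequence, are tested. The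
  restriction matters: the Webster test vectors are then free of barred variables, and so symmetric
  in them.\<close>

theorem faithful:
  assumes kills: "\<And>c l. c \<in> S \<Longrightarrow> set l \<subseteq> {..<r} \<Longrightarrow> app (rep p) (vsingle c (lmono c id l)) = (\<lambda>_. 0)"
  shows "p \<in> J"
proof -
  obtain q where q: "\<And>i. q i \<in> pol" and p: "p \<sim> (\<Sum>i\<in>basis. q i * (pw (fst i) * e (snd i)))"
    using spanning[of p] by blast
  let ?X = "\<Sum>i\<in>basis. q i * (pw (fst i) * e (snd i))"
  have X_kills: "app (rep ?X) (vsingle c (lmono c id l)) = (\<lambda>_. 0)" if "c \<in> S" "set l \<subseteq> {..<r}" for c l
  proof -
    have "app (rep (p - ?X)) (vsingle c (lmono c id l)) = (\<lambda>_. 0)"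
      using p J_kills that by (simp add: eqv_def)
    then show ?thesis using kills[OF that] by (simp add: rep.lift_minus fun_eq_iff)
  qed
  \<comment> \<open>The scalar by which the polynomial \<open>q i\<close> acts on the target
    sequence of the term \<open>i\<close>.\<close>
  define a where "a i = (SOME a. \<forall>f. app (rep (q i)) (vsingle (seq_of (snd i) (fst i)) f) = vsingle (seq_of (snd i) (fst i)) (a * f))" for i
  have a: "app (rep (q i)) (vsingle (seq_of (snd i) (fst i)) f) = vsingle (seq_of (snd i) (fst i)) (a i * f)" for i f
    using someI_ex[OF pol_acts_diagonally[OF q, of i "seq_of (snd i) (fst i)"]] unfolding a_def by blast
  have bas: "c \<in> S" "valid u" "u \<in> normal_words (r - 1)" "okw c u" if "(u, c) \<in> basis" for u c
    using that normal_words_letters[of u "r - 1"] by (auto simp: basis_def)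
  have a0: "a (u, c) = 0" if uc: "(u, c) \<in> basis" for u c
  \<comment> \<open>\<open>words_independent\<close> speaks of \<open>Suc R\<close> strands. Without
    strands, the empty word on the empty sequence is the only possible term.\<close>
  proof (cases "r = 0")
    case True
    have "basis \<subseteq> {([], [])}" unfolding basis_def using True length_S by auto
    then have b: "basis = {([], [])}" "u = []" "c = []" using uc by auto
    have "[] \<in> S" using bas(1)[OF uc] b by simp
    then have 1: "app (rep (q ([], []))) (vsingle [] 1) = (\<lambda>_. 0)"
      using X_kills[of "[]" "[]"] by (simp add: b rep.lift_hom rep_gen act_E lmono_def)
    have 2: "app (rep (q ([], []))) (vsingle [] 1) = vsingle [] (a ([], []) * 1)"
      using a[of "([], [])" 1] by (simp only: fst_conv snd_conv seq_of.simps)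
    have "vsingle ([] :: 'a list) (a ([], []) * 1) = (\<lambda>_. 0)" by (rule HOL.trans[OF HOL.sym[OF 2] 1])
    then show ?thesis by (simp only: vsingle_eq_0_iff b mult_1_right)
  next
    case False
    then obtain R where R: "r = Suc R" by (cases r) auto
    have c: "c \<in> S" "length c = Suc R" using bas(1)[OF uc] length_S R by auto
    define k where "k = seq_of c u"
    \<comment> \<open>The terms are separated by source \<open>c\<close> and target
      \<open>k\<close>; those in one class differ in their normal words.\<close>
    define U where "U = {v. (v, c) \<in> basis \<and> seq_of c v = k}"
    have finU: "finite U"
      by (rule finite_subset[of _ "fst ` basis"]) (auto simp: U_def finite_basis intro: rev_image_eqI)
    show ?thesis
    proof (rule words_independent[where q = "\<lambda>v. a (v, c)" and U = U and k = k and R = R and c = c])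
      fix l assume l: "set l \<subseteq> {..<Suc R}"
      let ?s = "\<lambda>v. \<Sum>\<pi> | \<pi> permutes {..<Suc R}. coef c v \<pi> * lmono (seq_of c v) \<pi> l"
      have "app (rep (q i * (pw (fst i) * e (snd i)))) (vsingle c (lmono c id l)) k
        = (if snd i = c \<and> seq_of c (fst i) = k then a i * ?s (fst i) else 0)" if i: "i \<in> basis" for i
      proof (cases i)
        case (Pair v d)
        then have v: "d \<in> S" "valid v" using bas i by auto
        show ?thesis
        proof (cases "d = c")
          case True
          have "app (rep (q i * (pw v * e c))) (vsingle c (lmono c id l)) = vsingle (seq_of c v) (a i * ?s v)"
            using v c l R a[of i] Pair True app_word_lmono[of c "Suc R" v l]
            by (simp add: rep.lift_hom rep_gen act_E rep_pw)
          then show ?thesis using Pair True by (simp add: vsingle_def)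
        next
          case False
          then show ?thesis using v Pair by (simp add: rep.lift_hom rep_gen act_E app_0)
        qed
      qed
      then have "(\<Sum>i\<in>basis. if snd i = c \<and> seq_of c (fst i) = k then a i * ?s (fst i) else 0) = 0"
        using fun_cong[OF X_kills[OF c(1), of l], of k] l R by (simp add: rep.lift_sum app_sum)
      moreover have "(\<Sum>i\<in>basis. if snd i = c \<and> seq_of c (fst i) = k then a i * ?s (fst i) else 0)
        = (\<Sum>i\<in>(\<lambda>v. (v, c)) ` U. if snd i = c \<and> seq_of c (fst i) = k then a i * ?s (fst i) else 0)"
        using finite_basis by (intro sum.mono_neutral_right) (auto simp: U_def)
      moreover have "\<dots> = (\<Sum>v\<in>U. a (v, c) * (\<Sum>\<pi> | \<pi> permutes {..<Suc R}. coef c v \<pi> * lmono k \<pi> l))"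
        by (subst sum.reindex) (auto simp: inj_on_def U_def intro!: sum.cong)
      ultimately show "(\<Sum>v\<in>U. a (v, c) * (\<Sum>\<pi> | \<pi> permutes {..<Suc R}. coef c v \<pi> * lmono k \<pi> l)) = 0"
        by simp
    next
      show "crossings_nonzero c v" if "v \<in> U" for v
        using that bas(2,4)[of v c] c by (intro okw_crossings) (auto simp: U_def)
    qed (use c finU uc bas R in \<open>auto simp: U_def k_def\<close>)
  qed
  have "?X \<sim> (\<Sum>i\<in>basis. 0)"
  proof (rule eqv_sum)
    fix i assume i: "i \<in> basis"
    obtain u c where uc: "i = (u, c)" by (cases i)
    note b = bas[OF i[unfolded uc]]
    let ?k = "seq_of c u"
    have k: "?k \<in> S" using seq_of_S b by simp
    have "app (rep (q i)) (vsingle ?k 1) = (\<lambda>_. 0)"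
      using a[of i 1] a0[of u c] i uc by simp
    \<comment> \<open>This turns a vanishing scalar back into a vanishing element of the algebra, on
      the idempotent at the left end of the term.\<close>
    then have z: "q i * e ?k \<in> J" using pol_faithful[OF k q] by blast
    have "q i * (pw u * e c) \<sim> q i * (e ?k * (pw u * e c))"
      using pw_e[OF b(1,2)] b(4) by (intro eqv_left) simp
    also have "\<dots> = (q i * e ?k) * (pw u * e c)" by (simp add: mult.assoc)
    finally show "q i * (pw (fst i) * e (snd i)) \<sim> 0"
      using eqv_J J(4)[OF z] by (simp add: uc eqv_0)
  qed
  then show ?thesis using eqv_J[OF p] by (simp add: eqv_0)
qed

end

section \<open>Representations of presented algebras\<close>

definition oprep :: "('g \<Rightarrow> ('a, 'k) oper) \<Rightarrow> ('k::field, 'g) free_alg \<Rightarrow> ('a, 'k) oper" where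
  "oprep gact = lift oper_scal (word_prod gact)"

lemma monoid_algebra_hom_oprep: "monoid_algebra_hom oper_scal (word_prod (gact :: 'g \<Rightarrow> ('a, 'k::field) oper))"
  by (rule monoid_algebra_hom_word) (simp_all only: oper_scal_hom, rule oper_scal_central)

lemmas oprep_hom = monoid_algebra_hom.lift_hom[OF monoid_algebra_hom_oprep, folded oprep_def]
lemmas oprep_power = monoid_algebra_hom.lift_power[OF monoid_algebra_hom_oprep, folded oprep_def]
lemma oprep_gen: "oprep gact (fgen g) = gact g"
  using monoid_algebra_hom.lift_single[OF monoid_algebra_hom_oprep, of gact "Word [g]" 1]
  by (simp add: oprep_def fgen_def word_prod_def oper_scal_hom)

lemma oprep_scal: "oprep gact (fscalar a) = oper_scal a"
  using monoid_algebra_hom.lift_single[OF monoid_algebra_hom_oprep, of gact 0 a]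
  by (simp add: oprep_def fscalar_def word_prod_simps)

definition supported :: "'a set \<Rightarrow> ('a \<Rightarrow> 'k::field rf) \<Rightarrow> bool" where
  "supported S v \<longleftrightarrow> (\<forall>c. c \<notin> S \<longrightarrow> v c = 0)"

definition killing :: "'a set \<Rightarrow> ('g \<Rightarrow> ('a, 'k) oper) \<Rightarrow> ('k::field, 'g) free_alg set" where
  "killing S gact = {x. \<forall>c\<in>S. \<forall>f. app (oprep gact x) (vsingle c f) = (\<lambda>_. 0)}"

lemma supported_oprep:
  assumes "\<And>g v. supported S v \<Longrightarrow> supported S (app (gact g) v)" "supported S v"
  shows "supported S (app (oprep gact x) v)"
  by (induction x rule: free_alg_induct)
    (use assms in \<open>auto simp: oprep_hom oprep_gen oprep_scal supported_def\<close>)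

lemma app_kills_supported:
  assumes "finite S" "\<And>c f. c \<in> S \<Longrightarrow> app T (vsingle c f) = (\<lambda>_. 0)" "supported S v"
  shows "app T v = (\<lambda>_. 0)"
proof -
  have "app T v = app T (\<lambda>d. \<Sum>c\<in>S. vsingle c (v c) d)"
    using vec_eq_sum_vsingle[OF assms(1), of v] assms(3) by (simp add: supported_def)
  also have "\<dots> = (\<lambda>d. \<Sum>c\<in>S. app T (vsingle c (v c)) d)" by (rule app_vec_sum)
  also have "\<dots> = (\<lambda>_. 0)" using assms(2) by simp
  finally show ?thesis .
qed

text \<open>Closure under right multiplication is the point: the right factor acts first and must
  not leave the vectors supported on \<open>S\<close>.\<close>

lemma tsi_killing:
  assumes "finite S" "\<And>g v. supported S v \<Longrightarrow> supported S (app (gact g) v)"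
  shows "tsi (killing S gact)"
  unfolding tsi_def
proof (intro conjI ballI allI)
  fix x a assume x: "x \<in> killing S gact"
  show "x * a \<in> killing S gact"
  proof -
    have "app (oprep gact x) (app (oprep gact a) (vsingle c f)) = (\<lambda>_. 0)" if "c \<in> S" for c f
    proof (rule app_kills_supported[OF assms(1)])
      show "supported S (app (oprep gact a) (vsingle c f))"
        by (rule supported_oprep[OF assms(2)]) (use that in \<open>auto simp: supported_def vsingle_def\<close>)
    qed (use x in \<open>simp add: killing_def\<close>)
    then show ?thesis by (simp add: killing_def oprep_hom)
  qed
qed (auto simp: killing_def oprep_hom app_0)

section \<open>Leading monomials\<close>

text \<open>A monic leading term for the order on exponent vectors that compares at the smallest
  index where they differ.\<close>

definition has_lead :: "'k::field mpoly \<Rightarrow> (nat \<Rightarrow>\<^sub>0 nat) \<Rightarrow> bool" where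
  "has_lead P \<alpha> \<longleftrightarrow> (\<forall>\<beta>\<in>Poly_Mapping.keys (P - Poly_Mapping.single \<alpha> 1). \<beta> < \<alpha>)"

lemma has_lead_mult:
  assumes "has_lead P \<alpha>" "has_lead Q \<beta>"
  shows "has_lead (P * Q) (\<alpha> + \<beta>)"
proof -
  define P' Q' where "P' = P - Poly_Mapping.single \<alpha> 1" and "Q' = Q - Poly_Mapping.single \<beta> 1"
  have "P * Q - Poly_Mapping.single (\<alpha> + \<beta>) 1 =
      P' * Poly_Mapping.single \<beta> 1 + Poly_Mapping.single \<alpha> 1 * Q' + P' * Q'"
    by (simp add: P'_def Q'_def algebra_simps mult_single)
  moreover have "\<gamma> < \<alpha> + \<beta>" if "\<gamma> \<in> Poly_Mapping.keys (P' * Poly_Mapping.single \<beta> 1 + Poly_Mapping.single \<alpha> 1 * Q' + P' * Q')" for \<gamma>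
  proof -
    have "\<gamma> \<in> Poly_Mapping.keys (P' * Poly_Mapping.single \<beta> 1) \<union> Poly_Mapping.keys (Poly_Mapping.single \<alpha> 1 * Q') \<union> Poly_Mapping.keys (P' * Q')"
      using that keys_add[of "P' * Poly_Mapping.single \<beta> 1 + Poly_Mapping.single \<alpha> 1 * Q'" "P' * Q'"]
        keys_add[of "P' * Poly_Mapping.single \<beta> 1" "Poly_Mapping.single \<alpha> 1 * Q'"] by blast
    then consider a where "a \<in> Poly_Mapping.keys P'" "\<gamma> = a + \<beta>" | b where "b \<in> Poly_Mapping.keys Q'" "\<gamma> = \<alpha> + b"
      | a b where "a \<in> Poly_Mapping.keys P'" "b \<in> Poly_Mapping.keys Q'" "\<gamma> = a + b"
      using keys_mult[of P' "Poly_Mapping.single \<beta> 1"] keys_mult[of "Poly_Mapping.single \<alpha> 1" Q'] keys_mult[of P' Q']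
      by (auto split: if_splits)
    then show ?thesis
      using assms by cases (auto simp: has_lead_def P'_def Q'_def intro: add_strict_mono)
  qed
  ultimately show ?thesis by (simp add: has_lead_def)
qed

lemma has_lead_single: "has_lead (Poly_Mapping.single \<alpha> 1) \<alpha>"
  by (simp add: has_lead_def)

lemma has_lead_prod_list:
  "(\<And>x. x \<in> set xs \<Longrightarrow> has_lead (P x) (ld x)) \<Longrightarrow> has_lead (prod_list (map P xs)) (sum_list (map ld xs))"
proof (induction xs)
  case Nil
  show ?case using has_lead_single[of 0] by simp
qed (auto intro: has_lead_mult)

lemma has_lead_lookup: "has_lead P \<alpha> \<Longrightarrow> Poly_Mapping.lookup P \<alpha> = 1"
  by (force simp: has_lead_def in_keys_iff lookup_minus)

lemma has_lead_lookup_above: "has_lead P \<alpha> \<Longrightarrow> \<alpha> < \<beta> \<Longrightarrow> Poly_Mapping.lookup P \<beta> = 0"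
proof -
  assume "has_lead P \<alpha>" "\<alpha> < \<beta>"
  then have "Poly_Mapping.lookup (P - Poly_Mapping.single \<alpha> 1) \<beta> = 0"
    by (auto simp: has_lead_def in_keys_iff dest: order.asym)
  then show ?thesis using \<open>\<alpha> < \<beta>\<close> by (simp add: lookup_minus lookup_single)
qed

text \<open>Among the terms with nonzero coefficient, the one with the largest leading exponent has
  nothing to cancel against.\<close>

lemma has_lead_independent:
  fixes C :: "'i \<Rightarrow> 'k::field"
  assumes "finite A" "\<And>i. i \<in> A \<Longrightarrow> has_lead (P i) (ld i)" "inj_on ld A"
    and zero: "(\<Sum>i\<in>A. Poly_Mapping.single 0 (C i) * P i) = 0" and "i \<in> A"
  shows "C i = 0"
proof (rule ccontr)
  assume "C i \<noteq> 0"
  define V where "V = {i \<in> A. C i \<noteq> 0}"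
  have V: "finite V" "V \<noteq> {}" using assms(1) \<open>i \<in> A\<close> \<open>C i \<noteq> 0\<close> by (auto simp: V_def)
  obtain m where m: "m \<in> V" "\<And>v. v \<in> V \<Longrightarrow> ld v \<le> ld m"
    using Max_in[of "ld ` V"] Max_ge[of "ld ` V"] V
    by (metis (no_types, lifting) finite_imageI imageE image_eqI image_is_empty)
  have lk: "Poly_Mapping.lookup (Poly_Mapping.single 0 c * Q) \<alpha> = c * Poly_Mapping.lookup Q \<alpha>" for c :: 'k and Q \<alpha>
    by (simp add: mult_map_scale_conv_mult[symmetric] map.rep_eq when_def)
  have "0 = Poly_Mapping.lookup (\<Sum>i\<in>A. Poly_Mapping.single 0 (C i) * P i) (ld m)"
    by (simp add: zero)
  also have "\<dots> = (\<Sum>i\<in>A. C i * Poly_Mapping.lookup (P i) (ld m))"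
    by (simp add: lookup_sum lk)
  also have "\<dots> = (\<Sum>i\<in>{m}. C i * Poly_Mapping.lookup (P i) (ld m))"
  proof (rule sum.mono_neutral_right[OF assms(1)])
    show "\<forall>i\<in>A - {m}. C i * Poly_Mapping.lookup (P i) (ld m) = 0"
    proof
      fix i assume i: "i \<in> A - {m}"
      show "C i * Poly_Mapping.lookup (P i) (ld m) = 0"
      proof (cases "C i = 0")
        case False
        then have "ld i \<le> ld m" "ld i \<noteq> ld m"
          using m i assms(3) by (auto simp: V_def inj_on_def)
        then show ?thesis using has_lead_lookup_above[OF assms(2)] i by simp
      qed simp
    qed
  qed (use m in \<open>auto simp: V_def\<close>)
  also have "\<dots> = C m" using m has_lead_lookup[OF assms(2)] by (simp add: V_def)
  finally show False using m by (simp add: V_def)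
qed

lemma tsi_sum: "tsi J \<Longrightarrow> (\<And>i. i \<in> A \<Longrightarrow> f i \<in> J) \<Longrightarrow> sum f A \<in> J"
  by (induction A rule: infinite_finite_induct) (auto dest: tsiD)

lemma single_sum: "Poly_Mapping.single a (sum f A) = (\<Sum>i\<in>A. Poly_Mapping.single a (f i))"
  by (induction A rule: infinite_finite_induct) (auto simp: single_add)

lemma commuting_words_eqv:
  assumes J: "tsi J" and comm: "\<And>g h. g \<in> Zs \<Longrightarrow> h \<in> Zs \<Longrightarrow> fgen g * fgen h - fgen h * fgen g \<in> J"
    and "set l \<subseteq> Zs" "mset l = mset l'"
  shows "prod_list (map fgen l) - prod_list (map fgen l') \<in> (J :: ('k::field, 'g) free_alg set)"
  using assms(3,4)
proof (induction l arbitrary: l')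
  case Nil
  then show ?case using tsiD[OF J] by simp
next
  case (Cons g l)
  note J' = tsiD[OF J]
  have "g \<in> set l'" using Cons.prems(2) by (metis list.set_intros(1) set_mset_mset)
  then obtain l1 l2 where l': "l' = l1 @ g # l2" by (meson split_list)
  have m: "mset l = mset (l1 @ l2)" using Cons.prems(2) l' by simp
  have sub: "set l' \<subseteq> Zs" using Cons.prems by (metis set_mset_mset)
  have slide: "set k \<subseteq> Zs \<Longrightarrow> fgen g * prod_list (map fgen k) - prod_list (map fgen k) * fgen g \<in> J" for k
  proof (induction k)
    case (Cons h k)
    have "(fgen g * fgen h - fgen h * fgen g) * prod_list (map fgen k)
      + fgen h * (fgen g * prod_list (map fgen k) - prod_list (map fgen k) * fgen g) \<in> J"
      using Cons comm[of g h] sub l' J' by auto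
    then show ?case by (simp add: algebra_simps)
  qed (use J' in simp)
  have "fgen g * (prod_list (map fgen l) - prod_list (map fgen (l1 @ l2)))
    + (fgen g * prod_list (map fgen l1) - prod_list (map fgen l1) * fgen g) * prod_list (map fgen l2) \<in> J"
    using Cons.IH[OF _ m] slide[of l1] Cons.prems sub l' J' by auto
  then show ?case by (simp add: l' algebra_simps)
qed

text \<open>A polynomial in the free algebra is a sum of noncommutative words, which modulo
  \<open>J\<close> are grouped by their multisets of letters. Generators in \<open>Zg\<close> act by
  monic polynomials whose leading exponents separate multisets. The others act by zero and vanish on
  the idempotent \<open>ec\<close>, so words containing them drop out on both sides; in the Webster
  algebra they are the dots on red strands.\<close>

lemma polynomials_faithful:
  fixes J :: "('k::field, 'g) free_alg set" and ec :: "('k, 'g) free_alg" and gact :: "'g \<Rightarrow> ('a, 'k) oper"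
  assumes J: "tsi J" and comm: "\<And>g h. g \<in> Zs \<Longrightarrow> h \<in> Zs \<Longrightarrow> fgen g * fgen h - fgen h * fgen g \<in> J"
    and good: "\<And>g f. g \<in> Zg \<Longrightarrow> app (gact g) (vsingle c f) = vsingle c (rf_poly (P g) * f)"
    and bad: "\<And>g f. g \<in> Zs - Zg \<Longrightarrow> app (gact g) (vsingle c f) = (\<lambda>_. 0)"
    and bad_J: "\<And>g. g \<in> Zs - Zg \<Longrightarrow> fgen g * ec \<in> J"
    and lead: "\<And>g. g \<in> Zg \<Longrightarrow> has_lead (P g) (ld g)"
    and inj: "\<And>l l'. set l \<subseteq> Zg \<Longrightarrow> set l' \<subseteq> Zg \<Longrightarrow> sum_list (map ld l) = sum_list (map ld l') \<Longrightarrow> mset l = mset l'"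
    and q: "q \<in> fcarrier Zs" and zero: "app (oprep gact q) (vsingle c 1) = (\<lambda>_. 0)"
    and "Zg \<subseteq> Zs"
  shows "q * ec \<in> J"
proof -
  note J' = tsiD[OF J]
  let ?w = "\<lambda>l. prod_list (map fgen l) :: ('k, 'g) free_alg"
  define K where "K = {w \<in> Poly_Mapping.keys q. set (letters w) \<subseteq> Zg}"
  define cf where "cf = Poly_Mapping.lookup q"
  have finK: "finite K" by (simp add: K_def)
  have keys: "set (letters w) \<subseteq> Zs" if "w \<in> Poly_Mapping.keys q" for w
    using q that by (auto simp: fcarrier_iff)
  have qsum: "q = (\<Sum>w\<in>Poly_Mapping.keys q. fscalar (cf w) * ?w (letters w))"
    unfolding cf_def using free_alg_eq_sum_words[of q] by (simp add: word_prod_def)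
  have act_good: "app (oprep gact (?w l)) (vsingle c f) = vsingle c (rf_poly (prod_list (map P l)) * f)"
    if "set l \<subseteq> Zg" for l f
    using that by (induction l arbitrary: f) (auto simp: oprep_hom oprep_gen good rf_poly_hom mult.assoc)
  have act_bad: "app (oprep gact (?w l)) (vsingle c f) = (\<lambda>_. 0) \<and> ?w l * ec \<in> J"
    if "set l \<subseteq> Zs" "\<not> set l \<subseteq> Zg" for l f
  proof -
    from that obtain g where g: "g \<in> set l" "g \<in> Zs - Zg" by blast
    then obtain l1 l2 where l: "l = l1 @ g # l2" by (meson split_list)
    have "?w l - ?w (l1 @ l2 @ [g]) \<in> J"
      by (rule commuting_words_eqv[OF J comm]) (use that l in auto)
    from J'(4)[OF this, of ec] have 1: "?w l * ec - ?w (l1 @ l2) * (fgen g * ec) \<in> J"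
      by (simp add: algebra_simps)
    have "?w (l1 @ l2) * (fgen g * ec) \<in> J" using bad_J[OF g(2)] J' by blast
    with J'(2)[OF 1 this] have "?w l * ec \<in> J" by simp
    moreover have "set k \<subseteq> Zs \<Longrightarrow> \<not> set k \<subseteq> Zg \<Longrightarrow> app (oprep gact (?w k)) (vsingle c f) = (\<lambda>_. 0)" for k f
    proof (induction k)
      case (Cons h k)
      show ?case
      proof (cases "set k \<subseteq> Zg")
        case True
        then have "h \<in> Zs - Zg" using Cons.prems by auto
        then show ?thesis using act_good[OF True] bad by (simp add: oprep_hom oprep_gen)
      next
        case False
        then show ?thesis using Cons by (simp add: oprep_hom oprep_gen app_0)
      qed
    qed simp
    ultimately show ?thesis using that by blast
  qed
  \<comment> \<open>Each multiset of letters gets one representative word \<open>rp M\<close>, and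
    \<open>C M\<close> collects the coefficients of all its orderings.\<close>
  define Ms where "Ms = (\<lambda>w. mset (letters w)) ` K"
  define rp where "rp M = (SOME l. mset l = M)" for M :: "'g multiset"
  have rp: "mset (rp M) = M" for M unfolding rp_def by (rule someI_ex) (rule ex_mset)
  define C where "C M = (\<Sum>w\<in>{w \<in> K. mset (letters w) = M}. cf w)" for M
  have rpM: "set (rp M) \<subseteq> Zg" if "M \<in> Ms" for M
  proof -
    from that obtain w where "w \<in> K" "M = mset (letters w)" by (auto simp: Ms_def)
    then show ?thesis using mset_eq_setD[OF rp[of "mset (letters w)"]] by (simp add: K_def)
  qed
  have P_mset: "prod_list (map P (letters w)) = prod_list (map P (rp (mset (letters w))))" for w
    using rp[of "mset (letters w)"] by (metis mset_map prod_mset_prod_list)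
  have act_zero: "app (oprep gact (fscalar (cf w) * ?w (letters w))) (vsingle c 1) d = 0"
    if "w \<in> Poly_Mapping.keys q - K" for w d
    using act_bad[of "letters w" 1] keys[of w] that by (auto simp: K_def oprep_hom oprep_scal)
  have "0 = app (oprep gact q) (vsingle c 1) c" by (simp add: zero)
  also have "\<dots> = (\<Sum>w\<in>Poly_Mapping.keys q. app (oprep gact (fscalar (cf w) * ?w (letters w))) (vsingle c 1) c)"
    by (subst (1) qsum) (simp add: oprep_hom app_sum)
  also have "\<dots> = (\<Sum>w\<in>K. app (oprep gact (fscalar (cf w) * ?w (letters w))) (vsingle c 1) c)"
    by (rule sum.mono_neutral_right) (use act_zero in \<open>auto simp: K_def\<close>)
  also have "\<dots> = (\<Sum>w\<in>K. rf_poly (Poly_Mapping.single 0 (cf w) * prod_list (map P (letters w))))"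
    by (intro sum.cong refl)
      (auto simp: K_def oprep_hom oprep_scal act_good rf_poly_hom rf_const_def)
  also have "\<dots> = rf_poly (\<Sum>w\<in>K. Poly_Mapping.single 0 (cf w) * prod_list (map P (letters w)))"
    by (simp add: rf_poly_sum)
  finally have "(\<Sum>w\<in>K. Poly_Mapping.single 0 (cf w) * prod_list (map P (letters w))) = 0"
    by (simp add: rf_poly_eq_0_iff)
  also have "(\<Sum>w\<in>K. Poly_Mapping.single 0 (cf w) * prod_list (map P (letters w)))
    = (\<Sum>M\<in>Ms. \<Sum>w\<in>{w \<in> K. mset (letters w) = M}. Poly_Mapping.single 0 (cf w) * prod_list (map P (letters w)))"
    unfolding Ms_def by (rule sum.image_gen[OF finK])
  also have "\<dots> = (\<Sum>M\<in>Ms. Poly_Mapping.single 0 (C M) * prod_list (map P (rp M)))"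
    by (rule sum.cong[OF HOL.refl])
      (auto simp: C_def P_mset single_sum sum_distrib_right intro!: sum.cong)
  finally have s: "(\<Sum>M\<in>Ms. Poly_Mapping.single 0 (C M) * prod_list (map P (rp M))) = 0" .
  have C0: "C M = 0" if "M \<in> Ms" for M
  proof (rule has_lead_independent[where A = Ms and P = "\<lambda>M. prod_list (map P (rp M))" and ld = "\<lambda>M. sum_list (map ld (rp M))"])
    show "inj_on (\<lambda>M. sum_list (map ld (rp M))) Ms"
      by (rule inj_onI) (metis inj rp rpM)
  qed (use s that rpM finK lead in \<open>auto simp: Ms_def intro!: has_lead_prod_list\<close>)
  have "(\<Sum>w\<in>Poly_Mapping.keys q - K. fscalar (cf w) * (?w (letters w) * ec)) \<in> J"
  proof -
    have "fscalar (cf w) * (?w (letters w) * ec) \<in> J" if "w \<in> Poly_Mapping.keys q - K" for w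
      using act_bad[of "letters w"] keys[of w] that J'(3) by (auto simp: K_def)
    then show ?thesis by (rule tsi_sum[OF J])
  qed
  moreover have "(\<Sum>w\<in>K. fscalar (cf w) * (?w (letters w) * ec)) \<in> J"
  proof -
    have "(\<Sum>w\<in>K. fscalar (cf w) * ((?w (letters w) - ?w (rp (mset (letters w)))) * ec)) \<in> J"
    proof (rule tsi_sum[OF J])
      fix w assume "w \<in> K"
      then have "?w (letters w) - ?w (rp (mset (letters w))) \<in> J"
        using keys by (intro commuting_words_eqv[OF J comm]) (auto simp: K_def rp)
      then show "fscalar (cf w) * ((?w (letters w) - ?w (rp (mset (letters w)))) * ec) \<in> J"
        using J' by blast
    qed
    moreover have "(\<Sum>w\<in>K. fscalar (cf w) * (?w (rp (mset (letters w))) * ec)) = 0"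
    proof -
      have "(\<Sum>w\<in>K. fscalar (cf w) * (?w (rp (mset (letters w))) * ec))
        = (\<Sum>M\<in>Ms. \<Sum>w\<in>{w \<in> K. mset (letters w) = M}. fscalar (cf w) * (?w (rp (mset (letters w))) * ec))"
        unfolding Ms_def by (rule sum.image_gen[OF finK])
      also have "\<dots> = (\<Sum>M\<in>Ms. fscalar (C M) * (?w (rp M) * ec))"
        by (rule sum.cong[OF HOL.refl])
          (auto simp: C_def fscalar_def single_sum sum_distrib_right intro!: sum.cong)
      also have "\<dots> = 0" using C0 by (simp add: fscalar_hom)
      finally show ?thesis .
    qed
    ultimately show ?thesis by (simp add: algebra_simps sum_subtractf)
  qed
  moreover have "q * ec = (\<Sum>w\<in>Poly_Mapping.keys q - K. fscalar (cf w) * (?w (letters w) * ec))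
      + (\<Sum>w\<in>K. fscalar (cf w) * (?w (letters w) * ec))"
    by (subst (1) qsum) (simp add: distrib_right sum_distrib_right mult.assoc sum.subset_diff[of K "Poly_Mapping.keys q"] K_def)
  ultimately show ?thesis using J'(2) by simp
qed

section \<open>The KLR algebra\<close>

text \<open>
  The variables are split into three families: \<open>yv\<close> belongs to the solid strands, \<open>xv\<close> to the
  barred strands, and \<open>rv\<close> consists of dummy variables that only distinguish the red strands of the
  Webster algebra.
\<close>

abbreviation (input) "yv j \<equiv> 3 * j :: nat"
abbreviation (input) "xv j \<equiv> Suc (3 * j) :: nat"
abbreviation (input) "rv j \<equiv> Suc (Suc (3 * j)) :: nat"

fun klr_lab :: "colour \<Rightarrow> nat \<Rightarrow> nat" where
  "klr_lab Plain j = yv j"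
| "klr_lab Bar j = xv j"

text \<open>The factors of a crossing and of its reverse must multiply to the right-hand side of the
  quadratic relation. All of it is placed on the crossing with \<open>Bar\<close> on the left, so
  the opposite crossing is a pure exchange.\<close>

definition klr_kap :: "colour \<Rightarrow> colour \<Rightarrow> 'k::field rf \<Rightarrow> 'k rf \<Rightarrow> 'k rf" where
  "klr_kap a b x y = (if a = Plain then 1 else y - x)"

global_interpretation klr: strand_rep klr_lab "klr_kap :: colour \<Rightarrow> colour \<Rightarrow> 'k::field rf \<Rightarrow> 'k rf \<Rightarrow> 'k rf"
proof
  show "klr_lab a i = klr_lab b j \<longleftrightarrow> a = b \<and> i = j" for a b i j
    by (cases a; cases b) (auto, presburger+)
qed (auto simp: klr_kap_def rf_perm_minus)

definition klr_act :: "nat \<Rightarrow> klr_gen \<Rightarrow> (colour list, 'k::field) oper" where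
  "klr_act r g = (case g of
      KE c \<Rightarrow> if length c = r then op_proj c else 0
    | KX j \<Rightarrow> if j < r then op_mult (\<lambda>c. klr.lv c j) else 0
    | KPsi j \<Rightarrow> if Suc j < r then klr.op_psi j else 0)"

abbreviation "klr_rep r \<equiv> oprep (klr_act r)"

lemma klr_act_simps:
  "length c = r \<Longrightarrow> klr_act r (KE c) = op_proj c"
  "j < r \<Longrightarrow> klr_act r (KX j) = op_mult (\<lambda>c. klr.lv c j)"
  "Suc j < r \<Longrightarrow> klr_act r (KPsi j) = klr.op_psi j"
  by (simp_all add: klr_act_def)

lemma finite_length_eq: "finite {c :: colour list. length c = r}"
proof -
  have "(UNIV :: colour set) = {Plain, Bar}" using colour.exhaust by auto
  then have "finite (UNIV :: colour set)" by (metis finite.emptyI finite.insertI)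
  from finite_lists_length_eq[OF this, of r] show ?thesis by simp
qed

lemma klr_presentation: "presentation (klr_gens r) (klr_rel r :: ('k::field, klr_gen) free_alg \<Rightarrow> _)"
proof
  fix a b :: "('k, klr_gen) free_alg" assume "klr_rel r a b"
  then show "a \<in> fcarrier (klr_gens r) \<and> b \<in> fcarrier (klr_gens r)"
    by cases (auto simp: klr_gens_def power2_eq_square split: colour.split
        intro!: fcarrier_mult fcarrier_minus fcarrier_add fcarrier_uminus fcarrier_sum)
qed

global_interpretation klr_pres: presentation "klr_gens r" "klr_rel r :: ('k::field, klr_gen) free_alg \<Rightarrow> _" for r
  by (rule klr_presentation)

lemma supported_klr_act:
  "supported {c. length c = r} v \<Longrightarrow> supported {c. length c = r} (app (klr_act r g) v)"
  by (cases g) (auto simp: supported_def klr_act_def app_op_proj app_op_mult klr.app_op_psi vsingle_def)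

lemma klr_rel_kills:
  assumes "klr_rel r a b" "length d = r"
  shows "app (klr_rep r a) (vsingle d f) = app (klr_rep r b) (vsingle d (f :: 'k::field rf))"
  using assms(1)
proof cases
  case unit
  have "(\<Sum>c | length c = r. app (op_proj c) (vsingle d f) x) = vsingle d f x" for x
  proof -
    have "(\<Sum>c | length c = r. app (op_proj c) (vsingle d f) x) = (\<Sum>c | length c = r. if c = d then vsingle d f x else 0)"
      by (intro sum.cong) auto
    then show ?thesis using assms(2) finite_length_eq by (simp add: sum.delta)
  qed
  then show ?thesis by (simp add: unit oprep_hom oprep_gen app_sum klr_act_simps)
next
  case (e_e c c')
  then show ?thesis using assms(2) by (simp add: oprep_hom oprep_gen klr_act_simps app_0)
next
  case (x_e c j)
  then show ?thesis using assms(2) by (simp add: oprep_hom oprep_gen klr_act_simps app_0)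
next
  case (psi_e c j)
  have "swap_at j c = swap_at j d \<longleftrightarrow> c = d"
    using psi_e assms(2) by (metis swap_at_swap_at)
  then show ?thesis using psi_e assms(2)
    by (simp add: oprep_hom oprep_gen klr_act_simps app_0 klr.app_op_psi_vsingle)
next
  case (x_x j k)
  then show ?thesis by (simp add: oprep_hom oprep_gen klr_act_simps mult.left_commute)
next
  case (psi_x j k)
  then show ?thesis using assms(2)
    by (simp add: oprep_hom oprep_gen klr_act_simps klr.app_op_psi_vsingle klr.dpsi_var_far klr.lam_swap_at_far)
next
  case (psi_psi j k)
  then show ?thesis using assms(2) klr.dpsi_far[of j k d f] klr.dpsi_far[of k j d f]
      swap_at_commute[of j k d] swap_at_commute[of k j d]
    by (auto simp: oprep_hom oprep_gen klr_act_simps klr.app_op_psi_vsingle)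
next
  case (slide1 c j)
  show ?thesis
  proof (cases "c = d")
    case True
    have "klr.lam d j \<noteq> klr.lam d (Suc j)" using slide1 True by (simp add: klr.lam_inj)
    note sl = klr.dd_slide(1)[OF this, of f]
    show ?thesis using slide1 True sl
      by (cases "d ! j = d ! Suc j")
        (simp_all add: oprep_hom oprep_gen klr_act_simps klr.app_op_psi_vsingle swap_at_same
          klr.dpsi_def klr.lam_swap_at mult.left_commute flip: vsingle_minus)
  qed (use slide1 in \<open>simp add: oprep_hom oprep_gen klr_act_simps app_0\<close>)
next
  case (slide2 c j)
  show ?thesis
  proof (cases "c = d")
    case True
    have "klr.lam d j \<noteq> klr.lam d (Suc j)" using slide2 True by (simp add: klr.lam_inj)
    note sl = klr.dd_slide(2)[OF this, of f]
    show ?thesis using slide2 True sl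
      by (cases "d ! j = d ! Suc j")
        (simp_all add: oprep_hom oprep_gen klr_act_simps klr.app_op_psi_vsingle swap_at_same
          klr.dpsi_def klr.lam_swap_at mult.left_commute flip: vsingle_minus)
  qed (use slide2 in \<open>simp add: oprep_hom oprep_gen klr_act_simps app_0\<close>)
next
  case (quad c j)
  show ?thesis
  proof (cases "c = d")
    case True
    show ?thesis unfolding quad(1,2) using quad(3,4) True
      by (cases "d ! j"; cases "d ! Suc j")
        (simp_all add: oprep_hom oprep_gen klr_act_simps klr.app_op_psi_vsingle power2_eq_square
          klr.dpsi_quad klr_kap_def algebra_simps flip: vsingle_minus vsingle_add vsingle_uminus)
  qed (use quad in \<open>simp add: oprep_hom oprep_gen klr_act_simps app_0 power2_eq_square split: colour.split\<close>)
next
  case (braid c j)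
  show ?thesis
  proof (cases "c = d")
    case True
    have ne: "klr.lv d j - klr.lv d (Suc (Suc j)) \<noteq> (0 :: 'k rf)"
      "klr.lv d (Suc (Suc j)) - klr.lv d j \<noteq> (0 :: 'k rf)"
      using braid True by (simp_all add: klr.lam_inj)
    \<comment> \<open>The quadratic polynomial is linear in each variable, so its divided difference
      in the outer variables is the constant 1 or -1.\<close>
    have r1: "(klr.lv d j - klr.lv d (Suc j) - (klr.lv d (Suc (Suc j)) - klr.lv d (Suc j)))
        / (klr.lv d j - klr.lv d (Suc (Suc j))) = (1 :: 'k rf)"
      "(klr.lv d (Suc j) - klr.lv d j - (klr.lv d (Suc j) - klr.lv d (Suc (Suc j))))
        / (klr.lv d j - klr.lv d (Suc (Suc j))) = (-1 :: 'k rf)"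
      using ne by (simp_all add: field_simps)
    have s: "swap_at j (swap_at (Suc j) (swap_at j d)) = d" if "d ! j = d ! Suc (Suc j)"
      using braid True that by (simp add: list_eq_iff_nth_eq nth_swap_at transpose_def)
    note b = klr.dpsi_braid[of j d f] swap_at_braid[of j d]
    show ?thesis using braid True b r1 s
      by (cases "d ! j"; cases "d ! Suc j"; cases "d ! Suc (Suc j)")
        (simp_all add: oprep_hom oprep_gen klr_act_simps klr.app_op_psi_vsingle klr_kap_def
          flip: vsingle_minus vsingle_add vsingle_uminus)
  qed (use braid in \<open>simp add: oprep_hom oprep_gen klr_act_simps app_0 split: colour.split\<close>)
qed

lemma klr_J_kills: "klr_pres.J r \<subseteq> killing {c. length c = r} (klr_act r :: _ \<Rightarrow> (_, 'k::field) oper)"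
proof (rule klr_pres.J_least)
  show "tsi (killing {c. length c = r} (klr_act r :: _ \<Rightarrow> (_, 'k) oper))"
    by (rule tsi_killing[OF finite_length_eq supported_klr_act])
  show "a - b \<in> killing {c. length c = r} (klr_act r :: _ \<Rightarrow> (_, 'k) oper)" if "klr_rel r a b" for a b
    using klr_rel_kills[OF that] by (simp add: killing_def oprep_hom)
  show "fgen g \<in> killing {c. length c = r} (klr_act r :: _ \<Rightarrow> (_, 'k) oper)" if "g \<notin> klr_gens r" for g
    using that by (cases g) (auto simp: killing_def oprep_gen klr_act_def klr_gens_def)
qed

lemma klr_faithful_rep:
  "faithful_rep (klr_pres.J r) r {c. length c = r} KE KX {..<r} KPsi (\<lambda>_ _. True) klr_lab
    (klr_kap :: _ \<Rightarrow> _ \<Rightarrow> 'k::field rf \<Rightarrow> _) (\<lambda>c t. klr.lv c t) (klr_act r)"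
proof
  let ?J = "klr_pres.J r :: ('k, klr_gen) free_alg set"
  note R = klr_pres.J_rel
  note J = klr_pres.J
  show "tsi (klr_pres.J r :: ('k, klr_gen) free_alg set)" by (rule klr_pres.tsi_J)
  show "fgen g \<in> ?J" if "g \<notin> KE ` {c. length c = r} \<union> KX ` {..<r} \<union> KPsi ` {p. Suc p < r}" for g
    by (rule klr_pres.J_gen) (use that in \<open>auto simp: klr_gens_def\<close>)
  show "finite {c :: colour list. length c = r}" by (rule finite_length_eq)
  show "(\<Sum>c | length c = r. fgen (KE c)) - 1 \<in> ?J" by (rule R[OF klr_rel.unit])
  show "fgen (KE c) * fgen (KE c') - (if c = c' then fgen (KE c) else 0) \<in> ?J"
    if "c \<in> {c. length c = r}" "c' \<in> {c. length c = r}" for c c'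
    using that by (intro R klr_rel.e_e) auto
  show "fgen (KX t) * fgen (KE c) - fgen (KE c) * fgen (KX t) \<in> ?J"
    if "c \<in> {c. length c = r}" "t \<in> {..<r}" for c t
    using that by (intro R klr_rel.x_e) auto
  show xx: "fgen (KX t) * fgen (KX t') - fgen (KX t') * fgen (KX t) \<in> ?J"
    if "t \<in> {..<r}" "t' \<in> {..<r}" for t t'
    using that by (intro R klr_rel.x_x) auto
  show "fgen (KPsi p) * fgen (KE c) - fgen (KE (swap_at p c)) * fgen (KPsi p) \<in> ?J"
    if "c \<in> {c. length c = r}" "Suc p < r" for c p
    using that by (intro R klr_rel.psi_e) auto
  show "\<exists>t'\<in>{..<r}. \<exists>a. (fgen (KPsi p) * fgen (KX t) - fgen (KX t') * fgen (KPsi p)) * fgen (KE c)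
      - fscalar a * fgen (KE c) \<in> ?J"
    if "c \<in> {c. length c = r}" "Suc p < r" "t \<in> {..<r}" for c p t
  proof -
    consider "t = p" | "t = Suc p" | "t \<noteq> p" "t \<noteq> Suc p" by blast
    then show ?thesis
    proof cases
      case 1
      show ?thesis using that R[OF klr_rel.slide2[of c r p]]
        by (intro bexI[of _ "Suc p"] exI[of _ "if c ! p = c ! Suc p then 1 else 0"])
          (auto simp: 1 fscalar_hom split: if_splits)
    next
      case 2
      have "- ((fgen (KX p) * fgen (KPsi p) - fgen (KPsi p) * fgen (KX (Suc p))) * fgen (KE c)
          - (if c ! p = c ! Suc p then fgen (KE c) else 0)) \<in> ?J"
        using that by (intro J(5) R[OF klr_rel.slide1]) auto
      moreover have "fscalar (- 1 :: 'k) = (- 1 :: ('k, klr_gen) free_alg)"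
        by (simp add: fscalar_def single_uminus)
      ultimately show ?thesis using that
        by (intro bexI[of _ "p"] exI[of _ "if c ! p = c ! Suc p then - 1 else 0"])
          (auto simp: 2 fscalar_hom algebra_simps split: if_splits)
    next
      case 3
      show ?thesis using that J(4)[OF R[OF klr_rel.psi_x[of p r t]], of "fgen (KE c)"] 3
        by (intro bexI[of _ t] exI[of _ 0]) (auto simp: fscalar_hom)
    qed
  qed
  show "\<exists>q\<in>fcarrier (KX ` {..<r}). fgen (KPsi p) * fgen (KPsi p) * fgen (KE c) - q * fgen (KE c) \<in> ?J"
    if "c \<in> {c. length c = r}" "Suc p < r" for c p
    using that R[OF klr_rel.quad[of c r p]]
    by (intro bexI[of _ "case (c ! p, c ! Suc p) of (Plain, Bar) \<Rightarrow> klr_x p - klr_x (Suc p)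
        | (Bar, Plain) \<Rightarrow> - klr_x p + klr_x (Suc p) | _ \<Rightarrow> 0"])
      (auto simp: power2_eq_square split: colour.splits intro!: fcarrier_minus fcarrier_add fcarrier_uminus)
  show "(fgen (KPsi p) * fgen (KPsi q) - fgen (KPsi q) * fgen (KPsi p)) * fgen (KE c) \<in> ?J"
    if "Suc q < r" "Suc p < q" for c p q
    using that by (intro J(4) R klr_rel.psi_psi) auto
  show "\<exists>q\<in>fcarrier (KX ` {..<r}). (fgen (KPsi p) * fgen (KPsi (Suc p)) * fgen (KPsi p)
      - fgen (KPsi (Suc p)) * fgen (KPsi p) * fgen (KPsi (Suc p))) * fgen (KE c) - q * fgen (KE c) \<in> ?J"
    if "c \<in> {c. length c = r}" "Suc (Suc p) < r" for c p
    using that R[OF klr_rel.braid[of c r p]]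
    by (intro bexI[of _ "case (c ! p, c ! Suc p, c ! Suc (Suc p)) of (Plain, Bar, Plain) \<Rightarrow> 1
        | (Bar, Plain, Bar) \<Rightarrow> - 1 | _ \<Rightarrow> 0"])
      (auto split: colour.splits intro!: fcarrier_uminus)
  show "klr_kap (c ! p) (c ! Suc p) (klr.lv c p) (klr.lv c (Suc p)) \<noteq> (0 :: 'k rf)"
    if "c \<in> {c. length c = r}" "Suc p < r" for c p
    using that by (auto simp: klr_kap_def klr.lam_inj)
  show "app (lift oper_scal (word_prod (klr_act r)) x) (vsingle c f) = (\<lambda>_. 0)"
    if "x \<in> ?J" "c \<in> {c. length c = r}" for x :: "('k, klr_gen) free_alg" and c f
    using klr_J_kills that by (auto simp: killing_def oprep_def)
  show "q * fgen (KE c) \<in> ?J"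
    if c: "c \<in> {c. length c = r}" and q: "q \<in> fcarrier (KX ` {..<r})"
      and z: "app (lift oper_scal (word_prod (klr_act r)) q) (vsingle c 1) = (\<lambda>_. 0)"
    for c and q :: "('k, klr_gen) free_alg"
  proof (rule polynomials_faithful[where Zs = "KX ` {..<r}" and Zg = "KX ` {..<r}" and gact = "klr_act r" and c = c
        and P = "\<lambda>g. case g of KX j \<Rightarrow> Poly_Mapping.single (Poly_Mapping.single (klr.lam c j) 1) 1 | _ \<Rightarrow> 0"
        and ld = "\<lambda>g. case g of KX j \<Rightarrow> Poly_Mapping.single (klr.lam c j) 1 | _ \<Rightarrow> 0"])
    fix l l' :: "klr_gen list"
    let ?ld = "(\<lambda>g. case g of KX j \<Rightarrow> Poly_Mapping.single (klr.lam c j) 1 | _ \<Rightarrow> 0) :: klr_gen \<Rightarrow> nat \<Rightarrow>\<^sub>0 nat"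
    assume l: "set l \<subseteq> KX ` {..<r}" "set l' \<subseteq> KX ` {..<r}"
      and eq: "sum_list (map ?ld l) = sum_list (map ?ld l')"
    \<comment> \<open>The leading terms of the dots are distinct variables, so each exponent counts
      the occurrences of one dot.\<close>
    have cnt: "Poly_Mapping.lookup (sum_list (map ?ld l)) (klr.lam c j) = count (mset l) (KX j)"
      if "set l \<subseteq> KX ` {..<r}" "j < r" for l j
      using that c by (induction l) (auto simp: lookup_add lookup_single when_def klr.lam_inj split: if_splits)
    show "mset l = mset l'"
    proof (rule multiset_eqI)
      fix g
      show "count (mset l) g = count (mset l') g"
      proof (cases "g \<in> KX ` {..<r}")
        case True
        then obtain j where "g = KX j" "j < r" by auto
        then show ?thesis using cnt[OF l(1)] cnt[OF l(2)] eq by metis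
      next
        case False
        then show ?thesis using l by (metis count_mset_0_iff subsetD)
      qed
    qed
  qed (use c q z xx in \<open>auto simp: klr_act_simps rf_var_def has_lead_single oprep_def klr_pres.tsi_J\<close>)
qed (auto simp: klr_act_simps)

section \<open>Elementary symmetric polynomials\<close>

definition esym :: "nat set \<Rightarrow> nat \<Rightarrow> 'k::field rf" where
  "esym A d = (\<Sum>U | U \<subseteq> A \<and> card U = d. \<Prod>t\<in>U. rf_var (xv t))"

lemma esym_0 [simp]: "finite A \<Longrightarrow> esym A 0 = 1"
proof -
  assume "finite A"
  then have "{U. U \<subseteq> A \<and> card U = 0} = {{}}" by (auto dest: finite_subset)
  then show ?thesis by (simp add: esym_def)
qed

text \<open>\<open>h\<close> is the effect of \<open>g\<close> on barred indices. It merely permutes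
  the subsets of \<open>A\<close> over which the sum is taken.\<close>

lemma rf_perm_esym:
  assumes "bij g" "\<And>t. g (xv t) = xv (h t)" "bij h" "h ` A = A"
  shows "rf_perm g (esym A d) = (esym A d :: 'k::field rf)"
proof -
  have inj: "inj h" using assms(3) by (simp add: bij_is_inj)
  have "rf_perm g (esym A d) = (\<Sum>U | U \<subseteq> A \<and> card U = d. \<Prod>t\<in>U. rf_var (xv (h t)) :: 'k rf)"
    by (simp add: esym_def rf_perm_sum rf_perm_prod rf_perm_var assms)
  also have "\<dots> = (\<Sum>U | U \<subseteq> A \<and> card U = d. \<Prod>t\<in>h ` U. rf_var (xv t))"
    using inj by (intro sum.cong refl) (simp add: prod.reindex inj_on_subset)
  also have "\<dots> = esym A d"
    unfolding esym_def
  proof (rule sum.reindex_bij_witness[of _ "\<lambda>U. inv_into UNIV h ` U" "\<lambda>U. h ` U"])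
    fix U assume U: "U \<in> {U. U \<subseteq> A \<and> card U = d}"
    show "h ` U \<in> {U. U \<subseteq> A \<and> card U = d}"
      using U assms(4) inj by (auto simp: card_image inj_on_subset)
    show "inv_into UNIV h ` h ` U = U" using inj by (simp add: image_image)
    have "inv_into UNIV h ` A = A" using inj assms(4) by (metis image_inv_f_f)
    moreover have "inj (inv_into UNIV h)" using assms(3) by (simp add: bij_imp_bij_inv bij_is_inj)
    ultimately show "inv_into UNIV h ` U \<in> {U. U \<subseteq> A \<and> card U = d}"
      using U by (auto simp: card_image inj_on_subset)
    show "h ` inv_into UNIV h ` U = U" using assms(3) by (simp add: bij_is_surj image_f_inv_f)
  qed auto
  finally show ?thesis .
qed

text \<open>The monic polynomial with the barred variables of a block as roots. Its coefficients are
  signed elementary symmetric polynomials, which makes it the right-hand side of the quadratic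
  relation between a red and a black strand.\<close>

definition qpoly :: "nat set \<Rightarrow> 'k::field rf \<Rightarrow> 'k rf" where
  "qpoly A y = (\<Prod>t\<in>A. y - rf_var (xv t))"

lemma qpoly_expand:
  assumes "finite A"
  shows "qpoly A y = (\<Sum>d\<le>card A. (-1) ^ d * esym A d * y ^ (card A - d))"
proof -
  have "qpoly A y = (\<Prod>t\<in>A. - rf_var (xv t) + y)" by (simp add: qpoly_def)
  also have "\<dots> = (\<Sum>U\<in>Pow A. (\<Prod>t\<in>U. - rf_var (xv t)) * (\<Prod>t\<in>A - U. y))"
    by (rule prod_add[OF assms])
  also have "\<dots> = (\<Sum>U\<in>Pow A. (-1) ^ card U * (\<Prod>t\<in>U. rf_var (xv t)) * y ^ (card A - card U))"
    using assms by (intro sum.cong refl) (auto simp: prod_uminus card_Diff_subset finite_subset)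
  also have "\<dots> = (\<Sum>d\<in>card ` Pow A. \<Sum>U\<in>{U \<in> Pow A. card U = d}. (-1) ^ card U * (\<Prod>t\<in>U. rf_var (xv t)) * y ^ (card A - card U))"
    by (rule sum.image_gen) (use assms in simp)
  also have "card ` Pow A = {..card A}"
  proof
    show "{..card A} \<subseteq> card ` Pow A"
    proof
      fix d assume "d \<in> {..card A}"
      then obtain U where "U \<subseteq> A" "card U = d" using obtain_subset_with_card_n[of d A] by auto
      then show "d \<in> card ` Pow A" by auto
    qed
  qed (use assms in \<open>auto intro: card_mono\<close>)
  also have "(\<Sum>d\<le>card A. \<Sum>U\<in>{U \<in> Pow A. card U = d}. (-1) ^ card U * (\<Prod>t\<in>U. rf_var (xv t)) * y ^ (card A - card U))
    = (\<Sum>d\<le>card A. (-1) ^ d * esym A d * y ^ (card A - d))"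
    by (intro sum.cong refl) (auto simp: esym_def sum_distrib_left sum_distrib_right intro!: sum.cong)
  finally show ?thesis .
qed

lemma sum_pairs_eq: "(\<Sum>(i, j) \<in> {(i, j). i + j = m}. f i j) = (\<Sum>j\<le>m. f (m - j) j)"
  "(\<Sum>(i, j) \<in> {(i, j). i + j = m}. f i j) = (\<Sum>i\<le>m. f i (m - i))" for m :: nat and f :: "nat \<Rightarrow> nat \<Rightarrow> 'b::comm_monoid_add"
  by (rule sum.reindex_bij_witness[of _ "\<lambda>j. (m - j, j)" snd]; auto)
    (rule sum.reindex_bij_witness[of _ "\<lambda>i. (i, m - i)" fst]; auto)

text \<open>Dividing each difference of powers in the expansion of \<open>qpoly\<close> by
  \<open>x - w\<close> produces the sum in the braid relation around a red strand.\<close>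

lemma qpoly_difference:
  assumes "finite A" "x \<noteq> w"
  shows "(qpoly A x - qpoly A w) / (x - w) =
    (\<Sum>(a, b, c) \<in> {(a, b, c). a + b + c + 1 = card A}. (-1) ^ c * x ^ a * esym A c * w ^ b)"
proof -
  let ?s = "card A"
  have "qpoly A x - qpoly A w = (\<Sum>d\<le>?s. (-1) ^ d * esym A d * (x ^ (?s - d) - w ^ (?s - d)))"
    by (simp add: qpoly_expand[OF assms(1)] sum_subtractf right_diff_distrib)
  also have "\<dots> = (x - w) * (\<Sum>d\<le>?s. \<Sum>i<?s - d. (-1) ^ d * x ^ i * esym A d * w ^ (?s - d - Suc i))"
    by (simp only: power_diff_sumr2 sum_distrib_left) (intro sum.cong refl, simp add: algebra_simps)
  also have "(\<Sum>d\<le>?s. \<Sum>i<?s - d. (-1) ^ d * x ^ i * esym A d * w ^ (?s - d - Suc i))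
    = (\<Sum>(d, i)\<in>(SIGMA d:{..?s}. {..<?s - d}). (-1) ^ d * x ^ i * esym A d * w ^ (?s - d - Suc i))"
    by (rule sum.Sigma) auto
  also have "\<dots> = (\<Sum>(a, b, c) \<in> {(a, b, c). a + b + c + 1 = ?s}. (-1) ^ c * x ^ a * esym A c * w ^ b)"
    by (rule sum.reindex_bij_witness[of _ "\<lambda>(a, b, c). (c, a)" "\<lambda>(d, i). (i, ?s - d - Suc i, d)"]) auto
  finally show ?thesis using assms(2) by simp
qed

section \<open>The redotted Webster algebra\<close>

text \<open>Red strands keep their order, so the number of barred strands to the left of block
  \<open>k\<close> is the same in every sequence. It fixes the names of the variables of the
  block.\<close>

definition offset :: "nat list \<Rightarrow> nat \<Rightarrow> nat" where
  "offset s k = sum_list (take k s)"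

abbreviation block :: "nat list \<Rightarrow> nat \<Rightarrow> nat set" where
  "block s k \<equiv> {offset s k..<offset s k + s ! k}"

lemma offset_Suc: "k < length s \<Longrightarrow> offset s (Suc k) = offset s k + s ! k"
  by (simp add: offset_def take_Suc_conv_app_nth)

lemma offset_mono: "k \<le> l \<Longrightarrow> l \<le> length s \<Longrightarrow> offset s k \<le> offset s l"
proof (induction rule: dec_induct)
  case (step l)
  then show ?case using offset_Suc[of l s] by simp
qed simp

lemma block_disjoint:
  assumes "k < length s" "l < length s" "k \<noteq> l"
  shows "block s k \<inter> block s l = {}"
proof -
  have "block s k \<inter> block s l = {}" if "k < l" "l < length s" for k l
    using offset_mono[of "Suc k" l s] offset_Suc[of k s] that by auto
  from this[of k l] this[of l k] show ?thesis using assms by (metis inf_commute linorder_neqE_nat)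
qed

text \<open>The pairing code makes the red labels injective in both arguments, as
  \<open>strand_rep\<close> demands; the residue modulo 3 keeps them apart from black and barred
  indices.\<close>

fun web_lab :: "strand \<Rightarrow> nat \<Rightarrow> nat" where
  "web_lab Single j = yv j"
| "web_lab (Multi k) j = rv (prod_encode (k, j))"

text \<open>With a red strand on the left and a black one on the right, the factor collects the KLR
  factors of all barred strands of the block. Two red strands get 0, in accordance with the relation
  \<open>psi_red_red\<close>.\<close>

definition web_kap :: "nat list \<Rightarrow> strand \<Rightarrow> strand \<Rightarrow> 'k::field rf \<Rightarrow> 'k rf \<Rightarrow> 'k rf" where
  "web_kap s a b x y = (case (a, b) of
      (Single, _) \<Rightarrow> 1 | (Multi k, Single) \<Rightarrow> qpoly (block s k) y | (Multi k, Multi l) \<Rightarrow> 0)"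

lemma web_lab_neq_xv [simp]: "web_lab a i \<noteq> xv t" "xv t \<noteq> web_lab a i"
  by (cases a; simp; presburger)+

lemma swp_web_qpoly: "swp (web_lab d i) (web_lab d j) (qpoly A y) = qpoly A (swp (web_lab d i) (web_lab d j) (y :: 'k::field rf))"
  by (simp add: qpoly_def rf_perm_prod rf_perm_minus swp_var transpose_def)

global_interpretation web: strand_rep web_lab "web_kap s :: strand \<Rightarrow> strand \<Rightarrow> 'k::field rf \<Rightarrow> 'k rf \<Rightarrow> 'k rf" for s
proof
  show "web_lab a i = web_lab b j \<longleftrightarrow> a = b \<and> i = j" for a b i j
    by (cases a; cases b) (auto, presburger+)
qed (auto simp: web_kap_def swp_web_qpoly split: strand.split)

definition web_act :: "nat list \<Rightarrow> nat \<Rightarrow> web_gen \<Rightarrow> (strand list, 'k::field) oper" where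
  "web_act s n g = (case g of
      WE w \<Rightarrow> if w \<in> Seqs (length s) n then op_proj w else 0
    | WY p \<Rightarrow> if p < length s + n then op_mult (\<lambda>w. if w ! p = Single then web.lv w p else 0) else 0
    | WEl k d \<Rightarrow> if k < length s \<and> 1 \<le> d \<and> d \<le> s ! k then op_mult (\<lambda>w. esym (block s k) d) else 0
    | WPsi p \<Rightarrow> if Suc p < length s + n then web.op_psi s p else 0)"

abbreviation "web_rep s n \<equiv> oprep (web_act s n)"

lemma web_act_simps:
  "w \<in> Seqs (length s) n \<Longrightarrow> web_act s n (WE w) = op_proj w"
  "p < length s + n \<Longrightarrow> web_act s n (WY p) = op_mult (\<lambda>w. if w ! p = Single then web.lv w p else 0)"
  "k < length s \<Longrightarrow> 1 \<le> d \<Longrightarrow> d \<le> s ! k \<Longrightarrow> web_act s n (WEl k d) = op_mult (\<lambda>w. esym (block s k) d)"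
  "Suc p < length s + n \<Longrightarrow> web_act s n (WPsi p) = web.op_psi s p"
  by (simp_all add: web_act_def)

lemma length_Seqs: "w \<in> Seqs m n \<Longrightarrow> length w = m + n"
proof -
  assume w: "w \<in> Seqs m n"
  have "length (filter (\<lambda>a. a \<noteq> Single) w) = m" using w by (simp add: Seqs_def)
  moreover have "length (filter (\<lambda>a. a = Single) w) = n"
  proof -
    have "(=) Single = (\<lambda>a. a = Single)" by auto
    then show ?thesis using w by (simp add: Seqs_def count_list_eq_length_filter)
  qed
  ultimately show ?thesis using sum_length_filter_compl[of "\<lambda>a. a = Single" w] by simp
qed

lemma Multi_in_Seqs: "w \<in> Seqs m n \<Longrightarrow> Multi k \<in> set w \<Longrightarrow> k < m"
proof -
  assume w: "w \<in> Seqs m n" "Multi k \<in> set w"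
  then have "Multi k \<in> set (filter (\<lambda>a. a \<noteq> Single) w)" by simp
  moreover have "filter (\<lambda>a. a \<noteq> Single) w = map Multi [0..<m]" using w(1) by (simp add: Seqs_def)
  ultimately have "Multi k \<in> set (map Multi [0..<m])" by metis
  then show ?thesis by auto
qed

lemma finite_Seqs: "finite (Seqs m n)"
proof -
  have "Seqs m n \<subseteq> {w. set w \<subseteq> insert Single (Multi ` {..<m}) \<and> length w = m + n}"
  proof
    fix w assume w: "w \<in> Seqs m n"
    have "a \<in> insert Single (Multi ` {..<m})" if "a \<in> set w" for a
      using Multi_in_Seqs[OF w] that by (cases a) auto
    then show "w \<in> {w. set w \<subseteq> insert Single (Multi ` {..<m}) \<and> length w = m + n}"
      using length_Seqs[OF w] by auto
  qed
  then show ?thesis by (rule finite_subset) (simp add: finite_lists_length_eq)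
qed

lemma swap_at_Seqs:
  assumes "w \<in> Seqs m n" "Suc p < m + n" "w ! p = Single \<or> w ! Suc p = Single"
  shows "swap_at p w \<in> Seqs m n"
proof -
  have "Suc p < length w" using assms length_Seqs by simp
  then obtain A x y B where w: "w = A @ x # y # B" "length A = p" by (rule split_at2)
  then have "x = Single \<or> y = Single" using assms(3) by (auto simp: nth_append)
  moreover have "swap_at p w = A @ y # x # B" using w swap_at_append[of A x y B] by simp
  ultimately show ?thesis using assms(1) w by (auto simp: Seqs_def)
qed

text \<open>A crossing can leave \<open>Seqs\<close> only by exchanging two different red strands,
  and then its factor is 0.\<close>

lemma supported_web_act:
  assumes v: "supported (Seqs (length s) n) v"
  shows "supported (Seqs (length s) n) (app (web_act s n g) v)"
proof (cases g)
  case (WPsi p)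
  have "web.dpsi s (swap_at p c) p (v (swap_at p c)) = 0"
    if c: "c \<notin> Seqs (length s) n" "Suc p < length c" "Suc p < length s + n" for c
  proof (cases "swap_at p c \<in> Seqs (length s) n")
    case True
    then have "swap_at p (swap_at p c) \<notin> Seqs (length s) n" using c by simp
    then have "swap_at p c ! p \<noteq> Single" "swap_at p c ! Suc p \<noteq> Single"
      using swap_at_Seqs[OF True c(3)] by auto
    moreover have "swap_at p c ! p \<noteq> swap_at p c ! Suc p"
      using c swap_at_same[of p "swap_at p c"] True by auto
    ultimately show ?thesis
      by (auto simp: web.dpsi_def web_kap_def split: strand.splits)
  qed (use v in \<open>simp add: supported_def\<close>)
  then show ?thesis
    using v WPsi by (auto simp: supported_def web_act_def web.app_op_psi)
qed (use v in \<open>auto simp: supported_def web_act_def app_op_proj app_op_mult vsingle_def\<close>)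

lemma op_mult_power: "app (op_mult \<zeta> ^ d) (vsingle c f) = vsingle c (\<zeta> c ^ d * f)"
  by (induction d arbitrary: f) (auto simp: power_Suc2 mult_ac simp del: power_Suc)

lemma neg_one_power: "app ((- 1) ^ d) (vsingle c f) = vsingle c ((- 1) ^ d * f)"
  by (induction d arbitrary: f) (auto simp: power_Suc2 app_0 vsingle_uminus simp del: power_Suc)

lemma web_E_acts:
  assumes "k < length s" "d \<le> s ! k"
  shows "app (web_rep s n (web_E k d)) (vsingle c f) = vsingle c (esym (block s k) d * f)"
  using assms by (auto simp: web_E_def oprep_hom oprep_gen web_act_simps)

lemma web_E_carrier: "k < length s \<Longrightarrow> d \<le> s ! k \<Longrightarrow> web_E k d \<in> fcarrier (web_gens s n)"
  by (auto simp: web_E_def web_gens_def)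

lemma distinct_reds:
  assumes "w \<in> Seqs m n" "Suc p < m + n" "w ! p = Multi k"
  shows "w ! Suc p \<noteq> Multi k"
proof
  assume k: "w ! Suc p = Multi k"
  have "Suc p < length w" using assms length_Seqs by simp
  then obtain A x y B where w: "w = A @ x # y # B" "length A = p" by (rule split_at2)
  then have "x = Multi k" "y = Multi k" using assms(3) k by (auto simp: nth_append)
  then have "\<not> distinct (filter (\<lambda>a. a \<noteq> Single) w)" using w by simp
  then show False using assms(1) by (simp add: Seqs_def distinct_map inj_on_def)
qed

lemma vsingle_sum: "vsingle c (\<Sum>i\<in>A. f i) = (\<lambda>d. \<Sum>i\<in>A. vsingle c (f i) d)"
  by (auto simp: vsingle_def)

lemma web_swp_esym: "swp (web_lab a i) (web_lab b j) (esym A d) = (esym A d :: 'k::field rf)"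
  by (rule rf_perm_esym[where h = id]) (auto simp: transpose_def)

lemma web_dpsi_esym: "web.dpsi s c p (esym A d * f) = esym A d * web.dpsi s c p (f :: 'k::field rf)"
  unfolding web.dpsi_def web.lam_def by (simp add: dd_sym_mult[OF web_swp_esym] mult.left_commute)

lemma web_presentation: "presentation (web_gens s n) (web_rel s n :: ('k::field, web_gen) free_alg \<Rightarrow> _)"
proof
  fix a b :: "('k, web_gen) free_alg" assume r: "web_rel s n a b"
  have red: "k < length s" if "w \<in> Seqs (length s) n" "w ! p = Multi k" "p < length s + n" for w p k
    using Multi_in_Seqs[OF that(1)] length_Seqs[OF that(1)] that by (metis nth_mem)
  have gens: "w \<in> Seqs (length s) n \<Longrightarrow> WE w \<in> web_gens s n" "p < length s + n \<Longrightarrow> WY p \<in> web_gens s n"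
    "Suc p < length s + n \<Longrightarrow> WPsi p \<in> web_gens s n" for w p by (auto simp: web_gens_def)
  note [intro!] = fcarrier_mult fcarrier_minus fcarrier_add fcarrier_uminus fcarrier_sum fcarrier_power
    fcarrier_fgen web_E_carrier gens
  show "a \<in> fcarrier (web_gens s n) \<and> b \<in> fcarrier (web_gens s n)"
    using r by cases (auto simp: swap_at_Seqs dest: red)
qed

global_interpretation web_pres: presentation "web_gens s n" "web_rel s n :: ('k::field, web_gen) free_alg \<Rightarrow> _" for s n
  by (rule web_presentation)

lemma web_kap_products:
  "web_kap s Single (Multi k) x y * web_kap s (Multi k) Single y x = qpoly (block s k) x"
  "web_kap s (Multi k) Single x y * web_kap s Single (Multi k) y x = qpoly (block s k) y"
  "web_kap s (Multi k) (Multi l) x y = 0"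
  by (simp_all add: web_kap_def)

lemma web_rel_kills:
  assumes "web_rel s n a b" "d \<in> Seqs (length s) n"
  shows "app (web_rep s n a) (vsingle d f) = app (web_rep s n b) (vsingle d (f :: 'k::field rf))"
proof -
  have len: "length d = length s + n" using length_Seqs[OF assms(2)] .
  have red: "k < length s" if "d ! p = Multi k" "p < length s + n" for p k
    using Multi_in_Seqs[OF assms(2)] len that by (metis nth_mem)
  note ops = oprep_hom oprep_gen web_act_simps app_0 web.app_op_psi_vsingle assms(2)
  show ?thesis
    using assms(1)
  proof cases
    case unit
    have "(\<Sum>c\<in>Seqs (length s) n. app (op_proj c) (vsingle d f) x) = vsingle d f x" for x
    proof -
      have "(\<Sum>c\<in>Seqs (length s) n. app (op_proj c) (vsingle d f) x) = (\<Sum>c\<in>Seqs (length s) n. if c = d then vsingle d f x else 0)"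
        by (intro sum.cong) auto
      then show ?thesis using assms(2) finite_Seqs by (simp add: sum.delta)
    qed
    then show ?thesis by (simp add: unit ops app_sum)
  next
    case (e_e w w')
    then show ?thesis by (simp add: ops)
  next
    case (y_e w p)
    then show ?thesis by (simp add: ops)
  next
    case (E_e w k d')
    then show ?thesis by (simp add: ops web_E_acts)
  next
    case (y_y p q)
    then show ?thesis by (simp add: ops mult.left_commute)
  next
    case (y_E p k d')
    then show ?thesis by (simp add: ops web_E_acts mult.left_commute)
  next
    case (E_E k d1 l d2)
    then show ?thesis by (simp add: ops web_E_acts mult.left_commute)
  next
    case (y_red w p k)
    then show ?thesis by (auto simp: ops)
  next
    case (psi_red_red w p k l)
    have "k \<noteq> l" using distinct_reds[OF psi_red_red(3-5)] psi_red_red(6) by auto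
    then show ?thesis using psi_red_red len
      by (cases "w = d") (simp_all add: ops web.dpsi_def web_kap_def)
  next
    case (psi_e w p)
    have "swap_at p w = swap_at p d \<longleftrightarrow> w = d"
      using psi_e len length_Seqs by (metis swap_at_swap_at)
    then show ?thesis using psi_e len assms(2) by (simp add: ops swap_at_Seqs)
  next
    case (psi_y p q)
    have "swap_at p d ! q = d ! q" using psi_y len by (simp add: nth_swap_at transpose_def)
    then show ?thesis using psi_y len by (simp add: ops web.dpsi_var_far web.lam_swap_at_far)
  next
    case (psi_psi p q)
    then show ?thesis using len web.dpsi_far[of p q d s f] web.dpsi_far[of q p d s f]
        swap_at_commute[of p q d] swap_at_commute[of q p d]
      by (auto simp: ops)
  next
    case (psi_E p k d')
    have "web.dpsi s d p (esym (block s k) d' * f) = esym (block s k) d' * web.dpsi s d p f"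
      by (rule web_dpsi_esym)
    then show ?thesis using psi_E len by (simp add: ops web_E_acts)
  next
    case (black1 w p)
    show ?thesis
    proof (cases "w = d")
      case True
      have "web.lam d p \<noteq> web.lam d (Suc p)" using black1 len by (simp add: web.lam_inj)
      note sl = web.dd_slide(1)[OF this, of f]
      show ?thesis using black1 True sl len
        by (simp add: ops swap_at_same web.dpsi_def mult.left_commute flip: vsingle_minus)
    qed (use black1 in \<open>simp add: ops\<close>)
  next
    case (black2 w p)
    show ?thesis
    proof (cases "w = d")
      case True
      have "web.lam d p \<noteq> web.lam d (Suc p)" using black2 len by (simp add: web.lam_inj)
      note sl = web.dd_slide(2)[OF this, of f]
      show ?thesis using black2 True sl len
        by (simp add: ops swap_at_same web.dpsi_def mult.left_commute flip: vsingle_minus)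
    qed (use black2 in \<open>simp add: ops\<close>)
  next
    case (black_quad w p)
    then show ?thesis using len by (cases "w = d") (simp_all add: ops power2_eq_square web.dpsi_quad)
  next
    case (mixed1 w p)
    then have "w ! p \<noteq> w ! Suc p" by auto
    then show ?thesis using mixed1 len
      by (cases "w = d") (auto simp: ops web.dpsi_def nth_swap_at web.lam_swap_at mult.left_commute)
  next
    case (mixed2 w p)
    then have "w ! p \<noteq> w ! Suc p" by auto
    then show ?thesis using mixed2 len
      by (cases "w = d") (auto simp: ops web.dpsi_def nth_swap_at web.lam_swap_at mult.left_commute)
  next
    case (black_red_quad w p k)
    show ?thesis
    proof (cases "w = d")
      case True
      have k: "k < length s" using red black_red_quad True by simp
      let ?y = "web.lv d p :: 'k rf"
      have "app (web_rep s n b) (vsingle d f) = vsingle d ((\<Sum>(d1, d2) \<in> {(d1, d2). d1 + d2 = s ! k}.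
          (- 1) ^ d2 * ?y ^ d1 * esym (block s k) d2) * f)"
        unfolding black_red_quad(2) using black_red_quad True k assms(2)
        by (auto simp: ops oprep_power app_sum vsingle_sum sum_distrib_right split_def web_E_acts op_mult_power neg_one_power mult.assoc fun_eq_iff
            intro!: sum.cong)
      also have "(\<Sum>(d1, d2) \<in> {(d1, d2). d1 + d2 = s ! k}. (- 1) ^ d2 * ?y ^ d1 * esym (block s k) d2)
          = qpoly (block s k) ?y"
        by (simp add: sum_pairs_eq(1) qpoly_expand mult_ac)
      finally show ?thesis
        using black_red_quad True len
        by (simp add: ops power2_eq_square web.dpsi_quad web_kap_products)
    qed (use black_red_quad in \<open>simp add: ops power2_eq_square app_sum split_def\<close>)
  next
    case (red_black_quad w p k)
    show ?thesis
    proof (cases "w = d")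
      case True
      have k: "k < length s" using red red_black_quad True by simp
      let ?y = "web.lv d (Suc p) :: 'k rf"
      have "app (web_rep s n b) (vsingle d f) = vsingle d ((\<Sum>(d1, d2) \<in> {(d1, d2). d1 + d2 = s ! k}.
          (- 1) ^ d1 * esym (block s k) d1 * ?y ^ d2) * f)"
        unfolding red_black_quad(2) using red_black_quad True k assms(2)
        by (auto simp: ops oprep_power app_sum vsingle_sum sum_distrib_right split_def web_E_acts op_mult_power neg_one_power mult.assoc fun_eq_iff
            intro!: sum.cong)
      also have "(\<Sum>(d1, d2) \<in> {(d1, d2). d1 + d2 = s ! k}. (- 1) ^ d1 * esym (block s k) d1 * ?y ^ d2)
          = qpoly (block s k) ?y"
        by (simp add: sum_pairs_eq(2) qpoly_expand)
      finally show ?thesis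
        using red_black_quad True len
        by (simp add: ops power2_eq_square web.dpsi_quad web_kap_products)
    qed (use red_black_quad in \<open>simp add: ops power2_eq_square app_sum split_def\<close>)
  next
    case (braid_black_red_black w p k)
    show ?thesis
    proof (cases "w = d")
      case True
      have k: "k < length s" using red braid_black_red_black True by simp
      let ?x = "web.lv d p :: 'k rf" and ?w = "web.lv d (Suc (Suc p)) :: 'k rf"
      have ne: "?x \<noteq> ?w" using braid_black_red_black True len by (simp add: web.lam_inj)
      have "app (web_rep s n b) (vsingle d f) = vsingle d ((\<Sum>(a, b, c) \<in> {(a, b, c). a + b + c + 1 = s ! k}.
          (- 1) ^ c * ?x ^ a * esym (block s k) c * ?w ^ b) * f)"
        unfolding braid_black_red_black(2) using braid_black_red_black True k assms(2)
        by (auto simp: ops oprep_power app_sum vsingle_sum sum_distrib_right split_def web_E_acts op_mult_power neg_one_power mult.assoc fun_eq_iff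
            intro!: sum.cong)
      also have "(\<Sum>(a, b, c) \<in> {(a, b, c). a + b + c + 1 = s ! k}. (- 1) ^ c * ?x ^ a * esym (block s k) c * ?w ^ b)
          = (qpoly (block s k) ?x - qpoly (block s k) ?w) / (?x - ?w)"
        using qpoly_difference[OF _ ne, of "block s k"] by simp
      finally have rhs: "app (web_rep s n b) (vsingle d f) =
        vsingle d ((qpoly (block s k) ?x - qpoly (block s k) ?w) / (?x - ?w) * f)" .
      have sd: "swap_at p (swap_at (Suc p) (swap_at p d)) = d"
        using braid_black_red_black True len by (simp add: list_eq_iff_nth_eq nth_swap_at transpose_def)
      show ?thesis
        unfolding rhs
        using braid_black_red_black True len web.dpsi_braid[of p d s f] swap_at_braid[of p d] sd
        by (simp add: ops web_kap_products flip: vsingle_minus)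
    qed (use braid_black_red_black in \<open>simp add: ops app_sum split_def\<close>)
  next
    case (braid_zero w p)
    show ?thesis
    proof (cases "w = d")
      case True
      \<comment> \<open>Equal outer strands around a different middle one would have to be red here,
        which exceeds the allowed number of red strands. So the error term in
        \<open>dpsi_braid\<close> is zero.\<close>
      have "d ! p = d ! Suc (Suc p) \<and> d ! p \<noteq> d ! Suc p \<Longrightarrow> False"
      proof -
        assume a: "d ! p = d ! Suc (Suc p) \<and> d ! p \<noteq> d ! Suc p"
        then have "d ! p \<noteq> Single" using braid_zero(6) True by metis
        then have "{p, Suc (Suc p)} \<subseteq> {q \<in> {p, Suc p, Suc (Suc p)}. d ! q \<noteq> Single}" using a by auto
        then have "card {p, Suc (Suc p)} \<le> card {q \<in> {p, Suc p, Suc (Suc p)}. d ! q \<noteq> Single}"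
          by (intro card_mono) auto
        then show False using braid_zero(5) True by simp
      qed
      then show ?thesis
        using braid_zero True len web.dpsi_braid[of p d s f] swap_at_braid[of p d]
        by (auto simp: ops simp flip: vsingle_minus split: if_splits)
    qed (use braid_zero in \<open>simp add: ops\<close>)
  qed
qed

section \<open>Leading monomials of the polynomial generators of the Webster algebra\<close>

definition esym_poly :: "nat set \<Rightarrow> nat \<Rightarrow> 'k::field mpoly" where
  "esym_poly A d = (\<Sum>U | U \<subseteq> A \<and> card U = d.
    Poly_Mapping.single (\<Sum>t\<in>U. Poly_Mapping.single (xv t) 1) 1)"

lemma rf_poly_esym_poly: "finite A \<Longrightarrow> rf_poly (esym_poly A d) = esym A d"
proof -
  assume "finite A"
  have "(Poly_Mapping.single (\<Sum>t\<in>U. Poly_Mapping.single (xv t) 1) 1 :: 'a mpoly)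
    = (\<Prod>t\<in>U. Poly_Mapping.single (Poly_Mapping.single (xv t) 1) 1)" for U
    by (induction U rule: infinite_finite_induct) (auto simp: mult_single[of _ "1 :: 'a" _ 1, simplified, symmetric])
  then show ?thesis by (simp add: esym_poly_def esym_def rf_poly_sum rf_poly_prod rf_var_def)
qed

lemma lookup_xv_sum:
  assumes "finite U"
  shows "Poly_Mapping.lookup (\<Sum>t\<in>U. Poly_Mapping.single (xv t) (1::nat)) v = (if \<exists>t\<in>U. v = xv t then 1 else 0)"
proof -
  have "Poly_Mapping.lookup (\<Sum>t\<in>U. Poly_Mapping.single (xv t) (1::nat)) v = (\<Sum>t\<in>U. if v = xv t then 1 else 0)"
    by (auto simp: lookup_sum lookup_single when_def intro!: sum.cong)
  also have "\<dots> = (if \<exists>t\<in>U. v = xv t then 1 else 0)"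
  proof (cases "\<exists>t\<in>U. v = xv t")
    case True
    then obtain u where u: "u \<in> U" "v = xv u" by blast
    then have "(\<Sum>t\<in>U. if v = xv t then 1 else 0) = (\<Sum>t\<in>U. if t = u then 1 else (0::nat))"
      by (intro sum.cong) auto
    then show ?thesis using u assms by auto
  qed auto
  finally show ?thesis .
qed

lemma keys_sum_mem: "\<beta> \<in> Poly_Mapping.keys (\<Sum>i\<in>A. f i) \<Longrightarrow> \<exists>i\<in>A. \<beta> \<in> Poly_Mapping.keys (f i)"
  by (auto simp: in_keys_iff lookup_sum intro: ccontr dest: sum.neutral)

text \<open>The least element of the initial segment missing from \<open>U\<close> is the first
  index at which the exponents differ: below it the two sets agree.\<close>

lemma initial_segment_greatest:
  assumes "U \<subseteq> {a..<a + m}" "card U = d" "U \<noteq> {a..<a + d}"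
  shows "(\<Sum>t\<in>U. Poly_Mapping.single (xv t) (1::nat)) < (\<Sum>t\<in>{a..<a + d}. Poly_Mapping.single (xv t) 1)"
proof -
  have fin: "finite U" using assms(1) finite_subset by blast
  have "\<not> {a..<a + d} \<subseteq> U"
    using card_subset_eq[OF fin, of "{a..<a + d}"] assms(2,3) by auto
  then have ne: "{a..<a + d} - U \<noteq> {}" by blast
  define k where "k = Min ({a..<a + d} - U)"
  have k: "k \<in> {a..<a + d} - U" unfolding k_def using Min_in[of "{a..<a + d} - U"] ne by blast
  have least: "j \<in> U" if "j \<in> {a..<a + d}" "j < k" for j
  proof (rule ccontr)
    assume "j \<notin> U"
    then have "k \<le> j" unfolding k_def using that by (intro Min_le) auto
    then show False using that by simp
  qed
  have "less_fun (Poly_Mapping.lookup (\<Sum>t\<in>U. Poly_Mapping.single (xv t) (1::nat)))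
    (Poly_Mapping.lookup (\<Sum>t\<in>{a..<a + d}. Poly_Mapping.single (xv t) 1))"
  proof (rule less_funI, intro exI[of _ "xv k"] conjI allI impI)
    show "Poly_Mapping.lookup (\<Sum>t\<in>U. Poly_Mapping.single (xv t) (1::nat)) (xv k)
      < Poly_Mapping.lookup (\<Sum>t\<in>{a..<a + d}. Poly_Mapping.single (xv t) 1) (xv k)"
      unfolding lookup_xv_sum[OF fin] lookup_xv_sum[OF finite_atLeastLessThan] using k by auto
    fix v assume v: "v < xv k"
    have "(\<exists>t\<in>U. v = xv t) \<longleftrightarrow> (\<exists>t\<in>{a..<a + d}. v = xv t)"
      using v k least assms(1) by (auto simp: subset_iff)
    then show "Poly_Mapping.lookup (\<Sum>t\<in>U. Poly_Mapping.single (xv t) (1::nat)) v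
      = Poly_Mapping.lookup (\<Sum>t\<in>{a..<a + d}. Poly_Mapping.single (xv t) 1) v"
      unfolding lookup_xv_sum[OF fin] lookup_xv_sum[OF finite_atLeastLessThan] by simp
  qed
  then show ?thesis by (simp add: less_poly_mapping.rep_eq)
qed

lemma has_lead_esym_poly:
  assumes "d \<le> m"
  shows "has_lead (esym_poly {a..<a + m} d) (\<Sum>t\<in>{a..<a + d}. Poly_Mapping.single (xv t) 1)"
proof -
  let ?P = "\<lambda>U. Poly_Mapping.single (\<Sum>t\<in>U. Poly_Mapping.single (xv t) (1::nat)) (1 :: 'a)"
  let ?S = "{U. U \<subseteq> {a..<a + m} \<and> card U = d}"
  have fin: "finite ?S" by (rule finite_subset[of _ "Pow {a..<a + m}"]) auto
  have "{a..<a + d} \<in> ?S" using assms by auto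
  then have "esym_poly {a..<a + m} d = ?P {a..<a + d} + (\<Sum>U\<in>?S - {{a..<a + d}}. ?P U)"
    unfolding esym_poly_def by (intro sum.remove[OF fin])
  then have e: "esym_poly {a..<a + m} d - ?P {a..<a + d} = (\<Sum>U\<in>?S - {{a..<a + d}}. ?P U)" by simp
  show ?thesis
    unfolding has_lead_def e
  proof
    fix \<beta> assume "\<beta> \<in> Poly_Mapping.keys (\<Sum>U\<in>?S - {{a..<a + d}}. ?P U)"
    from keys_sum_mem[OF this] obtain U where U: "U \<in> ?S - {{a..<a + d}}" "\<beta> \<in> Poly_Mapping.keys (?P U)" ..
    then have "\<beta> = (\<Sum>t\<in>U. Poly_Mapping.single (xv t) 1)" by simp
    then show "\<beta> < (\<Sum>t\<in>{a..<a + d}. Poly_Mapping.single (xv t) 1)"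
      using initial_segment_greatest[of U a m d] U(1) by blast
  qed
qed

definition web_vars :: "nat list \<Rightarrow> nat \<Rightarrow> web_gen set" where
  "web_vars s n = {WY p | p. p < length s + n} \<union> {WEl k d | k d. k < length s \<and> 1 \<le> d \<and> d \<le> s ! k}"

definition web_lead :: "nat list \<Rightarrow> strand list \<Rightarrow> web_gen \<Rightarrow> nat \<Rightarrow>\<^sub>0 nat" where
  "web_lead s c g = (case g of
      WY p \<Rightarrow> Poly_Mapping.single (web.lam c p) 1
    | WEl k d \<Rightarrow> \<Sum>t\<in>{offset s k..<offset s k + d}. Poly_Mapping.single (xv t) 1
    | _ \<Rightarrow> 0)"

text \<open>The exponent of the variable at place \<open>i\<close> of block \<open>k\<close> counts
  the letters \<open>WEl k d\<close> with \<open>i < d\<close>, so consecutive counts differ by the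
  multiplicity of \<open>WEl k (Suc i)\<close>. Disjoint blocks do not interfere, and the dots are
  read off from the black variables.\<close>

lemma web_lead_inj:
  assumes c: "length c = length s + n"
  defines "Zg \<equiv> {WY p | p. p < length s + n \<and> c ! p = Single} \<union> {WEl k d | k d. k < length s \<and> 1 \<le> d \<and> d \<le> s ! k}"
  assumes l: "set l \<subseteq> Zg" "set l' \<subseteq> Zg" and eq: "sum_list (map (web_lead s c) l) = sum_list (map (web_lead s c) l')"
  shows "mset l = mset l'"
proof (rule multiset_eqI)
  have lamY: "\<exists>i. web.lam c p = yv i" if "c ! p = Single" for c :: "strand list" and p
    using that by (simp add: web.lam_def)
  have cntY: "Poly_Mapping.lookup (sum_list (map (web_lead s c) l)) (web.lam c p) = count (mset l) (WY p)"
    if "set l \<subseteq> Zg" "p < length s + n" "c ! p = Single" for l p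
    using that(1)
  proof (induction l)
    case (Cons g l)
    have "Poly_Mapping.lookup (web_lead s c g) (web.lam c p) = (if g = WY p then 1 else 0)"
    proof -
      obtain i where i: "web.lam c p = yv i" using lamY by (metis \<open>c ! p = Single\<close>)
      have ne: "yv i \<noteq> xv t" for t by presburger
      from Cons.prems have "g \<in> Zg" by simp
      then consider q where "g = WY q" "q < length s + n" | k d where "g = WEl k d" by (auto simp: Zg_def)
      then show ?thesis
      proof cases
        case 1
        then show ?thesis using that(2,3) assms(1) by (auto simp: web_lead_def lookup_single when_def web.lam_inj)
      next
        case 2
        then show ?thesis using i ne by (simp add: web_lead_def lookup_xv_sum[simplified])
      qed
    qed
    then show ?case using Cons by (simp add: lookup_add)
  qed simp
  define cE where "cE l k i = length (filter (\<lambda>g. \<exists>d. g = WEl k d \<and> i < d) l)" for l k i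
  have cntE: "Poly_Mapping.lookup (sum_list (map (web_lead s c) l)) (xv (offset s k + i)) = cE l k i"
    if "set l \<subseteq> Zg" "k < length s" "i < s ! k" for l k i
    using that(1)
  proof (induction l)
    case (Cons g l)
    have "Poly_Mapping.lookup (web_lead s c g) (xv (offset s k + i)) = (if \<exists>d. g = WEl k d \<and> i < d then 1 else 0)"
    proof -
      from Cons.prems have "g \<in> Zg" by simp
      then consider q where "g = WY q" "c ! q = Single" | k' d where "g = WEl k' d" "k' < length s" "d \<le> s ! k'"
        by (auto simp: Zg_def)
      then show ?thesis
      proof cases
        case 1
        obtain j where j: "web.lam c q = yv j" using lamY[OF 1(2)] by blast
        have "yv j \<noteq> xv (offset s k + i)" by presburger
        then show ?thesis using 1 j by (simp add: web_lead_def lookup_single when_def)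
      next
        case 2
        have "k' = k" if "offset s k + i \<in> {offset s k'..<offset s k' + d}"
        proof (rule ccontr)
          assume "k' \<noteq> k"
          then have "block s k' \<inter> block s k = {}" using block_disjoint 2 \<open>k < length s\<close> by blast
          moreover have "offset s k + i \<in> block s k' \<inter> block s k" using that 2 \<open>i < s ! k\<close> by auto
          ultimately show False by blast
        qed
        moreover have "(\<exists>t\<in>A. 3 * offset s k + 3 * i = 3 * t) \<longleftrightarrow> offset s k + i \<in> A" for A
        proof -
          have "3 * offset s k + 3 * i = 3 * t \<longleftrightarrow> offset s k + i = t" for t by presburger
          then show ?thesis by simp
        qed
        ultimately show ?thesis using 2
          by (auto simp: web_lead_def lookup_xv_sum[simplified])
      qed
    qed
    then show ?case using Cons by (simp add: lookup_add cE_def)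
  qed (simp add: cE_def)
  have cE_step: "cE l k i = cE l k (Suc i) + count (mset l) (WEl k (Suc i))" for l k i
  proof (induction l)
    case (Cons g l)
    have "(\<exists>d. g = WEl k d \<and> i < d) \<longleftrightarrow> (\<exists>d. g = WEl k d \<and> Suc i < d) \<or> g = WEl k (Suc i)"
      using less_Suc_eq by (metis Suc_lessD Suc_lessI lessI)
    then show ?case using Cons by (auto simp: cE_def)
  qed (simp add: cE_def)
  have cE_top: "cE l k (s ! k) = 0" if "set l \<subseteq> Zg" for l k
    using that by (induction l) (auto simp: cE_def Zg_def)
  have cE_eq: "cE l k i = cE l' k i" if "k < length s" "i \<le> s ! k" for k i
    using that cntE[OF l(1), of k i] cntE[OF l(2), of k i] cE_top[OF l(1)] cE_top[OF l(2)] eq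
    by (cases "i = s ! k") auto
  fix g
  show "count (mset l) g = count (mset l') g"
  proof (cases "g \<in> Zg")
    case True
    then consider p where "g = WY p" "p < length s + n" "c ! p = Single"
      | k d where "g = WEl k d" "k < length s" "1 \<le> d" "d \<le> s ! k" by (auto simp: Zg_def)
    then show ?thesis
    proof cases
      case 1
      then show ?thesis using cntY[OF l(1)] cntY[OF l(2)] eq by metis
    next
      case 2
      then obtain i where i: "d = Suc i" by (cases d) auto
      show ?thesis using cE_step[of l k i] cE_step[of l' k i] cE_eq[of k i] cE_eq[of k d] 2 i by simp
    qed
  next
    case False
    then show ?thesis using l by (metis count_mset_0_iff subsetD)
  qed
qed

lemma web_J_kills: "web_pres.J s n \<subseteq> killing (Seqs (length s) n) (web_act s n :: _ \<Rightarrow> (_, 'k::field) oper)"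
proof (rule web_pres.J_least)
  show "tsi (killing (Seqs (length s) n) (web_act s n :: _ \<Rightarrow> (_, 'k) oper))"
    by (rule tsi_killing[OF finite_Seqs supported_web_act])
  show "a - b \<in> killing (Seqs (length s) n) (web_act s n :: _ \<Rightarrow> (_, 'k) oper)" if "web_rel s n a b" for a b
    using web_rel_kills[OF that] by (simp add: killing_def oprep_hom)
  show "fgen g \<in> killing (Seqs (length s) n) (web_act s n :: _ \<Rightarrow> (_, 'k) oper)" if "g \<notin> web_gens s n" for g
    using that by (cases g) (auto simp: killing_def oprep_gen web_act_def web_gens_def)
qed

text \<open>The polynomial generators already have the type of generators, so \<open>Z\<close> is
  the identity on \<open>web_vars\<close>. The relations that \<open>diagram_algebra\<close> asks
  for where two red strands cross are derived from \<open>psi_red_red\<close>.\<close>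

lemma web_faithful_rep:
  "faithful_rep (web_pres.J s n) (length s + n) (Seqs (length s) n) WE (\<lambda>g. g) (web_vars s n) WPsi
    (\<lambda>w p. w ! p = Single \<or> w ! Suc p = Single) web_lab
    (web_kap s :: _ \<Rightarrow> _ \<Rightarrow> 'k::field rf \<Rightarrow> _)
    (\<lambda>w g. case g of WY p \<Rightarrow> if w ! p = Single then web.lv w p else 0 | WEl k d \<Rightarrow> esym (block s k) d | _ \<Rightarrow> 0)
    (web_act s n)"
proof
  let ?J = "web_pres.J s n :: ('k, web_gen) free_alg set" and ?S = "Seqs (length s) n" and ?r = "length s + n"
  let ?Zg = "\<lambda>c. {WY p | p. p < ?r \<and> c ! p = Single} \<union> {WEl k d | k d. k < length s \<and> 1 \<le> d \<and> d \<le> s ! k}"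
  have R: "web_rel s n a b \<Longrightarrow> a - b \<in> ?J" for a b by (rule web_pres.J_rel)
  note J = web_pres.J
  have red: "k < length s" if "w \<in> ?S" "w ! p = Multi k" "p < ?r" for w p k
    using Multi_in_Seqs[OF that(1)] length_Seqs[OF that(1)] that by (metis nth_mem)
  have webE: "web_E k d = (fgen (WEl k d) :: ('k, web_gen) free_alg)" if "1 \<le> d" for k d
    using that by (simp add: web_E_def)
  have web_E_pol: "web_E k d \<in> fcarrier ((\<lambda>g. g) ` web_vars s n)" if "k < length s" "d \<le> s ! k" for k d
    using that by (auto simp: web_E_def web_vars_def)
  have Y_pol: "fgen (WY p) \<in> fcarrier ((\<lambda>g. g) ` web_vars s n)" if "p < ?r" for p
    using that by (auto simp: web_vars_def)
  show "tsi ?J" by (rule web_pres.tsi_J)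
  show "fgen g \<in> ?J" if "g \<notin> WE ` ?S \<union> (\<lambda>g. g) ` web_vars s n \<union> WPsi ` {p. Suc p < ?r}" for g
    by (rule web_pres.J_gen) (use that in \<open>auto simp: web_gens_def web_vars_def\<close>)
  show "finite ?S" by (rule finite_Seqs)
  show "length c = ?r" if "c \<in> ?S" for c using length_Seqs[OF that] .
  show "swap_at p c \<in> ?S" if "c \<in> ?S" "Suc p < ?r" "c ! p = Single \<or> c ! Suc p = Single" for c p
    using swap_at_Seqs that by blast
  show "(\<Sum>c\<in>?S. fgen (WE c)) - 1 \<in> ?J" by (rule R[OF web_rel.unit])
  show "fgen (WE c) * fgen (WE c') - (if c = c' then fgen (WE c) else 0) \<in> ?J"
    if "c \<in> ?S" "c' \<in> ?S" for c c'
    using that by (intro R web_rel.e_e)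
  show ze: "fgen t * fgen (WE c) - fgen (WE c) * fgen t \<in> ?J" if "c \<in> ?S" "t \<in> web_vars s n" for c t
  proof -
    have "fgen (WY p) * fgen (WE c) - fgen (WE c) * fgen (WY p) \<in> ?J" if "p < ?r" for p
      using R[OF web_rel.y_e[OF \<open>c \<in> ?S\<close> that]] .
    moreover have "fgen (WEl k d) * fgen (WE c) - fgen (WE c) * fgen (WEl k d) \<in> ?J"
      if "k < length s" "1 \<le> d" "d \<le> s ! k" for k d
      using R[OF web_rel.E_e[OF \<open>c \<in> ?S\<close> that]] webE[OF that(2)] by simp
    ultimately show ?thesis using that(2) unfolding web_vars_def by blast
  qed
  show zz: "fgen t * fgen t' - fgen t' * fgen t \<in> ?J" if "t \<in> web_vars s n" "t' \<in> web_vars s n" for t t'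
  proof -
    have yE: "fgen (WY p) * fgen (WEl k d) - fgen (WEl k d) * fgen (WY p) \<in> ?J"
      if "p < ?r" "k < length s" "1 \<le> d" "d \<le> s ! k" for p k d
      using R[OF web_rel.y_E[OF that]] webE[OF that(3)] by simp
    have Ey: "fgen (WEl k d) * fgen (WY p) - fgen (WY p) * fgen (WEl k d) \<in> ?J"
      if "p < ?r" "k < length s" "1 \<le> d" "d \<le> s ! k" for p k d
      using J(5)[OF yE[OF that]] by simp
    have EE: "fgen (WEl k d) * fgen (WEl l d') - fgen (WEl l d') * fgen (WEl k d) \<in> ?J"
      if "k < length s" "1 \<le> d" "d \<le> s ! k" "l < length s" "1 \<le> d'" "d' \<le> s ! l" for k d l d'
      using R[OF web_rel.E_E[OF that]] webE[OF that(2)] webE[OF that(5)] by simp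
    have yy: "fgen (WY p) * fgen (WY q) - fgen (WY q) * fgen (WY p) \<in> ?J" if "p < ?r" "q < ?r" for p q
      using R[OF web_rel.y_y[OF that]] .
    show ?thesis using that yy yE Ey EE unfolding web_vars_def by blast
  qed
  show "fgen (WPsi p) * fgen (WE c) - fgen (WE (swap_at p c)) * fgen (WPsi p) \<in> ?J"
    if "c \<in> ?S" "Suc p < ?r" "c ! p = Single \<or> c ! Suc p = Single" for c p
    using that by (intro R web_rel.psi_e)
  have rr: "fgen (WPsi p) * fgen (WE c) \<in> ?J"
    if c: "c \<in> ?S" "Suc p < ?r" and np: "\<not> (c ! p = Single \<or> c ! Suc p = Single)" for c p
  proof -
    obtain k l where "c ! p = Multi k" "c ! Suc p = Multi l" using np by (meson strand.exhaust)
    from R[OF web_rel.psi_red_red[OF c this]] show ?thesis by simp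
  qed
  then show "fgen (WPsi p) * fgen (WE c) \<in> ?J"
    if "c \<in> ?S" "Suc p < ?r" "\<not> (c ! p = Single \<or> c ! Suc p = Single)" for c p
    using that .

  show "\<exists>t'\<in>web_vars s n. \<exists>a. (fgen (WPsi p) * fgen t - fgen t' * fgen (WPsi p)) * fgen (WE c)
      - fscalar a * fgen (WE c) \<in> ?J"
    if c: "c \<in> ?S" and p: "Suc p < ?r" and t: "t \<in> web_vars s n" for c p t
  proof (cases "c ! p = Single \<or> c ! Suc p = Single")
    case False
    have 1: "fgen (WPsi p) * fgen (WE c) \<in> ?J" using rr[OF c p False] .
    \<comment> \<open>Between two red strands both products vanish on the idempotent, once
      \<open>t\<close> has been moved past it.\<close>
    have "fgen (WPsi p) * (fgen t * fgen (WE c) - fgen (WE c) * fgen t)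
      + (fgen (WPsi p) * fgen (WE c)) * fgen t - fgen t * (fgen (WPsi p) * fgen (WE c)) \<in> ?J"
      by (intro J(6) J(2) J(3)[OF ze[OF c t]] J(4)[OF 1] J(3)[OF 1])
    then show ?thesis
      using t by (intro bexI[of _ t] exI[of _ 0]) (auto simp: fscalar_hom algebra_simps)
  next
    case True
    have far: ?thesis if "fgen (WPsi p) * fgen t - fgen t * fgen (WPsi p) \<in> ?J"
      using J(4)[OF that, of "fgen (WE c)"] t by (intro bexI[of _ t] exI[of _ 0]) (auto simp: fscalar_hom)
    have vars: "WY p \<in> web_vars s n" "WY (Suc p) \<in> web_vars s n" using p by (auto simp: web_vars_def)
    have m1: "fscalar (- 1 :: 'k) = (- 1 :: ('k, web_gen) free_alg)"
      by (simp add: fscalar_def single_uminus)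
    consider "t = WY p" | "t = WY (Suc p)" | q where "t = WY q" "q < ?r" "q \<noteq> p" "q \<noteq> Suc p"
      | k d where "t = WEl k d" "k < length s" "1 \<le> d" "d \<le> s ! k" using t by (auto simp: web_vars_def)
    then show ?thesis
    proof cases
      case 1
      show ?thesis
      proof (cases "c ! p = Single \<and> c ! Suc p = Single")
        case True
        then show ?thesis using R[OF web_rel.black2[OF c p]] 1 vars
          by (intro bexI[of _ "WY (Suc p)"] exI[of _ 1]) (auto simp: fscalar_hom)
      next
        case False
        then have "(c ! p = Single) \<noteq> (c ! Suc p = Single)" using True by auto
        then show ?thesis using R[OF web_rel.mixed1[OF c p]] 1 vars
          by (intro bexI[of _ "WY (Suc p)"] exI[of _ 0]) (auto simp: fscalar_hom algebra_simps)
      qed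
    next
      case 2
      show ?thesis
      proof (cases "c ! p = Single \<and> c ! Suc p = Single")
        case True
        then show ?thesis using J(5)[OF R[OF web_rel.black1[OF c p]]] 2 vars
          by (intro bexI[of _ "WY p"] exI[of _ "- 1"]) (auto simp: m1 algebra_simps)
      next
        case False
        then have "(c ! p = Single) \<noteq> (c ! Suc p = Single)" using True by auto
        then show ?thesis using J(5)[OF R[OF web_rel.mixed2[OF c p]]] 2 vars
          by (intro bexI[of _ "WY p"] exI[of _ 0]) (auto simp: fscalar_hom algebra_simps)
      qed
    next
      case 3
      then show ?thesis using far R[OF web_rel.psi_y[OF p]] by simp
    next
      case 4
      then show ?thesis using far R[OF web_rel.psi_E[OF p 4(2-4)]] webE[OF 4(3)] by simp
    qed
  qed
  show "\<exists>q\<in>fcarrier ((\<lambda>g. g) ` web_vars s n). fgen (WPsi p) * fgen (WPsi p) * fgen (WE c) - q * fgen (WE c) \<in> ?J"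
    if c: "c \<in> ?S" and p: "Suc p < ?r" for c p
  proof -
    note pol [intro!] = fcarrier_sum fcarrier_mult fcarrier_power fcarrier_uminus fcarrier_1
    consider "c ! p = Single" "c ! Suc p = Single" | k where "c ! p = Single" "c ! Suc p = Multi k"
      | k where "c ! p = Multi k" "c ! Suc p = Single" | k l where "c ! p = Multi k" "c ! Suc p = Multi l"
      by (meson strand.exhaust)
    then show ?thesis
    proof cases
      case 1
      then show ?thesis using R[OF web_rel.black_quad[OF c p]] by (intro bexI[of _ 0]) (auto simp: power2_eq_square)
    next
      case 2
      then have k: "k < length s" using red[OF c 2(2) p] by simp
      show ?thesis
        using R[OF web_rel.black_red_quad[OF c p 2]] p k
        by (intro bexI[of _ "\<Sum>(d1, d2) \<in> {(d1, d2). d1 + d2 = s ! k}. (-1) ^ d2 * web_y p ^ d1 * web_E k d2"])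
          (auto simp: power2_eq_square sum_distrib_right split_def intro!: web_E_pol[unfolded image_ident] Y_pol[unfolded image_ident])
    next
      case 3
      then have k: "k < length s" using red[OF c 3(1)] p by simp
      show ?thesis
        using R[OF web_rel.red_black_quad[OF c p 3]] p k
        by (intro bexI[of _ "\<Sum>(d1, d2) \<in> {(d1, d2). d1 + d2 = s ! k}. (-1) ^ d1 * web_E k d1 * web_y (Suc p) ^ d2"])
          (auto simp: power2_eq_square sum_distrib_right split_def intro!: web_E_pol[unfolded image_ident] Y_pol[unfolded image_ident])
    next
      case 4
      then have "fgen (WPsi p) * fgen (WE c) \<in> ?J" using rr[OF c p] by simp
      from J(3)[OF this] show ?thesis by (intro bexI[of _ 0]) (auto simp: mult.assoc)
    qed
  qed
  show "(fgen (WPsi p) * fgen (WPsi q) - fgen (WPsi q) * fgen (WPsi p)) * fgen (WE c) \<in> ?J"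
    if "Suc q < ?r" "Suc p < q" for c p q
    using that by (intro J(4) R web_rel.psi_psi) auto
  show "\<exists>q\<in>fcarrier ((\<lambda>g. g) ` web_vars s n). (fgen (WPsi p) * fgen (WPsi (Suc p)) * fgen (WPsi p)
      - fgen (WPsi (Suc p)) * fgen (WPsi p) * fgen (WPsi (Suc p))) * fgen (WE c) - q * fgen (WE c) \<in> ?J"
    if c: "c \<in> ?S" and p: "Suc (Suc p) < ?r" for c p
  proof -
    note pol [intro!] = fcarrier_sum fcarrier_mult fcarrier_power fcarrier_uminus fcarrier_1
    let ?P = "Suc p" and ?Q = "Suc (Suc p)"
    have len: "length c = ?r" using length_Seqs[OF c] .
    have few: "card {q \<in> {p, ?P, ?Q}. c ! q \<noteq> Single} \<le> 1" if "{q \<in> {p, ?P, ?Q}. c ! q \<noteq> Single} \<subseteq> {t}" for t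
      using card_mono[OF _ that] by simp
    consider (mid) k where "c ! p = Single" "c ! ?P = Multi k" "c ! ?Q = Single"
      | (zero) "card {q \<in> {p, ?P, ?Q}. c ! q \<noteq> Single} \<le> 1"
          "\<not> (c ! p = Single \<and> c ! ?P \<noteq> Single \<and> c ! ?Q = Single)"
      | (many) "c ! p \<noteq> Single \<and> c ! ?P \<noteq> Single \<or> c ! p \<noteq> Single \<and> c ! ?Q \<noteq> Single
          \<or> c ! ?P \<noteq> Single \<and> c ! ?Q \<noteq> Single"
    proof (cases "c ! p \<noteq> Single \<and> c ! ?P \<noteq> Single \<or> c ! p \<noteq> Single \<and> c ! ?Q \<noteq> Single
          \<or> c ! ?P \<noteq> Single \<and> c ! ?Q \<noteq> Single")
      case False
      show ?thesis
      proof (cases "c ! p = Single \<and> c ! ?P \<noteq> Single \<and> c ! ?Q = Single")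
        case True
        then show ?thesis using mid by (metis strand.exhaust)
      next
        case F: False
        have "\<exists>t. {q \<in> {p, ?P, ?Q}. c ! q \<noteq> Single} \<subseteq> {t}" using False by blast
        then show ?thesis using zero F few by blast
      qed
    qed (use many in blast)
    then show ?thesis
    proof cases
      case mid
      then have k: "k < length s" using red[OF c mid(2)] p by simp
      show ?thesis
        using R[OF web_rel.braid_black_red_black[OF c p mid]] p k
        by (intro bexI[of _ "\<Sum>(a, b, d) \<in> {(a, b, d). a + b + d + 1 = s ! k}.
              (-1) ^ d * web_y p ^ a * web_E k d * web_y ?Q ^ b"])
          (auto simp: sum_distrib_right split_def intro!: web_E_pol[unfolded image_ident] Y_pol[unfolded image_ident])
    next
      case zero
      then show ?thesis using R[OF web_rel.braid_zero[OF c p zero]] by (intro bexI[of _ 0]) auto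
    next
      case many
      \<comment> \<open>With at least two red strands among three, each side of the braid relation
        crosses two red strands at some point and vanishes by itself. \<open>step\<close> follows
        the sequence through one crossing, or stops when that crossing is already zero.\<close>
      have step: "X * (fgen (WPsi j) * fgen (WE d)) \<in> ?J"
        if d: "d \<in> ?S" "Suc j < ?r"
          and X: "d ! j = Single \<or> d ! Suc j = Single \<Longrightarrow> swap_at j d \<in> ?S \<Longrightarrow> X * fgen (WE (swap_at j d)) \<in> ?J"
        for X :: "('k, web_gen) free_alg" and j d
      proof (cases "d ! j = Single \<or> d ! Suc j = Single")
        case True
        have "X * (fgen (WPsi j) * fgen (WE d) - fgen (WE (swap_at j d)) * fgen (WPsi j))
          + X * fgen (WE (swap_at j d)) * fgen (WPsi j) \<in> ?J"
          by (intro J(2) J(3)[OF R[OF web_rel.psi_e[OF d True]]] J(4)[OF X[OF True swap_at_Seqs[OF d True]]])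
        then show ?thesis by (simp add: algebra_simps)
      next
        case False
        then show ?thesis using rr[OF d] J(3) by blast
      qed
      have n1: "swap_at p c ! ?P = c ! p" "swap_at p c ! ?Q = c ! ?Q"
        "swap_at ?P (swap_at p c) ! p = c ! ?P" "swap_at ?P (swap_at p c) ! ?P = c ! ?Q"
        "swap_at ?P c ! p = c ! p" "swap_at ?P c ! ?P = c ! ?Q"
        "swap_at p (swap_at ?P c) ! ?P = c ! p" "swap_at p (swap_at ?P c) ! ?Q = c ! ?P"
        using p len by (simp_all add: nth_swap_at transpose_def)
      have "(fgen (WPsi p) * fgen (WPsi ?P)) * (fgen (WPsi p) * fgen (WE c)) \<in> ?J"
      proof (rule step[OF c])
        assume a: "c ! p = Single \<or> c ! ?P = Single" "swap_at p c \<in> ?S"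
        have "fgen (WPsi p) * (fgen (WPsi ?P) * fgen (WE (swap_at p c))) \<in> ?J"
        proof (rule step[OF a(2) p])
          assume b: "swap_at p c ! ?P = Single \<or> swap_at p c ! ?Q = Single" "swap_at ?P (swap_at p c) \<in> ?S"
          show "fgen (WPsi p) * fgen (WE (swap_at ?P (swap_at p c))) \<in> ?J"
            by (rule rr[OF b(2)]) (use many a b p in \<open>auto simp: n1\<close>)
        qed
        then show "fgen (WPsi p) * fgen (WPsi ?P) * fgen (WE (swap_at p c)) \<in> ?J" by (simp add: mult.assoc)
      qed (use p in simp)
      moreover have "(fgen (WPsi ?P) * fgen (WPsi p)) * (fgen (WPsi ?P) * fgen (WE c)) \<in> ?J"
      proof (rule step[OF c p])
        assume a: "c ! ?P = Single \<or> c ! ?Q = Single" "swap_at ?P c \<in> ?S"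
        have "fgen (WPsi ?P) * (fgen (WPsi p) * fgen (WE (swap_at ?P c))) \<in> ?J"
        proof (rule step[OF a(2)])
          assume b: "swap_at ?P c ! p = Single \<or> swap_at ?P c ! ?P = Single" "swap_at p (swap_at ?P c) \<in> ?S"
          show "fgen (WPsi ?P) * fgen (WE (swap_at p (swap_at ?P c))) \<in> ?J"
            by (rule rr[OF b(2) p]) (use many a b in \<open>auto simp: n1\<close>)
        qed (use p in simp)
        then show "fgen (WPsi ?P) * fgen (WPsi p) * fgen (WE (swap_at ?P c)) \<in> ?J" by (simp add: mult.assoc)
      qed
      ultimately show ?thesis using J(6) by (intro bexI[of _ 0]) (auto simp: algebra_simps)
    qed
  qed
  show "web_kap s (c ! p) (c ! Suc p) (web.lv c p) (web.lv c (Suc p)) \<noteq> (0 :: 'k rf)"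
    if "c \<in> ?S" "Suc p < ?r" "c ! p = Single \<or> c ! Suc p = Single" for c p
    using that by (auto simp: web_kap_def qpoly_def web.lam_def split: strand.split) presburger
  show "app (lift oper_scal (word_prod (web_act s n)) x) (vsingle c f) = (\<lambda>_. 0)"
    if "x \<in> ?J" "c \<in> ?S" for x :: "('k, web_gen) free_alg" and c f
    using subsetD[OF web_J_kills that(1)] that(2) by (simp add: killing_def oprep_def)
  show "q * fgen (WE c) \<in> ?J"
    if c: "c \<in> ?S" and q: "q \<in> fcarrier ((\<lambda>g. g) ` web_vars s n)"
      and z: "app (lift oper_scal (word_prod (web_act s n)) q) (vsingle c 1) = (\<lambda>_. 0)"
    for c and q :: "('k, web_gen) free_alg"
  proof (rule polynomials_faithful[where Zs = "web_vars s n" and gact = "web_act s n" and c = c and Zg = "?Zg c"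
        and P = "\<lambda>g. case g of WY p \<Rightarrow> Poly_Mapping.single (Poly_Mapping.single (web.lam c p) 1) 1
          | WEl k d \<Rightarrow> esym_poly (block s k) d | _ \<Rightarrow> 0"
        and ld = "web_lead s c"])
    show "mset l = mset l'" if "set l \<subseteq> ?Zg c" "set l' \<subseteq> ?Zg c"
      "sum_list (map (web_lead s c) l) = sum_list (map (web_lead s c) l')" for l l'
      by (rule web_lead_inj[OF length_Seqs[OF c] that])
    \<comment> \<open>The polynomial generators outside \<open>?Zg c\<close> are exactly the dots on
      red strands.\<close>
    show "fgen g * fgen (WE c) \<in> ?J" if g: "g \<in> web_vars s n - ?Zg c" for g
    proof -
      obtain p where p: "g = WY p" "p < ?r" "c ! p \<noteq> Single" using g by (auto simp: web_vars_def)
      then obtain k where "c ! p = Multi k" by (cases "c ! p") auto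
      then show ?thesis using R[OF web_rel.y_red[OF c p(2)]] p by simp
    qed
  qed (use c q z zz in \<open>auto simp: web_act_simps rf_var_def has_lead_single oprep_def web_pres.tsi_J web_vars_def
      web_lead_def has_lead_esym_poly[simplified] rf_poly_esym_poly\<close>)
qed (auto simp: web_act_simps web_vars_def)

section \<open>Divided differences on a block of barred strands\<close>

abbreviation "bar_swp i \<equiv> swp (xv i) (xv (Suc i))"
abbreviation "bar_dd i \<equiv> dd (xv i) (xv (Suc i))"

text \<open>Letters are relative to the first barred index of a block, so the combinatorics of words
  starting at letter 0 applies to every block.\<close>

definition dd_word :: "nat \<Rightarrow> nat list \<Rightarrow> 'k::field rf \<Rightarrow> 'k rf" where
  "dd_word o' l g = foldr (\<lambda>i. bar_dd (o' + i)) l g"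

lemma dd_zero [simp]: "dd a b 0 = (0 :: 'k::field rf)"
  by (simp add: dd_def)

lemma dd_word_zero [simp]: "dd_word b l 0 = (0 :: 'k::field rf)"
  by (induction l) (auto simp: dd_word_def)

lemma dd_word_append: "dd_word b (u @ v) g = dd_word b u (dd_word b v g)"
  by (simp add: dd_word_def)

lemma dd_word_braid_eq: "u \<approx> v \<Longrightarrow> dd_word b u g = dd_word b v (g :: 'k::field rf)"
proof (induction arbitrary: g rule: braid_eq.induct)
  case (comm p q a c)
  have "dd_word b [p, q] h = dd_word b [q, p] h" for h :: "'k rf"
    using comm unfolding dd_word_def by (auto intro: dd_commute)
  then show ?case by (simp only: dd_word_append)
next
  case (braid a p c)
  have "dd_word b [p, Suc p, p] h = dd_word b [Suc p, p, Suc p] h" for h :: "'k rf"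
    using dd_braid[of "xv (b + p)" "xv (b + Suc p)" "xv (b + Suc (Suc p))" h] by (simp add: dd_word_def)
  then show ?case by (simp only: dd_word_append)
qed auto

lemma dd_word_reducible: "reducible u \<Longrightarrow> dd_word b u g = (0 :: 'k::field rf)"
proof -
  assume "reducible u"
  then obtain a q c where "u \<approx> a @ [q, q] @ c" by (auto simp: reducible_def)
  then have "dd_word b u g = dd_word b a (dd_word b [q, q] (dd_word b c g))"
    by (simp only: dd_word_braid_eq dd_word_append)
  also have "dd_word b [q, q] (dd_word b c g) = 0" by (simp add: dd_word_def dd_dd)
  finally show ?thesis by simp
qed

lemma longest_word_Suc: "longest_word 0 (Suc (Suc R)) = longest_word 0 (Suc R) @ desc 0 (Suc R)"
  by (simp add: longest_word_def desc_def del: upt_Suc) (simp add: upt_Suc)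

lemma longest_word_normal: "longest_word 0 (Suc R) \<in> normal_words R"
proof (induction R)
  case 0
  then show ?case by (simp add: longest_word_def)
next
  case (Suc R)
  then show ?case unfolding longest_word_Suc by (intro normal_words_Suc_I) auto
qed

lemma length_normal_le: "v \<in> normal_words R \<Longrightarrow> length v \<le> length (longest_word 0 (Suc R))"
proof (induction R arbitrary: v)
  case 0
  then show ?case by simp
next
  case (Suc R)
  then obtain u t where "v = u @ desc t (Suc R)" "u \<in> normal_words R" "t \<le> Suc R" by auto
  then show ?case
    using Suc.IH[of u] unfolding longest_word_Suc by (simp add: desc_def del: upt_Suc desc_Suc)
qed

text \<open>The extended word is longer than every normal word, hence reducible, and reducible words
  of divided differences are zero. This is why the longest divided difference has symmetric
  values.\<close>

lemma bar_dd_longest: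
  assumes "Suc i < a"
  shows "bar_dd (b + i) (dd_word b (longest_word 0 a) g) = (0 :: 'k::field rf)"
proof -
  obtain R where R: "a = Suc R" using assms by (cases a) auto
  have "reducible (i # longest_word 0 (Suc R))"
  proof (rule ccontr)
    assume "\<not> reducible (i # longest_word 0 (Suc R))"
    then obtain v where "v \<in> normal_words R" "i # longest_word 0 (Suc R) \<approx> v"
      using normal_words_Cons[OF longest_word_normal, of i R] assms R by auto
    then show False using length_normal_le[of v R] braid_eq_length[of "i # longest_word 0 (Suc R)" v] by simp
  qed
  from dd_word_reducible[OF this, of b g] show ?thesis by (simp add: R dd_word_def)
qed

lemma dd_eq_0_swp: "a \<noteq> b \<Longrightarrow> dd a b f = 0 \<Longrightarrow> swp a b f = (f :: 'k::field rf)"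
  by (simp add: dd_def)

definition block_sym :: "nat \<Rightarrow> nat \<Rightarrow> 'k::field rf \<Rightarrow> bool" where
  "block_sym b a g \<longleftrightarrow> (\<forall>i. Suc i < a \<longrightarrow> bar_swp (b + i) g = g)"

lemma block_sym_mult: "block_sym b a g \<Longrightarrow> block_sym b a h \<Longrightarrow> block_sym b a (g * h)"
  by (simp add: block_sym_def rf_perm_mult)

lemma block_sym_prod: "(\<And>x. x \<in> A \<Longrightarrow> block_sym b a (f x)) \<Longrightarrow> block_sym b a (prod f A)"
  by (simp add: block_sym_def rf_perm_prod)

definition dlong :: "nat \<Rightarrow> nat \<Rightarrow> 'k::field rf \<Rightarrow> 'k rf" where
  "dlong b a g = dd_word b (longest_word 0 a) g"

lemma block_sym_dlong: "block_sym b a (dlong b a g)"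
  unfolding block_sym_def dlong_def by (intro allI impI dd_eq_0_swp bar_dd_longest) auto

lemma longest_word_letters: "set (longest_word 0 a) \<subseteq> {i. Suc i < a}"
  by (auto simp: longest_word_def)

lemma dd_word_sym_mult:
  assumes "block_sym b a h" "set l \<subseteq> {i. Suc i < a}"
  shows "dd_word b l (h * g) = h * dd_word b l g"
  using assms(2) by (induction l) (use assms(1) in \<open>auto simp: dd_word_def block_sym_def dd_sym_mult\<close>)

lemma dlong_sym_mult: "block_sym b a h \<Longrightarrow> dlong b a (h * g) = h * dlong b a g"
  unfolding dlong_def using dd_word_sym_mult longest_word_letters by blast

definition xdelta :: "nat \<Rightarrow> nat \<Rightarrow> 'k::field rf" where
  "xdelta b a = (\<Prod>i<a. rf_var (xv (b + i)) ^ (a - 1 - i))"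

text \<open>The descending factor that acts first lowers every positive exponent of the staircase in
  \<open>a + 1\<close> variables by one, which leaves the staircase in \<open>a\<close>
  variables.\<close>

lemma dlong_xdelta: "dlong b a (xdelta b a) = (1 :: 'k::field rf)"
proof (induction a)
  case 0
  then show ?case by (simp add: dlong_def xdelta_def longest_word_def dd_word_def)
next
  case (Suc a)
  let ?x = "\<lambda>i. rf_var (xv (b + i)) :: 'k rf"
  \<comment> \<open>\<open>M j\<close> is the staircase after \<open>j\<close> divided differences:
    the variables before place \<open>j\<close> have lost one power.\<close>
  define M where "M j = (\<Prod>i<Suc a. ?x i ^ (if i < j then a - 1 - i else a - i))" for j
  have step: "bar_dd (b + j) (M j) = M (Suc j)" if "j < a" for j
  proof -
    let ?R = "{..<Suc a} - {j, Suc j}"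
    define rest where "rest = (\<Prod>i\<in>?R. ?x i ^ (if i < j then a - 1 - i else a - i))"
    have split: "(\<Prod>i<Suc a. f i) = f j * f (Suc j) * (\<Prod>i\<in>?R. f i)" for f :: "nat \<Rightarrow> 'k rf"
    proof -
      have "{..<Suc a} = insert j (insert (Suc j) ?R)" using that by auto
      then have "(\<Prod>i<Suc a. f i) = (\<Prod>i\<in>insert j (insert (Suc j) ?R). f i)" by simp
      then show ?thesis by (simp add: mult.assoc)
    qed
    define e where "e = a - 1 - j"
    have e: "a - j = Suc e" "a - Suc j = e" "a - 1 - j = e"
      using that by (auto simp: e_def)
    \<comment> \<open>The exponents at \<open>j\<close> and \<open>Suc j\<close> differ by one, so
      up to a symmetric factor the divided difference sees a single variable, on which it takes the
      value 1.\<close>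
    have M1: "M j = ((?x j * ?x (Suc j)) ^ (a - 1 - j) * rest) * ?x j"
      unfolding M_def split rest_def by (simp add: e[simplified] power_mult_distrib mult_ac)
    have M2: "M (Suc j) = (?x j * ?x (Suc j)) ^ (a - 1 - j) * rest"
    proof -
      have "(\<Prod>i\<in>?R. ?x i ^ (if i < Suc j then a - 1 - i else a - i)) = rest"
        unfolding rest_def by (intro prod.cong) auto
      then show ?thesis unfolding M_def split by (simp add: e[simplified] power_mult_distrib mult_ac)
    qed
    have "bar_swp (b + j) rest = rest"
      unfolding rest_def rf_perm_prod
      by (intro prod.cong refl) (auto simp: rf_perm_power swp_var transpose_def)
    then have "bar_swp (b + j) ((?x j * ?x (Suc j)) ^ (a - 1 - j) * rest) = (?x j * ?x (Suc j)) ^ (a - 1 - j) * rest"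
      by (simp add: rf_perm_mult rf_perm_power swp_var mult.commute)
    from dd_sym_mult[OF this, of "?x j"] have "bar_dd (b + j) (M j)
      = (?x j * ?x (Suc j)) ^ (a - 1 - j) * rest * bar_dd (b + j) (?x j)"
      by (simp add: M1)
    also have "bar_dd (b + j) (?x j) = 1" by (simp add: dd_def swp_var)
    finally show ?thesis by (simp add: M2)
  qed
  have "dd_word b (rev [0..<j]) (M 0) = M j" if "j \<le> a" for j
    using that
  proof (induction j)
    case (Suc j)
    then show ?case using step[of j] by (simp add: dd_word_def)
  qed (simp add: dd_word_def)
  from this[of a] have "dd_word b (rev [0..<a]) (xdelta b (Suc a)) = M a"
    by (simp add: M_def xdelta_def)
  moreover have "M a = xdelta b a"
    by (simp add: M_def xdelta_def)
  moreover have "longest_word 0 (Suc a) = longest_word 0 a @ rev [0..<a]"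
    by (cases a) (simp_all add: longest_word_def del: upt_Suc, simp add: upt_Suc)
  ultimately show ?case using Suc by (simp add: dlong_def dd_word_append)
qed

text \<open>The operator of \<open>block_idem\<close>. By \<open>dlong_xdelta\<close> it is the
  projection onto the multiples of \<open>xdelta\<close> by functions symmetric in the
  block.\<close>

definition bar_idem :: "nat \<Rightarrow> nat \<Rightarrow> 'k::field rf \<Rightarrow> 'k rf" where
  "bar_idem b a g = xdelta b a * dlong b a g"

lemma bar_idem_fixes: "block_sym b a h \<Longrightarrow> bar_idem b a (xdelta b a * h) = xdelta b a * h"
  using dlong_sym_mult[of b a h "xdelta b a"] by (simp add: bar_idem_def dlong_xdelta mult.commute)

lemma longest_word_shift: "longest_word q a = map (\<lambda>i. q + i) (longest_word 0 a)"
proof -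
  have "rev [q..<q + j] = map (\<lambda>i. q + i) (rev [0..<j])" for j
    by (simp add: rev_map[symmetric] map_add_upt add.commute[of q])
  then show ?thesis by (simp add: longest_word_def map_concat o_def)
qed

lemma block_idem_acts:
  assumes c: "length c = r" "q + a \<le> r" and bar: "\<And>i. i < a \<Longrightarrow> c ! (q + i) = Bar"
    and lam: "\<And>i. i < a \<Longrightarrow> klr.lam c (q + i) = xv (b + i)"
  shows "app (klr_rep r (block_idem q a)) (vsingle c g) = vsingle c (bar_idem b a (g :: 'k::field rf))"
proof -
  have psi: "app (klr_rep r (prod_list (map klr_psi (map (\<lambda>i. q + i) l)))) (vsingle c h) = vsingle c (dd_word b l h)"
    if "set l \<subseteq> {i. Suc i < a}" for l and h :: "'k rf"
    using that
  proof (induction l)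
    case (Cons i l)
    then have i: "Suc i < a" by simp
    then have "c ! (q + i) = Bar" "c ! Suc (q + i) = Bar" "klr.lam c (q + i) = xv (b + i)"
      "klr.lam c (Suc (q + i)) = xv (Suc (b + i))" using bar[of i] bar[of "Suc i"] lam[of i] lam[of "Suc i"] by auto
    then show ?case
      using Cons i c by (simp add: oprep_hom oprep_gen klr_act_simps klr.app_op_psi_vsingle swap_at_same klr.dpsi_def dd_word_def)
  qed (simp add: oprep_hom dd_word_def)
  have x: "app (klr_rep r (prod_list (map (\<lambda>j. klr_x (q + j) ^ e j) l))) (vsingle c h)
      = vsingle c (prod_list (map (\<lambda>j. rf_var (xv (b + j)) ^ e j) l) * h)"
    if "set l \<subseteq> {..<a}" for e l and h :: "'k rf"
    using that
  proof (induction l)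
    case (Cons j l)
    then show ?case using c lam[of j]
      by (simp add: oprep_hom oprep_gen oprep_power klr_act_simps op_mult_power mult.assoc)
  qed (simp add: oprep_hom)
  have d: "prod_list (map (\<lambda>j. rf_var (xv (b + j)) ^ (a - 1 - j)) [0..<a]) = (xdelta b a :: 'k rf)"
    by (simp add: xdelta_def prod.distinct_set_conv_list[symmetric] atLeast0LessThan)
  have "app (klr_rep r (prod_list (map (\<lambda>j. klr_x (q + j) ^ (a - 1 - j)) [0..<a]))) (vsingle c h)
      = vsingle c (xdelta b a * h)" for h :: "'k rf"
    unfolding d[symmetric] by (rule x) auto
  then show ?thesis
    unfolding block_idem_def longest_word_shift[of q] oprep_hom app_ring psi[OF longest_word_letters]
    by (simp only: bar_idem_def dlong_def)
qed

section \<open>All blocks of barred strands at once\<close>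

definition all_sym :: "nat list \<Rightarrow> 'k::field rf \<Rightarrow> bool" where
  "all_sym s g \<longleftrightarrow> (\<forall>k<length s. block_sym (offset s k) (s ! k) g)"

definition all_delta :: "nat list \<Rightarrow> nat set \<Rightarrow> 'k::field rf" where
  "all_delta s K = (\<Prod>k\<in>K. xdelta (offset s k) (s ! k))"

definition thick_idem :: "nat list \<Rightarrow> nat list \<Rightarrow> 'k::field rf \<Rightarrow> 'k rf" where
  "thick_idem s ks g = foldr (\<lambda>k. bar_idem (offset s k) (s ! k)) ks g"

lemma xdelta_sym_other:
  assumes "k < length s" "l < length s" "k \<noteq> l"
  shows "block_sym (offset s k) (s ! k) (xdelta (offset s l) (s ! l) :: 'k::field rf)"
  unfolding block_sym_def xdelta_def
proof (intro allI impI)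
  fix i assume i: "Suc i < s ! k"
  have "transpose (xv (offset s k + i)) (xv (Suc (offset s k + i))) (xv (offset s l + j)) = xv (offset s l + j)"
    if "j < s ! l" for j
  proof -
    have "offset s l + j \<notin> block s k" using block_disjoint[OF assms] that by auto
    then have "offset s k + i \<noteq> offset s l + j" "Suc (offset s k + i) \<noteq> offset s l + j" using i by auto
    then have "xv (offset s l + j) \<noteq> xv (offset s k + i)" "xv (offset s l + j) \<noteq> xv (Suc (offset s k + i))"
      by presburger+
    then show ?thesis by (rule transpose_apply_other)
  qed
  then show "bar_swp (offset s k + i) (\<Prod>j<s ! l. rf_var (xv (offset s l + j)) ^ (s ! l - 1 - j))
    = (\<Prod>j<s ! l. rf_var (xv (offset s l + j)) ^ (s ! l - 1 - j) :: 'k rf)"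
    unfolding rf_perm_prod rf_perm_power swp_var by (intro prod.cong refl) simp
qed

lemma all_delta_sym_other:
  "k < length s \<Longrightarrow> K \<subseteq> {..<length s} - {k} \<Longrightarrow> block_sym (offset s k) (s ! k) (all_delta s K)"
  unfolding all_delta_def by (rule block_sym_prod) (auto intro: xdelta_sym_other)

lemma bar_idem_fixes_all:
  assumes k: "k < length s" and g: "all_sym s g"
  shows "bar_idem (offset s k) (s ! k) (all_delta s {..<length s} * g) = all_delta s {..<length s} * g"
proof -
  have d: "all_delta s {..<length s} = xdelta (offset s k) (s ! k) * all_delta s ({..<length s} - {k})"
    unfolding all_delta_def using k by (intro prod.remove) auto
  have "block_sym (offset s k) (s ! k) (all_delta s ({..<length s} - {k}) * g)"
    using g k by (intro block_sym_mult all_delta_sym_other) (auto simp: all_sym_def)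
  from bar_idem_fixes[OF this] show ?thesis unfolding d mult.assoc .
qed

lemma thick_idem_fixes:
  assumes "set ks \<subseteq> {..<length s}" "all_sym s g"
  shows "thick_idem s ks (all_delta s {..<length s} * g) = all_delta s {..<length s} * g"
  using assms(1) by (induction ks) (use assms(2) bar_idem_fixes_all in \<open>auto simp: thick_idem_def\<close>)

lemma dlong_sym_other:
  assumes "k < length s" "l < length s" "k \<noteq> l" "block_sym (offset s k) (s ! k) g"
  shows "block_sym (offset s k) (s ! k) (dlong (offset s l) (s ! l) (g :: 'k::field rf))"
proof -
  have "bar_swp (offset s k + i) (dd_word (offset s l) u h) = dd_word (offset s l) u (bar_swp (offset s k + i) h)"
    if i: "Suc i < s ! k" and u: "set u \<subseteq> {j. Suc j < s ! l}" for i u and h :: "'k rf"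
    using u
  proof (induction u)
    case (Cons j u)
    have "offset s l + j \<notin> block s k" "offset s l + Suc j \<notin> block s k"
      using block_disjoint[OF assms(1-3)] Cons.prems by auto
    then have "{xv (offset s k + i), xv (Suc (offset s k + i))} \<inter> {xv (offset s l + j), xv (Suc (offset s l + j))} = {}"
      using i by auto
    then show ?case using Cons by (simp add: dd_word_def swp_dd_commute)
  qed (simp add: dd_word_def)
  from this[OF _ longest_word_letters] show ?thesis
    using assms(4) by (simp add: block_sym_def dlong_def)
qed

text \<open>Blocks are treated from the right. The monomials of later blocks are symmetric in block
  \<open>j\<close> and pass through its divided differences, which in turn preserve the symmetry
  already reached, because the blocks have disjoint variables.\<close>

lemma thick_idem_image_aux:
  assumes "j \<le> length s"
  shows "\<exists>h. thick_idem s [j..<length s] g = all_delta s {j..<length s} * h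
    \<and> (\<forall>k\<in>{j..<length s}. block_sym (offset s k) (s ! k) (h :: 'k::field rf))"
  using assms
proof (induction j rule: inc_induct)
  case base
  then show ?case by (auto simp: thick_idem_def all_delta_def)
next
  case (step j)
  then obtain h where h: "thick_idem s [Suc j..<length s] g = all_delta s {Suc j..<length s} * h"
    "\<And>k. k \<in> {Suc j..<length s} \<Longrightarrow> block_sym (offset s k) (s ! k) h" by blast
  let ?h = "dlong (offset s j) (s ! j) h"
  have "thick_idem s [j..<length s] g = bar_idem (offset s j) (s ! j) (all_delta s {Suc j..<length s} * h)"
    using h(1) step.hyps by (simp add: thick_idem_def upt_conv_Cons)
  also have "\<dots> = xdelta (offset s j) (s ! j) * (all_delta s {Suc j..<length s} * ?h)"
    unfolding bar_idem_def using step.hyps by (subst dlong_sym_mult) (auto intro!: all_delta_sym_other)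
  also have "\<dots> = all_delta s {j..<length s} * ?h"
    using step.hyps by (simp add: all_delta_def prod.atLeast_Suc_lessThan mult.assoc)
  finally have "thick_idem s [j..<length s] g = all_delta s {j..<length s} * ?h" .
  moreover have "block_sym (offset s k) (s ! k) ?h" if "k \<in> {j..<length s}" for k
    using that step.hyps h(2)[of k] dlong_sym_other[of k s j h] block_sym_dlong
    by (cases "k = j") auto
  ultimately show ?case by blast
qed

lemma thick_idem_image:
  obtains h where "all_sym s h" "thick_idem s [0..<length s] g = all_delta s {..<length s} * (h :: 'k::field rf)"
proof -
  obtain h where h: "thick_idem s [0..<length s] g = all_delta s {0..<length s} * h"
    "\<forall>k\<in>{0..<length s}. block_sym (offset s k) (s ! k) h"
    using thick_idem_image_aux[of 0 s g] by auto
  then show ?thesis by (intro that[of h]) (auto simp: all_sym_def atLeast0LessThan)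
qed

lemma all_delta_nonzero: "all_delta s K \<noteq> (0 :: 'k::field rf)"
proof (cases "finite K")
  case True
  have "rf_var v \<noteq> (0 :: 'k rf)" for v
    by (simp add: rf_var_def rf_poly_eq_0_iff) (metis keys_zero keys_single zero_neq_one insert_not_empty)
  then show ?thesis using True by (simp add: all_delta_def xdelta_def)
qed (simp add: all_delta_def)

section \<open>Thick generators acting on the KLR representation\<close>

lemma expand_simps [simp]:
  "expand s [] = []" "expand s (a # w) = expand_strand s a @ expand s w"
  "expand s (u @ v) = expand s u @ expand s v"
  by (simp_all add: expand_def)

lemma count_list_replicate_colour [simp]: "count_list (replicate k a) b = (if a = b then k else 0)"
  by (induction k) auto

lemma expand_counts:
  assumes "filter (\<lambda>a. a \<noteq> Single) w = map Multi ks"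
  shows "count_list (expand s w) Plain = count_list w Single"
    "count_list (expand s w) Bar = sum_list (map ((!) s) ks)"
    "length (expand s w) = count_list w Single + sum_list (map ((!) s) ks)"
proof -
  have "count_list (expand s w) Plain = count_list w Single \<and>
    count_list (expand s w) Bar = sum_list (map ((!) s) ks) \<and>
    length (expand s w) = count_list w Single + sum_list (map ((!) s) ks)"
    using assms
  proof (induction w arbitrary: ks)
    case (Cons a w)
    show ?case
    proof (cases a)
      case Single
      then show ?thesis using Cons by simp
    next
      case (Multi k)
      then obtain ks' where "ks = k # ks'" "filter (\<lambda>a. a \<noteq> Single) w = map Multi ks'"
        using Cons.prems by (cases ks) auto
      then show ?thesis using Cons.IH[of ks'] Multi by simp
    qed
  qed simp
  then show "count_list (expand s w) Plain = count_list w Single"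
    "count_list (expand s w) Bar = sum_list (map ((!) s) ks)"
    "length (expand s w) = count_list w Single + sum_list (map ((!) s) ks)" by auto
qed

lemma sum_list_upt_offset: "k \<le> length s \<Longrightarrow> sum_list (map ((!) s) [0..<k]) = offset s k"
  by (induction k) (auto simp: offset_Suc, simp add: offset_def)

lemma Seqs_split:
  assumes "A @ B \<in> Seqs m n"
  shows "\<exists>j\<le>m. filter (\<lambda>a. a \<noteq> Single) A = map Multi [0..<j] \<and> (\<forall>k C. B = Multi k # C \<longrightarrow> j = k \<and> k < m)"
proof -
  let ?f = "filter (\<lambda>a. a \<noteq> Single)"
  define j where "j = length (?f A)"
  have eq: "?f A @ ?f B = map Multi [0..<m]" using assms by (simp add: Seqs_def)
  then have jm: "j \<le> m" by (metis j_def length_append length_map length_upt le_add1 diff_zero)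
  have "?f A = take j (map Multi [0..<m])" using eq by (metis j_def append_eq_conv_conj)
  then have A: "?f A = map Multi [0..<j]" using jm by (simp add: take_map)
  have "j = k \<and> k < m" if "B = Multi k # C" for k C
  proof -
    have l: "j < m" using arg_cong[OF eq, of length] that by (simp add: j_def)
    have "(?f A @ ?f B) ! j = Multi k" using that by (simp add: j_def nth_append)
    then have "map Multi [0..<m] ! j = Multi k" using eq by simp
    then show ?thesis using l by simp
  qed
  then show ?thesis using A jm by blast
qed

lemma length_expand:
  assumes "w \<in> Seqs (length s) n"
  shows "length (expand s w) = sum_list s + n"
proof -
  have "filter (\<lambda>a. a \<noteq> Single) w = map Multi [0..<length s]" "count_list w Single = n"
    using assms by (auto simp: Seqs_def)
  then show ?thesis using expand_counts(3)[of w "[0..<length s]" s] by (simp add: map_nth)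
qed

text \<open>A label depends on the number of strands of the same colour to the left. These counts
  identify the solid labels of an expansion with the black Webster labels, and the labels of a thick
  strand with its block.\<close>

lemma prefix_counts:
  assumes "A @ B \<in> Seqs (length s) n"
  shows "count_list (expand s A) Plain = count_list A Single"
    and "B = Multi k # C \<Longrightarrow> count_list (expand s A) Bar = offset s k \<and> k < length s"
proof -
  obtain j where j: "j \<le> length s" "filter (\<lambda>a. a \<noteq> Single) A = map Multi [0..<j]"
    "\<forall>k C. B = Multi k # C \<longrightarrow> j = k \<and> k < length s" using Seqs_split[OF assms] by blast
  show "count_list (expand s A) Plain = count_list A Single" using expand_counts(1)[OF j(2)] .
  show "B = Multi k # C \<Longrightarrow> count_list (expand s A) Bar = offset s k \<and> k < length s"
    using expand_counts(2)[OF j(2), of s] j sum_list_upt_offset[of j s] by auto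
qed

lemma klr_lam_append: "klr.lam (A @ c # B) (length A) = klr_lab c (count_list A c)"
  by (simp add: klr.lam_def)

lemma web_lam_append: "web.lam (A @ c # B) (length A) = web_lab c (count_list A c)"
  by (simp add: web.lam_def)

lemma lam_block:
  assumes "i < a"
  shows "(A @ replicate a Bar @ B) ! (length A + i) = Bar"
    "klr.lam (A @ replicate a Bar @ B) (length A + i) = xv (count_list A Bar + i)"
proof -
  have "A @ replicate a Bar @ B = (A @ replicate i Bar) @ Bar # replicate (a - Suc i) Bar @ B"
    using assms by (simp add: replicate_add[symmetric] flip: replicate_Suc)
  then have e: "A @ replicate a Bar @ B = (A @ replicate i Bar) @ Bar # replicate (a - Suc i) Bar @ B" .
  have l: "length A + i = length (A @ replicate i Bar)" by simp
  show "(A @ replicate a Bar @ B) ! (length A + i) = Bar" unfolding e l by (rule nth_append_length)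
  show "klr.lam (A @ replicate a Bar @ B) (length A + i) = xv (count_list A Bar + i)"
    unfolding e l klr_lam_append by simp
qed

lemma start_append: "start s (A @ B) (length A) = length (expand s A)"
  by (simp add: start_def)

lemma split_at: "p < length w \<Longrightarrow> \<exists>A B. w = A @ w ! p # B \<and> length A = p"
  by (metis id_take_nth_drop length_take less_imp_le min.absorb2)

lemma thick_block_acts:
  assumes w: "w \<in> Seqs (length s) n" and p: "p < length w" "w ! p = Multi k"
  shows "app (klr_rep (sum_list s + n) (block_idem (start s w p) (s ! k))) (vsingle (expand s w) g)
    = vsingle (expand s w) (bar_idem (offset s k) (s ! k) (g :: 'k::field rf))"
    and "k < length s" and "start s w p + s ! k \<le> sum_list s + n"
    and "i < s ! k \<Longrightarrow> klr.lam (expand s w) (start s w p + i) = xv (offset s k + i)"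
proof -
  obtain A B where AB: "w = A @ Multi k # B" "length A = p" using split_at[OF p(1)] p(2) by auto
  note c = prefix_counts(2)[OF w[unfolded AB(1)] HOL.refl]
  have st: "start s w p = length (expand s A)" using AB start_append by metis
  have ex: "expand s w = expand s A @ replicate (s ! k) Bar @ expand s B" using AB by simp
  show "k < length s" using c by simp
  show le: "start s w p + s ! k \<le> sum_list s + n"
    using length_expand[OF w] unfolding st ex by simp
  show lam: "i < s ! k \<Longrightarrow> klr.lam (expand s w) (start s w p + i) = xv (offset s k + i)" for i
    unfolding st ex using c lam_block(2) by simp
  show "app (klr_rep (sum_list s + n) (block_idem (start s w p) (s ! k))) (vsingle (expand s w) g)
    = vsingle (expand s w) (bar_idem (offset s k) (s ! k) g)"
    by (rule block_idem_acts[OF length_expand[OF w] le _ lam])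
      (simp only: st ex lam_block(1))
qed

definition strand_idem :: "nat list \<Rightarrow> strand \<Rightarrow> 'k::field rf \<Rightarrow> 'k rf" where
  "strand_idem s a g = (case a of Single \<Rightarrow> g | Multi k \<Rightarrow> bar_idem (offset s k) (s ! k) g)"

lemma foldr_strand_idem:
  "filter (\<lambda>a. a \<noteq> Single) w = map Multi ks \<Longrightarrow> foldr (strand_idem s) w g = thick_idem s ks g"
proof (induction w arbitrary: ks)
  case (Cons a w)
  show ?case
  proof (cases a)
    case Single
    then show ?thesis using Cons by (simp add: strand_idem_def)
  next
    case (Multi k)
    then obtain ks' where "ks = k # ks'" "filter (\<lambda>a. a \<noteq> Single) w = map Multi ks'"
      using Cons.prems by (cases ks) auto
    then show ?thesis using Cons.IH[of ks'] Multi by (simp add: strand_idem_def thick_idem_def)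
  qed
qed (simp add: thick_idem_def)

lemma thick_e_acts:
  assumes w: "w \<in> Seqs (length s) n" and c: "length c = sum_list s + n"
  shows "app (klr_rep (sum_list s + n) (thick_e s w)) (vsingle c g) =
    (if c = expand s w then vsingle c (thick_idem s [0..<length s] (g :: 'k::field rf)) else (\<lambda>_. 0))"
proof (cases "c = expand s w")
  case True
  let ?F = "(\<lambda>p. case w ! p of Single \<Rightarrow> 1 | Multi k \<Rightarrow> block_idem (start s w p) (s ! k)) :: nat \<Rightarrow> ('k, klr_gen) free_alg"
  have one: "app (klr_rep (sum_list s + n) (?F p)) (vsingle c h) = vsingle c (strand_idem s (w ! p) h)"
    if "p < length w" for p and h :: "'k rf"
    using thick_block_acts(1)[OF w that] True by (cases "w ! p") (auto simp: oprep_hom strand_idem_def)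
  have "app (klr_rep (sum_list s + n) (prod_list (map ?F ps))) (vsingle c h)
      = vsingle c (foldr (\<lambda>p. strand_idem s (w ! p)) ps h)" if "set ps \<subseteq> {..<length w}" for ps and h :: "'k rf"
    using that by (induction ps) (auto simp: oprep_hom one)
  from this[of "[0..<length w]" g]
  have "app (klr_rep (sum_list s + n) (prod_list (map ?F [0..<length w]))) (vsingle c g)
      = vsingle c (foldr (\<lambda>p. strand_idem s (w ! p)) [0..<length w] g)" by (simp add: atLeast0LessThan)
  also have "foldr (\<lambda>p. strand_idem s (w ! p)) [0..<length w] g = foldr (strand_idem s) (map ((!) w) [0..<length w]) g"
    by (simp only: foldr_map o_def)
  also have "\<dots> = thick_idem s [0..<length s] g"
    using w by (simp add: map_nth foldr_strand_idem Seqs_def)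
  finally show ?thesis
    using True c by (simp add: thick_e_def oprep_hom oprep_gen klr_act_simps)
next
  case False
  then show ?thesis
    using length_expand[OF w] by (simp add: thick_e_def oprep_hom oprep_gen klr_act_simps app_0)
qed

section \<open>Symmetric functions inside the KLR representation, and the thick generators on
  them\<close>

definition emb :: "nat list \<Rightarrow> strand list \<Rightarrow> 'k::field rf \<Rightarrow> colour list \<Rightarrow> 'k rf" where
  "emb s w h = vsingle (expand s w) (all_delta s {..<length s} * h)"

text \<open>When no thick strand expands to the empty word, the first colour of an expansion tells
  whether a solid or a thick strand comes first, and the fixed order of the thick strands tells
  which one. For \<open>n = 0\<close> there is only one sequence.\<close>

lemma expand_inj:
  assumes "n = 0 \<or> (\<forall>k<length s. 1 \<le> s ! k)" "w \<in> Seqs (length s) n" "w' \<in> Seqs (length s) n"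
    and "expand s w = expand s w'"
  shows "w = w'"
proof (cases "n = 0")
  case True
  have "u = map Multi [0..<length s]" if "u \<in> Seqs (length s) n" for u
  proof -
    have "filter (\<lambda>a. a \<noteq> Single) u = u"
      using that True by (intro filter_True) (auto simp: Seqs_def count_list_0_iff)
    then show ?thesis using that by (simp add: Seqs_def)
  qed
  then show ?thesis using assms by metis
next
  case False
  then have pos: "\<And>k. k < length s \<Longrightarrow> 1 \<le> s ! k" using assms(1) by auto
  have "u = u'" if "filter (\<lambda>a. a \<noteq> Single) u = filter (\<lambda>a. a \<noteq> Single) u'" "expand s u = expand s u'"
    "\<And>k. Multi k \<in> set u \<union> set u' \<Longrightarrow> 1 \<le> s ! k" for u u'
    using that
  proof (induction u arbitrary: u')
    case Nil
    then show ?case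
    proof (cases u')
      case (Cons a v)
      then show ?thesis using Nil by (cases a) auto
    qed simp
  next
    case (Cons a u)
    have ne: "expand_strand s b \<noteq> []" if "b \<in> set (a # u) \<union> set u'" for b
      using Cons.prems(3) that by (cases b) fastforce+
    then have "expand s (a # u) \<noteq> []" by simp
    then obtain b v where u': "u' = b # v" using Cons.prems(2) by (cases u') auto
    have "a = b"
    proof (cases a)
      case Single
      then have "hd (expand s u') = Plain" using Cons.prems(2) by (metis expand_simps(2) expand_strand.simps(1) append_Cons list.sel(1))
      then show ?thesis using Single u' Cons.prems(3) ne[of b] by (cases b) (auto simp: hd_append hd_replicate split: if_splits)
    next
      case (Multi k)
      then have "hd (expand s (a # u)) = Bar" using ne[of a] by (auto simp: hd_append hd_replicate)
      then have "hd (expand s u') = Bar" using Cons.prems(2) by simp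
      then have "b \<noteq> Single" using u' by auto
      then show ?thesis using Cons.prems(1) u' Multi by (cases b) auto
    qed
    then show ?case using Cons.IH[of v] Cons.prems u' by (auto split: if_splits)
  qed
  moreover have "1 \<le> s ! k" if "Multi k \<in> set w \<union> set w'" for k
    using that pos Multi_in_Seqs assms by blast
  ultimately show ?thesis using assms by (simp add: Seqs_def)
qed

text \<open>The solid strand passes the barred strands one at a time, beginning with the last. Each
  crossing has \<open>Bar\<close> on its left and contributes one linear factor of the block
  polynomial.\<close>

lemma cross_left:
  assumes "length A = q" "length (A @ replicate a Bar @ Plain # B) = r"
  shows "app (klr_rep r (prod_list (map klr_psi [q..<q + a]))) (vsingle (A @ replicate a Bar @ Plain # B) g)
    = vsingle (A @ Plain # replicate a Bar @ B)
        ((\<Prod>i<a. rf_var (yv (count_list A Plain)) - rf_var (xv (count_list A Bar + i))) * (g :: 'k::field rf))"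
  using assms(2)
proof (induction a arbitrary: B g)
  case 0
  then show ?case by (simp add: oprep_hom)
next
  case (Suc a)
  let ?c = "(A @ replicate a Bar) @ Bar # Plain # B"
  have c: "A @ replicate (Suc a) Bar @ Plain # B = ?c"
    by (simp add: replicate_append_same[symmetric])
  have lc: "length ?c = r" "Suc (q + a) < length ?c" using Suc.prems assms(1) by auto
  have q: "q + a = length (A @ replicate a Bar)" "Suc (q + a) = length ((A @ replicate a Bar) @ [Bar])" using assms(1) by auto
  have n: "?c ! (q + a) = Bar" "?c ! Suc (q + a) = Plain"
    unfolding q by (simp_all add: nth_append)
  have l1: "klr.lam ?c (q + a) = xv (count_list A Bar + a)"
    unfolding q(1) klr_lam_append by simp
  have l2: "klr.lam ?c (Suc (q + a)) = yv (count_list A Plain)"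
  proof -
    have "?c = ((A @ replicate a Bar) @ [Bar]) @ Plain # B" by simp
    then show ?thesis unfolding q(2) by (simp only: klr_lam_append) simp
  qed
  have sw: "swap_at (q + a) ?c = A @ replicate a Bar @ Plain # (Bar # B)"
    unfolding q(1) swap_at_append by simp
  let ?f = "(rf_var (yv (count_list A Plain)) - rf_var (xv (count_list A Bar + a))) :: 'k rf"
  have "app (klr_rep r (klr_psi (q + a))) (vsingle ?c g) = vsingle (swap_at (q + a) ?c) (?f * g)"
    using lc n l1 l2 by (simp add: oprep_gen klr_act_simps klr.app_op_psi_vsingle klr.dpsi_def klr_kap_def)
  then have "app (klr_rep r (klr_psi (q + a))) (vsingle ?c g) = vsingle (A @ replicate a Bar @ Plain # (Bar # B)) (?f * g)"
    unfolding sw .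
  then have "app (klr_rep r (prod_list (map klr_psi [q..<q + Suc a]))) (vsingle ?c g)
    = app (klr_rep r (prod_list (map klr_psi [q..<q + a]))) (vsingle (A @ replicate a Bar @ Plain # (Bar # B)) (?f * g))"
    by (simp add: oprep_hom)
  also have "\<dots> = vsingle (A @ Plain # replicate a Bar @ Bar # B)
      ((\<Prod>i<a. rf_var (yv (count_list A Plain)) - rf_var (xv (count_list A Bar + i))) * (?f * g))"
    using Suc.prems by (intro Suc.IH) simp
  finally show ?case unfolding c by (simp add: replicate_append_same[symmetric] mult.assoc)
qed

text \<open>Every crossing in this direction has \<open>Plain\<close> on its left and hence factor
  1. The induction moves each barred strand already passed into the prefix \<open>A\<close>.\<close>

lemma cross_right:
  assumes "length A = q" "length (A @ Plain # replicate a Bar @ B) = r"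
  shows "app (klr_rep r (prod_list (map klr_psi (rev [q..<q + a])))) (vsingle (A @ Plain # replicate a Bar @ B) g)
    = vsingle (A @ replicate a Bar @ Plain # B) (g :: 'k::field rf)"
  using assms
proof (induction a arbitrary: A q)
  case 0
  then show ?case by (simp add: oprep_hom)
next
  case (Suc a)
  let ?c = "A @ Plain # Bar # replicate a Bar @ B"
  have lc: "length ?c = r" "Suc q < length ?c" using Suc.prems by auto
  have n: "?c ! q = Plain" "?c ! Suc q = Bar" using Suc.prems(1) by (auto simp: nth_append)
  have sw: "swap_at q ?c = (A @ [Bar]) @ Plain # replicate a Bar @ B"
    unfolding Suc.prems(1)[symmetric] swap_at_append by simp
  have psi: "app (klr_rep r (klr_psi q)) (vsingle ?c g) = vsingle (swap_at q ?c) g"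
    using lc n by (simp add: oprep_gen klr_act_simps klr.app_op_psi_vsingle klr.dpsi_def klr_kap_def)
  have up: "rev [q..<q + Suc a] = rev [Suc q..<Suc q + a] @ [q]"
    by (simp add: upt_conv_Cons del: upt_Suc)
  have "app (klr_rep r (prod_list (map klr_psi (rev [q..<q + Suc a])))) (vsingle ?c g)
    = app (klr_rep r (prod_list (map klr_psi (rev [Suc q..<Suc q + a])))) (vsingle ((A @ [Bar]) @ Plain # replicate a Bar @ B) g)"
    unfolding up by (simp add: oprep_hom psi sw del: upt_Suc)
  also have "\<dots> = vsingle ((A @ [Bar]) @ replicate a Bar @ Plain # B) g"
    using Suc.prems by (intro Suc.IH) auto
  finally show ?case by simp
qed

text \<open>Lets the monomial \<open>all_delta\<close> pass through divided differences in black
  variables.\<close>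

lemma web_lab_swp_all_delta: "swp (web_lab a i) (web_lab b j) (all_delta s K) = (all_delta s K :: 'k::field rf)"
proof -
  have "transpose (web_lab a i) (web_lab b j) (xv t) = xv t" for t
    by (rule transpose_apply_other) (rule web_lab_neq_xv)+
  then have t: "(\<lambda>u. transpose (web_lab a i) (web_lab b j) (xv (u :: nat))) = (\<lambda>u. xv u)" by (rule ext)
  have v: "swp (web_lab a i) (web_lab b j) (rf_var (xv u)) = (rf_var (xv u) :: 'k rf)" for u
    unfolding swp_var by (rule arg_cong[where f = rf_var]) (rule fun_cong[OF t])
  show ?thesis
    unfolding all_delta_def xdelta_def rf_perm_prod rf_perm_power v ..
qed

lemma thick_e_fixes_emb:
  assumes "w \<in> Seqs (length s) n" "all_sym s (h :: 'k::field rf)"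
  shows "app (klr_rep (sum_list s + n) (thick_e s w)) (emb s w h) = emb s w h"
proof -
  have "thick_idem s [0..<length s] (all_delta s {..<length s} * h) = all_delta s {..<length s} * h"
    by (rule thick_idem_fixes[OF _ assms(2)]) (simp add: atLeast0LessThan)
  then show ?thesis
    unfolding emb_def thick_e_acts[OF assms(1) length_expand[OF assms(1)]] by simp
qed

text \<open>The thick idempotent at the right end fixes the embedded vector, so only the crossings
  count. The four kinds of neighbouring strands give a divided difference, the block polynomial, 1
  and 0, as on the Webster side.\<close>

lemma thick_Psi_acts:
  assumes w: "w \<in> Seqs (length s) n" and p: "Suc p < length s + n" and h: "all_sym s (h :: 'k::field rf)"
  shows "app (klr_rep (sum_list s + n) (thick_Psi s p w)) (emb s w h) = emb s (swap_at p w) (web.dpsi s w p h)"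
proof -
  let ?r = "sum_list s + n" and ?f = "all_delta s {..<length s} :: 'k rf"
  have "Suc p < length w" using p length_Seqs[OF w] by simp
  then obtain A x y B where AB: "w = A @ x # y # B" "length A = p" by (rule split_at2)
  have n: "w ! p = x" "w ! Suc p = y" using AB by (auto simp: nth_append)
  have sw: "swap_at p w = A @ y # x # B" using AB swap_at_append by metis
  have st: "start s w p = length (expand s A)" using AB start_append by metis
  note fixed = thick_e_fixes_emb[OF w h]
  have cP: "count_list (expand s A) Plain = count_list A Single"
    using prefix_counts(1)[of A "x # y # B"] w AB by simp
  have lx: "web.lam w p = web_lab x (count_list A x)" unfolding AB(1) AB(2)[symmetric] by (rule web_lam_append)
  have ly: "web.lam w (Suc p) = web_lab y (count_list (A @ [x]) y)"
    using web_lam_append[of "A @ [x]" y B] AB by simp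
  have lenw: "length (expand s w) = ?r" using length_expand[OF w] .
  consider (SS) "x = Single" "y = Single" | (MS) k where "x = Multi k" "y = Single"
    | (SM) k where "x = Single" "y = Multi k" | (MM) k l where "x = Multi k" "y = Multi l"
    by (meson strand.exhaust)
  then show ?thesis
  proof cases
    case SS
    let ?c = "expand s A @ Plain # Plain # expand s B"
    have ex: "expand s w = ?c" using AB SS by simp
    let ?q = "length (expand s A)"
    have q: "Suc ?q < length ?c" "length ?c = ?r" using lenw ex by auto
    have l1: "klr.lam ?c ?q = web.lam w p" unfolding klr_lam_append lx using SS cP by simp
    have l2: "klr.lam ?c (Suc ?q) = web.lam w (Suc p)"
      using klr_lam_append[of "expand s A @ [Plain]" Plain "expand s B"] SS cP ly by simp
    have "swp (web.lam w p) (web.lam w (Suc p)) ?f = ?f" unfolding lx ly by (rule web_lab_swp_all_delta)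
    then have "dd (web.lam w p) (web.lam w (Suc p)) (?f * h) = ?f * dd (web.lam w p) (web.lam w (Suc p)) h"
      by (rule dd_sym_mult)
    moreover have "?c ! ?q = Plain" "?c ! Suc ?q = Plain" by (auto simp: nth_append)
    ultimately have "app (klr_rep ?r (klr_psi ?q)) (emb s w h) = emb s w (web.dpsi s w p h)"
      using q swap_at_same[OF q(1)] SS n
      by (simp add: emb_def ex oprep_gen klr_act_simps klr.app_op_psi_vsingle klr.dpsi_def l1 l2 web.dpsi_def)
    moreover have "swap_at p w = w" using sw AB SS by simp
    ultimately show ?thesis using SS n fixed by (simp add: thick_Psi_def Let_def st oprep_hom)
  next
    case MS
    have cB: "count_list (expand s A) Bar = offset s k"
      using prefix_counts(2)[of A "x # y # B" s n k "y # B"] w AB MS by simp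
    have ex: "expand s w = expand s A @ replicate (s ! k) Bar @ Plain # expand s B" using AB MS by simp
    have ex': "expand s (swap_at p w) = expand s A @ Plain # replicate (s ! k) Bar @ expand s B" using sw MS by simp
    have kap: "web.dpsi s w p h = (\<Prod>i<s ! k. rf_var (yv (count_list (expand s A) Plain)) - rf_var (xv (count_list (expand s A) Bar + i))) * h"
    proof -
      have "qpoly (block s k) (rf_var (yv (count_list A Single)))
        = (\<Prod>i<s ! k. rf_var (yv (count_list A Single)) - rf_var (xv (offset s k + i)) :: 'k rf)"
        unfolding qpoly_def
        by (rule prod.reindex_bij_witness[of _ "\<lambda>i. offset s k + i" "\<lambda>t. t - offset s k"]) auto
      then show ?thesis using n MS ly cP cB by (simp add: web.dpsi_def web_kap_def)
    qed
    have "app (klr_rep ?r (prod_list (map klr_psi [length (expand s A)..<length (expand s A) + s ! k]))) (emb s w h)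
      = emb s (swap_at p w) (web.dpsi s w p h)"
      unfolding emb_def ex ex' kap
      by (subst cross_left) (use lenw ex in \<open>auto simp: mult.left_commute\<close>)
    then show ?thesis using MS n fixed by (simp add: thick_Psi_def Let_def st oprep_hom)
  next
    case SM
    have ex: "expand s w = expand s A @ Plain # replicate (s ! k) Bar @ expand s B" using AB SM by simp
    have ex': "expand s (swap_at p w) = expand s A @ replicate (s ! k) Bar @ Plain # expand s B" using sw SM by simp
    have "app (klr_rep ?r (prod_list (map klr_psi (rev [length (expand s A)..<length (expand s A) + s ! k])))) (emb s w h)
      = emb s (swap_at p w) (web.dpsi s w p h)"
      unfolding emb_def ex ex'
      by (subst cross_right) (use lenw ex SM n in \<open>auto simp: web.dpsi_def web_kap_def\<close>)
    then show ?thesis using SM n fixed by (simp add: thick_Psi_def Let_def st oprep_hom)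
  next
    case MM
    have "k \<noteq> l" using distinct_reds[OF w p] n MM by auto
    then have "web.dpsi s w p h = 0" using MM n by (simp add: web.dpsi_def web_kap_def)
    then show ?thesis using MM n by (simp add: thick_Psi_def Let_def emb_def oprep_hom)
  qed
qed

lemma thick_y_acts:
  assumes w: "w \<in> Seqs (length s) n" and p: "p < length s + n" and h: "all_sym s (h :: 'k::field rf)"
  shows "app (klr_rep (sum_list s + n) (thick_y s p w)) (emb s w h)
    = emb s w ((if w ! p = Single then web.lv w p else 0) * h)"
proof (cases "w ! p")
  case Single
  have "p < length w" using p length_Seqs[OF w] by simp
  then obtain A B where AB: "w = A @ Single # B" "length A = p" using split_at[of p w] Single by auto
  let ?q = "length (expand s A)"
  have st: "start s w p = ?q" using AB start_append by metis
  have "klr.lam (expand s w) ?q = web.lam w p"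
    using klr_lam_append[of "expand s A" Plain "expand s B"] web_lam_append[of A Single B]
      prefix_counts(1)[of A "Single # B" s n] w AB by simp
  moreover have "?q < sum_list s + n" using length_expand[OF w] AB by simp
  ultimately have "app (klr_rep (sum_list s + n) (klr_x ?q)) (emb s w h) = emb s w (web.lv w p * h)"
    using length_expand[OF w] by (simp add: emb_def oprep_gen klr_act_simps mult.left_commute)
  then show ?thesis using Single thick_e_fixes_emb[OF w h] by (simp add: thick_y_def st oprep_hom)
next
  case (Multi k)
  then show ?thesis by (simp add: thick_y_def oprep_hom emb_def)
qed

lemma inj_on_shift:
  assumes "\<And>x. x \<in> U \<Longrightarrow> b \<le> x"
  shows "inj_on (\<lambda>t. a + (t - b)) (U :: nat set)"
proof (rule inj_onI)
  fix x y assume "x \<in> U" "y \<in> U" "a + (x - b) = a + (y - b)"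
  then show "x = y" using assms[of x] assms[of y] by linarith
qed

lemma Multi_position:
  assumes w: "w \<in> Seqs m n" and k: "k < m"
  shows "length (takeWhile (\<lambda>a. a \<noteq> Multi k) w) < length w"
    and "w ! length (takeWhile (\<lambda>a. a \<noteq> Multi k) w) = Multi k"
proof -
  have "Multi k \<in> set (map Multi [0..<m])" using k by simp
  then have "Multi k \<in> set (filter (\<lambda>a. a \<noteq> Single) w)" using w by (simp add: Seqs_def)
  then have "Multi k \<in> set w" by simp
  then obtain A B where AB: "w = A @ Multi k # B" "Multi k \<notin> set A" by (meson split_list_first)
  have "takeWhile (\<lambda>a. a \<noteq> Multi k) w = A"
    unfolding AB(1) using AB(2) by (subst takeWhile_append2) auto
  then show "length (takeWhile (\<lambda>a. a \<noteq> Multi k) w) < length w"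
    and "w ! length (takeWhile (\<lambda>a. a \<noteq> Multi k) w) = Multi k" by (simp_all add: AB(1))
qed

text \<open>Positions in the expansion and barred indices differ by a shift within a block, and this
  shift matches the subsets in the two elementary symmetric sums.\<close>

lemma thick_E_acts:
  assumes w: "w \<in> Seqs (length s) n" and k: "k < length s" and h: "all_sym s (h :: 'k::field rf)"
  shows "app (klr_rep (sum_list s + n) (thick_E s k d w)) (emb s w h) = emb s w (esym (block s k) d * h)"
proof -
  define p where "p = length (takeWhile (\<lambda>a. a \<noteq> Multi k) w)"
  have p: "p < length w" "w ! p = Multi k" unfolding p_def by (rule Multi_position[OF w k])+
  let ?q = "start s w p" and ?r = "sum_list s + n"
  note blk = thick_block_acts[OF w p]
  have mono: "app (klr_rep ?r (prod_list (map klr_x l))) (emb s w g)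
    = emb s w (prod_list (map (\<lambda>t. rf_var (xv (offset s k + (t - ?q)))) l) * g)"
    if "set l \<subseteq> {?q..<?q + s ! k}" for l and g :: "'k rf"
    using that
  proof (induction l)
    case (Cons t l)
    then have "klr.lam (expand s w) t = xv (offset s k + (t - ?q))" "t < ?r"
      using blk(4)[of "t - ?q"] blk(3) by auto
    then show ?case using Cons length_expand[OF w]
      by (simp add: oprep_hom oprep_gen klr_act_simps emb_def mult_ac)
  qed (simp add: oprep_hom)
  let ?m = "\<lambda>U. \<Prod>t\<in>U. rf_var (xv (offset s k + (t - ?q))) :: 'k rf"
  have one: "app (klr_rep ?r (prod_list (map klr_x (sorted_list_of_set U)))) (emb s w h) = emb s w (?m U * h)"
    if "U \<subseteq> {?q..<?q + s ! k}" for U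
  proof -
    have fin: "finite U" using that finite_subset by blast
    have "prod_list (map (\<lambda>t. rf_var (xv (offset s k + (t - ?q)))) (sorted_list_of_set U)) = ?m U"
      using fin prod.distinct_set_conv_list[of "sorted_list_of_set U" "\<lambda>t. rf_var (xv (offset s k + (t - ?q))) :: 'k rf"] by simp
    then show ?thesis using mono[of "sorted_list_of_set U" h] that fin by simp
  qed
  have sum: "app (klr_rep ?r (elem_sym {?q..<?q + s ! k} d)) (emb s w h)
    = emb s w ((\<Sum>U | U \<subseteq> {?q..<?q + s ! k} \<and> card U = d. ?m U) * h)"
    unfolding elem_sym_def oprep_hom app_sum using one
    by (simp add: emb_def sum_distrib_left sum_distrib_right vsingle_sum)
  have "(\<Sum>U | U \<subseteq> {?q..<?q + s ! k} \<and> card U = d. ?m U) = esym (block s k) d"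
    unfolding esym_def
  proof (rule sum.reindex_bij_witness[of _ "\<lambda>V. (\<lambda>t. ?q + (t - offset s k)) ` V" "\<lambda>U. (\<lambda>t. offset s k + (t - ?q)) ` U"])
    fix U assume U: "U \<in> {U. U \<subseteq> {?q..<?q + s ! k} \<and> card U = d}"
    have ge: "x \<in> U \<Longrightarrow> ?q \<le> x \<and> x < ?q + s ! k" for x using U by auto
    have inj: "inj_on (\<lambda>t. offset s k + (t - ?q)) U" by (rule inj_on_shift) (use ge in blast)
    show "(\<lambda>t. ?q + (t - offset s k)) ` (\<lambda>t. offset s k + (t - ?q)) ` U = U"
      using ge by (simp add: image_image cong: image_cong)
    have im: "x \<in> U \<Longrightarrow> offset s k + (x - ?q) \<in> block s k" for x using ge[of x] by (simp, linarith)
    show "(\<lambda>t. offset s k + (t - ?q)) ` U \<in> {U. U \<subseteq> block s k \<and> card U = d}"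
      using U im card_image[OF inj] by (simp add: image_subset_iff del: atLeastLessThan_iff)
    show "(\<Prod>t\<in>(\<lambda>t. offset s k + (t - ?q)) ` U. rf_var (xv t)) = ?m U"
      using inj by (simp add: prod.reindex)
  next
    fix V assume V: "V \<in> {U. U \<subseteq> block s k \<and> card U = d}"
    have ge: "x \<in> V \<Longrightarrow> offset s k \<le> x \<and> x < offset s k + s ! k" for x using V by auto
    have inj: "inj_on (\<lambda>t. ?q + (t - offset s k)) V" by (rule inj_on_shift) (use ge in blast)
    show "(\<lambda>t. offset s k + (t - ?q)) ` (\<lambda>t. ?q + (t - offset s k)) ` V = V"
      using ge by (simp add: image_image cong: image_cong)
    have im: "x \<in> V \<Longrightarrow> ?q + (x - offset s k) \<in> {?q..<?q + s ! k}" for x using ge[of x] by (simp, linarith)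
    show "(\<lambda>t. ?q + (t - offset s k)) ` V \<in> {U. U \<subseteq> {?q..<?q + s ! k} \<and> card U = d}"
      using V im card_image[OF inj] by (simp add: image_subset_iff del: atLeastLessThan_iff)
  qed
  then show ?thesis
    using sum thick_e_fixes_emb[OF w h] by (simp add: thick_E_def Let_def p_def[symmetric] oprep_hom)
qed

section \<open>The intertwining map\<close>

lemma all_sym_0: "all_sym s 0"
  and all_sym_1: "all_sym s 1"
  and all_sym_const: "all_sym s (rf_const a)"
  and all_sym_add: "all_sym s g \<Longrightarrow> all_sym s h \<Longrightarrow> all_sym s (g + h)"
  and all_sym_uminus: "all_sym s g \<Longrightarrow> all_sym s (- g)"
  and all_sym_mult: "all_sym s g \<Longrightarrow> all_sym s h \<Longrightarrow> all_sym s (g * h)"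
  by (simp_all add: all_sym_def block_sym_def rf_perm_hom)

lemma all_sym_power: "all_sym s g \<Longrightarrow> all_sym s (g ^ k)"
  by (induction k) (auto intro: all_sym_1 all_sym_mult)

lemma all_sym_sum: "(\<And>i. i \<in> A \<Longrightarrow> all_sym s (f i)) \<Longrightarrow> all_sym s (sum f A)"
  by (induction A rule: infinite_finite_induct) (auto intro: all_sym_0 all_sym_add)

lemma all_sym_prod_list: "(\<And>x. x \<in> set xs \<Longrightarrow> all_sym s x) \<Longrightarrow> all_sym s (prod_list xs)"
  by (induction xs) (auto intro: all_sym_1 all_sym_mult)

lemma all_sym_web_lab: "all_sym s (rf_var (web_lab a j) :: 'k::field rf)"
proof -
  have "swp (xv t) (xv u) (rf_var (web_lab a j)) = (rf_var (web_lab a j) :: 'k rf)" for t u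
    unfolding swp_var by (rule arg_cong[where f = rf_var]) (rule transpose_apply_other; rule web_lab_neq_xv)
  then show ?thesis unfolding all_sym_def block_sym_def by blast
qed

lemma all_sym_lv: "all_sym s (web.lv w p)"
  unfolding web.lam_def by (rule all_sym_web_lab)

lemma all_sym_dd:
  assumes "all_sym s h"
  shows "all_sym s (dd (web_lab a i) (web_lab b j) (h :: 'k::field rf))"
proof -
  have "{xv t, xv u} \<inter> {web_lab a i, web_lab b j} = {}" for t u by simp
  then have "swp (xv t) (xv u) (dd (web_lab a i) (web_lab b j) h) = dd (web_lab a i) (web_lab b j) (swp (xv t) (xv u) h)" for t u
    by (rule swp_dd_commute)
  then show ?thesis using assms unfolding all_sym_def block_sym_def by metis
qed

lemma all_sym_esym:
  assumes k: "k < length s"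
  shows "all_sym s (esym (block s k) d :: 'k::field rf)"
  unfolding all_sym_def block_sym_def
proof (intro allI impI)
  fix l i assume l: "l < length s" "Suc i < s ! l"
  let ?h = "transpose (offset s l + i) (Suc (offset s l + i))"
  have t: "transpose (xv a) (xv b) (xv t) = xv (transpose a b t)" for a b t :: nat
    by (auto simp: transpose_def)
  have b: "bij (transpose a b)" for a b :: nat by simp
  have "offset s l + i \<in> block s k \<longleftrightarrow> Suc (offset s l + i) \<in> block s k"
  proof (cases "l = k")
    case True
    then show ?thesis using l by simp
  next
    case False
    have "offset s l + i \<in> block s l" "Suc (offset s l + i) \<in> block s l" using l by simp_all
    then show ?thesis using block_disjoint[OF l(1) k False] by blast
  qed
  then have im: "?h ` block s k = block s k" by (rule transpose_image_eq)
  show "bar_swp (offset s l + i) (esym (block s k) d :: 'k rf) = esym (block s k) d"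
    by (rule rf_perm_esym[OF b t b im])
qed

lemma all_sym_qpoly: "k < length s \<Longrightarrow> all_sym s y \<Longrightarrow> all_sym s (qpoly (block s k) (y :: 'k::field rf))"
  unfolding qpoly_expand[OF finite_atLeastLessThan]
  by (intro all_sym_sum all_sym_mult all_sym_power all_sym_uminus all_sym_1 all_sym_esym)

text \<open>The divided differences involve no barred variable, and the factors of mixed crossings
  are constants or block polynomials, which are symmetric themselves.\<close>

lemma all_sym_dpsi:
  assumes w: "w \<in> Seqs (length s) n" and p: "Suc p < length s + n" and h: "all_sym s h"
  shows "all_sym s (web.dpsi s w p (h :: 'k::field rf))"
proof -
  have red: "k < length s" if "w ! p = Multi k" for k
    using Multi_in_Seqs[OF w] length_Seqs[OF w] p that by (metis Suc_lessD nth_mem)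
  have "all_sym s (web_kap s (w ! p) (w ! Suc p) (web.lv w p) (web.lv w (Suc p)) :: 'k rf)"
  proof (cases "w ! p")
    case Single
    then show ?thesis by (simp add: web_kap_def all_sym_1)
  next
    case (Multi k)
    have "all_sym s (qpoly (block s k) (web.lv w (Suc p)) :: 'k rf)"
      by (rule all_sym_qpoly[OF red[OF Multi] all_sym_lv])
    then show ?thesis using Multi by (simp add: web_kap_def all_sym_0 split: strand.split)
  qed
  then show ?thesis
    using h all_sym_dd[OF h] by (auto simp: web.dpsi_def web.lam_def intro: all_sym_mult)
qed

definition symvec :: "nat list \<Rightarrow> nat \<Rightarrow> (strand list \<Rightarrow> 'k::field rf) \<Rightarrow> bool" where
  "symvec s n v \<longleftrightarrow> supported (Seqs (length s) n) v \<and> (\<forall>w. all_sym s (v w))"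

definition iota :: "nat list \<Rightarrow> nat \<Rightarrow> (strand list \<Rightarrow> 'k::field rf) \<Rightarrow> colour list \<Rightarrow> 'k rf" where
  "iota s n v = (\<lambda>c. \<Sum>w\<in>Seqs (length s) n. emb s w (v w) c)"

lemma symvec_vsingle: "w \<in> Seqs (length s) n \<Longrightarrow> all_sym s h \<Longrightarrow> symvec s n (vsingle w h)"
  by (auto simp: symvec_def supported_def vsingle_def all_sym_0)

lemma symvec_web_act:
  assumes v: "symvec s n (v :: _ \<Rightarrow> 'k::field rf)"
  shows "symvec s n (app (web_act s n g) v)"
proof -
  have sym: "all_sym s (v w)" for w using v by (simp add: symvec_def)
  have 0: "w \<notin> Seqs (length s) n \<Longrightarrow> v w = 0" for w using v by (simp add: symvec_def supported_def)
  have "all_sym s (app (web_act s n g) v w)" for w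
  proof (cases g)
    case (WE u)
    then show ?thesis by (auto simp: web_act_def app_op_proj vsingle_def all_sym_0 sym)
  next
    case (WY p)
    then show ?thesis
      by (auto simp: web_act_def app_op_mult all_sym_0 intro!: all_sym_mult all_sym_lv sym)
  next
    case (WEl k d)
    then show ?thesis by (auto simp: web_act_def app_op_mult all_sym_0 intro!: all_sym_mult all_sym_esym sym)
  next
    case (WPsi p)
    have "all_sym s (web.dpsi s (swap_at p w) p (v (swap_at p w)))" if "Suc p < length s + n"
      using all_sym_dpsi[OF _ that sym] 0[of "swap_at p w"] by (cases "swap_at p w \<in> Seqs (length s) n") (auto simp: all_sym_0)
    then show ?thesis using WPsi by (auto simp: web_act_def web.app_op_psi all_sym_0)
  qed
  then show ?thesis using v supported_web_act by (auto simp: symvec_def)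
qed

lemma emb_0 [simp]: "emb s w 0 = (\<lambda>_. 0)"
  by (simp add: emb_def)

lemma iota_0 [simp]: "iota s n (\<lambda>_. 0) = (\<lambda>_. 0)"
  by (simp add: iota_def)

lemma iota_add: "iota s n (\<lambda>w. u w + v w) = (\<lambda>c. iota s n u c + iota s n v c)"
  by (simp add: iota_def emb_def distrib_left vsingle_add sum.distrib)

lemma iota_scal: "iota s n (\<lambda>w. a * v w) = (\<lambda>c. a * iota s n v c)"
  by (simp add: iota_def emb_def mult.left_commute[of _ a] vsingle_scal sum_distrib_left)

lemma iota_sum: "iota s n (\<lambda>w. \<Sum>i\<in>A. f i w) = (\<lambda>c. \<Sum>i\<in>A. iota s n (f i) c)"
  by (induction A rule: infinite_finite_induct) (simp_all add: iota_add)

lemma iota_vsingle: "w \<in> Seqs (length s) n \<or> h = 0 \<Longrightarrow> iota s n (vsingle w h) = emb s w (h :: 'k::field rf)"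
proof (cases "w \<in> Seqs (length s) n")
  case True
  have "(\<Sum>u\<in>Seqs (length s) n. emb s u (vsingle w h u) c) = (\<Sum>u\<in>Seqs (length s) n. if u = w then emb s w h c else 0)" for c
    by (rule sum.cong) (auto simp: vsingle_def)
  then show ?thesis using True finite_Seqs by (simp add: iota_def)
qed auto

lemma intertwine:
  assumes "\<And>w h. w \<in> Seqs (length s) n \<Longrightarrow> all_sym s h \<Longrightarrow> app T (emb s w h) = iota s n (app Q (vsingle w h))"
    and v: "symvec s n (v :: _ \<Rightarrow> 'k::field rf)"
  shows "app T (iota s n v) = iota s n (app Q v)"
proof -
  let ?S = "Seqs (length s) n"
  have "app T (iota s n v) = (\<lambda>c. \<Sum>w\<in>?S. app T (emb s w (v w)) c)"
    unfolding iota_def by (rule app_vec_sum)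
  also have "\<dots> = (\<lambda>c. \<Sum>w\<in>?S. iota s n (app Q (vsingle w (v w))) c)"
    using assms by (simp add: symvec_def)
  also have "\<dots> = iota s n (app Q (\<lambda>d. \<Sum>w\<in>?S. vsingle w (v w) d))"
    unfolding app_vec_sum iota_sum ..
  also have "(\<lambda>d. \<Sum>w\<in>?S. vsingle w (v w) d) = v"
    using vec_eq_sum_vsingle[OF finite_Seqs[of "length s" n], of v] v by (simp add: symvec_def supported_def)
  finally show ?thesis .
qed

text \<open>Components of different sequences cannot overlap by \<open>expand_inj\<close>, and
  multiplication by \<open>all_delta\<close> is injective because that monomial is nonzero.\<close>

lemma iota_inj:
  assumes "n = 0 \<or> (\<forall>k<length s. 1 \<le> s ! k)" "supported (Seqs (length s) n) v"
    and 0: "iota s n v = (\<lambda>_. 0 :: 'k::field rf)"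
  shows "v = (\<lambda>_. 0)"
proof
  fix w
  show "v w = 0"
  proof (cases "w \<in> Seqs (length s) n")
    case True
    have "0 = iota s n v (expand s w)" using 0 by simp
    also have "\<dots> = (\<Sum>u\<in>Seqs (length s) n. if u = w then all_delta s {..<length s} * v w else 0)"
      unfolding iota_def
    proof (rule sum.cong[OF HOL.refl])
      fix u assume u: "u \<in> Seqs (length s) n"
      show "emb s u (v u) (expand s w) = (if u = w then all_delta s {..<length s} * v w else 0)"
        using expand_inj[OF assms(1) True u] by (auto simp: emb_def vsingle_def)
    qed
    also have "\<dots> = all_delta s {..<length s} * v w" using True finite_Seqs by simp
    finally show ?thesis using all_delta_nonzero[of s "{..<length s}", where 'k = 'k] by simp
  qed (use assms(2) in \<open>simp add: supported_def\<close>)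
qed

section \<open>The map of free algebras\<close>

lemma start_bound:
  assumes "w \<in> Seqs (length s) n" "p < length w"
  shows "start s w p + length (expand_strand s (w ! p)) \<le> sum_list s + n"
proof -
  obtain A B where AB: "w = A @ w ! p # B" "length A = p" using split_at[OF assms(2)] by blast
  then have st: "start s w p = length (expand s A)" using start_append by metis
  have "length (expand s (A @ w ! p # B)) = sum_list s + n" using length_expand[OF assms(1)] AB by simp
  then show ?thesis unfolding st by simp
qed

lemma start_bound_Suc:
  assumes "w \<in> Seqs (length s) n" "Suc p < length w"
  shows "start s w p + length (expand_strand s (w ! p)) + length (expand_strand s (w ! Suc p)) \<le> sum_list s + n"
proof -
  obtain A x y B where AB: "w = A @ x # y # B" "length A = p" using assms(2) by (rule split_at2)
  then have st: "start s w p = length (expand s A)" "w ! p = x" "w ! Suc p = y"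
    using start_append by (metis, auto simp: nth_append)
  have "length (expand s (A @ x # y # B)) = sum_list s + n" using length_expand[OF assms(1)] AB by simp
  then show ?thesis unfolding st by simp
qed

lemma klr_prod_carrier:
  "set l \<subseteq> {..<r} \<Longrightarrow> prod_list (map klr_x l) \<in> fcarrier (klr_gens r)"
  "(\<And>j. j \<in> set l \<Longrightarrow> Suc j < r) \<Longrightarrow> prod_list (map klr_psi l) \<in> fcarrier (klr_gens r)"
  by (rule fcarrier_prod_list, auto simp: klr_gens_def)+

lemma block_idem_carrier: "q + a \<le> r \<Longrightarrow> block_idem q a \<in> fcarrier (klr_gens r)"
  unfolding block_idem_def
proof (intro fcarrier_mult klr_prod_carrier(2))
  assume "q + a \<le> r"
  note le = this
  show "prod_list (map (\<lambda>j. klr_x (q + j) ^ (a - 1 - j)) [0..<a]) \<in> fcarrier (klr_gens r)"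
  proof (intro fcarrier_prod_list)
    fix x assume "x \<in> set (map (\<lambda>j. klr_x (q + j) ^ (a - 1 - j)) [0..<a])"
    then obtain j where j: "j < a" "x = klr_x (q + j) ^ (a - 1 - j)" by auto
    have "KX (q + j) \<in> klr_gens r" using j(1) le by (simp add: klr_gens_def)
    then show "x \<in> fcarrier (klr_gens r)" unfolding j(2) by (rule fcarrier_power[OF fcarrier_fgen])
  qed
  show "Suc j < r" if "j \<in> set (longest_word q a)" for j
    using that \<open>q + a \<le> r\<close> longest_word_letters[of a] unfolding longest_word_shift[of q a] by auto
qed

lemma thick_e_carrier:
  assumes w: "w \<in> Seqs (length s) n"
  shows "thick_e s w \<in> fcarrier (klr_gens (sum_list s + n))"
  unfolding thick_e_def
proof (intro fcarrier_mult fcarrier_prod_list)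
  show "klr_e (expand s w) \<in> fcarrier (klr_gens (sum_list s + n))"
    using length_expand[OF w] by (auto simp: klr_gens_def)
  fix x assume "x \<in> set (map (\<lambda>p. case w ! p of Single \<Rightarrow> 1 | Multi k \<Rightarrow> block_idem (start s w p) (s ! k)) [0..<length w])"
  then obtain p where p: "p < length w" "x = (case w ! p of Single \<Rightarrow> 1 | Multi k \<Rightarrow> block_idem (start s w p) (s ! k))" by auto
  then show "x \<in> fcarrier (klr_gens (sum_list s + n))"
    using start_bound[OF w p(1)] block_idem_carrier by (cases "w ! p") auto
qed

lemma elem_sym_carrier: "q + a \<le> r \<Longrightarrow> elem_sym {q..<q + a} d \<in> fcarrier (klr_gens r)"
  unfolding elem_sym_def
proof (intro fcarrier_sum klr_prod_carrier(1))
  fix U assume "q + a \<le> r" "U \<in> {U. U \<subseteq> {q..<q + a} \<and> card U = d}"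
  moreover from this have "finite U" using finite_subset by blast
  ultimately show "set (sorted_list_of_set U) \<subseteq> {..<r}" by auto
qed

text \<open>Every thick generator is a sum of elements that end in a thick idempotent on the right.
  This alone makes such an element vanish on the expansions of other sequences and absorb the sum of
  the thick idempotents.\<close>

definition factors :: "nat list \<Rightarrow> nat \<Rightarrow> strand list \<Rightarrow> ('k::field, klr_gen) free_alg \<Rightarrow> bool" where
  "factors s n w x \<longleftrightarrow> (\<exists>a\<in>fcarrier (klr_gens (sum_list s + n)). x = a * thick_e s w)"

lemma factorsI: "a \<in> fcarrier (klr_gens (sum_list s + n)) \<Longrightarrow> factors s n w (a * thick_e s w)"
  by (auto simp: factors_def)

lemma factors_0: "factors s n w 0"
  using factorsI[OF fcarrier_0] by simp

lemma factors_thick: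
  assumes w: "w \<in> Seqs (length s) n"
  shows "factors s n w (thick_e s w :: ('k::field, _) free_alg)"
    and "p < length s + n \<Longrightarrow> factors s n w (thick_y s p w :: ('k, _) free_alg)"
    and "k < length s \<Longrightarrow> factors s n w (thick_E s k d w :: ('k, _) free_alg)"
    and "Suc p < length s + n \<Longrightarrow> factors s n w (thick_Psi s p w :: ('k, _) free_alg)"
proof -
  show "factors s n w (thick_e s w :: ('k, _) free_alg)" using factorsI[OF fcarrier_1] by simp
  show "factors s n w (thick_y s p w :: ('k, _) free_alg)" if p: "p < length s + n"
  proof (cases "w ! p")
    case Single
    have "p < length w" using p length_Seqs[OF w] by simp
    then have "start s w p < sum_list s + n" using start_bound[OF w] Single by fastforce
    then show ?thesis using Single by (auto simp: thick_y_def klr_gens_def intro!: factorsI)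
  qed (simp add: thick_y_def factors_0)
  show "factors s n w (thick_E s k d w :: ('k, _) free_alg)" if k: "k < length s"
  proof -
    define p where "p = length (takeWhile (\<lambda>a. a \<noteq> Multi k) w)"
    have p: "p < length w" "w ! p = Multi k" unfolding p_def by (rule Multi_position[OF w k])+
    then have "start s w p + s ! k \<le> sum_list s + n" using start_bound[OF w p(1)] by simp
    then show ?thesis unfolding thick_E_def Let_def p_def[symmetric] by (intro factorsI elem_sym_carrier)
  qed
  show "factors s n w (thick_Psi s p w :: ('k, _) free_alg)" if p: "Suc p < length s + n"
  proof -
    have "Suc p < length w" using p length_Seqs[OF w] by simp
    note b = start_bound_Suc[OF w this]
    show ?thesis
    proof (cases "w ! p"; cases "w ! Suc p")
      assume "w ! p = Single" "w ! Suc p = Single"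
      then show ?thesis using b by (auto simp: thick_Psi_def Let_def klr_gens_def intro!: factorsI)
    next
      fix k assume "w ! p = Single" "w ! Suc p = Multi k"
      then show ?thesis using b by (auto simp: thick_Psi_def Let_def intro!: factorsI klr_prod_carrier(2))
    next
      fix k assume "w ! p = Multi k" "w ! Suc p = Single"
      then show ?thesis using b by (auto simp: thick_Psi_def Let_def intro!: factorsI klr_prod_carrier(2))
    qed (simp add: thick_Psi_def factors_0)
  qed
qed

lemma factors_carrier: "w \<in> Seqs (length s) n \<Longrightarrow> factors s n w x \<Longrightarrow> x \<in> fcarrier (klr_gens (sum_list s + n))"
  using thick_e_carrier by (auto simp: factors_def intro!: fcarrier_mult)

text \<open>The value 0 outside \<open>web_gens s n\<close> parallels \<open>web_act\<close>, so
  equivariance holds for every generator of the type and inductions over the free algebra carry no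
  side condition.\<close>

definition thick_gen :: "nat list \<Rightarrow> nat \<Rightarrow> web_gen \<Rightarrow> ('k::field, klr_gen) free_alg" where
  "thick_gen s n g = (if g \<notin> web_gens s n then 0 else case g of
      WE w \<Rightarrow> thick_e s w
    | WY p \<Rightarrow> \<Sum>w\<in>Seqs (length s) n. thick_y s p w
    | WEl k d \<Rightarrow> \<Sum>w\<in>Seqs (length s) n. thick_E s k d w
    | WPsi p \<Rightarrow> \<Sum>w\<in>Seqs (length s) n. thick_Psi s p w)"

lemma SC_generators_eq: "SC_generators s n = thick_gen s n ` web_gens s n"
proof
  show "SC_generators s n \<subseteq> thick_gen s n ` web_gens s n"
  proof
    fix x assume "x \<in> SC_generators s n"
    then consider w where "w \<in> Seqs (length s) n" "x = thick_e s w"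
      | p where "p < length s + n" "x = (\<Sum>w\<in>Seqs (length s) n. thick_y s p w)"
      | k d where "k < length s" "1 \<le> d" "d \<le> s ! k" "x = (\<Sum>w\<in>Seqs (length s) n. thick_E s k d w)"
      | p where "Suc p < length s + n" "x = (\<Sum>w\<in>Seqs (length s) n. thick_Psi s p w)"
      by (auto simp: SC_generators_def Let_def)
    then show "x \<in> thick_gen s n ` web_gens s n"
    proof cases
      case (1 w)
      then show ?thesis by (intro image_eqI[of _ _ "WE w"]) (auto simp: thick_gen_def web_gens_def)
    next
      case (2 p)
      then show ?thesis by (intro image_eqI[of _ _ "WY p"]) (auto simp: thick_gen_def web_gens_def)
    next
      case (3 k d)
      then show ?thesis by (intro image_eqI[of _ _ "WEl k d"]) (auto simp: thick_gen_def web_gens_def)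
    next
      case (4 p)
      then show ?thesis by (intro image_eqI[of _ _ "WPsi p"]) (auto simp: thick_gen_def web_gens_def)
    qed
  qed
  show "thick_gen s n ` web_gens s n \<subseteq> SC_generators s n"
  proof (rule image_subsetI)
    fix g assume g: "g \<in> web_gens s n"
    show "thick_gen s n g \<in> SC_generators s n"
    proof (cases g)
      case (WE w)
      then have "w \<in> Seqs (length s) n" "thick_gen s n g = thick_e s w"
        using g by (simp_all add: thick_gen_def web_gens_def)
      then show ?thesis unfolding SC_generators_def Let_def by blast
    next
      case (WY p)
      then have "p < length s + n" "thick_gen s n g = (\<Sum>w\<in>Seqs (length s) n. thick_y s p w)"
        using g by (simp_all add: thick_gen_def web_gens_def)
      then show ?thesis unfolding SC_generators_def Let_def by blast
    next
      case (WEl k d)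
      then have "k < length s" "1 \<le> d" "d \<le> s ! k" "thick_gen s n g = (\<Sum>w\<in>Seqs (length s) n. thick_E s k d w)"
        using g by (simp_all add: thick_gen_def web_gens_def)
      then show ?thesis unfolding SC_generators_def Let_def by blast
    next
      case (WPsi p)
      then have "Suc p < length s + n" "thick_gen s n g = (\<Sum>w\<in>Seqs (length s) n. thick_Psi s p w)"
        using g by (simp_all add: thick_gen_def web_gens_def)
      then show ?thesis unfolding SC_generators_def Let_def by blast
    qed
  qed
qed

lemma thick_gen_sum:
  assumes "g \<in> web_gens s n"
  obtains X :: "strand list \<Rightarrow> ('k::field, klr_gen) free_alg"
  where "\<And>w. w \<in> Seqs (length s) n \<Longrightarrow> factors s n w (X w)" "thick_gen s n g = sum X (Seqs (length s) n)"
proof (cases g)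
  case (WE u)
  then have u: "u \<in> Seqs (length s) n" using assms by (simp add: web_gens_def)
  \<comment> \<open>An idempotent generator is brought into the same form, as a sum over all
    sequences with a single nonzero term.\<close>
  show ?thesis
    using WE assms u finite_Seqs[of "length s" n] factors_thick(1)[OF u] factors_0
    by (intro that[of "\<lambda>w. if w = u then thick_e s u else 0"]) (auto simp: thick_gen_def)
next
  case (WY p)
  then show ?thesis using assms factors_thick(2)
    by (intro that[of "thick_y s p"]) (auto simp: thick_gen_def web_gens_def)
next
  case (WEl k d)
  then show ?thesis using assms factors_thick(3)
    by (intro that[of "thick_E s k d"]) (auto simp: thick_gen_def web_gens_def)
next
  case (WPsi p)
  then show ?thesis using assms factors_thick(4)
    by (intro that[of "thick_Psi s p"]) (auto simp: thick_gen_def web_gens_def)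
qed

lemma thick_gen_carrier: "(thick_gen s n g :: ('k::field, _) free_alg) \<in> fcarrier (klr_gens (sum_list s + n))"
proof (cases "g \<in> web_gens s n")
  case True
  then obtain X :: "strand list \<Rightarrow> ('k, klr_gen) free_alg"
    where "\<And>w. w \<in> Seqs (length s) n \<Longrightarrow> factors s n w (X w)" "thick_gen s n g = sum X (Seqs (length s) n)"
    by (rule thick_gen_sum) blast
  then show ?thesis by (auto intro!: fcarrier_sum intro: factors_carrier)
qed (simp add: thick_gen_def)

lemma factors_kills_other:
  assumes H: "n = 0 \<or> (\<forall>k<length s. 1 \<le> s ! k)"
    and w: "w \<in> Seqs (length s) n" "w' \<in> Seqs (length s) n" "w \<noteq> w'" and x: "factors s n w x"
  shows "app (klr_rep (sum_list s + n) x) (vsingle (expand s w') (h :: 'k::field rf)) = (\<lambda>_. 0)"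
proof -
  have "expand s w' \<noteq> expand s w" using expand_inj[OF H w(1,2)] w(3) by metis
  then show ?thesis
    using x by (auto simp: factors_def oprep_hom app_0 thick_e_acts[OF w(1) length_expand[OF w(2)]])
qed

lemma sum_factors_acts:
  assumes H: "n = 0 \<or> (\<forall>k<length s. 1 \<le> s ! k)"
    and X: "\<And>w. w \<in> Seqs (length s) n \<Longrightarrow> factors s n w (X w)" and w: "w \<in> Seqs (length s) n"
  shows "app (klr_rep (sum_list s + n) (sum X (Seqs (length s) n))) (emb s w h)
    = app (klr_rep (sum_list s + n) (X w)) (emb s w (h :: 'k::field rf))"
proof -
  let ?a = "\<lambda>u. app (klr_rep (sum_list s + n) (X u)) (emb s w h)"
  have "?a u = (\<lambda>_. 0)" if "u \<in> Seqs (length s) n" "u \<noteq> w" for u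
    unfolding emb_def by (rule factors_kills_other[OF H that(1) w that(2) X[OF that(1)]])
  then have "(\<Sum>u\<in>Seqs (length s) n. ?a u c) = (\<Sum>u\<in>Seqs (length s) n. if u = w then ?a w c else 0)" for c
    by (intro sum.cong) auto
  then show ?thesis using w finite_Seqs by (simp add: oprep_hom app_sum)
qed

lemma thick_gen_acts:
  assumes H: "n = 0 \<or> (\<forall>k<length s. 1 \<le> s ! k)"
    and w: "w \<in> Seqs (length s) n" and h: "all_sym s (h :: 'k::field rf)"
  shows "app (klr_rep (sum_list s + n) (thick_gen s n g)) (emb s w h) = iota s n (app (web_act s n g) (vsingle w h))"
proof (cases "g \<in> web_gens s n")
  case g: True
  note sum = sum_factors_acts[OF H _ w]
  show ?thesis
  proof (cases g)
    case (WE u)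
    then have u: "u \<in> Seqs (length s) n" using g by (simp add: web_gens_def)
    show ?thesis
    proof (cases "u = w")
      case True
      then show ?thesis using WE g w thick_e_fixes_emb[OF w h] by (simp add: thick_gen_def web_act_simps iota_vsingle)
    next
      case False
      then show ?thesis
        using WE g u factors_kills_other[OF H u w False factors_thick(1)[OF u]]
        by (simp add: thick_gen_def web_act_simps emb_def)
    qed
  next
    case (WY p)
    then have p: "p < length s + n" using g by (simp add: web_gens_def)
    show ?thesis
      using g w p unfolding WY
      by (simp add: thick_gen_def sum[OF factors_thick(2)[OF _ p]] thick_y_acts[OF w p h] web_act_simps iota_vsingle)
  next
    case (WEl k d)
    then have k: "k < length s" "1 \<le> d" "d \<le> s ! k" using g by (simp_all add: web_gens_def)
    have X: "factors s n u (thick_E s k d u :: ('k, _) free_alg)" if "u \<in> Seqs (length s) n" for u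
      by (rule factors_thick(3)[OF that k(1)])
    show ?thesis
      using g w k unfolding WEl
      by (simp add: thick_gen_def sum[OF X] thick_E_acts[OF w k(1) h] web_act_simps iota_vsingle)
  next
    case (WPsi p)
    then have p: "Suc p < length s + n" using g by (simp add: web_gens_def)
    \<comment> \<open>If the crossing leaves \<open>Seqs\<close>, both strands are red and the value
      is 0, the second case that \<open>iota_vsingle\<close> allows.\<close>
    have "swap_at p w \<in> Seqs (length s) n \<or> web.dpsi s w p h = 0"
    proof (cases "w ! p = Single \<or> w ! Suc p = Single")
      case True
      then show ?thesis using swap_at_Seqs[OF w p] by blast
    next
      case False
      then obtain k l where kl: "w ! p = Multi k" "w ! Suc p = Multi l" by (meson strand.exhaust)
      then have "k \<noteq> l" using distinct_reds[OF w p] by auto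
      then show ?thesis using kl by (simp add: web.dpsi_def web_kap_def)
    qed
    moreover have X: "factors s n u (thick_Psi s p u :: ('k, _) free_alg)" if "u \<in> Seqs (length s) n" for u
      by (rule factors_thick(4)[OF that p])
    ultimately show ?thesis
      using g p length_Seqs[OF w] unfolding WPsi
      by (simp add: thick_gen_def sum[OF X] thick_Psi_acts[OF w p h] web_act_simps iota_vsingle web.app_op_psi_vsingle)
  qed
next
  case False
  then show ?thesis by (cases g) (auto simp: thick_gen_def web_act_def web_gens_def oprep_hom)
qed

text \<open>The empty word goes to the unit of the whole KLR algebra, not to that of the thick
  subalgebra; \<open>thick_map\<close> corrects this.\<close>

definition thick_hom :: "nat list \<Rightarrow> nat \<Rightarrow> ('k::field, web_gen) free_alg \<Rightarrow> ('k, klr_gen) free_alg" where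
  "thick_hom s n = lift fscalar (word_prod (thick_gen s n))"

lemma monoid_algebra_hom_thick_hom:
  "monoid_algebra_hom fscalar (word_prod (thick_gen s n :: _ \<Rightarrow> ('k::field, klr_gen) free_alg))"
  by (rule monoid_algebra_hom_word) (simp_all only: fscalar_hom, rule fscalar_central)

lemmas thick_hom_hom = monoid_algebra_hom.lift_hom[OF monoid_algebra_hom_thick_hom, folded thick_hom_def]

lemma thick_hom_gen: "thick_hom s n (fgen g) = thick_gen s n g"
  using monoid_algebra_hom.lift_single[OF monoid_algebra_hom_thick_hom, of s n "Word [g]" 1]
  by (simp add: thick_hom_def fgen_def word_prod_def fscalar_hom)

lemma thick_hom_scal: "thick_hom s n (fscalar a) = fscalar a"
  using monoid_algebra_hom.lift_single[OF monoid_algebra_hom_thick_hom, of s n 0 a]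
  by (simp add: thick_hom_def fscalar_def word_prod_simps)

lemma thick_hom_carrier: "thick_hom s n p \<in> fcarrier (klr_gens (sum_list s + n))"
  by (induction p rule: free_alg_induct) (auto simp: thick_hom_hom thick_hom_gen thick_hom_scal thick_gen_carrier)

text \<open>Symmetry and equivariance are proved together, because a generator is known to be
  equivariant only on symmetric vectors.\<close>

lemma thick_hom_acts:
  assumes H: "n = 0 \<or> (\<forall>k<length s. 1 \<le> s ! k)" and v: "symvec s n (v :: _ \<Rightarrow> 'k::field rf)"
  shows "symvec s n (app (web_rep s n p) v) \<and>
    app (klr_rep (sum_list s + n) (thick_hom s n p)) (iota s n v) = iota s n (app (web_rep s n p) v)"
proof (induction p rule: free_alg_induct)
  case zero
  then show ?case by (simp add: thick_hom_hom oprep_hom symvec_def supported_def all_sym_0)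
next
  case (add p q)
  then show ?case by (simp add: thick_hom_hom oprep_hom symvec_def supported_def all_sym_add iota_add)
next
  case (scal a p)
  then show ?case
    by (simp add: thick_hom_hom thick_hom_scal oprep_scal oprep_hom symvec_def supported_def all_sym_mult all_sym_const iota_scal)
next
  case (gen g p)
  have "app (klr_rep (sum_list s + n) (thick_gen s n g)) (iota s n (app (web_rep s n p) v))
    = iota s n (app (web_act s n g) (app (web_rep s n p) v))"
    using gen by (intro intertwine thick_gen_acts[OF H]) auto
  then show ?case using gen symvec_web_act[of s n "app (web_rep s n p) v" g] by (simp add: thick_hom_hom thick_hom_gen oprep_gen oprep_hom)
next
  case one
  then show ?case using v by (simp add: thick_hom_hom oprep_hom)
qed

section \<open>The isomorphism with the thick subalgebra\<close>

text \<open>From here on, identities in the KLR algebra are checked on vectors.\<close>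

lemma klr_J_iff:
  "x \<in> klr_pres.J r \<longleftrightarrow> (\<forall>c f. length c = r \<longrightarrow> app (klr_rep r x) (vsingle c (f :: 'k::field rf)) = (\<lambda>_. 0))"
proof
  show "x \<in> klr_pres.J r \<Longrightarrow> \<forall>c f. length c = r \<longrightarrow> app (klr_rep r x) (vsingle c f) = (\<lambda>_. 0)"
    using klr_J_kills[of r] by (auto simp: killing_def)
  show "\<forall>c f. length c = r \<longrightarrow> app (klr_rep r x) (vsingle c f) = (\<lambda>_. 0) \<Longrightarrow> x \<in> klr_pres.J r"
    by (rule faithful_rep.faithful[OF klr_faithful_rep]) (simp add: oprep_def)
qed

lemma web_J_acts_0:
  assumes "p \<in> web_pres.J s n" "supported (Seqs (length s) n) (v :: _ \<Rightarrow> 'k::field rf)"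
  shows "app (web_rep s n p) v = (\<lambda>_. 0)"
proof (rule app_kills_supported[OF finite_Seqs _ assms(2)])
  show "app (web_rep s n p) (vsingle c f) = (\<lambda>_. 0)" if "c \<in> Seqs (length s) n" for c f
    using web_J_kills[of s n] assms(1) that by (auto simp: killing_def)
qed

text \<open>The test monomials of \<open>faithful\<close> consist of black and red variables and are
  therefore symmetric in all blocks. So the vectors visible on the KLR side already detect the whole
  Webster ideal.\<close>

lemma web_J_symvec:
  assumes "\<And>v :: _ \<Rightarrow> 'k::field rf. symvec s n v \<Longrightarrow> app (web_rep s n p) v = (\<lambda>_. 0)"
  shows "p \<in> web_pres.J s n"
proof (rule faithful_rep.faithful[OF web_faithful_rep])
  fix c l assume c: "c \<in> Seqs (length s) n"
  have "all_sym s (web.lmono c id l :: 'k rf)"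
    unfolding web.lmono_def by (rule all_sym_prod_list) (auto simp: all_sym_lv)
  from assms[OF symvec_vsingle[OF c this]]
  show "app (lift oper_scal (word_prod (web_act s n)) p) (vsingle c (web.lmono c id l)) = (\<lambda>_. 0)"
    by (simp add: oprep_def)
qed

section \<open>The thick unit and the corrected map\<close>

definition thick_unit :: "nat list \<Rightarrow> nat \<Rightarrow> ('k::field, klr_gen) free_alg" where
  "thick_unit s n = (\<Sum>w\<in>Seqs (length s) n. thick_e s w)"

lemma thick_unit_carrier: "thick_unit s n \<in> fcarrier (klr_gens (sum_list s + n))"
  unfolding thick_unit_def by (intro fcarrier_sum thick_e_carrier)

text \<open>The fixed term of type \<open>'k itself\<close> ties all lemmas of this context to one
  ground field.\<close>

context
  fixes s :: "nat list" and n :: nat and r :: nat and ground :: "'k::field itself"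
  assumes H: "n = 0 \<or> (\<forall>k<length s. 1 \<le> s ! k)"
  defines "r \<equiv> sum_list s + n"
begin

lemma thick_e_image:
  assumes w: "w \<in> Seqs (length s) n" and c: "length c = r"
  obtains h where "all_sym s h"
    "app (klr_rep r (thick_e s w)) (vsingle c f) = (if c = expand s w then emb s w h else (\<lambda>_. 0))"
proof -
  obtain h where h: "all_sym s h" "thick_idem s [0..<length s] f = all_delta s {..<length s} * h"
    by (rule thick_idem_image)
  show ?thesis
    by (rule that[OF h(1)]) (use thick_e_acts[OF w, of c f] c h(2) in \<open>simp add: emb_def r_def\<close>)
qed

lemma thick_e_orthogonal:
  assumes w: "w \<in> Seqs (length s) n" "u \<in> Seqs (length s) n" and c: "length c = r"
  shows "app (klr_rep r (thick_e s w)) (app (klr_rep r (thick_e s u)) (vsingle c f))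
    = (if u = w then app (klr_rep r (thick_e s w)) (vsingle c f) else (\<lambda>_. 0))"
proof -
  obtain h where h: "all_sym s h"
    "app (klr_rep r (thick_e s u)) (vsingle c f) = (if c = expand s u then emb s u h else (\<lambda>_. 0))"
    using thick_e_image[OF w(2) c] by blast
  have fixed: "u = w \<Longrightarrow> app (klr_rep r (thick_e s w)) (emb s u h) = emb s u h"
    using thick_e_fixes_emb[OF w(1) h(1)] by (simp add: r_def)
  have kill: "app (klr_rep r (thick_e s w)) (emb s u h) = (\<lambda>_. 0)" if "u \<noteq> w"
    unfolding emb_def r_def by (rule factors_kills_other[OF H w that[symmetric] factors_thick(1)[OF w(1)]])
  show ?thesis
  proof (cases "c = expand s u")
    case True
    then have *: "app (klr_rep r (thick_e s u)) (vsingle c f) = emb s u h" using h(2) by simp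
    show ?thesis
    proof (cases "u = w")
      case True
      then show ?thesis using fixed * by simp
    next
      case False
      then show ?thesis using kill * by simp
    qed
  next
    case False
    have *: "app (klr_rep r (thick_e s u)) (vsingle c f) = (\<lambda>_. 0)" using h(2) False by simp
    show ?thesis unfolding * app_0 using * by (cases "u = w") simp_all
  qed
qed

text \<open>At most one sequence expands to \<open>c\<close>, so at most one idempotent of the sum
  survives. Together with \<open>thick_unit_fixes\<close> this makes the thick unit a projection
  onto the embedded symmetric vectors.\<close>

lemma thick_unit_image:
  assumes c: "length c = r"
  obtains v where "symvec s n v" "app (klr_rep r (thick_unit s n)) (vsingle c f) = iota s n v"
proof (cases "\<exists>w\<in>Seqs (length s) n. expand s w = c")
  case True
  then obtain w where w: "w \<in> Seqs (length s) n" "expand s w = c" by blast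
  obtain h where h: "all_sym s h" "app (klr_rep r (thick_e s w)) (vsingle c f) = (if c = expand s w then emb s w h else (\<lambda>_. 0))"
    using thick_e_image[OF w(1) c] by blast
  have "app (klr_rep r (thick_e s u)) (vsingle c f) = (if u = w then emb s w h else (\<lambda>_. 0))" if u: "u \<in> Seqs (length s) n" for u
  proof (cases "u = w")
    case False
    have "app (klr_rep r (thick_e s u)) (vsingle (expand s w) f) = (\<lambda>_. 0)"
      unfolding r_def by (rule factors_kills_other[OF H u w(1) False factors_thick(1)[OF u]])
    then show ?thesis using w(2) False by simp
  qed (use h(2) w(2) in simp)
  then have "app (klr_rep r (thick_unit s n)) (vsingle c f) = (\<lambda>d. \<Sum>u\<in>Seqs (length s) n. if u = w then emb s w h d else 0)"
    by (auto simp: thick_unit_def oprep_hom app_sum fun_eq_iff intro!: sum.cong)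
  also have "\<dots> = iota s n (vsingle w h)" using w(1) finite_Seqs by (simp add: iota_vsingle)
  finally show ?thesis using symvec_vsingle[OF w(1) h(1)] that by blast
next
  case False
  have "app (klr_rep r (thick_e s u)) (vsingle c f) = (\<lambda>_. 0)" if u: "u \<in> Seqs (length s) n" for u
    using thick_e_acts[OF u, of c f] c False u by (auto simp: r_def)
  then have "app (klr_rep r (thick_unit s n)) (vsingle c f) = iota s n (\<lambda>_. 0)"
    by (simp add: thick_unit_def oprep_hom app_sum)
  then show ?thesis by (rule that[rotated]) (simp add: symvec_def supported_def all_sym_0)
qed

lemma thick_unit_fixes:
  assumes v: "symvec s n v"
  shows "app (klr_rep r (thick_unit s n)) (iota s n v) = iota s n v"
proof -
  have "app (klr_rep r (thick_unit s n)) (emb s w h) = iota s n (app 1 (vsingle w h))"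
    if w: "w \<in> Seqs (length s) n" and h: "all_sym s h" for w h
    using sum_factors_acts[OF H factors_thick(1) w, of h] thick_e_fixes_emb[OF w h] w
    by (simp add: thick_unit_def r_def iota_vsingle)
  from intertwine[OF this v] show ?thesis by simp
qed

text \<open>Against the idempotent at the right end of \<open>x\<close>, only the summand of
  \<open>w\<close> survives.\<close>

lemma factors_thick_unit:
  assumes w: "w \<in> Seqs (length s) n" and x: "factors s n w x" and c: "length c = r"
  shows "app (klr_rep r x) (app (klr_rep r (thick_unit s n)) (vsingle c f)) = app (klr_rep r x) (vsingle c f)"
proof -
  obtain a where a: "x = a * thick_e s w" using x by (auto simp: factors_def)
  have "app (klr_rep r (thick_e s w)) (app (klr_rep r (thick_unit s n)) (vsingle c f))
    = (\<lambda>d. \<Sum>u\<in>Seqs (length s) n. app (klr_rep r (thick_e s w)) (app (klr_rep r (thick_e s u)) (vsingle c f)) d)"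
    unfolding thick_unit_def oprep_hom app_sum app_vec_sum ..
  also have "\<dots> = (\<lambda>d. \<Sum>u\<in>Seqs (length s) n. if u = w then app (klr_rep r (thick_e s w)) (vsingle c f) d else 0)"
  proof (intro ext sum.cong HOL.refl)
    fix d u assume u: "u \<in> Seqs (length s) n"
    show "app (klr_rep r (thick_e s w)) (app (klr_rep r (thick_e s u)) (vsingle c f)) d
      = (if u = w then app (klr_rep r (thick_e s w)) (vsingle c f) d else 0)"
      unfolding thick_e_orthogonal[OF w u c] by simp
  qed
  also have "\<dots> = app (klr_rep r (thick_e s w)) (vsingle c f)" using w finite_Seqs by simp
  finally show ?thesis by (simp add: a oprep_hom)
qed

text \<open>The factor on the right first projects onto the embedded symmetric vectors, on which
  \<open>thick_hom\<close> is compared with the Webster action by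
  \<open>thick_hom_acts\<close>.\<close>

definition thick_map :: "('k, web_gen) free_alg \<Rightarrow> ('k, klr_gen) free_alg" where
  "thick_map p = thick_hom s n p * thick_unit s n"

lemma thick_map_carrier: "thick_map p \<in> fcarrier (klr_gens r)"
  unfolding thick_map_def r_def by (intro fcarrier_mult thick_hom_carrier thick_unit_carrier)

text \<open>Well-definedness and injectivity at once. An element of the Webster ideal kills the
  symmetric vectors, onto which the thick unit projects. Conversely, \<open>iota\<close> is
  injective and the symmetric vectors detect the Webster ideal.\<close>

lemma thick_map_in_J: "thick_map p \<in> klr_pres.J r \<longleftrightarrow> p \<in> web_pres.J s n"
proof
  assume p: "p \<in> web_pres.J s n"
  have "app (klr_rep r (thick_map p)) (vsingle c f) = (\<lambda>_. 0)" if "length c = r" for c f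
  proof -
    from that obtain v where v: "symvec s n v" "app (klr_rep r (thick_unit s n)) (vsingle c f) = iota s n v"
      by (rule thick_unit_image)
    then have "app (web_rep s n p) v = (\<lambda>_. 0)" using web_J_acts_0[OF p] by (simp add: symvec_def)
    then show ?thesis
      using v thick_hom_acts[OF H v(1), of p] by (simp add: thick_map_def oprep_hom r_def)
  qed
  then show "thick_map p \<in> klr_pres.J r" unfolding klr_J_iff by blast
next
  assume p: "thick_map p \<in> klr_pres.J r"
  show "p \<in> web_pres.J s n"
  proof (rule web_J_symvec)
    fix v :: "strand list \<Rightarrow> 'k rf" assume v: "symvec s n v"
    have "app (klr_rep r (thick_map p)) (iota s n v) = (\<lambda>_. 0)"
    proof (rule app_kills_supported[OF finite_length_eq])
      show "supported {c. length c = r} (iota s n v)"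
        using length_expand by (auto simp: supported_def iota_def emb_def vsingle_def r_def intro!: sum.neutral)
      show "app (klr_rep r (thick_map p)) (vsingle c f) = (\<lambda>_. 0)" if "c \<in> {c. length c = r}" for c f
        using p that unfolding klr_J_iff by blast
    qed
    then have "iota s n (app (web_rep s n p) v) = (\<lambda>_. 0)"
      using thick_hom_acts[OF H v, of p] thick_unit_fixes[OF v] by (simp add: thick_map_def oprep_hom r_def)
    moreover have "supported (Seqs (length s) n) (app (web_rep s n p) v)"
      using thick_hom_acts[OF H v, of p] by (simp add: symvec_def)
    ultimately show "app (web_rep s n p) v = (\<lambda>_. 0)" using iota_inj[OF H] by blast
  qed
qed

text \<open>Multiplicativity holds only modulo the relations: the thick unit between the two factors
  acts as the identity on the embedded symmetric vectors that the right factor produces.\<close>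

lemma thick_map_mult: "thick_map p * thick_map q - thick_map (p * q) \<in> klr_pres.J r"
proof -
  have "app (klr_rep r (thick_map p * thick_map q - thick_map (p * q))) (vsingle c f) = (\<lambda>_. 0)" if "length c = r" for c f
  proof -
  from that obtain v where v: "symvec s n v" "app (klr_rep r (thick_unit s n)) (vsingle c f) = iota s n v"
    by (rule thick_unit_image)
  have q: "symvec s n (app (web_rep s n q) v)" using thick_hom_acts[OF H v(1), of q] by blast
  have "app (klr_rep r (thick_map p * thick_map q)) (vsingle c f) = app (klr_rep r (thick_map (p * q))) (vsingle c f)"
    using v thick_hom_acts[OF H v(1), of q] thick_unit_fixes[OF q]
    by (simp add: thick_map_def oprep_hom thick_hom_hom r_def)
  then show ?thesis by (simp add: oprep_hom)
  qed
  then show ?thesis unfolding klr_J_iff by blast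
qed

lemma thick_map_gen:
  assumes "g \<in> web_gens s n"
  shows "thick_map (fgen g) - thick_gen s n g \<in> klr_pres.J r"
proof -
  have "app (klr_rep r (thick_map (fgen g) - thick_gen s n g)) (vsingle c f) = (\<lambda>_. 0)" if c: "length c = r" for c f
  proof -
  obtain X :: "strand list \<Rightarrow> ('k, klr_gen) free_alg"
    where X: "\<And>w. w \<in> Seqs (length s) n \<Longrightarrow> factors s n w (X w)" "thick_gen s n g = sum X (Seqs (length s) n)"
    using thick_gen_sum[OF assms] by blast
  have "app (klr_rep r (sum X (Seqs (length s) n))) (app (klr_rep r (thick_unit s n)) (vsingle c f)) = app (klr_rep r (sum X (Seqs (length s) n))) (vsingle c f)"
    using factors_thick_unit[OF _ X(1) c] by (simp add: oprep_hom app_sum)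
  then show ?thesis by (simp add: thick_map_def oprep_hom thick_hom_gen X(2))
  qed
  then show ?thesis unfolding klr_J_iff by blast
qed

lemma thick_map_linear:
  "thick_map (p + q) = thick_map p + thick_map q" "thick_map (p - q) = thick_map p - thick_map q"
  "thick_map (fscalar a * p) = fscalar a * thick_map p" "thick_map 0 = 0" "thick_map 1 = thick_unit s n"
  by (simp_all add: thick_map_def thick_hom_hom thick_hom_scal algebra_simps)

section \<open>The image of the map and the isomorphism\<close>

definition thick_cls :: "('k, web_gen) free_alg \<Rightarrow> ('k, klr_gen) free_alg set" where
  "thick_cls p = klr_class r (thick_map p)"

lemma thick_cls_eq_iff:
  assumes "p \<in> fcarrier (web_gens s n)" "q \<in> fcarrier (web_gens s n)"
  shows "thick_cls p = thick_cls q \<longleftrightarrow> web_pres.cls s n p = web_pres.cls s n q"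
  unfolding thick_cls_def klr_class_def klr_pres.cls_eq_iff[OF thick_map_carrier thick_map_carrier]
    web_pres.cls_eq_iff[OF assms] thick_map_linear(2)[symmetric] thick_map_in_J ..

lemma thick_cls_hom:
  "thick_cls p \<otimes>\<^bsub>KLR r\<^esub> thick_cls q = thick_cls (p * q)"
  "thick_cls p \<oplus>\<^bsub>KLR r\<^esub> thick_cls q = thick_cls (p + q)"
  "a \<odot>\<^bsub>KLR r\<^esub> thick_cls p = thick_cls (fscalar a * p)"
  "\<zero>\<^bsub>KLR r\<^esub> = thick_cls 0"
proof -
  note C = thick_map_carrier fcarrier_mult[OF thick_map_carrier thick_map_carrier]
  have "klr_class r (thick_map p * thick_map q) = klr_class r (thick_map (p * q))"
    unfolding klr_class_def klr_pres.cls_eq_iff[OF C(2) C(1)] by (rule thick_map_mult)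
  then show "thick_cls p \<otimes>\<^bsub>KLR r\<^esub> thick_cls q = thick_cls (p * q)"
    using klr_pres.PA_simps(1)[OF C(1) C(1)] by (simp add: KLR_def thick_cls_def klr_class_def)
  show "thick_cls p \<oplus>\<^bsub>KLR r\<^esub> thick_cls q = thick_cls (p + q)"
    using klr_pres.PA_simps(2)[OF C(1) C(1)] by (simp add: KLR_def thick_cls_def klr_class_def thick_map_linear)
  show "a \<odot>\<^bsub>KLR r\<^esub> thick_cls p = thick_cls (fscalar a * p)"
    using klr_pres.PA_simps(5)[OF C(1)] by (simp add: KLR_def thick_cls_def klr_class_def thick_map_linear)
  show "\<zero>\<^bsub>KLR r\<^esub> = thick_cls 0"
    using klr_pres.PA_simps(4) by (simp add: KLR_def thick_cls_def klr_class_def thick_map_linear)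
qed

lemma thick_cls_gen: "g \<in> web_gens s n \<Longrightarrow> thick_cls (fgen g) = klr_class r (thick_gen s n g)"
  unfolding thick_cls_def klr_class_def
  by (subst klr_pres.cls_eq_iff[OF thick_map_carrier]) (use thick_gen_carrier thick_map_gen in \<open>auto simp: r_def\<close>)

lemma S_C_carrier: "carrier (S_C s n) = thick_cls ` fcarrier (web_gens s n)"
proof -
  let ?span = "subalg_span (KLR r) (klr_class r ` SC_generators s n) :: ('k, klr_gen) free_alg set set"
  have gen: "thick_cls (fgen g) \<in> ?span" if "g \<in> web_gens s n" for g
    unfolding thick_cls_gen[OF that] SC_generators_eq using that by (intro subalg_span.incl) blast
  \<comment> \<open>A subalgebra span need not contain a unit; here the unit is a sum of generators.
    Partial sums allow an induction.\<close>
  have unit: "thick_cls (\<Sum>w\<in>A. web_e w) \<in> ?span" if "A \<subseteq> Seqs (length s) n" for A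
    using finite_subset[OF that finite_Seqs] that
  proof (induction A rule: finite_induct)
    case empty
    show ?case unfolding sum.empty thick_cls_hom(4)[symmetric] by (rule subalg_span.zero)
  next
    case (insert w A)
    then have "thick_cls (web_e w) \<oplus>\<^bsub>KLR r\<^esub> thick_cls (\<Sum>w\<in>A. web_e w) \<in> ?span"
      by (intro subalg_span.add gen) (auto simp: web_gens_def)
    then show ?case using insert by (simp add: thick_cls_hom)
  qed
  have carr: "(\<Sum>w\<in>Seqs (length s) n. web_e w) \<in> (fcarrier (web_gens s n) :: ('k, web_gen) free_alg set)"
    by (auto simp: web_gens_def intro!: fcarrier_sum)
  have "thick_cls (\<Sum>w\<in>Seqs (length s) n. web_e w) = thick_cls 1"
    unfolding thick_cls_eq_iff[OF carr fcarrier_1] web_pres.cls_eq_iff[OF carr fcarrier_1]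
    by (rule web_pres.J_rel[OF web_rel.unit])
  then have unit1: "thick_cls 1 \<in> ?span" using unit[of "Seqs (length s) n"] by simp
  have "?span = thick_cls ` fcarrier (web_gens s n)"
  proof
    show "?span \<subseteq> thick_cls ` fcarrier (web_gens s n)"
    proof
      fix x assume "x \<in> ?span"
      then show "x \<in> thick_cls ` fcarrier (web_gens s n)"
      proof induction
        case (incl x)
        then obtain g where "g \<in> web_gens s n" "x = klr_class r (thick_gen s n g)"
          by (auto simp: SC_generators_eq)
        then show ?case using thick_cls_gen by (intro image_eqI[of _ _ "fgen g"]) auto
      next
        case zero
        then show ?case by (auto simp: thick_cls_hom(4))
      next
        case (add x y)
        then show ?case by (auto simp: thick_cls_hom intro!: imageI fcarrier_add)
      next
        case (smult x c)
        then show ?case by (auto simp: thick_cls_hom intro!: imageI fcarrier_mult)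
      next
        case (mult x y)
        then show ?case by (auto simp: thick_cls_hom intro!: imageI fcarrier_mult)
      qed
    qed
    show "thick_cls ` fcarrier (web_gens s n) \<subseteq> ?span"
    proof (rule image_subsetI)
      fix p :: "('k, web_gen) free_alg" assume "p \<in> fcarrier (web_gens s n)"
      then show "thick_cls p \<in> ?span"
      proof (induction p rule: fcarrier_induct)
        case zero
        show ?case unfolding thick_cls_hom(4)[symmetric] by (rule subalg_span.zero)
      next
        case (add p q)
        then show ?case using subalg_span.add[OF add] by (simp add: thick_cls_hom)
      next
        case (scal a p)
        then show ?case using subalg_span.smult[OF scal] by (simp add: thick_cls_hom)
      next
        case (gen g p)
        then show ?case using subalg_span.mult[OF gen(1)[THEN \<open>\<And>g. g \<in> web_gens s n \<Longrightarrow> thick_cls (fgen g) \<in> ?span\<close>] gen(2)]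
          by (simp add: thick_cls_hom)
      next
        case one
        then show ?case by (rule unit1)
      qed
    qed
  qed
  then show ?thesis by (simp add: S_C_def Let_def r_def)
qed

lemma S_C_webster: "alg_isomorphic (S_C s n :: ('k, ('k, klr_gen) free_alg set) module) (webster s n)"
proof -
  let ?F = "fcarrier (web_gens s n) :: ('k, web_gen) free_alg set" and ?cls = "web_pres.cls s n"
  let ?A = "S_C s n :: ('k, ('k, klr_gen) free_alg set) module"
  \<comment> \<open>The inverse of \<open>thick_cls\<close> on classes, by choice of a preimage;
    \<open>thick_cls_eq_iff\<close> makes the resulting class independent of the choice.\<close>
  define h where "h X = ?cls (SOME p. p \<in> ?F \<and> X = thick_cls p)" for X
  have h: "h (thick_cls p) = ?cls p" if p: "p \<in> ?F" for p
  proof -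
    have "\<exists>q. q \<in> ?F \<and> thick_cls p = thick_cls q" using p by blast
    from someI_ex[OF this] show ?thesis using thick_cls_eq_iff[OF p] by (auto simp: h_def)
  qed
  have ops: "x \<otimes>\<^bsub>?A\<^esub> y = x \<otimes>\<^bsub>KLR r\<^esub> y" "x \<oplus>\<^bsub>?A\<^esub> y = x \<oplus>\<^bsub>KLR r\<^esub> y" "a \<odot>\<^bsub>?A\<^esub> x = a \<odot>\<^bsub>KLR r\<^esub> x"
    "\<one>\<^bsub>?A\<^esub> = thick_cls 1" for x y a
    by (simp_all add: S_C_def Let_def r_def thick_cls_def thick_map_linear thick_unit_def)
  have "h \<in> ring_iso ?A (webster s n)"
  proof (rule ring_iso_memI)
    fix x y assume "x \<in> carrier ?A" "y \<in> carrier ?A"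
    then obtain p q where p: "p \<in> ?F" "x = thick_cls p" and q: "q \<in> ?F" "y = thick_cls q"
      unfolding S_C_carrier by blast
    show "h x \<in> carrier (webster s n)"
      using p by (auto simp: webster_def web_pres.PA_carrier h)
    show "h (x \<otimes>\<^bsub>?A\<^esub> y) = h x \<otimes>\<^bsub>webster s n\<^esub> h y"
      unfolding ops p(2) q(2) thick_cls_hom webster_def h[OF fcarrier_mult[OF p(1) q(1)]] h[OF p(1)] h[OF q(1)]
      by (rule web_pres.PA_simps(1)[OF p(1) q(1), symmetric])
    show "h (x \<oplus>\<^bsub>?A\<^esub> y) = h x \<oplus>\<^bsub>webster s n\<^esub> h y"
      unfolding ops p(2) q(2) thick_cls_hom webster_def h[OF fcarrier_add[OF p(1) q(1)]] h[OF p(1)] h[OF q(1)]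
      by (rule web_pres.PA_simps(2)[OF p(1) q(1), symmetric])
  next
    show "h \<one>\<^bsub>?A\<^esub> = \<one>\<^bsub>webster s n\<^esub>"
      unfolding ops webster_def h[OF fcarrier_1] by (rule web_pres.PA_simps(3)[symmetric])
    show "bij_betw h (carrier ?A) (carrier (webster s n))"
      unfolding bij_betw_def
    proof
      show "inj_on h (carrier ?A)"
      proof (rule inj_onI)
        fix x y assume "x \<in> carrier ?A" "y \<in> carrier ?A" and eq: "h x = h y"
        then obtain p q where p: "p \<in> ?F" "x = thick_cls p" and q: "q \<in> ?F" "y = thick_cls q"
          unfolding S_C_carrier by blast
        then show "x = y" using eq thick_cls_eq_iff[OF p(1) q(1)] by (simp add: h)
      qed
      show "h ` carrier ?A = carrier (webster s n)"
        unfolding S_C_carrier webster_def web_pres.PA_carrier image_image by (rule image_cong[OF HOL.refl h])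
    qed
  qed
  moreover have "h (a \<odot>\<^bsub>?A\<^esub> x) = a \<odot>\<^bsub>webster s n\<^esub> h x" if x: "x \<in> carrier ?A" for a x
  proof -
    obtain p where p: "p \<in> ?F" "x = thick_cls p" using x unfolding S_C_carrier by blast
    show ?thesis
      unfolding ops p(2) thick_cls_hom webster_def h[OF fcarrier_mult[OF fcarrier_fscalar p(1)]] h[OF p(1)]
      by (rule web_pres.PA_simps(5)[OF p(1), symmetric])
  qed
  ultimately show ?thesis unfolding alg_isomorphic_def by blast
qed

end

theorem theorem4p4:
  fixes s :: "nat list" and n :: nat
  assumes "n = 0 \<or> (\<forall>k < length s. 1 \<le> s ! k)"
  shows "alg_isomorphic
           (S_C s n :: ('k::field, ('k, klr_gen) free_alg set) module)
           (webster s n)"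
  by (rule S_C_webster[OF assms])

end
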